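(* Let $m_1,m_2,m_3>0$ be arbitrary masses. Consider the solutions of the Newtonian three-body problem with these masses having zero angular momentum and negative energy. Every such solution, defined on its maximal interval of existence, admits a syzygy, except for exactly one: the Lagrange homothety solution (which has no syzygy). Here, for each given value of the negative energy, the Lagrange homothety solution is regarded as a single solution, i.e. solutions are identified if they differ by a rigid motion (rotation or reflection) of the plane and a time translation.
   Context: Setting. Three point masses $m_1,m_2,m_3>0$ with positions $x_1(t),x_2(t),x_3(t)$ in the Euclidean plane $\mathbb{R}^2$ satisfy Newton's equations $m_i\ddot x_i=\partial U/\partial x_i$, where $U=\sum_{i<j} m_im_j/r_{ij}$ and $r_{ij}=|x_i-x_j|$. The center of mass is fixed at the origin: $\sum_i m_ix_i=0$. The energy is $H=K/2-U$ with $K=\sum_i m_i|\dot x_i|^2$, and the angular momentum is $J=\sum_i m_i\,x_i\wedge\dot x_i$. Here $J=0$ and $H<0$. Solutions. Solutions are analytically continued through binary collisions by Levi-Civita regularization: at an isolated time $t_c$ at which exactly two of the masses coincide, the solution is continued by the branch for which the positions are real-analytic functions of $(t-t_c)^{1/3}$ near $t_c$ (an elastic bounce of the colliding pair). Each solution is taken on its maximal (open) interval of existence in this sense. A solution fails to extend past a finite time $b$ if and only if it ends in triple collision there, i.e. the three positions tend to the same point as $t\to b$ (and similarly backwards in time). Syzygy. A syzygy is an instant in the interval of existence at which the three masses are collinear. Binary collisions count as syzygies. Lagrange homothety solution. This is the solution which begins and ends in triple collision, such that at every instant of its (finite, open) interval of existence the three masses form an equilateral triangle that evolves only by scaling (homothety)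 about the center of mass. Half-way through its evolution the three bodies are instantaneously at rest, forming an equilateral triangle whose size is determined by the value of the negative energy. *)

theory Defs
  imports "HOL-Analysis.Analysis"
begin

type_synonym plane = "real ^ 2"
type_synonym config = "3 \<Rightarrow> plane"
type_synonym trajectory = "real \<Rightarrow> config"

definition wedge :: "plane \<Rightarrow> plane \<Rightarrow> real" where
  "wedge u v = u $ 1 * v $ 2 - u $ 2 * v $ 1"

text \<open>A configuration without collisions is exactly an injective one.\<close>

definition potential :: "(3 \<Rightarrow> real) \<Rightarrow> config \<Rightarrow> real" where
  "potential m q = (\<Sum>(i, j)\<in>{(i, j). i < j}. m i * m j / dist (q i) (q j))"

definition velocity :: "trajectory \<Rightarrow> real \<Rightarrow> config" where
  "velocity x t i = vector_derivative (\<lambda>s. x s i) (at t)"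

definition energy :: "(3 \<Rightarrow> real) \<Rightarrow> trajectory \<Rightarrow> real \<Rightarrow> real" where
  "energy m x t = (\<Sum>i\<in>UNIV. m i * (norm (velocity x t i))\<^sup>2) / 2 - potential m (x t)"

definition angular_momentum :: "(3 \<Rightarrow> real) \<Rightarrow> trajectory \<Rightarrow> real \<Rightarrow> real" where
  "angular_momentum m x t = (\<Sum>i\<in>UNIV. m i * wedge (x t i) (velocity x t i))"

text \<open>Newton's equations at the time \<open>t\<close>: here \<open>v\<close> is the velocity of the \<open>i\<close>-th mass near \<open>t\<close>,
  \<open>a\<close> is its acceleration at \<open>t\<close>, and the gradient is the partial gradient of the potential with
  respect to the position of the \<open>i\<close>-th mass.\<close>

definition newton_at :: "(3 \<Rightarrow> real) \<Rightarrow> trajectory \<Rightarrow> real \<Rightarrow> bool" where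
  "newton_at m x t \<longleftrightarrow> inj (x t) \<and>
     (\<forall>i. \<exists>v a. (\<forall>\<^sub>F s in nhds t. ((\<lambda>r. x r i) has_vector_derivative v s) (at s)) \<and>
        (v has_vector_derivative a) (at t) \<and>
        (GDERIV (\<lambda>q. potential m ((x t)(i := q))) (x t i) :> m i *\<^sub>R a))"

text \<open>An isolated binary collision, continued by the branch that is real-analytic in the cube root
  of \<open>t - tc\<close>. The function \<open>root 3\<close> is the odd real cube root, so the power series
  describes the motion on both sides of the collision.\<close>

definition regularized_binary_collision_at :: "trajectory \<Rightarrow> real \<Rightarrow> bool" where
  "regularized_binary_collision_at x tc \<longleftrightarrow>
     card (range (x tc)) = 2 \<and>
     (\<forall>\<^sub>F t in at tc. inj (x t)) \<and>
     (\<forall>i. \<exists>c. \<forall>\<^sub>F t in nhds tc. (\<lambda>n. root 3 (t - tc) ^ n *\<^sub>R c n) sums x t i)"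

text \<open>Only the values of a trajectory on the open time interval \<open>I\<close> matter.\<close>

definition solution :: "(3 \<Rightarrow> real) \<Rightarrow> real set \<Rightarrow> trajectory \<Rightarrow> bool" where
  "solution m I x \<longleftrightarrow> open I \<and> is_interval I \<and> I \<noteq> {} \<and>
     (\<forall>t\<in>I. (\<Sum>i\<in>UNIV. m i *\<^sub>R x t i) = 0) \<and>
     (\<forall>t\<in>I. newton_at m x t \<or> regularized_binary_collision_at x t)"

definition maximal_solution :: "(3 \<Rightarrow> real) \<Rightarrow> real set \<Rightarrow> trajectory \<Rightarrow> bool" where
  "maximal_solution m I x \<longleftrightarrow> solution m I x \<and>
     (\<forall>I' x'. solution m I' x' \<and> I \<subseteq> I' \<and> (\<forall>t\<in>I. x' t = x t) \<longrightarrow> I' = I)"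

text \<open>Velocities do not exist at binary collisions, so the two integrals are prescribed at the
  remaining times. The solution being analytic in the cube root of time, they take the same values
  before and after a collision.\<close>

definition has_energy :: "(3 \<Rightarrow> real) \<Rightarrow> real \<Rightarrow> real set \<Rightarrow> trajectory \<Rightarrow> bool" where
  "has_energy m h I x \<longleftrightarrow> (\<forall>t\<in>I. inj (x t) \<longrightarrow> energy m x t = h)"

definition zero_angular_momentum :: "(3 \<Rightarrow> real) \<Rightarrow> real set \<Rightarrow> trajectory \<Rightarrow> bool" where
  "zero_angular_momentum m I x \<longleftrightarrow> (\<forall>t\<in>I. inj (x t) \<longrightarrow> angular_momentum m x t = 0)"

text \<open>Binary collisions are included: a set of at most two points is collinear.\<close>

definition has_syzygy :: "real set \<Rightarrow> trajectory \<Rightarrow> bool" where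
  "has_syzygy I x \<longleftrightarrow> (\<exists>t\<in>I. collinear (range (x t)))"

definition equilateral :: "config \<Rightarrow> bool" where
  "equilateral q \<longleftrightarrow> (\<exists>d>0. \<forall>i j. i \<noteq> j \<longrightarrow> dist (q i) (q j) = d)"

definition triple_collision :: "trajectory \<Rightarrow> real filter \<Rightarrow> bool" where
  "triple_collision x F \<longleftrightarrow> (\<exists>p. \<forall>i. ((\<lambda>t. x t i) \<longlongrightarrow> p) F)"

text \<open>The center of mass of a solution is the origin, so scaling about it is scalar
  multiplication.\<close>

definition lagrange_homothety :: "real set \<Rightarrow> trajectory \<Rightarrow> bool" where
  "lagrange_homothety I x \<longleftrightarrow>
     (\<exists>a b. a < b \<and> I = {a<..<b} \<and>
        triple_collision x (at_right a) \<and> triple_collision x (at_left b)) \<and>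
     (\<forall>t\<in>I. equilateral (x t)) \<and>
     (\<exists>q \<rho>. \<forall>t\<in>I. \<rho> t > 0 \<and> (\<forall>i. x t i = \<rho> t *\<^sub>R q i))"

text \<open>Rigid motions fix the common center of mass, hence are linear; orthogonal transformations of
  the plane are its rotations and reflections.\<close>

definition congruent_solutions ::
  "real set \<Rightarrow> trajectory \<Rightarrow> real set \<Rightarrow> trajectory \<Rightarrow> bool" where
  "congruent_solutions I x I' x' \<longleftrightarrow>
     (\<exists>(A :: plane \<Rightarrow> plane) \<tau>. orthogonal_transformation A \<and> I' = (\<lambda>t. t + \<tau>) ` I \<and>
        (\<forall>t\<in>I. \<forall>i. x' (t + \<tau>) i = A (x t i)))"

end

theory Submission
  imports Defs "HOL-Complex_Analysis.Complex_Analysis"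
begin

text \<open>Let \<open>W > 0\<close> be twice the area of a triangle that moves without syzygies and
  \<open>T = \<Sum> (m i + m j) / r i j ^ 3\<close>. Zero angular momentum gives \<open>S'' \<le> - (T / 2) S\<close> for \<open>S = sqrt W\<close>, and
  negative energy bounds \<open>T\<close> away from \<open>0\<close>, so by Sturm comparison the motion lasts only a finite time.
  At a finite endpoint it either runs into triple collision, where the moment of inertia decays at
  least linearly, or it continues through a regular point or a regularized binary collision, against
  maximality. The distance \<open>a = sqrt n\<close> of the shape from the equilateral shape of the opposite
  orientation satisfies the reverse inequality \<open>a'' \<ge> - (T / 2) a\<close>, strictly off the equilateral
  shapes, so that \<open>P = a' S - a S'\<close> increases. As \<open>(S / a)' = - P / n\<close> and \<open>1 / n\<close> is not integrable at a
  triple collision, positivity of \<open>S / a\<close> forces \<open>P \<le> 0\<close> up to the right end and \<open>P \<ge> 0\<close> from the left end.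
  Hence \<open>P = 0\<close> and the triangle is equilateral throughout; zero angular momentum then keeps it from
  rotating. Its size solves the radial Kepler problem with both ends in collision, whose solution at a
  given energy is unique up to time translation.\<close>

text \<open>\<open>maximal_solution\<close> quantifies over all continuations, so ruling out an
  endpoint that is not a triple collision means constructing one, and
  \<open>regularized_binary_collision_at\<close> demands convergent series in the cube root of time,
  just where Newton's field is singular. The equations are therefore rewritten as a polynomial
  system. Its formal solution, coefficient bounds and Lipschitz constants come from inductions over
  the syntax of polynomials, and a bounded solution continues past a finite endpoint. In these
  variables a regular endpoint and a binary collision look alike, so one argument serves both. The
  variables are redundant; their algebraic relations survive the continuation by the identity
  theorem, and that permits the return to Newton's equations on the far side. The shape argument
  works because the same factor T governs both second-order inequalities: P is their Wronskian, and
  T cancels in its derivative. Measuring from the equilateral shape of the opposite orientation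
  keeps n positive, since n is half the sum of the squared sides plus sqrt 3 times W.\<close>

section \<open>Analytic solutions of polynomial differential equations\<close>

text \<open>Polynomials are deeply embedded so that one expression can be read over the reals, over
  formal power series, and as a bound; each fact about the vector field is then an induction over
  syntax.\<close>

datatype 'n pexp = Cst real | Var 'n | Plus "'n pexp" "'n pexp" | Times "'n pexp" "'n pexp"

primrec peval :: "('n \<Rightarrow> real) \<Rightarrow> 'n pexp \<Rightarrow> real" where
  "peval y (Cst c) = c"
| "peval y (Var k) = y k"
| "peval y (Plus e f) = peval y e + peval y f"
| "peval y (Times e f) = peval y e * peval y f"

primrec pfps :: "('n \<Rightarrow> real fps) \<Rightarrow> 'n pexp \<Rightarrow> real fps" where
  "pfps y (Cst c) = fps_const c"
| "pfps y (Var k) = y k"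
| "pfps y (Plus e f) = pfps y e + pfps y f"
| "pfps y (Times e f) = pfps y e * pfps y f"

text \<open>A Cauchy product up to order i uses only coefficients up to order i. Since integration
  shifts the order by one, each coefficient of a solution is determined by the earlier ones.\<close>

lemma pfps_causal:
  assumes "\<And>k i. i \<le> n \<Longrightarrow> fps_nth (g k) i = fps_nth (g' k) i" "i \<le> n"
  shows "fps_nth (pfps g e) i = fps_nth (pfps g' e) i"
  using assms(2)
proof (induction e arbitrary: i)
  case (Times e f)
  then show ?case by (auto simp: fps_mult_nth intro!: sum.cong)
qed (use assms(1) in auto)

section \<open>Formal solutions by Picard iteration\<close>

primrec picard :: "('n \<Rightarrow> 'n pexp) \<Rightarrow> ('n \<Rightarrow> real) \<Rightarrow> nat \<Rightarrow> 'n \<Rightarrow> real fps" where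
  "picard F y0 0 k = fps_const (y0 k)"
| "picard F y0 (Suc N) k = fps_integral (pfps (picard F y0 N) (F k)) (y0 k)"

text \<open>Every iteration settles one more coefficient, so the iterates converge coefficientwise
  and are stationary on and below the diagonal.\<close>

lemma picard_stable_step:
  "i \<le> N \<Longrightarrow> fps_nth (picard F y0 (Suc N) k) i = fps_nth (picard F y0 N k) i"
proof (induction N arbitrary: i k)
  case (Suc N)
  show ?case
  proof (cases i)
    case (Suc j)
    then have "j \<le> N" using Suc.prems by simp
    then have "fps_nth (pfps (picard F y0 (Suc N)) (F k)) j = fps_nth (pfps (picard F y0 N) (F k)) j"
      by (intro pfps_causal[where n = N] Suc.IH)
    then show ?thesis by (subst (1 2) picard.simps) (simp add: Suc del: picard.simps)
  qed simp
qed simp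

lemma picard_stable: "i \<le> N \<Longrightarrow> fps_nth (picard F y0 N k) i = fps_nth (picard F y0 i k) i"
proof (induction N rule: dec_induct)
  case (step N)
  then show ?case using picard_stable_step[of i N F y0 k] by presburger
qed simp

lemma fps_ode_solution:
  obtains g :: "'n \<Rightarrow> real fps"
  where "\<And>k. g k = fps_integral (pfps g (F k)) (y0 k)"
proof
  \<comment> \<open>The diagonal of the iterates: coefficient n is read off at iterate n, where it
    has become stationary.\<close>
  define g where "g = (\<lambda>k. Abs_fps (\<lambda>n. fps_nth (picard F y0 n k) n))"
  have agree: "fps_nth (g k) i = fps_nth (picard F y0 N k) i" if "i \<le> N" for i N k
    unfolding g_def by (simp add: picard_stable[OF that])
  fix k
  show "g k = fps_integral (pfps g (F k)) (y0 k)"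
  proof (rule fps_ext)
    fix n
    show "fps_nth (g k) n = fps_nth (fps_integral (pfps g (F k)) (y0 k)) n"
    proof (cases n)
      case 0
      then show ?thesis by (simp add: g_def)
    next
      case (Suc j)
      have "fps_nth (pfps g (F k)) j = fps_nth (pfps (picard F y0 j) (F k)) j"
        by (rule pfps_causal[where n = j]) (auto intro: agree)
      then show ?thesis using agree[of n n k] by (simp add: Suc)
    qed
  qed
qed

section \<open>Convergence by weighted majorants\<close>

lemma sum_inverse_squares_le: "(\<Sum>i\<le>n. 1 / (real i + 1)\<^sup>2) \<le> 2 - 1 / (real n + 1)"
proof (induction n)
  case (Suc n)
  have "1 / (real n + 2)\<^sup>2 \<le> 1 / (real n + 1) - 1 / (real n + 2)"
    by (simp add: divide_simps power2_eq_square)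
  then show ?case using Suc by (simp add: algebra_simps)
qed simp

text \<open>The weight \<open>1 / (n + 1)\<^sup>2\<close> makes the bounded sequences an algebra under the Cauchy product,
  so that products of any degree cost only a constant.\<close>

lemma convolution_weight_le:
  "(\<Sum>i\<le>n. 1 / (real i + 1)\<^sup>2 * (1 / (real (n - i) + 1)\<^sup>2)) \<le> 8 / (real n + 1)\<^sup>2"
proof -
  \<comment> \<open>The product of weights is split into a sum by (a + b)^2 \<le> 2 (a^2 + b^2) with
    a + b = n + 2. Each of the two resulting sums is at most 2, whence the constant 8.\<close>
  have "1 / (real i + 1)\<^sup>2 * (1 / (real (n - i) + 1)\<^sup>2)
      \<le> 2 / (real n + 2)\<^sup>2 * (1 / (real i + 1)\<^sup>2 + 1 / (real (n - i) + 1)\<^sup>2)" if "i \<le> n" for i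
  proof -
    define a b where "a = real i + 1" and "b = real (n - i) + 1"
    have ab: "a > 0" "b > 0" "a + b = real n + 2" using that by (auto simp: a_def b_def of_nat_diff)
    have "(a + b)\<^sup>2 \<le> 2 * (a\<^sup>2 + b\<^sup>2)"
      using sum_squares_ge_zero[of "a - b" 0] by (simp add: power2_eq_square algebra_simps)
    then have "1 / a\<^sup>2 * (1 / b\<^sup>2) \<le> 2 / (a + b)\<^sup>2 * (1 / a\<^sup>2 + 1 / b\<^sup>2)"
      using ab by (simp add: divide_simps algebra_simps)
    then show ?thesis using ab by (simp add: a_def b_def add.commute)
  qed
  then have "(\<Sum>i\<le>n. 1 / (real i + 1)\<^sup>2 * (1 / (real (n - i) + 1)\<^sup>2))
      \<le> (\<Sum>i\<le>n. 2 / (real n + 2)\<^sup>2 * (1 / (real i + 1)\<^sup>2 + 1 / (real (n - i) + 1)\<^sup>2))"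
    by (intro sum_mono) auto
  also have "\<dots> = 2 / (real n + 2)\<^sup>2 * ((\<Sum>i\<le>n. 1 / (real i + 1)\<^sup>2) + (\<Sum>i\<le>n. 1 / (real (n - i) + 1)\<^sup>2))"
    by (simp only: sum_distrib_left[symmetric] sum.distrib)
  also have "(\<Sum>i\<le>n. 1 / (real (n - i) + 1)\<^sup>2) = (\<Sum>i\<le>n. 1 / (real i + 1)\<^sup>2)"
    using sum.nat_diff_reindex[of "\<lambda>i. 1 / (real i + 1)\<^sup>2" "Suc n"] by (simp add: lessThan_Suc_atMost)
  also have "2 / (real n + 2)\<^sup>2 * ((\<Sum>i\<le>n. 1 / (real i + 1)\<^sup>2) + (\<Sum>i\<le>n. 1 / (real i + 1)\<^sup>2))
      \<le> 2 / (real n + 2)\<^sup>2 * (2 + 2)"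
    using sum_inverse_squares_le[of n] by (intro mult_left_mono add_mono) (auto intro: order_trans)
  also have "\<dots> \<le> 8 / (real n + 1)\<^sup>2"
    by (simp add: frac_le power_mono)
  finally show ?thesis .
qed

text \<open>The factor 8 is the constant of \<open>convolution_weight_le\<close>: weighted bounds
  with constant \<open>A\<close> on the variables pass to weighted bounds with constant
  \<open>pbound A e\<close> on the expression, with the same rate.\<close>

primrec pbound :: "real \<Rightarrow> 'n pexp \<Rightarrow> real" where
  "pbound A (Cst c) = \<bar>c\<bar>"
| "pbound A (Var k) = A"
| "pbound A (Plus e f) = pbound A e + pbound A f"
| "pbound A (Times e f) = 8 * pbound A e * pbound A f"

lemma pbound_nonneg: "A \<ge> 0 \<Longrightarrow> pbound A e \<ge> 0"
  by (induction e) auto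

lemma pfps_bound:
  assumes "A \<ge> 0" "\<kappa> \<ge> 0"
    and "\<And>k i. i \<le> n \<Longrightarrow> \<bar>fps_nth (g k) i\<bar> \<le> A * \<kappa> ^ i / (real i + 1)\<^sup>2"
    and "i \<le> n"
  shows "\<bar>fps_nth (pfps g e) i\<bar> \<le> pbound A e * \<kappa> ^ i / (real i + 1)\<^sup>2"
  using assms(4)
proof (induction e arbitrary: i)
  case (Cst c)
  then show ?case using assms(2) by (cases i) auto
next
  case (Var k)
  then show ?case using assms(3) by simp
next
  case (Plus e f)
  from Plus.IH[OF Plus.prems] show ?case by (simp add: distrib_right add_divide_distrib)
next
  case (Times e f)
  let ?B = "pbound A e" and ?C = "pbound A f"
  have "\<bar>fps_nth (pfps g e * pfps g f) i\<bar> \<le> (\<Sum>j\<le>i. \<bar>fps_nth (pfps g e) j\<bar> * \<bar>fps_nth (pfps g f) (i - j)\<bar>)"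
    by (simp add: fps_mult_nth atLeast0AtMost flip: abs_mult)
  also have "\<dots> \<le> (\<Sum>j\<le>i. (?B * \<kappa> ^ j / (real j + 1)\<^sup>2) * (?C * \<kappa> ^ (i - j) / (real (i - j) + 1)\<^sup>2))"
    using Times.prems by (intro sum_mono mult_mono Times.IH)
      (auto intro!: divide_nonneg_nonneg mult_nonneg_nonneg pbound_nonneg zero_le_power assms)
  also have "\<dots> = ?B * ?C * \<kappa> ^ i * (\<Sum>j\<le>i. 1 / (real j + 1)\<^sup>2 * (1 / (real (i - j) + 1)\<^sup>2))"
    unfolding sum_distrib_left
  proof (intro sum.cong refl)
    fix j assume "j \<in> {..i}"
    then have "\<kappa> ^ i = \<kappa> ^ j * \<kappa> ^ (i - j)" by (simp flip: power_add)
    then show "(?B * \<kappa> ^ j / (real j + 1)\<^sup>2) * (?C * \<kappa> ^ (i - j) / (real (i - j) + 1)\<^sup>2)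
      = ?B * ?C * \<kappa> ^ i * (1 / (real j + 1)\<^sup>2 * (1 / (real (i - j) + 1)\<^sup>2))"
      by (simp add: field_simps)
  qed
  also have "\<dots> \<le> ?B * ?C * \<kappa> ^ i * (8 / (real i + 1)\<^sup>2)"
    by (intro mult_left_mono convolution_weight_le mult_nonneg_nonneg pbound_nonneg assms zero_le_power)
  finally show ?case by (simp add: mult.assoc mult.commute mult.left_commute)
qed

text \<open>Majorant induction: coefficient j + 1 of the solution is coefficient j of the field
  divided by j + 1. The constant bounding the field depends on \<open>A\<close> but not on the rate
  \<kappa>, so a large \<kappa> absorbs it; the division by j + 1 is not even exploited.\<close>

lemma fps_ode_solution_bound:
  fixes g :: "'n::finite \<Rightarrow> real fps"
  assumes g: "\<And>k. g k = fps_integral (pfps g (F k)) (y0 k)"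
  obtains A \<kappa> where "A > 0" "\<kappa> > 0" "\<And>k i. \<bar>fps_nth (g k) i\<bar> \<le> A * \<kappa> ^ i"
proof -
  define A where "A = 1 + (\<Sum>k\<in>UNIV. \<bar>y0 k\<bar>)"
  have A: "A > 0" by (simp add: A_def add_pos_nonneg sum_nonneg)
  have Ay: "\<bar>y0 k\<bar> \<le> A" for k
    using member_le_sum[of k UNIV "\<lambda>k. \<bar>y0 k\<bar>"] by (simp add: A_def)
  define B where "B = 1 + (\<Sum>k\<in>UNIV. pbound A (F k))"
  have B: "B > 0" using A by (auto simp: B_def intro!: add_pos_nonneg sum_nonneg pbound_nonneg)
  have By: "pbound A (F k) \<le> B" for k
    using member_le_sum[of k UNIV "\<lambda>k. pbound A (F k)"] A by (simp add: B_def pbound_nonneg)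
  \<comment> \<open>Chosen to give 4 B \<kappa>^j = A \<kappa>^(j+1); the 4 pays for moving the
    weight from (j + 1)^2 to (j + 2)^2.\<close>
  define \<kappa> where "\<kappa> = 4 * B / A"
  have \<kappa>: "\<kappa> > 0" using A B by (simp add: \<kappa>_def)
  have main: "\<bar>fps_nth (g k) n\<bar> \<le> A * \<kappa> ^ n / (real n + 1)\<^sup>2" for n k
  proof (induction n arbitrary: k rule: less_induct)
    case (less n)
    show ?case
    proof (cases n)
      case 0
      then show ?thesis using Ay by (subst g) simp
    next
      case (Suc j)
      have "\<bar>fps_nth (pfps g (F k)) j\<bar> \<le> pbound A (F k) * \<kappa> ^ j / (real j + 1)\<^sup>2"
        using A \<kappa> Suc by (intro pfps_bound[where n = j] less.IH) auto
      also have "\<dots> \<le> B * \<kappa> ^ j / (real j + 1)\<^sup>2"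
        using \<kappa> By by (intro divide_right_mono mult_right_mono) auto
      finally have 1: "\<bar>fps_nth (pfps g (F k)) j\<bar> \<le> B * \<kappa> ^ j / (real j + 1)\<^sup>2" .
      have "\<bar>fps_nth (g k) n\<bar> = \<bar>fps_nth (pfps g (F k)) j\<bar> / (real j + 1)"
        by (subst g) (simp add: Suc abs_mult divide_inverse mult.commute add.commute)
      also have "\<dots> \<le> \<bar>fps_nth (pfps g (F k)) j\<bar> / 1"
        by (intro divide_left_mono) auto
      also have "\<dots> \<le> B * \<kappa> ^ j / (real j + 1)\<^sup>2" using 1 by simp
      also have "\<dots> \<le> 4 * B * \<kappa> ^ j / (real j + 2)\<^sup>2"
      proof -
        have "(real j + 2)\<^sup>2 \<le> (2 * (real j + 1))\<^sup>2" by (intro power_mono) auto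
        then have "(real j + 2)\<^sup>2 \<le> 4 * (real j + 1)\<^sup>2" by (simp only: power_mult_distrib) simp
        then have "B * \<kappa> ^ j * (real j + 2)\<^sup>2 \<le> B * \<kappa> ^ j * (4 * (real j + 1)\<^sup>2)"
          using B \<kappa> by (intro mult_left_mono) auto
        then show ?thesis by (simp add: divide_simps mult.assoc mult.commute mult.left_commute)
      qed
      also have "4 * B * \<kappa> ^ j = A * \<kappa> ^ n" using A by (simp add: Suc \<kappa>_def)
      finally show ?thesis by (simp add: Suc add.commute)
    qed
  qed
  show ?thesis
  proof (rule that[OF A \<kappa>])
    fix k i
    have "A * \<kappa> ^ i / (real i + 1)\<^sup>2 \<le> A * \<kappa> ^ i / 1"
      using A \<kappa> by (intro divide_left_mono) auto
    then show "\<bar>fps_nth (g k) i\<bar> \<le> A * \<kappa> ^ i" using main[of k i] by simp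
  qed
qed

lemma fps_conv_radius_ge_of_bound:
  fixes g :: "real fps"
  assumes "\<And>i. \<bar>fps_nth g i\<bar> \<le> A * \<kappa> ^ i" "\<kappa> > 0"
  shows "fps_conv_radius g \<ge> ereal (1 / \<kappa>)"
  unfolding fps_conv_radius_def
proof (rule conv_radius_geI_ex)
  fix r assume r: "0 < r" "ereal r < ereal (1 / \<kappa>)"
  have "summable (\<lambda>n. fps_nth g n * r ^ n)"
  proof (rule summable_comparison_test)
    show "\<exists>N. \<forall>n\<ge>N. norm (fps_nth g n * r ^ n) \<le> A * (\<kappa> * r) ^ n"
      using assms(1) r by (auto simp: abs_mult power_mult_distrib mult.assoc[symmetric] intro!: mult_right_mono)
    show "summable (\<lambda>n. A * (\<kappa> * r) ^ n)"
      using r assms(2) by (intro summable_mult summable_geometric) (auto simp: field_simps)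
  qed
  then show "\<exists>z. norm z = r \<and> summable (\<lambda>n. fps_nth g n * z ^ n)"
    using r by (intro exI[of _ r]) auto
qed

lemma pfps_conv_radius:
  assumes "\<And>k. fps_conv_radius (g k) \<ge> R"
  shows "fps_conv_radius (pfps g e) \<ge> R"
proof (induction e)
  case (Plus e f)
  then show ?case using fps_conv_radius_add[of "pfps g e" "pfps g f"] by (simp add: min_def split: if_splits)
next
  case (Times e f)
  then show ?case using fps_conv_radius_mult[of "pfps g e" "pfps g f"] by (simp add: min_def split: if_splits)
qed (use assms in auto)

lemma eval_pfps:
  assumes R: "\<And>k. fps_conv_radius (g k) \<ge> R" and z: "ereal \<bar>z\<bar> < R"
  shows "eval_fps (pfps g e) z = peval (\<lambda>k. eval_fps (g k) z) e"
proof -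
  have *: "ereal (norm z) < fps_conv_radius (pfps g e)" for e
    using z pfps_conv_radius[of R g e] R by (auto intro: order.strict_trans2)
  show ?thesis
    by (induction e) (use * in \<open>auto simp: eval_fps_add eval_fps_mult\<close>)
qed

text \<open>The formal identity is exported along with the differential equation of the sums: the
  order of vanishing of the time at a collision is later read off from the coefficients.\<close>

lemma poly_ode_exists:
  fixes F :: "'n::finite \<Rightarrow> 'n pexp"
  obtains g :: "'n \<Rightarrow> real fps" and \<epsilon> :: real
  where "\<epsilon> > 0" "\<And>k. fps_conv_radius (g k) \<ge> ereal \<epsilon>" "\<And>k. eval_fps (g k) 0 = y0 k"
    "\<And>k s. \<bar>s\<bar> < \<epsilon> \<Longrightarrow>
      (eval_fps (g k) has_real_derivative peval (\<lambda>k. eval_fps (g k) s) (F k)) (at s)"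
    "\<And>k. fps_deriv (g k) = pfps g (F k)"
proof -
  obtain g where g: "\<And>k. g k = fps_integral (pfps g (F k)) (y0 k)"
    by (rule fps_ode_solution[where F = F and ?y0.0 = y0]) (rule that; assumption)
  obtain A \<kappa> where A: "A > 0" "\<kappa> > 0" "\<And>k i. \<bar>fps_nth (g k) i\<bar> \<le> A * \<kappa> ^ i"
    using fps_ode_solution_bound[of g F y0] g by metis
  have R: "fps_conv_radius (g k) \<ge> ereal (1 / \<kappa>)" for k
    using A by (intro fps_conv_radius_ge_of_bound) auto
  show ?thesis
  proof
    show "1 / \<kappa> > 0" using A by simp
    show "fps_conv_radius (g k) \<ge> ereal (1 / \<kappa>)" for k by (rule R)
    show "eval_fps (g k) 0 = y0 k" for k by (subst g) (simp add: eval_fps_at_0)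
    show deriv: "fps_deriv (g k) = pfps g (F k)" for k
      by (subst g) (rule fps_deriv_fps_integral)
    fix k s assume s: "\<bar>s\<bar> < 1 / \<kappa>"
    have "(eval_fps (g k) has_field_derivative eval_fps (fps_deriv (g k)) s) (at s)"
      using s by (intro has_field_derivative_eval_fps order.strict_trans2[OF _ R[of k]]) simp
    then show "(eval_fps (g k) has_real_derivative peval (\<lambda>k. eval_fps (g k) s) (F k)) (at s)"
      unfolding deriv using eval_pfps[of "ereal (1 / \<kappa>)" g s "F k"] R s by simp
  qed
qed

section \<open>Uniqueness, and continuation to an endpoint\<close>

primrec plip :: "real \<Rightarrow> 'n pexp \<Rightarrow> real" where
  "plip A (Cst c) = 0"
| "plip A (Var k) = 1"
| "plip A (Plus e f) = plip A e + plip A f"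
| "plip A (Times e f) = plip A e * pbound A f + pbound A e * plip A f"

lemma plip_nonneg: "A \<ge> 0 \<Longrightarrow> plip A e \<ge> 0"
  by (induction e) (auto intro!: add_nonneg_nonneg mult_nonneg_nonneg pbound_nonneg)

lemma peval_bound:
  assumes "A \<ge> 0" "\<And>k. \<bar>y k\<bar> \<le> A"
  shows "\<bar>peval y e\<bar> \<le> pbound A e"
proof (induction e)
  case (Times e f)
  have "\<bar>peval y e\<bar> * \<bar>peval y f\<bar> \<le> pbound A e * pbound A f"
    using Times assms by (intro mult_mono pbound_nonneg) auto
  also have "\<dots> \<le> 8 * (pbound A e * pbound A f)"
    using pbound_nonneg[OF assms(1), of e] pbound_nonneg[OF assms(1), of f] by simp
  finally show ?case by (simp add: abs_mult)
qed (use assms in auto)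

lemma peval_lipschitz:
  assumes "A \<ge> 0" "\<And>k. \<bar>y k\<bar> \<le> A" "\<And>k. \<bar>z k\<bar> \<le> A" "\<And>k. \<bar>y k - z k\<bar> \<le> d"
  shows "\<bar>peval y e - peval z e\<bar> \<le> plip A e * d"
proof (induction e)
  case (Plus e f)
  then show ?case by (simp add: distrib_right)
next
  case (Times e f)
  have "peval y e * peval y f - peval z e * peval z f
      = (peval y e - peval z e) * peval y f + peval z e * (peval y f - peval z f)"
    by (simp add: algebra_simps)
  then have "\<bar>peval y e * peval y f - peval z e * peval z f\<bar>
      \<le> \<bar>peval y e - peval z e\<bar> * \<bar>peval y f\<bar> + \<bar>peval z e\<bar> * \<bar>peval y f - peval z f\<bar>"
    by (metis abs_triangle_ineq abs_mult)
  also have "\<dots> \<le> (plip A e * d) * pbound A f + pbound A e * (plip A f * d)"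
  proof -
    \<comment> \<open>Any index serves as witness that d is nonnegative.\<close>
    have "\<bar>y undefined - z undefined\<bar> \<le> d" by (rule assms)
    then have "d \<ge> 0" by linarith
    then show ?thesis
      by (intro add_mono mult_mono Times.IH peval_bound assms mult_nonneg_nonneg plip_nonneg pbound_nonneg abs_ge_zero)
  qed
  finally show ?case by (simp add: algebra_simps)
qed (use assms in auto)

text \<open>Gronwall backwards in time: D exp(L s) is nondecreasing because D' \<ge> - L D, and it
  tends to 0 at the right end, so it is nonpositive before.\<close>

lemma gronwall_zero_left:
  fixes D D' :: "real \<Rightarrow> real"
  assumes der: "\<And>s. a < s \<Longrightarrow> s < b \<Longrightarrow> (D has_real_derivative D' s) (at s)"
    and bd: "\<And>s. a < s \<Longrightarrow> s < b \<Longrightarrow> \<bar>D' s\<bar> \<le> L * D s"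
    and lim: "(D \<longlongrightarrow> 0) (at_left b)" and s: "a < s" "s < b" and nn: "D s \<ge> 0"
  shows "D s = 0"
proof -
  define E where "E = (\<lambda>s. D s * exp (L * s))"
  have E': "(E has_real_derivative (D' s + L * D s) * exp (L * s)) (at s)" if "a < s" "s < b" for s
    unfolding E_def by (rule derivative_eq_intros der that refl)+ (simp add: algebra_simps)
  have mono: "E s \<le> E t" if "a < s" "s \<le> t" "t < b" for s t
  proof (rule DERIV_nonneg_imp_nondecreasing[OF that(2)])
    fix x assume "s \<le> x" "x \<le> t"
    then have x: "a < x" "x < b" using that by auto
    have "D' x + L * D x \<ge> 0" using bd[OF x] by (simp add: abs_le_iff)
    then show "\<exists>y. (E has_real_derivative y) (at x) \<and> 0 \<le> y" using E'[OF x] by force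
  qed
  have "(E \<longlongrightarrow> 0 * exp (L * b)) (at_left b)"
    unfolding E_def by (intro tendsto_intros lim)
  moreover have "eventually (\<lambda>t. E s \<le> E t) (at_left b)"
    using eventually_at_left[of s b] s mono by (auto intro!: exI[of _ s])
  ultimately have "E s \<le> 0"
    by (metis mult_zero_left tendsto_lowerbound trivial_limit_at_left_real)
  then have "D s \<le> 0" by (simp add: E_def mult_le_0_iff)
  then show ?thesis using nn by simp
qed

text \<open>A bounded derivative makes f Lipschitz on a half-open interval ending at b, hence
  uniformly continuous, hence extendable to the closure point b.\<close>

lemma bounded_derivative_limit_left:
  fixes f f' :: "real \<Rightarrow> real"
  assumes ab: "a < b"
    and der: "\<And>s. a < s \<Longrightarrow> s < b \<Longrightarrow> (f has_real_derivative f' s) (at s)"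
    and bd: "\<And>s. a < s \<Longrightarrow> s < b \<Longrightarrow> \<bar>f' s\<bar> \<le> C"
  shows "\<exists>l. (f \<longlongrightarrow> l) (at_left b)"
proof -
  define c where "c = (a + b) / 2"
  have c: "a < c" "c < b" using ab by (auto simp: c_def)
  have "\<bar>f' c\<bar> \<le> C" using c by (intro bd)
  then have C: "C \<ge> 0" by linarith
  have "C-lipschitz_on {c..<b} f"
  proof (rule lipschitz_onI[OF _ C])
    fix s t assume st: "s \<in> {c..<b}" "t \<in> {c..<b}"
    have "norm (f s - f t) \<le> C * norm (s - t)"
    proof (rule field_differentiable_bound)
      show "convex {c..<b}" "s \<in> {c..<b}" "t \<in> {c..<b}" using st by simp_all
      fix z assume z: "z \<in> {c..<b}"
      then show "(f has_real_derivative f' z) (at z within {c..<b})"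
        using c der[of z] by (simp add: has_field_derivative_at_within)
      show "norm (f' z) \<le> C" using z c bd by simp
    qed
    then show "dist (f s) (f t) \<le> C * dist s t" by (simp add: dist_norm)
  qed
  then have "uniformly_continuous_on {c..<b} f"
    by (rule lipschitz_on_uniformly_continuous)
  moreover have "b \<in> closure {c..<b}" using c by simp
  ultimately obtain l where "(f \<longlongrightarrow> l) (at b within {c..<b})"
    by (rule uniformly_continuous_on_extension_at_closure)
  moreover have "at b within {c..<b} = at_left b"
    by (rule at_within_nhd[of b "{c<..}"]) (use c in auto)
  ultimately show ?thesis by auto
qed

text \<open>A bounded solution has bounded derivatives and therefore limits at b. The series
  solution started from these limits coincides with it to the left of b by Gronwall, and so
  continues it analytically; its argument is the time counted from b.\<close>

lemma poly_ode_endpoint: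
  fixes F :: "'n::finite \<Rightarrow> 'n pexp" and y :: "real \<Rightarrow> 'n \<Rightarrow> real"
  assumes ab: "a < b"
    and der: "\<And>k s. a < s \<Longrightarrow> s < b \<Longrightarrow> ((\<lambda>s. y s k) has_real_derivative peval (y s) (F k)) (at s)"
    and bd: "\<And>k s. a < s \<Longrightarrow> s < b \<Longrightarrow> \<bar>y s k\<bar> \<le> A"
  obtains g :: "'n \<Rightarrow> real fps" and \<epsilon> :: real
  where "\<epsilon> > 0" "\<epsilon> \<le> b - a" "\<And>k. fps_conv_radius (g k) \<ge> ereal \<epsilon>"
    "\<And>k s. \<bar>s\<bar> < \<epsilon> \<Longrightarrow>
      (eval_fps (g k) has_real_derivative peval (\<lambda>k. eval_fps (g k) s) (F k)) (at s)"
    "\<And>k s. - \<epsilon> < s \<Longrightarrow> s < 0 \<Longrightarrow> y (b + s) k = eval_fps (g k) s"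
    "\<And>k. fps_deriv (g k) = pfps g (F k)"
proof -
  have "\<bar>y ((a + b) / 2) undefined\<bar> \<le> A" using bd[of "(a + b) / 2" undefined] ab by simp
  then have A0: "A \<ge> 0" by linarith
  have "\<exists>l. ((\<lambda>s. y s k) \<longlongrightarrow> l) (at_left b)" for k
    by (rule bounded_derivative_limit_left[OF ab der[of _ k], where C = "pbound A (F k)"])
      (auto intro!: peval_bound A0 bd)
  then obtain y0 where y0: "\<And>k. ((\<lambda>s. y s k) \<longlongrightarrow> y0 k) (at_left b)" by metis
  obtain g \<epsilon>0 where g: "\<epsilon>0 > 0" "\<And>k. fps_conv_radius (g k) \<ge> ereal \<epsilon>0" "\<And>k. eval_fps (g k) 0 = y0 k"
    "\<And>k s. \<bar>s\<bar> < \<epsilon>0 \<Longrightarrow>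
      (eval_fps (g k) has_real_derivative peval (\<lambda>k. eval_fps (g k) s) (F k)) (at s)"
    "\<And>k. fps_deriv (g k) = pfps g (F k)"
    by (rule poly_ode_exists[where F = F and ?y0.0 = y0]) (rule that; assumption)
  define Y where "Y = (\<lambda>s k. eval_fps (g k) s)"
  \<comment> \<open>Half the radius leaves a compact interval on which the series are bounded, so
    that one Lipschitz constant serves both solutions.\<close>
  define \<epsilon> where "\<epsilon> = min (\<epsilon>0 / 2) (b - a)"
  have \<epsilon>: "\<epsilon> > 0" "\<epsilon> < \<epsilon>0" "\<epsilon> \<le> b - a" using g(1) ab by (auto simp: \<epsilon>_def)
  have "\<exists>B. \<forall>s. \<bar>s\<bar> \<le> \<epsilon> \<longrightarrow> \<bar>Y s k\<bar> \<le> B" for k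
  proof -
    have "continuous_on {-\<epsilon>..\<epsilon>} (eval_fps (g k))"
      using \<epsilon> g(4) by (intro continuous_at_imp_continuous_on ballI DERIV_isCont[OF g(4)]) auto
    then have "bounded (eval_fps (g k) ` {-\<epsilon>..\<epsilon>})"
      by (intro compact_imp_bounded compact_continuous_image) auto
    then obtain B where "\<forall>z\<in>{-\<epsilon>..\<epsilon>}. \<bar>eval_fps (g k) z\<bar> \<le> B" by (auto simp: bounded_iff)
    then show ?thesis by (intro exI[of _ B]) (auto simp: Y_def abs_le_iff)
  qed
  then obtain B where B: "\<And>k s. \<bar>s\<bar> \<le> \<epsilon> \<Longrightarrow> \<bar>Y s k\<bar> \<le> B k" by metis
  define A' where "A' = A + (\<Sum>k\<in>UNIV. \<bar>B k\<bar>)"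
  have A': "A' \<ge> 0" "A' \<ge> A" using A0 by (auto simp: A'_def intro!: add_nonneg_nonneg sum_nonneg)
  have BA: "\<bar>Y s k\<bar> \<le> A'" if "\<bar>s\<bar> \<le> \<epsilon>" for s k
    using B[OF that, of k] member_le_sum[of k UNIV "\<lambda>k. \<bar>B k\<bar>"] A0 by (simp add: A'_def)
  define L where "L = 2 * (\<Sum>k\<in>UNIV. plip A' (F k))"
  define D where "D = (\<lambda>s. \<Sum>k\<in>UNIV. (y s k - Y (s - b) k)\<^sup>2)"
  define D' where "D' = (\<lambda>s. \<Sum>k\<in>UNIV. 2 * (y s k - Y (s - b) k) * (peval (y s) (F k) - peval (Y (s - b)) (F k)))"
  have Yder: "((\<lambda>s. Y (s - b) k) has_real_derivative peval (Y (s - b)) (F k)) (at s)"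
    if "\<bar>s - b\<bar> < \<epsilon>0" for s k
    using DERIV_shift[of "\<lambda>s. Y s k" _ s "- b"] g(4)[OF that, of k] by (simp add: Y_def)
  have zero: "D s = 0" if "b - \<epsilon> < s" "s < b" for s
  proof (rule gronwall_zero_left[of "b - \<epsilon>" b D D' L, OF _ _ _ that])
    fix s assume s: "b - \<epsilon> < s" "s < b"
    then have s': "a < s" "\<bar>s - b\<bar> < \<epsilon>0" "\<bar>s - b\<bar> \<le> \<epsilon>" using \<epsilon> by auto
    show "(D has_real_derivative D' s) (at s)"
      unfolding D_def D'_def
      by (rule derivative_eq_intros der Yder s s' refl)+ (simp add: algebra_simps)
    have sq: "\<bar>y s k - Y (s - b) k\<bar> \<le> sqrt (D s)" for k
    proof -
      have "(y s k - Y (s - b) k)\<^sup>2 \<le> D s"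
        unfolding D_def by (rule member_le_sum) auto
      then show ?thesis using real_le_rsqrt abs_ge_zero by (metis power2_abs)
    qed
    have D0: "D s \<ge> 0" unfolding D_def by (simp add: sum_nonneg)
    have "\<bar>D' s\<bar> \<le> (\<Sum>k\<in>UNIV. 2 * \<bar>y s k - Y (s - b) k\<bar> * \<bar>peval (y s) (F k) - peval (Y (s - b)) (F k)\<bar>)"
      unfolding D'_def by (rule order_trans[OF sum_abs]) (simp only: abs_mult abs_numeral order_refl)
    also have "\<dots> \<le> (\<Sum>k\<in>UNIV. 2 * sqrt (D s) * (plip A' (F k) * sqrt (D s)))"
    proof (intro sum_mono mult_mono)
      fix k show "\<bar>peval (y s) (F k) - peval (Y (s - b)) (F k)\<bar> \<le> plip A' (F k) * sqrt (D s)"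
        by (intro peval_lipschitz BA s' sq A' order_trans[OF bd[OF s'(1) s(2)] A'(2)])
    qed (use sq D0 in \<open>simp_all add: mult_left_mono\<close>)
    also have "\<dots> = L * D s"
      unfolding L_def sum_distrib_left sum_distrib_right
    proof (intro sum.cong refl)
      fix k
      have "sqrt (D s) * sqrt (D s) = D s" using D0 by simp
      then show "2 * sqrt (D s) * (plip A' (F k) * sqrt (D s)) = 2 * plip A' (F k) * D s"
        by (metis mult.assoc mult.commute)
    qed
    finally show "\<bar>D' s\<bar> \<le> L * D s" .
  next
    have "((\<lambda>s. Y (s - b) k) \<longlongrightarrow> y0 k) (at_left b)" for k
    proof -
      have "((\<lambda>s. Y (s - b) k) \<longlongrightarrow> Y (b - b) k) (at b)"
        using DERIV_isCont[OF Yder[of b k]] g(1) by (simp add: isCont_def)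
      from tendsto_within_subset[OF this subset_UNIV] show ?thesis by (simp add: Y_def g(3))
    qed
    then have "(D \<longlongrightarrow> (\<Sum>k\<in>UNIV. (y0 k - y0 k)\<^sup>2)) (at_left b)"
      unfolding D_def by (intro tendsto_intros y0)
    then show "(D \<longlongrightarrow> 0) (at_left b)" by simp
  qed (simp add: D_def sum_nonneg)
  show ?thesis
  proof
    show "\<epsilon> > 0" "\<epsilon> \<le> b - a" by fact+
    show "fps_deriv (g k) = pfps g (F k)" for k by (rule g(5))
    show "fps_conv_radius (g k) \<ge> ereal \<epsilon>" for k using order_trans[OF _ g(2)[of k], of "ereal \<epsilon>"] \<epsilon> by simp
    show "(eval_fps (g k) has_real_derivative peval (\<lambda>k. eval_fps (g k) s) (F k)) (at s)"
      if "\<bar>s\<bar> < \<epsilon>" for k s using g(4) that \<epsilon> by simp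
    show "y (b + s) k = eval_fps (g k) s" if "- \<epsilon> < s" "s < 0" for k s
    proof -
      have "D (b + s) = 0" using that by (intro zero) auto
      then have "y (b + s) k - Y (b + s - b) k = 0" by (simp add: D_def sum_nonneg_eq_0_iff)
      then show ?thesis by (simp add: Y_def)
    qed
  qed
qed

section \<open>Parametrization by the cube root of time\<close>

text \<open>The last conclusion avoids naming the range of f, whose endpoints need not be known: a
  value enclosed between two attained values is attained in between.\<close>

lemma increasing_inverse:
  fixes f f' :: "real \<Rightarrow> real"
  assumes der: "\<And>t. a < t \<Longrightarrow> t < b \<Longrightarrow> (f has_real_derivative f' t) (at t)"
    and pos: "\<And>t. a < t \<Longrightarrow> t < b \<Longrightarrow> f' t > 0"
  obtains g :: "real \<Rightarrow> real"
  where "\<And>t. a < t \<Longrightarrow> t < b \<Longrightarrow> g (f t) = t"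
    "\<And>t. a < t \<Longrightarrow> t < b \<Longrightarrow> (g has_real_derivative 1 / f' t) (at (f t))"
    "\<And>s t. a < s \<Longrightarrow> s < t \<Longrightarrow> t < b \<Longrightarrow> f s < f t"
    "\<And>s t y. a < s \<Longrightarrow> s < t \<Longrightarrow> t < b \<Longrightarrow> f s < y \<Longrightarrow> y < f t \<Longrightarrow>
      s < g y \<and> g y < t \<and> f (g y) = y"
proof -
  have less: "f s < f t" if "a < s" "s < t" "t < b" for s t
  proof (rule DERIV_pos_imp_increasing[OF that(2)])
    fix x assume "s \<le> x" "x \<le> t"
    then have "a < x" "x < b" using that by linarith+
    then show "\<exists>y. (f has_real_derivative y) (at x) \<and> 0 < y" using der pos by blast
  qed
  then have inj: "inj_on f {a<..<b}"
    by (intro linorder_inj_onI') (metis greaterThanLessThan_iff less_irrefl)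
  define g where "g = the_inv_into {a<..<b} f"
  have g: "g (f t) = t" if "a < t" "t < b" for t
    using the_inv_into_f_f[OF inj] that by (simp add: g_def)
  have cont: "continuous_on {a<..<b} f"
    by (intro continuous_at_imp_continuous_on ballI) (simp add: DERIV_isCont[OF der])
  show ?thesis
  proof (rule that[OF g _ less])
    fix t assume t: "a < t" "t < b"
    have "f' t \<noteq> 0" "t \<in> {a<..<b}" using pos[OF t] t by simp_all
    from has_field_derivative_inverse_strong[OF der[OF t] this(1) _ this(2) cont]
    have "DERIV g (f t) :> inverse (f' t)" using g by simp
    then show "(g has_real_derivative 1 / f' t) (at (f t))" by (simp add: inverse_eq_divide)
  next
    fix s t y assume st: "a < s" "s < t" "t < b" "f s < y" "y < f t"
    have "continuous_on {s..t} f" by (rule continuous_on_subset[OF cont]) (use st in auto)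
    then obtain x where x: "s \<le> x" "x \<le> t" "f x = y"
      using IVT'[of f s y t] st by auto
    have "x \<noteq> s" "x \<noteq> t" using st x(3) by auto
    then have "s < x" "x < t" using x by simp_all
    moreover have "g y = x" using g[of x] x st \<open>s < x\<close> \<open>x < t\<close> by simp
    ultimately show "s < g y \<and> g y < t \<and> f (g y) = y" using x(3) by simp
  qed auto
qed

section \<open>Analytic identities and the analytic cube root\<close>

lemma ereal_less_le_trans: "x < y \<Longrightarrow> ereal y \<le> R \<Longrightarrow> ereal x < R"
  by (rule less_le_trans[of _ "ereal y"]) auto

text \<open>One-sided identity theorem: a nonzero power series has no zeros in a punctured
  neighbourhood of 0, in particular not a whole interval to the left.\<close>

lemma eval_fps_zero_left_imp_zero:
  fixes G :: "real fps"
  assumes \<epsilon>: "\<epsilon> > 0" "fps_conv_radius G \<ge> ereal \<epsilon>"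
    and zero: "\<And>s. - \<epsilon> < s \<Longrightarrow> s < 0 \<Longrightarrow> eval_fps G s = 0"
  shows "G = 0"
proof (rule ccontr)
  assume "G \<noteq> 0"
  then obtain m where m: "fps_nth G m \<noteq> 0" by (auto simp: fps_eq_iff)
  have R: "ereal (norm s) < fps_conv_radius G" if "\<bar>s\<bar> < \<epsilon>" for s
    using \<epsilon>(2) that by (simp add: ereal_less_le_trans)
  have "continuous (at 0) (eval_fps G)" using R[of 0] \<epsilon> by (intro continuous_eval_fps) auto
  then have "(eval_fps G \<longlongrightarrow> eval_fps G 0) (at_left 0)"
    by (meson continuous_within continuous_at_imp_continuous_at_within)
  moreover have "eventually (\<lambda>s. eval_fps G s = 0) (at_left 0)"
    using eventually_at_left[of "-\<epsilon>" 0] \<epsilon> zero by (auto intro!: exI[of _ "-\<epsilon>"])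
  then have "(eval_fps G \<longlongrightarrow> 0) (at_left 0)" by (simp add: tendsto_eventually)
  ultimately have G0: "eval_fps G 0 = 0"
    using tendsto_unique trivial_limit_at_left_real by blast
  then have "m \<noteq> 0" using m by (cases m) (auto simp: eval_fps_at_0)
  moreover have "(\<lambda>n. fps_nth G n * (s - 0) ^ n) sums eval_fps G s" if "norm (s - 0) < \<epsilon>" for s
    using sums_eval_fps[of s G] R[of s] that by simp
  ultimately obtain r where r: "r > 0" "\<And>z. z \<in> cball 0 r - {0} \<Longrightarrow> eval_fps G z \<noteq> 0"
    using powser_0_nonzero[OF \<epsilon>(1), where a = "fps_nth G" and \<xi> = 0 and f = "eval_fps G" and m = m] G0 m by auto
  define z where "z = - min r (\<epsilon> / 2)"
  have "z \<in> cball 0 r - {0}" "- \<epsilon> < z" "z < 0"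
    using r(1) \<epsilon>(1) by (auto simp: z_def min_def)
  then show False using r(2) zero by blast
qed

text \<open>This carries relations across an endpoint: a polynomial relation between the variables
  that holds before s = 0 holds after it as well.\<close>

lemma peval_identity:
  assumes \<epsilon>: "\<epsilon> > 0" "\<And>k. fps_conv_radius (g k) \<ge> ereal \<epsilon>"
    and zero: "\<And>s. - \<epsilon> < s \<Longrightarrow> s < 0 \<Longrightarrow> peval (\<lambda>k. eval_fps (g k) s) e = 0"
    and s: "\<bar>s\<bar> < \<epsilon>"
  shows "peval (\<lambda>k. eval_fps (g k) s) e = 0"
proof -
  have "pfps g e = 0"
    by (rule eval_fps_zero_left_imp_zero[OF \<epsilon>(1) pfps_conv_radius[OF \<epsilon>(2)]])
      (use zero eval_pfps[of "ereal \<epsilon>" g, OF \<epsilon>(2)] in simp)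
  then show ?thesis using eval_pfps[of "ereal \<epsilon>" g s e, OF \<epsilon>(2)] s by (simp add: eval_fps_def)
qed

text \<open>Complexification makes the holomorphic inverse function theorem and Taylor expansion on
  discs available for real series.\<close>

definition fps_complex :: "real fps \<Rightarrow> complex fps" where
  "fps_complex f = Abs_fps (\<lambda>n. complex_of_real (fps_nth f n))"

lemma fps_nth_fps_complex [simp]: "fps_nth (fps_complex f) n = of_real (fps_nth f n)"
  by (simp add: fps_complex_def)

lemma fps_conv_radius_fps_complex [simp]: "fps_conv_radius (fps_complex f) = fps_conv_radius f"
proof -
  have "fps_conv_radius (fps_complex f) = fps_conv_radius (Abs_fps (\<lambda>n. norm (fps_nth (fps_complex f) n)))"
    by (rule fps_conv_radius_norm[symmetric])
  also have "\<dots> = fps_conv_radius (Abs_fps (\<lambda>n. norm (fps_nth f n)))" by simp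
  also have "\<dots> = fps_conv_radius f" by (rule fps_conv_radius_norm)
  finally show ?thesis .
qed

lemma eval_fps_complex:
  assumes "ereal \<bar>s\<bar> < fps_conv_radius f"
  shows "eval_fps (fps_complex f) (of_real s) = of_real (eval_fps f s)"
proof -
  have "(\<lambda>n. fps_nth f n * s ^ n) sums eval_fps f s"
    using assms by (intro sums_eval_fps) simp
  then have "(\<lambda>n. complex_of_real (fps_nth f n * s ^ n)) sums of_real (eval_fps f s)"
    by (rule sums_of_real)
  then show ?thesis by (simp add: eval_fps_def sums_iff)
qed

text \<open>The cube root of \<open>T s = c s\<^sup>3 + \<dots>\<close> is a local analytic coordinate.\<close>

lemma cube_root_parametrization:
  fixes T :: "real fps"
  assumes \<epsilon>: "\<epsilon> > 0" "fps_conv_radius T \<ge> ereal \<epsilon>"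
    and T: "fps_nth T 0 = 0" "fps_nth T 1 = 0" "fps_nth T 2 = 0" "fps_nth T 3 > 0"
  obtains \<delta> :: real and \<sigma> :: "real \<Rightarrow> real"
  where "\<delta> > 0" "\<And>\<tau>. \<bar>\<tau>\<bar> < \<delta> \<Longrightarrow> \<bar>\<sigma> \<tau>\<bar> < \<epsilon>" "\<And>\<tau>. \<bar>\<tau>\<bar> < \<delta> \<Longrightarrow> eval_fps T (\<sigma> \<tau>) = \<tau> ^ 3"
    "\<And>X. fps_conv_radius X \<ge> ereal \<epsilon> \<Longrightarrow>
      \<exists>C. \<forall>\<tau>. \<bar>\<tau>\<bar> < \<delta> \<longrightarrow> (\<lambda>n. C n * \<tau> ^ n) sums eval_fps X (\<sigma> \<tau>)"
proof -
  \<comment> \<open>T = s^3 G with G(0) > 0, so only a cube root of G has to be taken.\<close>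
  define G where "G = fps_shift 3 T"
  have RG: "fps_conv_radius G \<ge> ereal \<epsilon>" using \<epsilon>(2) by (simp add: G_def)
  have TG: "T = G * fps_X ^ 3"
  proof (rule fps_ext)
    fix n show "fps_nth T n = fps_nth (G * fps_X ^ 3) n"
    proof (cases "n < 3")
      case True
      then have "n = 0 \<or> n = 1 \<or> n = 2" by auto
      then show ?thesis using T True by (auto simp: fps_X_power_mult_right_nth)
    qed (simp add: G_def fps_X_power_mult_right_nth)
  qed
  have evT: "eval_fps T s = s ^ 3 * eval_fps G s" if "\<bar>s\<bar> < \<epsilon>" for s
    using that RG by (subst TG, subst eval_fps_mult) (simp_all add: ereal_less_le_trans)
  define Gc where "Gc = eval_fps (fps_complex G)"
  have sub: "ball 0 \<epsilon> \<subseteq> eball (0::complex) (fps_conv_radius (fps_complex X))"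
    if "fps_conv_radius X \<ge> ereal \<epsilon>" for X
    using that by (intro ball_eball_mono) simp
  have holX: "eval_fps (fps_complex X) holomorphic_on ball 0 \<epsilon>" if "fps_conv_radius X \<ge> ereal \<epsilon>" for X
    using sub[OF that] by (rule holomorphic_on_eval_fps)
  have holG: "Gc holomorphic_on ball 0 \<epsilon>" unfolding Gc_def by (rule holX[OF RG])
  have Gc0: "Gc 0 = of_real (fps_nth T 3)" by (simp add: Gc_def eval_fps_at_0 G_def)
  have "isCont Gc 0"
    using holG \<epsilon>(1) by (intro continuous_on_interior[OF holomorphic_on_imp_continuous_on[OF holG]]) simp
  then have "isCont (\<lambda>z. Re (Gc z)) 0" unfolding isCont_def by (rule tendsto_Re)
  then have "((\<lambda>z. Re (Gc z)) \<longlongrightarrow> Re (Gc 0)) (nhds 0)"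
    unfolding isCont_def by (rule tendsto_at_iff_tendsto_nhds[THEN iffD1])
  then have "eventually (\<lambda>z. Re (Gc z) > 0) (nhds 0)"
    using T(4) Gc0 by (intro order_tendstoD(1)) auto
  then obtain e where e: "e > 0" "\<And>z. dist z 0 < e \<Longrightarrow> Re (Gc z) > 0"
    unfolding eventually_nhds_metric by blast
  define \<epsilon>' where "\<epsilon>' = min e \<epsilon>"
  have \<epsilon>': "\<epsilon>' > 0" "\<epsilon>' \<le> \<epsilon>" using e \<epsilon> by (auto simp: \<epsilon>'_def)
  have GRe: "Re (Gc z) > 0" if "z \<in> ball 0 \<epsilon>'" for z
    using that e(2)[of z] by (simp add: \<epsilon>'_def dist_commute)
  have holG': "Gc holomorphic_on ball 0 \<epsilon>'" using holG by (rule holomorphic_on_subset) (use \<epsilon>' in auto)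
  \<comment> \<open>The analytic cube root of T: G has positive real part near 0, so the principal
    logarithm is holomorphic there. Its derivative at 0 is a cube root of G(0), so it is locally
    invertible.\<close>
  define \<kappa> where "\<kappa> = (\<lambda>z. z * exp (Ln (Gc z) / 3))"
  have nonpos: "Gc z \<notin> \<real>\<^sub>\<le>\<^sub>0" if "z \<in> ball 0 \<epsilon>'" for z
    using GRe[OF that] by (auto simp: complex_nonpos_Reals_iff)
  have hol\<kappa>: "\<kappa> holomorphic_on ball 0 \<epsilon>'"
    unfolding \<kappa>_def by (intro holomorphic_intros holG' nonpos) auto
  have der\<kappa>: "deriv \<kappa> 0 \<noteq> 0"
  proof -
    have "(\<lambda>z. exp (Ln (Gc z) / 3)) holomorphic_on ball 0 \<epsilon>'"
      by (intro holomorphic_intros holG' nonpos) auto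
    then have "(\<lambda>z. exp (Ln (Gc z) / 3)) field_differentiable at 0"
      using \<epsilon>'(1) by (intro holomorphic_on_imp_differentiable_at[of _ "ball 0 \<epsilon>'"]) auto
    then obtain D where "((\<lambda>z. exp (Ln (Gc z) / 3)) has_field_derivative D) (at 0)"
      by (auto simp: field_differentiable_def)
    then have "(\<kappa> has_field_derivative exp (Ln (Gc 0) / 3)) (at 0)"
      unfolding \<kappa>_def using DERIV_mult[OF DERIV_ident] by fastforce
    then show ?thesis by (simp add: DERIV_imp_deriv)
  qed
  have "0 \<in> ball (0::complex) \<epsilon>'" using \<epsilon>'(1) by simp
  then obtain r where r: "r > 0" "ball 0 r \<subseteq> ball (0::complex) \<epsilon>'" "open (\<kappa> ` ball 0 r)" "inj_on \<kappa> (ball 0 r)"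
    by (rule has_complex_derivative_locally_invertible[OF hol\<kappa> _ open_ball der\<kappa>]) (rule that; assumption)
  have hol\<kappa>r: "\<kappa> holomorphic_on ball 0 r" using hol\<kappa> r(2) by (rule holomorphic_on_subset)
  obtain \<psi> where \<psi>: "\<psi> holomorphic_on \<kappa> ` ball 0 r" "\<And>z. z \<in> ball 0 r \<Longrightarrow> \<psi> (\<kappa> z) = z"
    by (rule holomorphic_has_inverse[OF hol\<kappa>r open_ball r(4)]) (rule that; assumption)
  have "\<kappa> 0 \<in> \<kappa> ` ball 0 r" using r(1) by (intro imageI) auto
  then have "0 \<in> \<kappa> ` ball 0 r" by (simp add: \<kappa>_def)
  then obtain d where d: "d > 0" "ball 0 d \<subseteq> \<kappa> ` ball 0 r"
    using r(3) open_contains_ball by blast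
  define k where "k = (\<lambda>s. s * exp (ln (eval_fps G s) / 3))"
  have inball: "complex_of_real s \<in> ball 0 \<epsilon>'" "\<bar>s\<bar> < \<epsilon>" if "\<bar>s\<bar> < r" for s
  proof -
    have "complex_of_real s \<in> ball 0 r" using that by simp
    then show "complex_of_real s \<in> ball 0 \<epsilon>'" using r(2) by blast
    then show "\<bar>s\<bar> < \<epsilon>" using \<epsilon>' by auto
  qed
  have Gs: "Gc (of_real s) = of_real (eval_fps G s)" "eval_fps G s > 0" if "\<bar>s\<bar> < r" for s
  proof -
    show 1: "Gc (of_real s) = of_real (eval_fps G s)"
      unfolding Gc_def using inball[OF that] RG by (intro eval_fps_complex) (rule ereal_less_le_trans)
    show "eval_fps G s > 0" using GRe[OF inball(1)[OF that]] by (simp add: 1)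
  qed
  have \<kappa>k: "\<kappa> (of_real s) = of_real (k s)" if "\<bar>s\<bar> < r" for s
    using Gs[OF that] by (simp add: \<kappa>_def k_def Ln_of_real exp_of_real[symmetric])
  have k3: "k s ^ 3 = eval_fps T s" if "\<bar>s\<bar> < r" for s
  proof -
    have "exp (ln (eval_fps G s) / 3) ^ 3 = eval_fps G s"
      using Gs(2)[OF that] by (simp flip: exp_of_nat_mult)
    then show ?thesis using evT inball(2)[OF that] by (simp add: k_def power_mult_distrib)
  qed
  define \<rho> where "\<rho> = r / 2"
  have \<rho>: "\<rho> > 0" "\<rho> < r" using r(1) by (auto simp: \<rho>_def)
  have contk: "continuous_on {-\<rho>..\<rho>} k"
  proof -
    have "{-\<rho>..\<rho>} \<subseteq> eball 0 (fps_conv_radius G)"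
    proof
      fix s assume "s \<in> {-\<rho>..\<rho>}"
      then have "\<bar>s\<bar> < \<epsilon>" using inball(2)[of s] \<rho> by auto
      then show "s \<in> eball 0 (fps_conv_radius G)" using RG by (simp add: ereal_less_le_trans)
    qed
    then have "continuous_on {-\<rho>..\<rho>} (eval_fps G)"
      by (rule continuous_on_subset[OF continuous_on_eval_fps])
    moreover have "eval_fps G s \<noteq> 0" if "s \<in> {-\<rho>..\<rho>}" for s
    proof -
      have "\<bar>s\<bar> < r" using that \<rho> by auto
      from Gs(2)[OF this] show ?thesis by simp
    qed
    ultimately show ?thesis unfolding k_def
      by (intro continuous_on_mult continuous_on_id continuous_on_exp continuous_on_divide
          continuous_on_ln continuous_on_const ballI) simp_all
  qed
  define \<delta> where "\<delta> = min d (min (k \<rho>) (- k (- \<rho>)))"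
  have \<delta>: "\<delta> > 0" using d(1) \<rho> by (simp add: \<delta>_def k_def)
  have ex: "\<exists>s. \<bar>s\<bar> \<le> \<rho> \<and> k s = \<tau>" if "\<bar>\<tau>\<bar> < \<delta>" for \<tau>
  proof -
    have "\<delta> \<le> k \<rho>" "\<delta> \<le> - k (- \<rho>)" by (simp_all add: \<delta>_def)
    then have 1: "k (- \<rho>) \<le> \<tau>" "\<tau> \<le> k \<rho>" "- \<rho> \<le> \<rho>" using that \<rho> by linarith+
    obtain s where "- \<rho> \<le> s" "s \<le> \<rho>" "k s = \<tau>"
      using IVT'[OF 1 contk] by (elim exE conjE)
    then show ?thesis by (intro exI[of _ s]) linarith
  qed
  \<comment> \<open>The inverse along the real axis, obtained from the intermediate value theorem.
    Comparison with the holomorphic inverse \<psi> shows that \<psi> takes real values at real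
    arguments.\<close>
  define \<sigma> where "\<sigma> = (\<lambda>\<tau>. SOME s. \<bar>s\<bar> \<le> \<rho> \<and> k s = \<tau>)"
  have \<sigma>_both: "\<bar>\<sigma> \<tau>\<bar> \<le> \<rho> \<and> k (\<sigma> \<tau>) = \<tau>" if "\<bar>\<tau>\<bar> < \<delta>" for \<tau>
    unfolding \<sigma>_def by (rule someI_ex[OF ex[OF that]])
  have \<sigma>r: "\<bar>\<sigma> \<tau>\<bar> < r" if "\<bar>\<tau>\<bar> < \<delta>" for \<tau> using \<sigma>_both[OF that] \<rho> by linarith
  have \<sigma>k: "k (\<sigma> \<tau>) = \<tau>" if "\<bar>\<tau>\<bar> < \<delta>" for \<tau> using \<sigma>_both[OF that] by (rule conjunct2)
  have \<psi>\<sigma>: "\<psi> (of_real \<tau>) = of_real (\<sigma> \<tau>)" if \<tau>: "\<bar>\<tau>\<bar> < \<delta>" for \<tau>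
  proof -
    have "complex_of_real (\<sigma> \<tau>) \<in> ball 0 r" using \<sigma>r[OF \<tau>] by simp
    from \<psi>(2)[OF this] show ?thesis by (simp only: \<kappa>k[OF \<sigma>r[OF \<tau>]] \<sigma>k[OF \<tau>])
  qed
  show ?thesis
  proof (rule that[OF \<delta>])
    fix \<tau> :: real assume \<tau>: "\<bar>\<tau>\<bar> < \<delta>"
    show "\<bar>\<sigma> \<tau>\<bar> < \<epsilon>" using inball(2)[OF \<sigma>r[OF \<tau>]] .
    show "eval_fps T (\<sigma> \<tau>) = \<tau> ^ 3" using k3[OF \<sigma>r[OF \<tau>]] by (simp only: \<sigma>k[OF \<tau>])
  next
    fix X :: "real fps" assume X: "fps_conv_radius X \<ge> ereal \<epsilon>"
    define H where "H = eval_fps (fps_complex X) \<circ> \<psi>"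
    have "H holomorphic_on ball 0 \<delta>"
      unfolding H_def
    proof (rule holomorphic_on_compose_gen[OF _ holX[OF X]])
      have sub: "ball 0 \<delta> \<subseteq> \<kappa> ` ball 0 r"
        by (rule subset_trans[OF subset_ball d(2)]) (simp add: \<delta>_def)
      show "\<psi> holomorphic_on ball 0 \<delta>"
        using \<psi>(1) sub by (rule holomorphic_on_subset)
      have "\<psi> ` (\<kappa> ` ball 0 r) \<subseteq> ball 0 r" by (auto simp only: \<psi>(2))
      also have "\<dots> \<subseteq> ball 0 \<epsilon>" using r(2) subset_ball[OF \<epsilon>'(2)] by (rule subset_trans)
      finally show "\<psi> ` ball 0 \<delta> \<subseteq> ball 0 \<epsilon>"
        using image_mono[OF sub, of \<psi>] by (rule subset_trans[rotated])
    qed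
    then have sums: "(\<lambda>n. (deriv ^^ n) H 0 / fact n * (w - 0) ^ n) sums H w" if "w \<in> ball 0 \<delta>" for w
      using that by (rule holomorphic_power_series)
    \<comment> \<open>Passing to real parts of the Taylor coefficients changes nothing on the real
      axis, where H is real.\<close>
    define C where "C = (\<lambda>n. Re ((deriv ^^ n) H 0 / fact n))"
    have "(\<lambda>n. C n * \<tau> ^ n) sums eval_fps X (\<sigma> \<tau>)" if \<tau>: "\<bar>\<tau>\<bar> < \<delta>" for \<tau>
    proof -
      have "(\<lambda>n. Re ((deriv ^^ n) H 0 / fact n * of_real \<tau> ^ n)) sums Re (H (of_real \<tau>))"
        using sums[of "of_real \<tau>"] \<tau> by (intro sums_Re) simp
      moreover have "Re (c * of_real \<tau> ^ n) = Re c * \<tau> ^ n" for c n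
        unfolding of_real_power[symmetric] by simp
      moreover have "H (of_real \<tau>) = of_real (eval_fps X (\<sigma> \<tau>))"
        unfolding H_def o_def \<psi>\<sigma>[OF \<tau>]
        by (intro eval_fps_complex ereal_less_le_trans[OF inball(2)[OF \<sigma>r[OF \<tau>]] X])
      ultimately show ?thesis unfolding C_def by (simp only: Re_complex_of_real)
    qed
    then show "\<exists>C. \<forall>\<tau>. \<bar>\<tau>\<bar> < \<delta> \<longrightarrow> (\<lambda>n. C n * \<tau> ^ n) sums eval_fps X (\<sigma> \<tau>)" by blast
  qed
qed

section \<open>Regularization of a perturbed binary\<close>

no_notation fps_nth (infixl "$" 75)


lemma inner_plane: "x \<bullet> y = x $ 1 * y $ 1 + x $ 2 * y $ 2" for x y :: plane
  by (simp add: inner_vec_def sum_2)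

lemma has_vector_derivative_vec:
  fixes f :: "real \<Rightarrow> 'n::finite \<Rightarrow> real"
  assumes "\<And>k. ((\<lambda>s. f s k) has_real_derivative f' k) (at s)"
  shows "((\<lambda>s. \<chi> k. f s k) has_vector_derivative (\<chi> k. f' k)) (at s)"
  unfolding has_vector_derivative_def
proof (subst has_derivative_componentwise_within, intro ballI)
  fix i :: "real ^ 'n" assume "i \<in> Basis"
  then obtain k where i: "i = axis k 1" by (auto simp: Basis_vec_def)
  have "((\<lambda>s. f s k) has_derivative (\<lambda>x. x * f' k)) (at s)"
    using assms[of k] by (simp add: has_field_derivative_def mult_commute_abs)
  then show "((\<lambda>x. (\<chi> k. f x k) \<bullet> i) has_derivative (\<lambda>x. (x *\<^sub>R (\<chi> k. f' k)) \<bullet> i)) (at s)"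
    by (simp add: i inner_axis)
qed

lemma has_real_derivative_vec_nth:
  assumes "(f has_vector_derivative f') (at t)"
  shows "((\<lambda>t. f t $ k) has_real_derivative f' $ k) (at t)"
  using bounded_linear.has_vector_derivative[OF bounded_linear_vec_nth assms]
  by (simp add: has_real_derivative_iff_has_vector_derivative)

lemma has_real_derivative_inner:
  assumes "(f has_vector_derivative f') (at t)" "(g has_vector_derivative g') (at t)"
  shows "((\<lambda>t. f t \<bullet> g t) has_real_derivative f t \<bullet> g' + f' \<bullet> g t) (at t)"
  using bounded_bilinear.has_vector_derivative[OF bounded_bilinear_inner assms]
  by (simp add: has_real_derivative_iff_has_vector_derivative)

lemma has_real_derivative_norm:
  fixes f :: "real \<Rightarrow> 'a::real_inner"
  assumes "(f has_vector_derivative f') (at t)" "f t \<noteq> 0"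
  shows "((\<lambda>t. norm (f t)) has_real_derivative (f t \<bullet> f') / norm (f t)) (at t)"
proof -
  have "((\<lambda>t. sqrt (f t \<bullet> f t)) has_real_derivative
      (f t \<bullet> f' + f' \<bullet> f t) * (inverse (sqrt (f t \<bullet> f t)) / 2)) (at t)"
    using assms(2) by (intro DERIV_chain2[OF DERIV_real_sqrt has_real_derivative_inner[OF assms(1) assms(1)],
          THEN DERIV_cong]) auto
  then show ?thesis
    by (simp add: norm_eq_sqrt_inner inner_commute field_simps)
qed

definition grav :: "plane \<Rightarrow> plane" where
  "grav d = d /\<^sub>R norm d ^ 3"

text \<open>This also holds at 0, where both sides vanish by the convention for division; hence no
  hypothesis on d.\<close>

lemma norm_grav: "norm (grav d) = 1 / (norm d)\<^sup>2"
  by (cases "d = 0") (simp_all add: grav_def field_simps power2_eq_square power3_eq_cube)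

datatype var = vq 2 | vy 2 | vE | vA 2 | vr | ve | vR 2 | vV 2 | vu | vw | vt

instance var :: finite
proof
  have "(UNIV :: var set) = range vq \<union> range vy \<union> range vA \<union> range vR \<union> range vV \<union> {vE, vr, ve, vu, vw, vt}"
  proof (intro set_eqI iffI UNIV_I)
    fix x show "x \<in> range vq \<union> range vy \<union> range vA \<union> range vR \<union> range vV \<union> {vE, vr, ve, vu, vw, vt}"
      by (cases x) auto
  qed
  then show "finite (UNIV :: var set)" by (metis finite_UnI finite_imageI finite finite.emptyI finite.insertI)
qed

definition pneg :: "'n pexp \<Rightarrow> 'n pexp" where "pneg e = Times (Cst (-1)) e"
definition pdot :: "(2 \<Rightarrow> 'n pexp) \<Rightarrow> (2 \<Rightarrow> 'n pexp) \<Rightarrow> 'n pexp" where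
  "pdot x y = Plus (Times (x 1) (y 1)) (Times (x 2) (y 2))"
definition pcube :: "'n pexp \<Rightarrow> 'n pexp" where "pcube e = Times e (Times e e)"

lemma peval_ops [simp]:
  "peval y (pneg e) = - peval y e"
  "peval y (pdot f g) = (\<chi> k. peval y (f k)) \<bullet> (\<chi> k. peval y (g k))"
  "peval y (pcube e) = peval y e ^ 3"
  by (simp_all add: pneg_def pdot_def pcube_def inner_plane power3_eq_cube)

text \<open>With the inverse distance u of d as a variable of its own, the field d / |d|^3 becomes
  the polynomial d u^3.\<close>

definition pgrav :: "real \<Rightarrow> var \<Rightarrow> 2 \<Rightarrow> var pexp" where
  "pgrav a u k = Times (Plus (Var (vR k)) (Times (Cst a) (Var (vq k)))) (pcube (Var u))"

definition ppert :: "real \<Rightarrow> real \<Rightarrow> real \<Rightarrow> 2 \<Rightarrow> var pexp" where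
  "ppert c a b k = Times (Cst c) (Plus (pgrav b vw k) (pneg (pgrav a vu k)))"

text \<open>The derivative - u^3 (d . d') of an inverse distance, with d' taken in fictitious time:
  R contributes r V, and q contributes y, which already contains the factor r.\<close>

definition pinvdist :: "real \<Rightarrow> var \<Rightarrow> var pexp" where
  "pinvdist a u = pneg (Times (pcube (Var u)) (pdot
     (\<lambda>k. Plus (Var (vR k)) (Times (Cst a) (Var (vq k))))
     (\<lambda>k. Plus (Times (Var vr) (Var (vV k))) (Times (Cst a) (Var (vy k))))))"

text \<open>The Sperling--Burdet regularization of the relative motion \<open>q\<close> of a pair perturbed by a third
  body: in the fictitious time \<open>s\<close> with \<open>dt = r ds\<close>, \<open>r = |q|\<close>, and with \<open>y = dq/ds\<close>, the Kepler
  energy \<open>E\<close>, the Laplace vector \<open>A\<close>, \<open>e = dr/ds\<close>, the third body \<open>R\<close> with velocity \<open>V\<close>, and the inverse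
  distances \<open>u\<close>, \<open>w\<close> of the third body as further variables, the equations are polynomial and stay
  regular at \<open>q = 0\<close>.\<close>

fun kfield :: "real \<Rightarrow> real \<Rightarrow> real \<Rightarrow> real \<Rightarrow> real \<Rightarrow> real \<Rightarrow> var \<Rightarrow> var pexp" where
  "kfield \<mu> c \<alpha> \<beta> a b (vq k) = Var (vy k)"
| "kfield \<mu> c \<alpha> \<beta> a b (vy k) = Plus (Times (Cst 2) (Times (Var vE) (Var (vq k))))
     (Plus (pneg (Var (vA k))) (Times (Times (Var vr) (Var vr)) (ppert c a b k)))"
| "kfield \<mu> c \<alpha> \<beta> a b vE = pdot (\<lambda>k. Var (vy k)) (ppert c a b)"
| "kfield \<mu> c \<alpha> \<beta> a b (vA k) =
     Plus (Times (Cst 2) (Times (pdot (\<lambda>k. Var (vy k)) (ppert c a b)) (Var (vq k))))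
       (Plus (pneg (Times (pdot (\<lambda>k. Var (vq k)) (ppert c a b)) (Var (vy k))))
         (pneg (Times (pdot (\<lambda>k. Var (vq k)) (\<lambda>k. Var (vy k))) (ppert c a b k))))"
| "kfield \<mu> c \<alpha> \<beta> a b vr = Var ve"
| "kfield \<mu> c \<alpha> \<beta> a b ve = Plus (Times (Cst 2) (Times (Var vE) (Var vr)))
     (Plus (Cst \<mu>) (Times (Var vr) (pdot (\<lambda>k. Var (vq k)) (ppert c a b))))"
| "kfield \<mu> c \<alpha> \<beta> a b (vR k) = Times (Var vr) (Var (vV k))"
| "kfield \<mu> c \<alpha> \<beta> a b (vV k) = pneg (Times (Var vr)
     (Plus (Times (Cst \<alpha>) (pgrav a vu k)) (Times (Cst \<beta>) (pgrav b vw k))))"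
| "kfield \<mu> c \<alpha> \<beta> a b vu = pinvdist a vu"
| "kfield \<mu> c \<alpha> \<beta> a b vw = pinvdist b vw"
| "kfield \<mu> c \<alpha> \<beta> a b vt = Var vr"

text \<open>Physical states in the regular variables; y = r w since w is the velocity in physical
  time. The energy of the pair stays bounded at a collision although its two terms do not, which is
  why it is a variable. Physical time is carried along so that its own expansion in s is part of the
  solution.\<close>

fun kval :: "real \<Rightarrow> real \<Rightarrow> real \<Rightarrow> real \<Rightarrow> plane \<Rightarrow> plane \<Rightarrow> plane \<Rightarrow> plane \<Rightarrow> var \<Rightarrow> real" where
  "kval \<mu> a b t q w R V (vq k) = q $ k"
| "kval \<mu> a b t q w R V (vy k) = norm q * w $ k"
| "kval \<mu> a b t q w R V vE = (w \<bullet> w) / 2 - \<mu> / norm q"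
| "kval \<mu> a b t q w R V (vA k) = (w \<bullet> w - \<mu> / norm q) * q $ k - (q \<bullet> w) * w $ k"
| "kval \<mu> a b t q w R V vr = norm q"
| "kval \<mu> a b t q w R V ve = q \<bullet> w"
| "kval \<mu> a b t q w R V (vR k) = R $ k"
| "kval \<mu> a b t q w R V (vV k) = V $ k"
| "kval \<mu> a b t q w R V vu = 1 / norm (R + a *\<^sub>R q)"
| "kval \<mu> a b t q w R V vw = 1 / norm (R + b *\<^sub>R q)"
| "kval \<mu> a b t q w R V vt = t"

lemma vec_lambda_simps:
  "(\<chi> k. x $ k) = x" "(\<chi> k. s * x $ k) = s *\<^sub>R x" "(\<chi> k. x $ k + y $ k) = x + y"
  for x y :: "real ^ 'n"
  by (simp_all add: vec_eq_iff)

lemma vec_lambda_combine: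
  "(\<chi> k. x $ k + s * y $ k) = x + s *\<^sub>R y"
  "(\<chi> k. r * x $ k + s * (r * y $ k)) = r *\<^sub>R (x + s *\<^sub>R y)"
  for x y :: "real ^ 'n"
  by (simp_all add: vec_eq_iff algebra_simps)

lemma peval_pgrav:
  "y u = 1 / norm (R + a *\<^sub>R q) \<Longrightarrow> (\<And>k. y (vR k) = R $ k) \<Longrightarrow> (\<And>k. y (vq k) = q $ k) \<Longrightarrow>
    peval y (pgrav a u k) = grav (R + a *\<^sub>R q) $ k"
  by (simp add: pgrav_def grav_def power_one_over divide_inverse power_inverse mult.commute)

text \<open>The Kepler force cancels in the derivatives of the energy and of the Laplace vector,
  leaving only the perturbation P; no negative power of r remains after passing to fictitious time.
  The quotient by \<open>norm (q t)\<close> is that change of time.\<close>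

lemma kval_deriv:
  fixes q w R V :: "real \<Rightarrow> plane" and a b c :: real
  defines "di \<equiv> \<lambda>t. R t + a *\<^sub>R q t" and "dj \<equiv> \<lambda>t. R t + b *\<^sub>R q t"
  defines "P \<equiv> \<lambda>t. c *\<^sub>R (grav (dj t) - grav (di t))"
  assumes q: "(q has_vector_derivative w t) (at t)"
    and w: "(w has_vector_derivative (P t - \<mu> *\<^sub>R grav (q t))) (at t)"
    and R: "(R has_vector_derivative V t) (at t)"
    and V: "(V has_vector_derivative - (\<alpha> *\<^sub>R grav (di t) + \<beta> *\<^sub>R grav (dj t))) (at t)"
    and nz: "q t \<noteq> 0" "di t \<noteq> 0" "dj t \<noteq> 0"
  shows "((\<lambda>t. kval \<mu> a b t (q t) (w t) (R t) (V t) k) has_real_derivative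
      peval (kval \<mu> a b t (q t) (w t) (R t) (V t)) (kfield \<mu> c \<alpha> \<beta> a b k) / norm (q t)) (at t)"
proof -
  let ?r = "norm (q t)"
  let ?kv = "kval \<mu> a b t (q t) (w t) (R t) (V t)"
  have r: "?r > 0" "?r \<noteq> 0" using nz by auto
  have rr: "q t \<bullet> q t = ?r\<^sup>2" by (simp add: dot_square_norm)
  have Pk: "peval ?kv (ppert c a b k) = P t $ k" for k
    by (simp add: ppert_def P_def di_def dj_def peval_pgrav[where R = "R t" and q = "q t"])
  have Pv: "(\<chi> k. peval ?kv (ppert c a b k)) = P t" by (simp add: Pk vec_lambda_simps)
  note dq = has_real_derivative_vec_nth[OF q] and dw = has_real_derivative_vec_nth[OF w]
    and dR = has_real_derivative_vec_nth[OF R] and dV = has_real_derivative_vec_nth[OF V]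
  have dr: "((\<lambda>t. norm (q t)) has_real_derivative (q t \<bullet> w t) / ?r) (at t)"
    by (rule has_real_derivative_norm[OF q nz(1)])
  have dmr: "((\<lambda>t. \<mu> / norm (q t)) has_real_derivative - \<mu> * (q t \<bullet> w t) / ?r ^ 3) (at t)"
    by (rule DERIV_cong[OF DERIV_divide[OF DERIV_const dr r(2)]])
      (use r in \<open>simp add: field_simps power2_eq_square power3_eq_cube\<close>)
  have dww: "((\<lambda>t. w t \<bullet> w t) has_real_derivative 2 * (w t \<bullet> P t) - 2 * \<mu> * (q t \<bullet> w t) / ?r ^ 3) (at t)"
    by (rule DERIV_cong[OF has_real_derivative_inner[OF w w]])
      (simp add: grav_def inner_diff_right inner_diff_left inner_commute field_simps)
  have dqw: "((\<lambda>t. q t \<bullet> w t) has_real_derivative w t \<bullet> w t + q t \<bullet> P t - \<mu> / ?r) (at t)"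
    by (rule DERIV_cong[OF has_real_derivative_inner[OF q w]])
      (use r in \<open>simp add: grav_def inner_diff_right inner_diff_left inner_commute rr field_simps
        power2_eq_square power3_eq_cube\<close>)
  have ddi: "(di has_vector_derivative V t + a *\<^sub>R w t) (at t)"
    unfolding di_def by (intro has_vector_derivative_add R bounded_linear.has_vector_derivative[OF bounded_linear_scaleR_right q])
  have ddj: "(dj has_vector_derivative V t + b *\<^sub>R w t) (at t)"
    unfolding dj_def by (intro has_vector_derivative_add R bounded_linear.has_vector_derivative[OF bounded_linear_scaleR_right q])
  have inv: "((\<lambda>t. 1 / norm (d t)) has_real_derivative - (d t \<bullet> d') / norm (d t) ^ 3) (at t)"
    if "(d has_vector_derivative d') (at t)" "d t \<noteq> 0" for d :: "real \<Rightarrow> plane" and d'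
    by (rule derivative_eq_intros has_real_derivative_norm[OF that] refl)+
      (use that(2) in \<open>simp_all add: field_simps power2_eq_square power3_eq_cube\<close>)
  show ?thesis
  proof (cases k)
    case (vq j)
    then show ?thesis using dq[of j] r by simp
  next
    case (vy j)
    have "((\<lambda>t. norm (q t) * w t $ j) has_real_derivative
        (q t \<bullet> w t) / ?r * w t $ j + ?r * (P t $ j - \<mu> * q t $ j / ?r ^ 3)) (at t)"
      by (rule DERIV_cong[OF DERIV_mult[OF dr dw]])
        (simp add: grav_def field_simps)
    then show ?thesis
      by (simp add: vy Pk, elim DERIV_cong)
        (use r in \<open>simp add: field_simps power2_eq_square power3_eq_cube\<close>)
  next
    case vE
    have "((\<lambda>t. (w t \<bullet> w t) / 2 - \<mu> / norm (q t)) has_real_derivative w t \<bullet> P t) (at t)"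
      by (rule DERIV_cong[OF DERIV_diff[OF DERIV_cdivide[OF dww] dmr]])
        (use r in \<open>simp add: field_simps power2_eq_square power3_eq_cube\<close>)
    then show ?thesis using r by (simp add: vE Pv vec_lambda_simps)
  next
    case (vA j)
    have "((\<lambda>t. (w t \<bullet> w t - \<mu> / norm (q t)) * q t $ j - (q t \<bullet> w t) * w t $ j) has_real_derivative
        2 * (w t \<bullet> P t) * q t $ j - (q t \<bullet> P t) * w t $ j - (q t \<bullet> w t) * P t $ j) (at t)"
      by (rule DERIV_cong[OF DERIV_diff[OF DERIV_mult[OF DERIV_diff[OF dww dmr] dq] DERIV_mult[OF dqw dw]]])
        (use r in \<open>simp_all add: grav_def field_simps power2_eq_square power3_eq_cube\<close>)
    then show ?thesis
      by (simp add: vA Pk Pv vec_lambda_simps, elim DERIV_cong)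
        (use r in \<open>simp add: field_simps\<close>)
  next
    case vr
    then show ?thesis using dr by simp
  next
    case ve
    show ?thesis using dqw
      by (simp add: ve Pv vec_lambda_simps, elim DERIV_cong)
        (use r in \<open>simp add: field_simps\<close>)
  next
    case (vR j)
    then show ?thesis using dR[of j] r by simp
  next
    case (vV j)
    have "peval ?kv (kfield \<mu> c \<alpha> \<beta> a b (vV j)) / ?r = (- (\<alpha> *\<^sub>R grav (di t) + \<beta> *\<^sub>R grav (dj t))) $ j"
      using r by (simp add: peval_pgrav[where R = "R t" and q = "q t"] di_def dj_def field_simps)
    moreover have "((\<lambda>t. kval \<mu> a b t (q t) (w t) (R t) (V t) (vV j)) has_real_derivative
        (- (\<alpha> *\<^sub>R grav (di t) + \<beta> *\<^sub>R grav (dj t))) $ j) (at t)"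
      using dV[of j] by simp
    ultimately show ?thesis by (simp only: vV)
  next
    case vu
    have "peval ?kv (kfield \<mu> c \<alpha> \<beta> a b vu) / ?r = - (di t \<bullet> (V t + a *\<^sub>R w t)) / norm (di t) ^ 3"
      using r by (simp add: pinvdist_def di_def vec_lambda_combine power_one_over)
    moreover have "((\<lambda>t. kval \<mu> a b t (q t) (w t) (R t) (V t) vu) has_real_derivative
        - (di t \<bullet> (V t + a *\<^sub>R w t)) / norm (di t) ^ 3) (at t)"
      using inv[OF ddi nz(2)] by (simp add: di_def)
    ultimately show ?thesis by (simp only: vu)
  next
    case vw
    have "peval ?kv (kfield \<mu> c \<alpha> \<beta> a b vw) / ?r = - (dj t \<bullet> (V t + b *\<^sub>R w t)) / norm (dj t) ^ 3"
      using r by (simp add: pinvdist_def dj_def vec_lambda_combine power_one_over)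
    moreover have "((\<lambda>t. kval \<mu> a b t (q t) (w t) (R t) (V t) vw) has_real_derivative
        - (dj t \<bullet> (V t + b *\<^sub>R w t)) / norm (dj t) ^ 3) (at t)"
      using inv[OF ddj nz(3)] by (simp add: dj_def)
    ultimately show ?thesis by (simp only: vw)
  next
    case vt
    then show ?thesis using r by simp
  qed
qed

text \<open>The tidal acceleration of the pair: R + a q and R + b q point from its two members to
  the third body, and only the difference of the attractions acts on q.\<close>

definition kepler_pert :: "real \<Rightarrow> real \<Rightarrow> real \<Rightarrow> plane \<Rightarrow> plane \<Rightarrow> plane" where
  "kepler_pert c a b q R = c *\<^sub>R (grav (R + b *\<^sub>R q) - grav (R + a *\<^sub>R q))"

definition jacobi_motion_at ::
  "real \<Rightarrow> real \<Rightarrow> real \<Rightarrow> real \<Rightarrow> real \<Rightarrow> real \<Rightarrow>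
    (real \<Rightarrow> plane) \<Rightarrow> (real \<Rightarrow> plane) \<Rightarrow> (real \<Rightarrow> plane) \<Rightarrow> (real \<Rightarrow> plane) \<Rightarrow> real \<Rightarrow> bool" where
  "jacobi_motion_at \<mu> c \<alpha> \<beta> a b q w R V t \<longleftrightarrow>
     (q has_vector_derivative w t) (at t) \<and>
     (w has_vector_derivative kepler_pert c a b (q t) (R t) - \<mu> *\<^sub>R grav (q t)) (at t) \<and>
     (R has_vector_derivative V t) (at t) \<and>
     (V has_vector_derivative
        - (\<alpha> *\<^sub>R grav (R t + a *\<^sub>R q t) + \<beta> *\<^sub>R grav (R t + b *\<^sub>R q t))) (at t) \<and>
     q t \<noteq> 0 \<and> R t + a *\<^sub>R q t \<noteq> 0 \<and> R t + b *\<^sub>R q t \<noteq> 0"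

section \<open>Analyticity in the fictitious time up to the endpoint\<close>

lemma jacobi_kval_deriv:
  assumes "jacobi_motion_at \<mu> c \<alpha> \<beta> a b q w R V t"
  shows "((\<lambda>t. kval \<mu> a b t (q t) (w t) (R t) (V t) k) has_real_derivative
      peval (kval \<mu> a b t (q t) (w t) (R t) (V t)) (kfield \<mu> c \<alpha> \<beta> a b k) / norm (q t)) (at t)"
  using assms unfolding jacobi_motion_at_def kepler_pert_def
  by (intro kval_deriv) auto

lemma peval_ppert:
  "peval (kval \<mu> a b t q w R V) (ppert c a b k) = kepler_pert c a b q R $ k"
  by (simp add: ppert_def kepler_pert_def peval_pgrav[where R = R and q = q])

lemma norm_kepler_pert_le:
  assumes "\<delta> > 0" "norm (R + a *\<^sub>R q) \<ge> \<delta>" "norm (R + b *\<^sub>R q) \<ge> \<delta>"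
  shows "norm (kepler_pert c a b q R) \<le> \<bar>c\<bar> * (2 / \<delta>\<^sup>2)"
proof -
  have g: "norm (grav d) \<le> 1 / \<delta>\<^sup>2" if "norm d \<ge> \<delta>" for d
  proof -
    have "norm d > 0" using that assms(1) by linarith
    then show ?thesis
      unfolding norm_grav using that assms(1) by (intro divide_left_mono power_mono) auto
  qed
  have "norm (grav (R + b *\<^sub>R q) - grav (R + a *\<^sub>R q)) \<le> 1 / \<delta>\<^sup>2 + 1 / \<delta>\<^sup>2"
    by (rule order_trans[OF norm_triangle_ineq4 add_mono[OF g[OF assms(3)] g[OF assms(2)]]])
  then show ?thesis unfolding kepler_pert_def norm_scaleR
    by (intro mult_left_mono) auto
qed

text \<open>In the time S with dS = dt / |q| the system is polynomial with bounded variables, so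
  \<open>poly_ode_endpoint\<close> applies once the endpoint is reached at a finite S. It is: (q .
  w)' = 2 E + \<mu> / |q| + q . P with everything but \<mu> / |q| bounded, so \<mu> S is q . w up to
  a bounded error, and q . w is bounded.\<close>

lemma sundman_analytic:
  assumes \<mu>: "\<mu> > 0" and t12: "t1 < t2" and C: "C > 0" and \<delta>: "\<delta> > 0"
    and mot: "\<And>t. t1 < t \<Longrightarrow> t < t2 \<Longrightarrow> jacobi_motion_at \<mu> c \<alpha> \<beta> a b q w R V t"
    and bq: "\<And>t. t1 < t \<Longrightarrow> t < t2 \<Longrightarrow> norm (q t) \<le> C"
    and bR: "\<And>t. t1 < t \<Longrightarrow> t < t2 \<Longrightarrow> norm (R t) \<le> C"
    and bV: "\<And>t. t1 < t \<Longrightarrow> t < t2 \<Longrightarrow> norm (V t) \<le> C"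
    and bE: "\<And>t. t1 < t \<Longrightarrow> t < t2 \<Longrightarrow> \<bar>(w t \<bullet> w t) / 2 - \<mu> / norm (q t)\<bar> \<le> C"
    and bi: "\<And>t. t1 < t \<Longrightarrow> t < t2 \<Longrightarrow> norm (R t + a *\<^sub>R q t) \<ge> \<delta>"
    and bj: "\<And>t. t1 < t \<Longrightarrow> t < t2 \<Longrightarrow> norm (R t + b *\<^sub>R q t) \<ge> \<delta>"
  obtains g :: "var \<Rightarrow> real fps" and \<epsilon> t0 :: real
  where "\<epsilon> > 0" "t1 \<le> t0" "t0 < t2" "\<And>k. fps_conv_radius (g k) \<ge> ereal \<epsilon>"
    "\<And>k s. \<bar>s\<bar> < \<epsilon> \<Longrightarrow> (eval_fps (g k) has_real_derivative
      peval (\<lambda>k. eval_fps (g k) s) (kfield \<mu> c \<alpha> \<beta> a b k)) (at s)"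
    "\<And>k. fps_deriv (g k) = pfps g (kfield \<mu> c \<alpha> \<beta> a b k)"
    "\<And>s. - \<epsilon> < s \<Longrightarrow> s < 0 \<Longrightarrow> \<exists>t. t0 < t \<and> t < t2 \<and>
      (\<forall>k. eval_fps (g k) s = kval \<mu> a b t (q t) (w t) (R t) (V t) k)"
    "\<And>t. t0 < t \<Longrightarrow> t < t2 \<Longrightarrow> \<exists>s. - \<epsilon> < s \<and> s < 0 \<and> eval_fps (g vt) s = t"
proof -
  define kv where "kv = (\<lambda>t. kval \<mu> a b t (q t) (w t) (R t) (V t))"
  let ?F = "kfield \<mu> c \<alpha> \<beta> a b"
  have dkv: "((\<lambda>t. kv t k) has_real_derivative peval (kv t) (?F k) / norm (q t)) (at t)"
    if "t1 < t" "t < t2" for t k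
    using jacobi_kval_deriv[OF mot[OF that]] by (simp add: kv_def)
  have q0: "norm (q t) > 0" if "t1 < t" "t < t2" for t
    using mot[OF that] by (simp add: jacobi_motion_at_def)
  \<comment> \<open>From |q| (w . w) = 2 E |q| + 2 \<mu> \<le> 2 C^2 + 2 \<mu>, multiplied once more
    by |q| \<le> C.\<close>
  define C4 where "C4 = 2 * C ^ 3 + 2 * \<mu> * C"
  have rww: "norm (q t) * (w t \<bullet> w t) \<le> 2 * C * C + 2 * \<mu>" "(norm (q t) * norm (w t))\<^sup>2 \<le> C4"
    if t: "t1 < t" "t < t2" for t
  proof -
    define E where "E = (w t \<bullet> w t) / 2 - \<mu> / norm (q t)"
    have E: "\<bar>E\<bar> \<le> C" using bE[OF t] by (simp add: E_def)
    have 1: "norm (q t) * (w t \<bullet> w t) = 2 * (E * norm (q t)) + 2 * \<mu>"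
      using q0[OF t] by (simp add: E_def field_simps)
    have 2: "E * norm (q t) \<le> C * C"
      using E bq[OF t] C by (intro mult_mono) auto
    show 3: "norm (q t) * (w t \<bullet> w t) \<le> 2 * C * C + 2 * \<mu>" using 1 2 by simp
    have "(norm (q t) * norm (w t))\<^sup>2 = norm (q t) * (norm (q t) * (w t \<bullet> w t))"
      by (simp add: power2_eq_square dot_square_norm)
    also have "\<dots> \<le> C * (2 * C * C + 2 * \<mu>)"
      using 3 bq[OF t] C by (intro mult_mono) auto
    finally show "(norm (q t) * norm (w t))\<^sup>2 \<le> C4"
      by (simp add: C4_def algebra_simps power3_eq_cube)
  qed
  have rw: "norm (q t) * norm (w t) \<le> 1 + C4" if t: "t1 < t" "t < t2" for t
  proof -
    have "x \<le> 1 + x\<^sup>2" for x :: real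
    proof -
      have "(x - 1)\<^sup>2 = x\<^sup>2 - 2 * x + 1" by (simp add: power2_diff)
      then show ?thesis using zero_le_power2[of "x - 1"] zero_le_power2[of x] by linarith
    qed
    from order_trans[OF this add_left_mono[OF rww(2)[OF t]]] show ?thesis .
  qed
  have qw: "\<bar>q t \<bullet> w t\<bar> \<le> 1 + C4" if "t1 < t" "t < t2" for t
    using Cauchy_Schwarz_ineq2 rw[OF that] by (rule order_trans)
  \<comment> \<open>Bounds |2 E + q . P|, the part of (q . w)' other than \<mu> / |q|.\<close>
  define C3 where "C3 = 2 * C + C * (\<bar>c\<bar> * (2 / \<delta>\<^sup>2))"
  have qP: "\<bar>q t \<bullet> kepler_pert c a b (q t) (R t)\<bar> \<le> C * (\<bar>c\<bar> * (2 / \<delta>\<^sup>2))" if t: "t1 < t" "t < t2" for t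
  proof -
    have "\<bar>q t \<bullet> kepler_pert c a b (q t) (R t)\<bar> \<le> norm (q t) * norm (kepler_pert c a b (q t) (R t))"
      by (rule Cauchy_Schwarz_ineq2)
    also have "\<dots> \<le> C * (\<bar>c\<bar> * (2 / \<delta>\<^sup>2))"
      using bq[OF t] norm_kepler_pert_le[OF \<delta> bi[OF t] bj[OF t]] C by (intro mult_mono) auto
    finally show ?thesis .
  qed
  \<comment> \<open>Three successive points leave room on the left: S is integrated from m, its
    bound and its inverse are used beyond m1, and the system is followed from m2 on.\<close>
  define m where "m = (t1 + t2) / 2"
  have m: "t1 < m" "m < t2" using t12 by (auto simp: m_def)
  define m1 where "m1 = (m + t2) / 2"
  have m1: "m < m1" "m1 < t2" using m by (auto simp: m1_def)
  define m2 where "m2 = (m1 + t2) / 2"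
  have m2: "m1 < m2" "m2 < t2" using m1 by (auto simp: m2_def)
  define S where "S = (\<lambda>t. integral {m..t} (\<lambda>x. 1 / norm (q x)))"
  have dS: "(S has_real_derivative 1 / norm (q t)) (at t)" if t: "m < t" "t < t2" for t
  proof -
    define u where "u = (t + t2) / 2"
    have u: "t < u" "u < t2" using t by (auto simp: u_def)
    have "isCont q x" if "t1 < x" "x < t2" for x
      using mot[OF that] unfolding jacobi_motion_at_def by (auto intro: has_vector_derivative_continuous)
    then have "continuous_on {m..u} q"
      using m u by (intro continuous_at_imp_continuous_on ballI) simp
    moreover have "norm (q x) \<noteq> 0" if "x \<in> {m..u}" for x
      using q0[of x] that m u by simp
    ultimately have "continuous_on {m..u} (\<lambda>x. 1 / norm (q x))"
      by (intro continuous_on_divide continuous_on_const continuous_on_norm ballI)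
    from integral_has_real_derivative[OF this, of t] have
      "(S has_real_derivative 1 / norm (q t)) (at t within {m..u})"
      using t u by (simp add: S_def)
    then show ?thesis
      using t u by (simp add: at_within_Icc_at)
  qed
  have Spos: "1 / norm (q t) > 0" if "m < t" "t < t2" for t
    using q0[of t] that m by simp
  \<comment> \<open>H' = - (2 E + q . P) - C3 \<le> 0, so H stays below its value at m1; with q . w
    bounded this bounds S.\<close>
  define H where "H = (\<lambda>t. \<mu> * S t - q t \<bullet> w t - C3 * t)"
  have H: "H t \<le> H m1" if t: "m1 \<le> t" "t < t2" for t
  proof (rule DERIV_nonpos_imp_nonincreasing[OF t(1)])
    fix x assume x: "m1 \<le> x" "x \<le> t"
    then have x': "m < x" "t1 < x" "x < t2" using m m1 t by auto
    define E where "E = (w x \<bullet> w x) / 2 - \<mu> / norm (q x)"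
    define p where "p = q x \<bullet> kepler_pert c a b (q x) (R x)"
    have "((\<lambda>t. q t \<bullet> w t) has_real_derivative 2 * E + \<mu> / norm (q x) + p) (at x)"
    proof (rule DERIV_cong)
      show "((\<lambda>t. q t \<bullet> w t) has_real_derivative peval (kv x) (?F ve) / norm (q x)) (at x)"
        using dkv[OF x'(2,3), of ve] by (simp add: kv_def)
      show "peval (kv x) (?F ve) / norm (q x) = 2 * E + \<mu> / norm (q x) + p"
        using q0[OF x'(2,3)] by (simp add: kv_def peval_ppert vec_lambda_simps E_def p_def field_simps)
    qed
    then have "(H has_real_derivative \<mu> * (1 / norm (q x)) - (2 * E + \<mu> / norm (q x) + p) - C3) (at x)"
      unfolding H_def
      using DERIV_cmult[OF DERIV_ident, of C3 x] by (intro DERIV_diff DERIV_cmult dS[OF x'(1,3)]) simp_all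
    moreover have "\<mu> * (1 / norm (q x)) - (2 * E + \<mu> / norm (q x) + p) - C3 \<le> 0"
      using bE[OF x'(2,3)] qP[OF x'(2,3)] by (simp add: C3_def E_def[symmetric] p_def[symmetric] abs_le_iff)
    ultimately show "\<exists>y. (H has_real_derivative y) (at x) \<and> y \<le> 0" by blast
  qed
  define B where "B = (H m1 + (1 + C4) + C3 * t2) / \<mu>"
  have C3: "C3 \<ge> 0" using C by (simp add: C3_def)
  have SB: "S t \<le> B" if t: "m1 < t" "t < t2" for t
  proof -
    have "t1 < t" using t m m1 by simp
    have "\<mu> * S t = H t + q t \<bullet> w t + C3 * t" by (simp add: H_def)
    also have "\<dots> \<le> H m1 + (1 + C4) + C3 * t2"
      using H[of t] qw[of t] t \<open>t1 < t\<close> C3 by (intro add_mono mult_left_mono) auto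
    finally show ?thesis using \<mu> by (simp add: B_def field_simps)
  qed
  have dS1: "(S has_real_derivative 1 / norm (q t)) (at t)" if "m1 < t" "t < t2" for t
    using dS that m1 by simp
  have Spos1: "1 / norm (q t) > 0" if "m1 < t" "t < t2" for t
    using Spos that m1 by simp
  obtain T where T: "\<And>t. m1 < t \<Longrightarrow> t < t2 \<Longrightarrow> T (S t) = t"
    "\<And>t. m1 < t \<Longrightarrow> t < t2 \<Longrightarrow> (T has_real_derivative 1 / (1 / norm (q t))) (at (S t))"
    "\<And>s t. m1 < s \<Longrightarrow> s < t \<Longrightarrow> t < t2 \<Longrightarrow> S s < S t"
    "\<And>s t y. m1 < s \<Longrightarrow> s < t \<Longrightarrow> t < t2 \<Longrightarrow> S s < y \<Longrightarrow> y < S t \<Longrightarrow> s < T y \<and> T y < t \<and> S (T y) = y"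
    by (rule increasing_inverse[of m1 t2 S "\<lambda>t. 1 / norm (q t)", OF dS1 Spos1]) ((assumption | rule that)+)
  \<comment> \<open>The fictitious time of the endpoint t2, finite by \<open>SB\<close>.\<close>
  define bb where "bb = Sup (S ` {m1<..<t2})"
  have bdd: "bdd_above (S ` {m1<..<t2})" using SB by (intro bdd_aboveI2[where M = B]) auto
  have Slt: "S t < bb" if t: "m1 < t" "t < t2" for t
  proof -
    define u where "u = (t + t2) / 2"
    have u: "t < u" "u < t2" using t by (auto simp: u_def)
    have "S t < S u" using T(3) t u by blast
    also have "S u \<le> bb" unfolding bb_def using u t bdd by (intro cSup_upper) auto
    finally show ?thesis .
  qed
  have Tin: "z < T y \<and> T y < t2 \<and> S (T y) = y" if y: "S z < y" "y < bb" and z: "m1 < z" "z < t2" for z y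
  proof -
    obtain t where t: "t \<in> {m1<..<t2}" "y < S t"
      using y(2) less_cSup_iff[OF _ bdd] m1 unfolding bb_def by auto
    have "z < t"
    proof (rule ccontr)
      assume "\<not> z < t"
      then have "S t \<le> S z" using T(3)[of t z] t z by (cases "t = z") auto
      then show False using t y by simp
    qed
    then show ?thesis using T(4)[of z t y] z t y by auto
  qed
  define y where "y = (\<lambda>s. kv (T s))"
  have Sm2: "S m2 < bb" by (rule Slt[OF m2])
  have dy: "((\<lambda>s. y s k) has_real_derivative peval (y s) (?F k)) (at s)" if s: "S m2 < s" "s < bb" for s k
  proof -
    have Ts: "m2 < T s" "T s < t2" "S (T s) = s" using Tin[OF s m2] by auto
    then have Ts': "m1 < T s" "t1 < T s" using m m1 m2 by auto
    have "(T has_real_derivative norm (q (T s))) (at s)"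
      using T(2)[OF Ts'(1) Ts(2)] Ts(3) by simp
    from DERIV_chain2[OF dkv[OF Ts'(2) Ts(2)] this]
    show ?thesis using q0[OF Ts'(2) Ts(2)] by (simp add: y_def)
  qed
  define A where "A = C + (1 + C4) + (2 * (2 * C * C + 2 * \<mu>) + \<mu>) + 1 / \<delta> + \<bar>t1\<bar> + \<bar>t2\<bar>"
  have C40: "C4 \<ge> 0" using C \<mu> by (simp add: C4_def)
  have parts: "0 \<le> C" "0 \<le> 1 + C4" "0 \<le> 2 * (2 * C * C + 2 * \<mu>) + \<mu>" "0 \<le> 1 / \<delta>" "0 \<le> \<bar>t1\<bar>" "0 \<le> \<bar>t2\<bar>"
    using C \<mu> C40 \<delta> by simp_all
  have AC: "C \<le> A" "1 + C4 \<le> A" "2 * (2 * C * C + 2 * \<mu>) + \<mu> \<le> A" "1 / \<delta> \<le> A" "\<bar>t1\<bar> + \<bar>t2\<bar> \<le> A"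
    unfolding A_def using parts by linarith+
  have kvA: "\<bar>kv t k\<bar> \<le> A" if t: "t1 < t" "t < t2" for t k
  proof (cases k)
    case (vq j)
    then show ?thesis
      unfolding kv_def vq kval.simps using component_le_norm_cart[of "q t" j] bq[OF t] AC by linarith
  next
    case (vy j)
    have "\<bar>norm (q t) * w t $ j\<bar> \<le> norm (q t) * norm (w t)"
      using component_le_norm_cart[of "w t" j] by (simp add: abs_mult mult_left_mono)
    then show ?thesis unfolding kv_def vy kval.simps using rw[OF t] AC by linarith
  next
    case vE
    then show ?thesis unfolding kv_def vE kval.simps using bE[OF t] AC by linarith
  next
    case (vA j)
    have a1: "\<bar>(w t \<bullet> w t - \<mu> / norm (q t)) * q t $ j\<bar> \<le> (2 * C * C + 2 * \<mu>) + \<mu>"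
    proof -
      have "\<bar>w t \<bullet> w t - \<mu> / norm (q t)\<bar> \<le> w t \<bullet> w t + \<mu> / norm (q t)"
        using \<mu> by (simp add: abs_le_iff)
      then have "\<bar>(w t \<bullet> w t - \<mu> / norm (q t)) * q t $ j\<bar> \<le> (w t \<bullet> w t + \<mu> / norm (q t)) * norm (q t)"
        unfolding abs_mult using component_le_norm_cart[of "q t" j] \<mu> by (intro mult_mono) auto
      also have "\<dots> = norm (q t) * (w t \<bullet> w t) + \<mu>" using q0[OF t] by (simp add: field_simps)
      finally show ?thesis using rww(1)[OF t] by simp
    qed
    have a2: "\<bar>(q t \<bullet> w t) * w t $ j\<bar> \<le> 2 * C * C + 2 * \<mu>"
    proof -
      have "\<bar>(q t \<bullet> w t) * w t $ j\<bar> \<le> (norm (q t) * norm (w t)) * norm (w t)"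
        unfolding abs_mult using Cauchy_Schwarz_ineq2 component_le_norm_cart by (intro mult_mono) auto
      also have "\<dots> = norm (q t) * (w t \<bullet> w t)" by (simp add: dot_square_norm power2_eq_square)
      finally show ?thesis using rww(1)[OF t] by simp
    qed
    have "\<bar>x - y\<bar> \<le> A" if "\<bar>x\<bar> \<le> (2 * C * C + 2 * \<mu>) + \<mu>" "\<bar>y\<bar> \<le> 2 * C * C + 2 * \<mu>" for x y
    proof -
      have "\<bar>x - y\<bar> \<le> \<bar>x\<bar> + \<bar>y\<bar>" by (rule abs_triangle_ineq4)
      also have "\<dots> \<le> ((2 * C * C + 2 * \<mu>) + \<mu>) + (2 * C * C + 2 * \<mu>)" by (rule add_mono[OF that])
      also have "\<dots> = 2 * (2 * C * C + 2 * \<mu>) + \<mu>" by simp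
      finally show ?thesis using AC(3) by (rule order_trans)
    qed
    from this[OF a1 a2] show ?thesis unfolding kv_def vA kval.simps .
  next
    case vr
    then show ?thesis unfolding kv_def vr kval.simps abs_norm_cancel using bq[OF t] AC by linarith
  next
    case ve
    then show ?thesis unfolding kv_def ve kval.simps using qw[OF t] AC by linarith
  next
    case (vR j)
    then show ?thesis
      unfolding kv_def vR kval.simps using component_le_norm_cart[of "R t" j] bR[OF t] AC by linarith
  next
    case (vV j)
    then show ?thesis
      unfolding kv_def vV kval.simps using component_le_norm_cart[of "V t" j] bV[OF t] AC by linarith
  next
    case vu
    have "1 / norm (R t + a *\<^sub>R q t) \<le> 1 / \<delta>" using bi[OF t] \<delta> by (simp add: frac_le)
    then show ?thesis unfolding kv_def vu kval.simps using AC(4) by simp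
  next
    case vw
    have "1 / norm (R t + b *\<^sub>R q t) \<le> 1 / \<delta>" using bj[OF t] \<delta> by (simp add: frac_le)
    then show ?thesis unfolding kv_def vw kval.simps using AC(4) by simp
  next
    case vt
    have "\<bar>t\<bar> \<le> \<bar>t1\<bar> + \<bar>t2\<bar>" using t by auto
    then show ?thesis unfolding kv_def vt kval.simps using AC by linarith
  qed
  have yA: "\<bar>y s k\<bar> \<le> A" if s: "S m2 < s" "s < bb" for s k
    using kvA[of "T s" k] Tin[OF s m2] m m1 m2 by (simp add: y_def)
  obtain g e where g: "e > 0" "e \<le> bb - S m2" "\<And>k. fps_conv_radius (g k) \<ge> ereal e"
    "\<And>k s. \<bar>s\<bar> < e \<Longrightarrow> (eval_fps (g k) has_real_derivative peval (\<lambda>k. eval_fps (g k) s) (?F k)) (at s)"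
    "\<And>k s. - e < s \<Longrightarrow> s < 0 \<Longrightarrow> y (bb + s) k = eval_fps (g k) s"
    "\<And>k. fps_deriv (g k) = pfps g (?F k)"
    by (rule poly_ode_endpoint[OF Sm2 dy yA]) ((assumption | rule that)+)
  \<comment> \<open>Halved so that bb - \<epsilon> lies strictly above S m2, where the inverse of S
    is under control.\<close>
  define \<epsilon> where "\<epsilon> = e / 2"
  have \<epsilon>: "\<epsilon> > 0" "\<epsilon> < e" using g(1) by (auto simp: \<epsilon>_def)
  define t0 where "t0 = T (bb - \<epsilon>)"
  have t0: "m2 < t0" "t0 < t2" "S t0 = bb - \<epsilon>"
    using Tin[of m2 "bb - \<epsilon>"] m2 g(2) \<epsilon> by (auto simp: t0_def)
  show ?thesis
  proof (rule that[OF \<epsilon>(1)])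
    show "t1 \<le> t0" "t0 < t2" using t0 m m1 m2 by auto
    show "fps_conv_radius (g k) \<ge> ereal \<epsilon>" for k
      by (rule order_trans[OF _ g(3)]) (use \<epsilon> in simp)
    show "(eval_fps (g k) has_real_derivative peval (\<lambda>k. eval_fps (g k) s) (?F k)) (at s)"
      if "\<bar>s\<bar> < \<epsilon>" for k s using g(4) that \<epsilon> by simp
    show "fps_deriv (g k) = pfps g (?F k)" for k by (rule g(6))
    show "\<exists>t. t0 < t \<and> t < t2 \<and> (\<forall>k. eval_fps (g k) s = kval \<mu> a b t (q t) (w t) (R t) (V t) k)"
      if s: "- \<epsilon> < s" "s < 0" for s
    proof (intro exI[of _ "T (bb + s)"] conjI allI)
      have "S t0 < bb + s" "bb + s < bb" using t0 s by auto
      from Tin[OF this] show "t0 < T (bb + s)" "T (bb + s) < t2" using t0 m2 by auto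
      show "eval_fps (g k) s = kval \<mu> a b (T (bb + s)) (q (T (bb + s))) (w (T (bb + s)))
          (R (T (bb + s))) (V (T (bb + s))) k" for k
        using g(5)[of s k] s \<epsilon> by (simp add: y_def kv_def)
    qed
    show "\<exists>s. - \<epsilon> < s \<and> s < 0 \<and> eval_fps (g vt) s = t" if t: "t0 < t" "t < t2" for t
    proof (intro exI[of _ "S t - bb"] conjI)
      have t': "m1 < t" using t t0 m2 by simp
      have "S t0 < S t" using T(3)[of t0 t] t t0 m2 by simp
      then show 1: "- \<epsilon> < S t - bb" using t0 by simp
      show 2: "S t - bb < 0" using Slt[OF t' t(2)] by simp
      show "eval_fps (g vt) (S t - bb) = t"
        using g(5)[of "S t - bb" vt] 1 2 \<epsilon> T(1)[OF t' t(2)] by (simp add: y_def kv_def)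
    qed
  qed
qed

section \<open>Continuation past the endpoint and return to physical time\<close>

lemma left_limit_bounds:
  fixes f :: "real \<Rightarrow> real"
  assumes "isCont f 0" "\<epsilon> > 0" "\<And>s. - \<epsilon> < s \<Longrightarrow> s < 0 \<Longrightarrow> f s \<ge> l"
  shows "f 0 \<ge> l"
proof (rule tendsto_lowerbound)
  show "(f \<longlongrightarrow> f 0) (at_left 0)"
    using assms(1) unfolding isCont_def by (rule tendsto_within_subset) simp
  show "\<forall>\<^sub>F s in at_left 0. l \<le> f s"
    using assms(2,3) eventually_at_left[of "- \<epsilon>" 0] by (auto intro!: exI[of _ "- \<epsilon>"])
qed simp

lemma isCont_pos_nhd:
  fixes f :: "real \<Rightarrow> real"
  assumes "isCont f 0" "f 0 > 0"
  obtains d where "d > 0" "\<And>s. \<bar>s\<bar> < d \<Longrightarrow> f s > 0"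
proof -
  have "(f \<longlongrightarrow> f 0) (nhds 0)"
    using assms(1) unfolding isCont_def by (rule tendsto_at_iff_tendsto_nhds[THEN iffD1])
  then have "eventually (\<lambda>s. f s > 0) (nhds 0)" using assms(2) by (rule order_tendstoD(1))
  then show ?thesis unfolding eventually_nhds_metric dist_real_def using that by auto
qed

text \<open>Physical time increases strictly through a collision although its derivative r vanishes
  there; the isolated zero is bridged by splitting at 0.\<close>

lemma strict_mono_across_zero:
  fixes T :: "real \<Rightarrow> real"
  assumes der: "\<And>s. \<bar>s\<bar> < e \<Longrightarrow> (T has_real_derivative r s) (at s)"
    and pos: "\<And>s. \<bar>s\<bar> < e \<Longrightarrow> s \<noteq> 0 \<Longrightarrow> r s > 0"
    and st: "\<bar>s\<bar> < e" "\<bar>t\<bar> < e" "s < t"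
  shows "T s < T t"
proof -
  have main: "T s < T t" if "\<bar>s\<bar> < e" "\<bar>t\<bar> < e" "s < t" "0 \<notin> {s<..<t}" for s t
  proof (rule DERIV_pos_imp_increasing_open[OF that(3)])
    show "\<exists>y. (T has_real_derivative y) (at x) \<and> y > 0" if x: "s < x" "x < t" for x
    proof -
      have "\<bar>x\<bar> < e" "x \<noteq> 0" using x \<open>\<bar>s\<bar> < e\<close> \<open>\<bar>t\<bar> < e\<close> \<open>0 \<notin> {s<..<t}\<close> by auto
      then show ?thesis using der pos by blast
    qed
    show "continuous_on {s..t} T"
      using that by (intro continuous_at_imp_continuous_on ballI DERIV_isCont[OF der]) auto
  qed
  show ?thesis
  proof (cases "0 \<in> {s<..<t}")
    case True
    then have "T s < T 0" "T 0 < T t" using st by (auto intro!: main)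
    then show ?thesis by simp
  qed (use main st in blast)
qed

lemma sums_vec_plane:
  fixes x :: plane
  assumes "\<And>j. (\<lambda>n. C j n * z ^ n) sums x $ j"
  shows "(\<lambda>n. z ^ n *\<^sub>R (\<chi> j. C j n)) sums x"
  using assms unfolding sums_def
  by (intro vec_tendstoI) (simp add: mult.commute)

text \<open>The series solution exists on both sides of s = 0. Relations that hold by definition
  before s = 0 persist after it and identify r with |q| and u, w with the inverse distances. Since
  dt/ds = r > 0 off 0, time can be inverted and the physical motion recovered. If r(0) = 0, then t -
  t2 starts with a positive multiple of s^3, so s and all positions are analytic in the cube root of
  t - t2.\<close>

lemma jacobi_extension:
  assumes \<mu>: "\<mu> > 0" and t12: "t1 < t2" and C: "C > 0" and \<delta>: "\<delta> > 0"
    and mot: "\<And>t. t1 < t \<Longrightarrow> t < t2 \<Longrightarrow> jacobi_motion_at \<mu> c \<alpha> \<beta> a b q w R V t"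
    and bq: "\<And>t. t1 < t \<Longrightarrow> t < t2 \<Longrightarrow> norm (q t) \<le> C"
    and bR: "\<And>t. t1 < t \<Longrightarrow> t < t2 \<Longrightarrow> norm (R t) \<le> C"
    and bV: "\<And>t. t1 < t \<Longrightarrow> t < t2 \<Longrightarrow> norm (V t) \<le> C"
    and bE: "\<And>t. t1 < t \<Longrightarrow> t < t2 \<Longrightarrow> \<bar>(w t \<bullet> w t) / 2 - \<mu> / norm (q t)\<bar> \<le> C"
    and bi: "\<And>t. t1 < t \<Longrightarrow> t < t2 \<Longrightarrow> norm (R t + a *\<^sub>R q t) \<ge> \<delta>"
    and bj: "\<And>t. t1 < t \<Longrightarrow> t < t2 \<Longrightarrow> norm (R t + b *\<^sub>R q t) \<ge> \<delta>"
  obtains e and q' w' R' V' :: "real \<Rightarrow> plane"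
  where "e > 0" "e \<le> t2 - t1"
    "\<And>t. t2 - e < t \<Longrightarrow> t < t2 \<Longrightarrow> q' t = q t \<and> R' t = R t"
    "\<And>t. \<bar>t - t2\<bar> < e \<Longrightarrow> q' t \<noteq> 0 \<Longrightarrow> jacobi_motion_at \<mu> c \<alpha> \<beta> a b q' w' R' V' t"
    "\<And>t. \<bar>t - t2\<bar> < e \<Longrightarrow> t \<noteq> t2 \<Longrightarrow> q' t \<noteq> 0"
    "\<And>t. \<bar>t - t2\<bar> < e \<Longrightarrow> R' t + a *\<^sub>R q' t \<noteq> 0 \<and> R' t + b *\<^sub>R q' t \<noteq> 0"
    "q' t2 = 0 \<Longrightarrow> \<exists>cq cR. \<forall>t. \<bar>t - t2\<bar> < e \<longrightarrow>
      (\<lambda>n. root 3 (t - t2) ^ n *\<^sub>R cq n) sums q' t \<and> (\<lambda>n. root 3 (t - t2) ^ n *\<^sub>R cR n) sums R' t"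
proof -
  let ?F = "kfield \<mu> c \<alpha> \<beta> a b"
  obtain g :: "var \<Rightarrow> real fps" and \<epsilon> t0 where \<epsilon>: "\<epsilon> > 0" and t0: "t1 \<le> t0" "t0 < t2"
    and rad: "\<And>k. fps_conv_radius (g k) \<ge> ereal \<epsilon>"
    and der0: "\<And>k s. \<bar>s\<bar> < \<epsilon> \<Longrightarrow> (eval_fps (g k) has_real_derivative
      peval (\<lambda>k. eval_fps (g k) s) (?F k)) (at s)"
    and fder: "\<And>k. fps_deriv (g k) = pfps g (?F k)"
    and match: "\<And>s. - \<epsilon> < s \<Longrightarrow> s < 0 \<Longrightarrow> \<exists>t. t0 < t \<and> t < t2 \<and>
      (\<forall>k. eval_fps (g k) s = kval \<mu> a b t (q t) (w t) (R t) (V t) k)"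
    and cover: "\<And>t. t0 < t \<Longrightarrow> t < t2 \<Longrightarrow> \<exists>s. - \<epsilon> < s \<and> s < 0 \<and> eval_fps (g vt) s = t"
    by (rule sundman_analytic[OF assms]) ((assumption | rule that)+)
  define X where "X = (\<lambda>k s. eval_fps (g k) s)"
  define Y where "Y = (\<lambda>s k. X k s)"
  have YX: "Y s k = X k s" for s k by (simp add: Y_def)
  have der: "(X k has_real_derivative peval (Y s) (?F k)) (at s)" if "\<bar>s\<bar> < \<epsilon>" for k s
    using der0[OF that, of k] by (simp add: X_def Y_def)
  have cont: "isCont (X k) s" if "\<bar>s\<bar> < \<epsilon>" for k s
    using der[OF that] by (rule DERIV_isCont)
  have cont0: "isCont (X k) 0" for k using cont \<epsilon> by simp
  \<comment> \<open>Every relation below is checked only for physical states and then transported by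
    the identity theorem.\<close>
  have ident: "peval (Y s) e = 0" if e: "\<And>t. t0 < t \<Longrightarrow> t < t2 \<Longrightarrow> peval (kval \<mu> a b t (q t) (w t) (R t) (V t)) e = 0"
    and s: "\<bar>s\<bar> < \<epsilon>" for e s
    unfolding Y_def X_def
  proof (rule peval_identity[OF \<epsilon> rad _ s])
    fix s assume "- \<epsilon> < s" "s < 0"
    from match[OF this] obtain t where t: "t0 < t" "t < t2"
      "\<And>k. eval_fps (g k) s = kval \<mu> a b t (q t) (w t) (R t) (V t) k" by blast
    then have "(\<lambda>k. eval_fps (g k) s) = kval \<mu> a b t (q t) (w t) (R t) (V t)" by auto
    then show "peval (\<lambda>k. eval_fps (g k) s) e = 0" using e[OF t(1,2)] by simp
  qed
  define Q where "Q = (\<lambda>s. \<chi> j. X (vq j) s)"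
  define W where "W = (\<lambda>s. \<chi> j. X (vy j) s)"
  define RR where "RR = (\<lambda>s. \<chi> j. X (vR j) s)"
  define VV where "VV = (\<lambda>s. \<chi> j. X (vV j) s)"
  have nzt: "q t \<noteq> 0" "R t + a *\<^sub>R q t \<noteq> 0" "R t + b *\<^sub>R q t \<noteq> 0" if "t0 < t" "t < t2" for t
    using mot[of t] that t0 by (auto simp: jacobi_motion_at_def)
  have id1: "Q s \<bullet> Q s = (X vr s)\<^sup>2" if "\<bar>s\<bar> < \<epsilon>" for s
    using ident[of "Plus (pdot (\<lambda>j. Var (vq j)) (\<lambda>j. Var (vq j))) (pneg (Times (Var vr) (Var vr)))", OF _ that]
    by (simp add: Y_def Q_def power2_eq_square vec_lambda_simps dot_square_norm)
  \<comment> \<open>By the definition of E and A one has r (2 E q - A) = e y - \<mu> q. This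
    relation later turns the derivative of y / r into Newton's acceleration.\<close>
  have id2: "X vr s * (2 * (X vE s * X (vq j) s) - X (vA j) s) - X ve s * X (vy j) s + \<mu> * X (vq j) s = 0"
    if "\<bar>s\<bar> < \<epsilon>" for s j
  proof -
    let ?e = "Plus (Times (Var vr) (Plus (Times (Cst 2) (Times (Var vE) (Var (vq j)))) (pneg (Var (vA j)))))
      (Plus (pneg (Times (Var ve) (Var (vy j)))) (Times (Cst \<mu>) (Var (vq j))))"
    have "peval (Y s) ?e = 0"
      by (rule ident[OF _ that]) (use nzt in \<open>simp add: field_simps\<close>)
    then show ?thesis by (simp add: Y_def)
  qed
  \<comment> \<open>As u^2 |d|^2 = 1, neither u nor the distance to the third body can vanish on the
    far side.\<close>
  have idu: "(X vu s)\<^sup>2 * ((RR s + a *\<^sub>R Q s) \<bullet> (RR s + a *\<^sub>R Q s)) = 1" if "\<bar>s\<bar> < \<epsilon>" for s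
  proof -
    let ?d = "\<lambda>j. Plus (Var (vR j)) (Times (Cst a) (Var (vq j)))"
    have "peval (Y s) (Plus (Times (Times (Var vu) (Var vu)) (pdot ?d ?d)) (Cst (- 1))) = 0"
      by (rule ident[OF _ that])
        (use nzt in \<open>simp add: vec_lambda_combine dot_square_norm power2_eq_square\<close>)
    then show ?thesis
      by (simp add: Y_def RR_def Q_def power2_eq_square inner_plane)
  qed
  have idw: "(X vw s)\<^sup>2 * ((RR s + b *\<^sub>R Q s) \<bullet> (RR s + b *\<^sub>R Q s)) = 1" if "\<bar>s\<bar> < \<epsilon>" for s
  proof -
    let ?d = "\<lambda>j. Plus (Var (vR j)) (Times (Cst b) (Var (vq j)))"
    have "peval (Y s) (Plus (Times (Times (Var vw) (Var vw)) (pdot ?d ?d)) (Cst (- 1))) = 0"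
      by (rule ident[OF _ that])
        (use nzt in \<open>simp add: vec_lambda_combine dot_square_norm power2_eq_square\<close>)
    then show ?thesis
      by (simp add: Y_def RR_def Q_def power2_eq_square inner_plane)
  qed
  \<comment> \<open>The energy relation |y|^2 = 2 r (E r + \<mu>): it makes y vanish at a
    collision.\<close>
  have id5: "W s \<bullet> W s = X vr s * (2 * (X vE s * X vr s) + 2 * \<mu>)" if "\<bar>s\<bar> < \<epsilon>" for s
  proof -
    let ?e = "Plus (pdot (\<lambda>j. Var (vy j)) (\<lambda>j. Var (vy j)))
      (pneg (Times (Var vr) (Plus (Times (Cst 2) (Times (Var vE) (Var vr))) (Cst (2 * \<mu>)))))"
    have "peval (Y s) ?e = 0"
      by (rule ident[OF _ that]) (use nzt in \<open>simp add: vec_lambda_simps field_simps\<close>)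
    then show ?thesis by (simp add: Y_def W_def)
  qed
  have neg: "X vr s > 0" "X vu s > 0" "X vw s > 0" "t0 < X vt s" "X vt s < t2" "(X ve s)\<^sup>2 \<le> W s \<bullet> W s"
    if s: "- \<epsilon> < s" "s < 0" for s
  proof -
    from match[OF s] obtain t where t: "t0 < t" "t < t2"
      "\<And>k. X k s = kval \<mu> a b t (q t) (w t) (R t) (V t) k" unfolding X_def by blast
    show "X vr s > 0" "X vu s > 0" "X vw s > 0" "t0 < X vt s" "X vt s < t2"
      using nzt[OF t(1,2)] t(1,2) by (simp_all add: t(3))
    have "(q t \<bullet> w t)\<^sup>2 \<le> (q t \<bullet> q t) * (w t \<bullet> w t)" by (rule Cauchy_Schwarz_ineq)
    then show "(X ve s)\<^sup>2 \<le> W s \<bullet> W s"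
      by (simp add: t(3) W_def vec_lambda_simps dot_square_norm power2_eq_square mult.left_commute mult.assoc)
  qed
  have r0: "X vr 0 \<ge> 0" by (rule left_limit_bounds[OF cont0 \<epsilon>]) (use neg(1) in \<open>simp add: less_imp_le\<close>)
  have "X vu 0 \<ge> 0" by (rule left_limit_bounds[OF cont0 \<epsilon>]) (use neg(2) in \<open>simp add: less_imp_le\<close>)
  moreover have "X vu 0 \<noteq> 0" using idu[of 0] \<epsilon> by auto
  ultimately have "X vu 0 > 0" by simp
  then obtain du where du: "du > 0" "\<And>s. \<bar>s\<bar> < du \<Longrightarrow> X vu s > 0"
    by (rule isCont_pos_nhd[OF cont0]) ((assumption | rule that)+)
  have "X vw 0 \<ge> 0" by (rule left_limit_bounds[OF cont0 \<epsilon>]) (use neg(3) in \<open>simp add: less_imp_le\<close>)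
  moreover have "X vw 0 \<noteq> 0" using idw[of 0] \<epsilon> by auto
  ultimately have "X vw 0 > 0" by simp
  then obtain dw where dw: "dw > 0" "\<And>s. \<bar>s\<bar> < dw \<Longrightarrow> X vw s > 0"
    by (rule isCont_pos_nhd[OF cont0]) ((assumption | rule that)+)
  have dT: "(X vt has_real_derivative X vr s) (at s)" if "\<bar>s\<bar> < \<epsilon>" for s
    using der[OF that, of vt] by (simp add: Y_def)
  have drr: "(X vr has_real_derivative X ve s) (at s)" if "\<bar>s\<bar> < \<epsilon>" for s
    using der[OF that, of vr] by (simp add: Y_def)
  \<comment> \<open>The endpoint is not reached too early: times between the value at 0 and t2 are
    attained at negative s by \<open>cover\<close>, against monotonicity.\<close>
  have T0: "X vt 0 = t2"
  proof (rule order_antisym)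
    have "isCont (\<lambda>s. - X vt s) 0" using cont0 by (intro isCont_minus)
    from left_limit_bounds[OF this \<epsilon>, of "- t2"] neg(5) show "X vt 0 \<le> t2" by (simp add: less_imp_le)
    show "t2 \<le> X vt 0"
    proof (rule ccontr)
      assume "\<not> t2 \<le> X vt 0"
      then obtain t where t: "max t0 (X vt 0) < t" "t < t2" using t0 dense[of "max t0 (X vt 0)" t2] by auto
      then obtain s where s: "- \<epsilon> < s" "s < 0" "X vt s = t" using cover[of t] unfolding X_def by auto
      have "X vt s \<le> X vt 0"
      proof (rule DERIV_nonneg_imp_nondecreasing[where f = "X vt"])
        show "s \<le> 0" using s by simp
        fix x assume x: "s \<le> x" "x \<le> 0"
        have "X vr x \<ge> 0" using neg(1)[of x] r0 x s by (cases "x = 0") auto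
        then show "\<exists>y. (X vt has_real_derivative y) (at x) \<and> 0 \<le> y" using dT[of x] x s by auto
      qed
      then show False using s t by simp
    qed
  qed
  \<comment> \<open>At a collision y = 0 by \<open>id5\<close>; then e = 0 by the Cauchy-Schwarz
    bound e^2 \<le> |y|^2, which passes to the limit from the left.\<close>
  have coll: "X ve 0 = 0" "W 0 = 0" if "X vr 0 = 0"
  proof -
    have W0: "W 0 \<bullet> W 0 = 0" using id5[of 0] \<epsilon> that by simp
    then show "W 0 = 0" by simp
    have "isCont (\<lambda>s. W s \<bullet> W s - (X ve s)\<^sup>2) 0"
      unfolding W_def inner_plane by (simp, intro continuous_intros cont0)
    from left_limit_bounds[OF this \<epsilon>, of 0] neg(6) have "(X ve 0)\<^sup>2 \<le> W 0 \<bullet> W 0" by simp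
    then show "X ve 0 = 0" using W0 by simp
  qed
  \<comment> \<open>At a collision r(0) = e(0) = 0 and e'(0) = \<mu> > 0, so r increases again after
    0: the pair bounces. On the left r > 0 is known.\<close>
  have "\<exists>d>0. \<forall>s. \<bar>s\<bar> < d \<longrightarrow> s \<noteq> 0 \<longrightarrow> X vr s > 0"
  proof (cases "X vr 0 = 0")
    case False
    then have "X vr 0 > 0" using r0 by simp
    from isCont_pos_nhd[OF cont0 this] show ?thesis by metis
  next
    case True
    have "(X ve has_real_derivative \<mu>) (at 0)"
      using der[of 0 ve] \<epsilon> True by (simp add: Y_def)
    from DERIV_pos_inc_right[OF this \<mu>] obtain d where d: "d > 0" "\<And>h. h > 0 \<Longrightarrow> h < d \<Longrightarrow> X ve 0 < X ve (0 + h)"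
      by blast
    have "X vr s > 0" if s: "\<bar>s\<bar> < min d \<epsilon>" "s \<noteq> 0" for s
    proof (cases "s < 0")
      case False
      then have "0 < s" using s by simp
      have "X vr 0 < X vr s"
      proof (rule DERIV_pos_imp_increasing_open[OF \<open>0 < s\<close>])
        fix x assume x: "0 < x" "x < s"
        have "X ve x > 0" using d(2)[of x] x s coll(1)[OF True] by simp
        then show "\<exists>y. (X vr has_real_derivative y) (at x) \<and> 0 < y" using drr[of x] x s by auto
      next
        show "continuous_on {0..s} (X vr)" using s by (intro continuous_at_imp_continuous_on ballI cont) auto
      qed
      then show ?thesis using True by simp
    qed (use neg(1) s in auto)
    then show ?thesis using d(1) \<epsilon> by (intro exI[of _ "min d \<epsilon>"]) auto
  qed
  then obtain dr where dr: "dr > 0" "\<And>s. \<bar>s\<bar> < dr \<Longrightarrow> s \<noteq> 0 \<Longrightarrow> X vr s > 0" by blast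
  define z where "z = min (min \<epsilon> dr) (min du dw)"
  have z: "z > 0" "z \<le> \<epsilon>" "z \<le> dr" "z \<le> du" "z \<le> dw"
    using \<epsilon> dr(1) du(1) dw(1) by (auto simp: z_def)
  have mono: "X vt s < X vt t" if "\<bar>s\<bar> < z" "\<bar>t\<bar> < z" "s < t" for s t
    by (rule strict_mono_across_zero[of z "X vt" "X vr", OF dT dr(2)]) (use z that in auto)
  have inj: "inj_on (X vt) {-z<..<z}"
  proof (intro linorder_inj_onI')
    fix s t assume "s \<in> {-z<..<z}" "t \<in> {-z<..<z}" "s < t"
    then have "X vt s < X vt t" by (intro mono) auto
    then show "X vt s \<noteq> X vt t" by simp
  qed
  define sh where "sh = the_inv_into {-z<..<z} (X vt)"
  have sh_T: "sh (X vt s) = s" if "\<bar>s\<bar> < z" for s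
    unfolding sh_def by (rule the_inv_into_f_f[OF inj]) (use that in auto)
  define e0 where "e0 = min (X vt (z/2) - t2) (t2 - X vt (- z/2))"
  have e0: "e0 > 0" using mono[of 0 "z/2"] mono[of "-z/2" 0] z by (auto simp: e0_def T0)
  have T_sh: "\<bar>sh t\<bar> < z \<and> X vt (sh t) = t" if t: "\<bar>t - t2\<bar> < e0" for t
  proof -
    have "continuous_on {-z/2..z/2} (X vt)" using z by (intro continuous_at_imp_continuous_on ballI cont) auto
    moreover have "X vt (-z/2) \<le> t" "t \<le> X vt (z/2)" "-z/2 \<le> z/2" using t z by (auto simp: e0_def)
    ultimately obtain s where s: "-z/2 \<le> s" "s \<le> z/2" "X vt s = t" using IVT' by blast
    then have "\<bar>s\<bar> < z" using z by auto
    then show ?thesis using sh_T[of s] s(3) by auto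
  qed
  define q' where "q' = (\<lambda>t. Q (sh t))"
  \<comment> \<open>The velocity in physical time is y / r. At a collision the quotient is only a
    default value; the equations of motion are claimed where q' is nonzero.\<close>
  define w' where "w' = (\<lambda>t. \<chi> j. X (vy j) (sh t) / X vr (sh t))"
  define R' where "R' = (\<lambda>t. RR (sh t))"
  define V' where "V' = (\<lambda>t. VV (sh t))"
  have normQ: "norm (Q s) = X vr s" if "\<bar>s\<bar> < z" for s
  proof -
    have "X vr s \<ge> 0" using dr(2)[of s] r0 that z by (cases "s = 0") auto
    then show ?thesis using id1[of s] that z by (simp add: norm_eq_sqrt_inner)
  qed
  have duw: "X vu s = 1 / norm (RR s + a *\<^sub>R Q s)" "X vw s = 1 / norm (RR s + b *\<^sub>R Q s)"
    "RR s + a *\<^sub>R Q s \<noteq> 0" "RR s + b *\<^sub>R Q s \<noteq> 0" if s: "\<bar>s\<bar> < z" for s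
  proof -
    have *: "x = 1 / norm d \<and> d \<noteq> 0" if "x > 0" "x\<^sup>2 * (d \<bullet> d) = 1" for x and d :: plane
    proof -
      have "(x * norm d)\<^sup>2 = 1" using that(2) by (simp add: power_mult_distrib dot_square_norm)
      then have "x * norm d = 1 \<or> x * norm d = - 1" by (simp only: power2_eq_1_iff)
      moreover have "x * norm d \<ge> 0" using that(1) by simp
      ultimately have "x * norm d = 1" by linarith
      then have "d \<noteq> 0" by auto
      then show ?thesis using \<open>x * norm d = 1\<close> by (simp add: eq_divide_eq)
    qed
    show "X vu s = 1 / norm (RR s + a *\<^sub>R Q s)" "X vw s = 1 / norm (RR s + b *\<^sub>R Q s)"
      "RR s + a *\<^sub>R Q s \<noteq> 0" "RR s + b *\<^sub>R Q s \<noteq> 0"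
      using *[OF du(2) idu, of s] *[OF dw(2) idw, of s] s z by auto
  qed
  have match': "q' t = q t \<and> R' t = R t" if t: "t2 - e0 < t" "t < t2" for t
  proof -
    have s: "\<bar>sh t\<bar> < z" "X vt (sh t) = t" using T_sh[of t] t by auto
    have "sh t < 0"
    proof (rule ccontr)
      assume "\<not> sh t < 0"
      then have "X vt 0 \<le> X vt (sh t)" using mono[of 0 "sh t"] s(1) z by (cases "sh t = 0") auto
      then show False using T0 s(2) t by simp
    qed
    moreover have "- \<epsilon> < sh t" using s(1) z by auto
    ultimately obtain t' where t': "\<And>k. X k (sh t) = kval \<mu> a b t' (q t') (w t') (R t') (V t') k"
      using match[of "sh t"] unfolding X_def by blast
    have "t' = t" using t'[of vt] s(2) by simp
    then show ?thesis by (simp add: q'_def R'_def Q_def RR_def t' vec_lambda_simps)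
  qed
  have motion: "jacobi_motion_at \<mu> c \<alpha> \<beta> a b q' w' R' V' t" if t: "\<bar>t - t2\<bar> < e0" and nz: "q' t \<noteq> 0" for t
  proof -
    define s where "s = sh t"
    have s: "\<bar>s\<bar> < z" "X vt s = t" using T_sh[OF t] by (auto simp: s_def)
    have s\<epsilon>: "\<bar>s\<bar> < \<epsilon>" using s z by simp
    have r: "X vr s > 0" using nz normQ[OF s(1)] by (simp add: q'_def s_def[symmetric]) (metis zero_less_norm_iff)
    have "(sh has_real_derivative inverse (X vr s)) (at (X vt s))"
    proof (rule has_field_derivative_inverse_strong[OF dT[OF s\<epsilon>]])
      show "X vr s \<noteq> 0" "open {-z<..<z}" "s \<in> {-z<..<z}" using r s by auto
      show "continuous_on {-z<..<z} (X vt)" using z by (intro continuous_at_imp_continuous_on ballI cont) auto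
      show "sh (X vt x) = x" if "x \<in> {-z<..<z}" for x using that by (intro sh_T) auto
    qed
    then have dsh: "(sh has_real_derivative inverse (X vr s)) (at t)" by (simp add: s(2))
    have dX: "((\<lambda>t. X k (sh t)) has_real_derivative peval (Y s) (?F k) / X vr s) (at t)" for k
      using DERIV_chain2[OF der[OF s\<epsilon>[unfolded s_def]] dsh, of k]
      by (simp add: s_def divide_inverse)
    have Qj: "Q s $ j = X (vq j) s" for j by (simp add: Q_def)
    have pg: "peval (Y s) (pgrav a vu k) = grav (RR s + a *\<^sub>R Q s) $ k"
      "peval (Y s) (pgrav b vw k) = grav (RR s + b *\<^sub>R Q s) $ k" for k
      using duw[OF s(1)] by (intro peval_pgrav; simp add: YX RR_def Q_def)+
    have pp: "peval (Y s) (ppert c a b k) = kepler_pert c a b (Q s) (RR s) $ k" for k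
      by (simp add: ppert_def kepler_pert_def pg)
    have "(q' has_vector_derivative (\<chi> j. X (vy j) s / X vr s)) (at t)"
      unfolding q'_def Q_def by (rule has_vector_derivative_vec) (use dX[of "vq _"] in \<open>simp add: YX\<close>)
    moreover have "(R' has_vector_derivative (\<chi> j. X (vV j) s)) (at t)"
      unfolding R'_def RR_def
    proof (rule has_vector_derivative_vec)
      show "((\<lambda>t. X (vR k) (sh t)) has_real_derivative X (vV k) s) (at t)" for k
        using dX[of "vR k"] r by (simp add: YX)
    qed
    moreover have "(V' has_vector_derivative
        (\<chi> j. - (\<alpha> * grav (RR s + a *\<^sub>R Q s) $ j + \<beta> * grav (RR s + b *\<^sub>R Q s) $ j))) (at t)"
      unfolding V'_def VV_def
    proof (rule has_vector_derivative_vec)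
      show "((\<lambda>t. X (vV k) (sh t)) has_real_derivative
        - (\<alpha> * grav (RR s + a *\<^sub>R Q s) $ k + \<beta> * grav (RR s + b *\<^sub>R Q s) $ k)) (at t)" for k
        by (rule DERIV_cong[OF dX]) (use r in \<open>simp add: pg YX\<close>)
    qed
    moreover have "(w' has_vector_derivative
        (\<chi> j. kepler_pert c a b (Q s) (RR s) $ j - \<mu> * (X (vq j) s / X vr s ^ 3))) (at t)"
      unfolding w'_def
    proof (rule has_vector_derivative_vec)
      fix k
      have r': "X vr (sh t) \<noteq> 0" using r by (simp add: s_def)
      let ?p = "kepler_pert c a b (Q s) (RR s) $ k"
      have *: "X ve s * X (vy k) s = X vr s * (2 * (X vE s * X (vq k) s) - X (vA k) s) + \<mu> * X (vq k) s"
        using id2[OF s\<epsilon>, of k] by simp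
      have "((\<lambda>t. X (vy k) (sh t) / X vr (sh t)) has_real_derivative
          ((2 * (X vE s * X (vq k) s) + (- X (vA k) s + X vr s * X vr s * ?p)) / X vr s * X vr s
            - X (vy k) s * (X ve s / X vr s)) / (X vr s * X vr s)) (at t)"
        using DERIV_divide[OF dX[of "vy k"] dX[of vr] r'] by (simp add: pp s_def[symmetric] YX)
      moreover have "((2 * (X vE s * X (vq k) s) + (- X (vA k) s + X vr s * X vr s * ?p)) / X vr s * X vr s
            - X (vy k) s * (X ve s / X vr s)) / (X vr s * X vr s) = ?p - \<mu> * (X (vq k) s / X vr s ^ 3)"
      proof -
        have "(X1 / r * r - y * (h / r)) / (r * r) = p - \<mu> * (x / r ^ 3)"
          if "r > 0" "h * y = r * B + \<mu> * x" "X1 = B + r * r * p" for X1 r y h p x B :: real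
        proof -
          have "(X1 / r * r - y * (h / r)) / (r * r) = (X1 * r - h * y) / r ^ 3"
            using that(1) by (simp add: field_simps power3_eq_cube)
          also have "X1 * r - h * y = r ^ 3 * p - \<mu> * x"
            unfolding that(2,3) by (simp add: algebra_simps power3_eq_cube)
          also have "(r ^ 3 * p - \<mu> * x) / r ^ 3 = p - \<mu> * (x / r ^ 3)"
            using that(1) by (simp add: field_simps)
          finally show ?thesis .
        qed
        note aux = this
        show ?thesis by (rule aux[OF r *]) simp
      qed
      ultimately show "((\<lambda>t. X (vy k) (sh t) / X vr (sh t)) has_real_derivative
          ?p - \<mu> * (X (vq k) s / X vr s ^ 3)) (at t)" by simp
    qed
    moreover have "(\<chi> j. kepler_pert c a b (Q s) (RR s) $ j - \<mu> * (X (vq j) s / X vr s ^ 3))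
        = kepler_pert c a b (q' t) (R' t) - \<mu> *\<^sub>R grav (q' t)"
      by (simp add: vec_eq_iff q'_def R'_def s_def[symmetric] grav_def normQ[OF s(1)] Qj divide_inverse)
    moreover have "(\<chi> j. - (\<alpha> * grav (RR s + a *\<^sub>R Q s) $ j + \<beta> * grav (RR s + b *\<^sub>R Q s) $ j))
        = - (\<alpha> *\<^sub>R grav (R' t + a *\<^sub>R q' t) + \<beta> *\<^sub>R grav (R' t + b *\<^sub>R q' t))"
      by (simp add: vec_eq_iff q'_def R'_def s_def[symmetric])
    moreover have "w' t = (\<chi> j. X (vy j) s / X vr s)" "V' t = (\<chi> j. X (vV j) s)"
      by (simp_all add: w'_def V'_def VV_def s_def)
    ultimately show ?thesis
      unfolding jacobi_motion_at_def using nz duw(3,4)[OF s(1)]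
      by (simp add: q'_def R'_def s_def)
  qed
  have nzq: "q' t \<noteq> 0" if t: "\<bar>t - t2\<bar> < e0" "t \<noteq> t2" for t
  proof -
    have s: "\<bar>sh t\<bar> < z" "X vt (sh t) = t" using T_sh[OF t(1)] by auto
    have "sh t \<noteq> 0" using s(2) T0 t(2) by auto
    then have "norm (q' t) > 0" using dr(2)[of "sh t"] s z normQ[OF s(1)] by (simp add: q'_def)
    then show ?thesis by simp
  qed
  have nzd: "R' t + a *\<^sub>R q' t \<noteq> 0 \<and> R' t + b *\<^sub>R q' t \<noteq> 0" if t: "\<bar>t - t2\<bar> < e0" for t
    using T_sh[OF t] duw(3,4) by (auto simp: q'_def R'_def)
  have e0t: "e0 \<le> t2 - t1"
    using neg(4)[of "- z/2"] z t0 by (simp add: e0_def min_le_iff_disj)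
  have t2r: "q' t2 = 0 \<Longrightarrow> X vr 0 = 0"
    using sh_T[of 0] z(1) normQ[of 0] by (simp add: T0 q'_def)
  have series: "\<exists>d>0. \<exists>cq cR. \<forall>t. \<bar>t - t2\<bar> < d \<longrightarrow>
      (\<lambda>n. root 3 (t - t2) ^ n *\<^sub>R cq n) sums q' t \<and> (\<lambda>n. root 3 (t - t2) ^ n *\<^sub>R cR n) sums R' t"
    if "X vr 0 = 0"
  proof -
    define T where "T = g vt - fps_const t2"
    have radz: "fps_conv_radius (g k) \<ge> ereal z" for k
      by (rule order_trans[OF _ rad]) (use z in simp)
    have Trad: "fps_conv_radius T \<ge> ereal z"
      unfolding T_def by (rule order_trans[OF _ fps_conv_radius_diff]) (simp add: radz)
    have nth0: "fps_nth (pfps g e) 0 = peval (Y 0) e" for e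
      using eval_pfps[of "ereal \<epsilon>" g 0 e, OF rad] \<epsilon> by (simp add: eval_fps_at_0 Y_def X_def)
    have X0: "fps_nth (g k) 0 = X k 0" for k by (simp add: X_def eval_fps_at_0)
    have n1: "fps_nth (g k) (Suc n) * real (Suc n) = fps_nth (pfps g (?F k)) n" for k n
      using arg_cong[OF fder[of k], of "\<lambda>f. fps_nth f n"] by (simp add: mult.commute)
    have v1: "fps_nth (g vt) (Suc n) * real (Suc n) = fps_nth (g vr) n" for n using n1[of vt n] by simp
    have v2: "fps_nth (g vr) (Suc n) * real (Suc n) = fps_nth (g ve) n" for n using n1[of vr n] by simp
    have e1: "fps_nth (g ve) 1 = \<mu>"
      using n1[of ve 0] nth0[of "?F ve"] that by (simp add: Y_def)
    \<comment> \<open>From t' = r, r' = e and e'(0) = \<mu> the expansion of t - t2 begins with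
      (\<mu> / 6) s^3.\<close>
    have T3: "fps_nth T 0 = 0" "fps_nth T 1 = 0" "fps_nth T 2 = 0" "fps_nth T 3 > 0"
    proof -
      show "fps_nth T 0 = 0" by (simp add: T_def X0 T0)
      show "fps_nth T 1 = 0" using v1[of 0] that by (simp add: T_def X0)
      have r1: "fps_nth (g vr) 1 = 0" using v2[of 0] coll(1)[OF that] by (simp add: X0)
      show "fps_nth T 2 = 0" using v1[of 1] r1 by (simp add: T_def numeral_2_eq_2)
      have "fps_nth (g vr) 2 * 2 = \<mu>" using v2[of 1] e1 by (simp add: numeral_2_eq_2)
      then show "fps_nth T 3 > 0" using v1[of 2] \<mu> by (simp add: T_def numeral_3_eq_3 numeral_2_eq_2)
    qed
    obtain d and \<sigma> :: "real \<Rightarrow> real" where d: "d > 0" "\<And>\<tau>. \<bar>\<tau>\<bar> < d \<Longrightarrow> \<bar>\<sigma> \<tau>\<bar> < z"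
      "\<And>\<tau>. \<bar>\<tau>\<bar> < d \<Longrightarrow> eval_fps T (\<sigma> \<tau>) = \<tau> ^ 3"
      "\<And>X. fps_conv_radius X \<ge> ereal z \<Longrightarrow>
        \<exists>C. \<forall>\<tau>. \<bar>\<tau>\<bar> < d \<longrightarrow> (\<lambda>n. C n * \<tau> ^ n) sums eval_fps X (\<sigma> \<tau>)"
      by (rule cube_root_parametrization[OF z(1) Trad T3]) ((assumption | rule that)+)
    obtain Cc where Cc: "\<And>k \<tau>. \<bar>\<tau>\<bar> < d \<Longrightarrow> (\<lambda>n. Cc k n * \<tau> ^ n) sums X k (\<sigma> \<tau>)"
      using d(4)[OF radz] unfolding X_def by metis
    have sums: "(\<lambda>n. Cc k n * root 3 (t - t2) ^ n) sums X k (sh t)" if t: "\<bar>t - t2\<bar> < d ^ 3" for k t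
    proof -
      have "\<bar>root 3 (t - t2)\<bar> = root 3 \<bar>t - t2\<bar>" by (simp add: real_root_abs)
      also have "\<dots> < root 3 (d ^ 3)" using t by (intro real_root_less_mono) auto
      also have "\<dots> = d" using d(1) by (simp add: real_root_power_cancel)
      finally have \<tau>: "\<bar>root 3 (t - t2)\<bar> < d" .
      have "eval_fps T (\<sigma> (root 3 (t - t2))) = X vt (\<sigma> (root 3 (t - t2))) - t2"
        unfolding T_def X_def
        by (subst eval_fps_diff) (use d(2)[OF \<tau>] in \<open>simp_all add: ereal_less_le_trans[OF _ radz]\<close>)
      then have "X vt (\<sigma> (root 3 (t - t2))) = t" using d(3)[OF \<tau>] by (simp add: odd_real_root_pow)
      then have "sh t = \<sigma> (root 3 (t - t2))" using sh_T[OF d(2)[OF \<tau>]] by simp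
      then show ?thesis using Cc[OF \<tau>] by simp
    qed
    show ?thesis
    proof (intro exI conjI allI impI)
      show "d ^ 3 > 0" using d(1) by simp
      fix t assume t: "\<bar>t - t2\<bar> < d ^ 3"
      show "(\<lambda>n. root 3 (t - t2) ^ n *\<^sub>R (\<chi> j. Cc (vq j) n)) sums q' t"
        using sums[OF t] by (intro sums_vec_plane) (simp add: q'_def Q_def)
      show "(\<lambda>n. root 3 (t - t2) ^ n *\<^sub>R (\<chi> j. Cc (vR j) n)) sums R' t"
        using sums[OF t] by (intro sums_vec_plane) (simp add: R'_def RR_def)
    qed
  qed
  have "\<exists>e>0. e \<le> e0 \<and> (q' t2 = 0 \<longrightarrow> (\<exists>cq cR. \<forall>t. \<bar>t - t2\<bar> < e \<longrightarrow>
      (\<lambda>n. root 3 (t - t2) ^ n *\<^sub>R cq n) sums q' t \<and> (\<lambda>n. root 3 (t - t2) ^ n *\<^sub>R cR n) sums R' t))"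
  proof (cases "q' t2 = 0")
    case True
    from series[OF t2r[OF True]] obtain d cq cR where d: "d > 0" "\<And>t. \<bar>t - t2\<bar> < d \<Longrightarrow>
      (\<lambda>n. root 3 (t - t2) ^ n *\<^sub>R cq n) sums q' t \<and> (\<lambda>n. root 3 (t - t2) ^ n *\<^sub>R cR n) sums R' t"
      by blast
    then show ?thesis using e0 by (intro exI[of _ "min d e0"]) auto
  qed (use e0 in auto)
  then obtain e where e: "e > 0" "e \<le> e0" "q' t2 = 0 \<Longrightarrow> (\<exists>cq cR. \<forall>t. \<bar>t - t2\<bar> < e \<longrightarrow>
      (\<lambda>n. root 3 (t - t2) ^ n *\<^sub>R cq n) sums q' t \<and> (\<lambda>n. root 3 (t - t2) ^ n *\<^sub>R cR n) sums R' t)"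
    by blast
  show ?thesis
    by (rule that[of e q' R' w' V'])
      (use e e0t match' motion nzq nzd in \<open>simp_all\<close>)
qed

section \<open>Newton's equations in Jacobi coordinates\<close>

lemma UNIV_three: "distinct [i, j, k] \<Longrightarrow> (UNIV :: 3 set) = {i, j, k}"
  by (rule card_subset_eq[symmetric]) auto

lemma sum_three:
  fixes f :: "3 \<Rightarrow> 'a::comm_monoid_add"
  assumes "distinct [i, j, k]"
  shows "sum f UNIV = f i + f j + f k"
  unfolding UNIV_three[OF assms] using assms by (simp add: add.assoc)

lemma distinct_third:
  fixes i j :: 3
  assumes "i \<noteq> j"
  obtains k where "distinct [i, j, k]"
proof -
  have "card {i, j} < CARD(3)" using assms by simp
  then have "{i, j} \<noteq> UNIV" by auto
  then obtain k where "k \<notin> {i, j}" by blast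
  then have "distinct [i, j, k]" using assms by auto
  then show ?thesis by (rule that)
qed

text \<open>The summand is symmetric, so any labelling of the three bodies enumerates the pairs; the
  order on the index type then disappears from the development.\<close>

lemma potential_eq:
  assumes d: "distinct [i, j, k]"
  shows "potential m q = m i * m j / dist (q i) (q j) + m i * m k / dist (q i) (q k)
    + m j * m k / dist (q j) (q k)"
proof -
  define f where "f = (\<lambda>(a, b). m a * m b / dist (q a) (q b))"
  define od where "od = (\<lambda>a b :: 3. if a < b then (a, b) else (b, a))"
  have fo: "f (od a b) = m a * m b / dist (q a) (q b)" for a b
    by (simp add: f_def od_def dist_commute)
  have "{(a, b). a < b} = {od i j, od i k, od j k}"
  proof (intro set_eqI iffI)
    fix p :: "3 \<times> 3" assume "p \<in> {(a, b). a < b}"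
    then obtain a b where p: "p = (a, b)" "a < b" by auto
    have "a \<in> {i, j, k}" "b \<in> {i, j, k}" using UNIV_three[OF d] by auto
    then show "p \<in> {od i j, od i k, od j k}" using p by (auto simp: od_def)
  next
    fix p :: "3 \<times> 3" assume "p \<in> {od i j, od i k, od j k}"
    then show "p \<in> {(a, b). a < b}" using d by (auto simp: od_def split: if_splits)
  qed
  moreover have "od i j \<noteq> od i k" "od i j \<noteq> od j k" "od i k \<noteq> od j k" using d by (auto simp: od_def)
  ultimately have "sum f {(a, b). a < b} = f (od i j) + f (od i k) + f (od j k)"
    by (simp add: add.assoc)
  moreover have "potential m q = sum f {(a, b). a < b}" by (simp add: potential_def f_def)
  ultimately show ?thesis by (simp add: fo)
qed

section \<open>Gradient of the potential and accelerations\<close>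

definition accel :: "(3 \<Rightarrow> real) \<Rightarrow> config \<Rightarrow> 3 \<Rightarrow> plane" where
  "accel m q i = (\<Sum>j\<in>UNIV - {i}. m j *\<^sub>R grav (q j - q i))"

lemma accel_eq:
  assumes d: "distinct [i, j, k]"
  shows "accel m q i = m j *\<^sub>R grav (q j - q i) + m k *\<^sub>R grav (q k - q i)"
proof -
  have "UNIV - {i} = {j, k}" using UNIV_three[OF d] d by auto
  then show ?thesis using d by (simp add: accel_def)
qed

lemma GDERIV_inverse_dist:
  fixes a x :: plane
  assumes "x \<noteq> a"
  shows "GDERIV (\<lambda>y. c / dist y a) x :> c *\<^sub>R grav (a - x)"
proof -
  have nz: "norm (x - a) \<noteq> 0" using assms by simp
  have "((\<lambda>y. norm (y - a)) has_derivative (\<lambda>h. h \<bullet> sgn (x - a))) (at x)"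
  proof -
    have "(norm has_derivative (\<lambda>h. h \<bullet> sgn (x - a))) (at (x - a))"
      using GDERIV_norm[of "x - a"] assms by (simp add: gderiv_def)
    moreover have "((\<lambda>y. y - a) has_derivative (\<lambda>h. h)) (at x)"
      by (auto intro!: derivative_eq_intros)
    ultimately show ?thesis
      using has_derivative_compose[of "\<lambda>y. y - a" "\<lambda>h. h" x UNIV norm "\<lambda>h. h \<bullet> sgn (x - a)"] by simp
  qed
  then have "((\<lambda>y. c / norm (y - a)) has_derivative
      (\<lambda>h. - c * (inverse (norm (x - a)) * (h \<bullet> sgn (x - a)) * inverse (norm (x - a))))) (at x)"
    using nz by (auto intro!: derivative_eq_intros simp: divide_inverse)
  moreover have "- c * (inverse (norm (x - a)) * (h \<bullet> sgn (x - a)) * inverse (norm (x - a)))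
      = h \<bullet> (c *\<^sub>R grav (a - x))" for h
    using nz by (simp add: grav_def sgn_div_norm norm_minus_commute inner_diff_right field_simps
        power3_eq_cube)
  ultimately show ?thesis by (simp add: gderiv_def dist_norm)
qed

lemma GDERIV_potential:
  assumes "inj q"
  shows "GDERIV (\<lambda>y. potential m (q(i := y))) (q i) :> m i *\<^sub>R accel m q i"
proof -
  obtain j :: 3 where "j \<noteq> i" by (metis one_neq_zero)
  then obtain k where d: "distinct [i, j, k]" using distinct_third[of i j] by metis
  then have ne: "q i \<noteq> q j" "q i \<noteq> q k" using assms by (auto dest: injD)
  have "potential m (q(i := y)) = m i * m j / dist y (q j) + m i * m k / dist y (q k)
      + m j * m k / dist (q j) (q k)" for y
    using d unfolding potential_eq[OF d] by auto
  moreover have "GDERIV (\<lambda>y. m i * m j / dist y (q j) + m i * m k / dist y (q k)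
      + m j * m k / dist (q j) (q k)) (q i) :>
      (m i * m j) *\<^sub>R grav (q j - q i) + (m i * m k) *\<^sub>R grav (q k - q i) + 0"
    by (intro GDERIV_add GDERIV_const GDERIV_inverse_dist ne)
  ultimately show ?thesis by (simp add: accel_eq[OF d] scaleR_add_right)
qed

lemma GDERIV_unique:
  fixes D D' :: "'a::real_inner"
  assumes "GDERIV f x :> D" "GDERIV f x :> D'"
  shows "D = D'"
proof -
  have "(\<lambda>h. h \<bullet> D) = (\<lambda>h. h \<bullet> D')"
    using assms unfolding gderiv_def by (rule has_derivative_unique)
  then have "(D - D') \<bullet> (D - D') = 0" by (simp add: inner_diff_right fun_eq_iff)
  then show ?thesis by simp
qed

text \<open>The existential witnesses in \<open>newton_at\<close> are forced: v agrees with
  \<open>velocity\<close> near t, and a is determined by uniqueness of the gradient, the mass being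
  nonzero.\<close>

lemma newton_atD:
  assumes m: "\<And>i. m i > 0" and n: "newton_at m x t"
  shows "inj (x t)"
    "((\<lambda>s. x s i) has_vector_derivative velocity x t i) (at t)"
    "((\<lambda>s. velocity x s i) has_vector_derivative accel m (x t) i) (at t)"
proof -
  show inj: "inj (x t)" using n by (simp add: newton_at_def)
  obtain v a where v: "\<forall>\<^sub>F s in nhds t. ((\<lambda>r. x r i) has_vector_derivative v s) (at s)"
    and a: "(v has_vector_derivative a) (at t)"
    and g: "GDERIV (\<lambda>q. potential m ((x t)(i := q))) (x t i) :> m i *\<^sub>R a"
    using n unfolding newton_at_def by blast
  have ev: "\<forall>\<^sub>F s in nhds t. velocity x s i = v s"
    using v by eventually_elim (simp add: velocity_def vector_derivative_at)
  show "((\<lambda>s. x s i) has_vector_derivative velocity x t i) (at t)"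
    using eventually_nhds_x_imp_x[OF v] eventually_nhds_x_imp_x[OF ev] by simp
  have "m i *\<^sub>R a = m i *\<^sub>R accel m (x t) i"
    by (rule GDERIV_unique[OF g GDERIV_potential[OF inj]])
  then have "a = accel m (x t) i" using m[of i] by simp
  moreover obtain S where S: "open S" "t \<in> S" "\<And>s. s \<in> S \<Longrightarrow> velocity x s i = v s"
    using ev unfolding eventually_nhds by blast
  ultimately show "((\<lambda>s. velocity x s i) has_vector_derivative accel m (x t) i) (at t)"
    using has_vector_derivative_transform_within_open[OF a S(1,2), of "\<lambda>s. velocity x s i"] by simp
qed

lemma newton_atI:
  assumes "inj (x t)" "\<And>i. \<forall>\<^sub>F s in nhds t. ((\<lambda>r. x r i) has_vector_derivative v i s) (at s)"
    "\<And>i. (v i has_vector_derivative accel m (x t) i) (at t)"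
  shows "newton_at m x t"
  unfolding newton_at_def using assms GDERIV_potential[OF assms(1)] by blast

lemma newton_at_cong:
  assumes "newton_at m x t" "\<forall>\<^sub>F s in nhds t. y s = x s"
  shows "newton_at m y t"
proof -
  have yt: "y t = x t" using assms(2) by (rule eventually_nhds_x_imp_x)
  have "\<forall>\<^sub>F s in nhds t. ((\<lambda>r. y r i) has_vector_derivative v s) (at s)"
    if v: "\<forall>\<^sub>F s in nhds t. ((\<lambda>r. x r i) has_vector_derivative v s) (at s)" for v i
  proof -
    obtain S where S: "open S" "t \<in> S" "\<And>s. s \<in> S \<Longrightarrow> y s = x s"
      using assms(2) unfolding eventually_nhds by blast
    have "\<forall>\<^sub>F s in nhds t. s \<in> S" using S by (intro eventually_nhds_in_open)
    with v show ?thesis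
    proof eventually_elim
      case (elim s)
      then show ?case
        using has_vector_derivative_transform_within_open[OF elim(1) S(1) elim(2), of "\<lambda>r. y r i"] S(3) by simp
    qed
  qed
  then show ?thesis using assms(1) unfolding newton_at_def yt by blast
qed

section \<open>Jacobi coordinates of a pair and a third body\<close>

lemma grav_minus: "grav (- d) = - grav d"
  by (simp add: grav_def)

definition jq :: "3 \<Rightarrow> 3 \<Rightarrow> config \<Rightarrow> plane" where
  "jq i j x = x j - x i"

text \<open>The second Jacobi vector: the position of body k relative to the center of mass of the
  pair i, j. \<open>jpos\<close> inverts the two vectors under a center of mass at the
  origin.\<close>

definition jR :: "(3 \<Rightarrow> real) \<Rightarrow> 3 \<Rightarrow> 3 \<Rightarrow> 3 \<Rightarrow> config \<Rightarrow> plane" where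
  "jR m i j k x = x k - (m i / (m i + m j)) *\<^sub>R x i - (m j / (m i + m j)) *\<^sub>R x j"

lemma jacobi_third_body:
  assumes "m i + m j \<noteq> (0::real)"
  shows "jR m i j k x + (m j / (m i + m j)) *\<^sub>R jq i j x = x k - x i"
    "jR m i j k x + (- (m i / (m i + m j))) *\<^sub>R jq i j x = x k - x j"
proof -
  have 1: "m i / (m i + m j) + m j / (m i + m j) = 1"
    using assms by (simp add: add_divide_distrib[symmetric])
  then have "(m i / (m i + m j)) *\<^sub>R y + (m j / (m i + m j)) *\<^sub>R y = y" for y :: plane
    by (simp add: scaleR_add_left[symmetric])
  from this[of "x i"] this[of "x j"]
  show "jR m i j k x + (m j / (m i + m j)) *\<^sub>R jq i j x = x k - x i"
    "jR m i j k x + (- (m i / (m i + m j))) *\<^sub>R jq i j x = x k - x j"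
    by (simp_all add: jR_def jq_def algebra_simps)
qed

definition total_mass :: "(3 \<Rightarrow> real) \<Rightarrow> real" where "total_mass m = sum m UNIV"

definition jpos :: "(3 \<Rightarrow> real) \<Rightarrow> 3 \<Rightarrow> 3 \<Rightarrow> 3 \<Rightarrow> plane \<Rightarrow> plane \<Rightarrow> config" where
  "jpos m i j k q R l =
     (if l = k then ((m i + m j) / total_mass m) *\<^sub>R R
      else if l = i then - (m k / total_mass m) *\<^sub>R R - (m j / (m i + m j)) *\<^sub>R q
      else - (m k / total_mass m) *\<^sub>R R + (m i / (m i + m j)) *\<^sub>R q)"

text \<open>The attraction of body i enters R'' with m i from the acceleration of k and with m i m k
  / (m i + m j) from that of the pair; together this is total mass times m i / (m i + m j). The
  constants a and b are those for which R + a q and R + b q are the edges to k.\<close>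

definition jacobi_newton_at ::
  "(3 \<Rightarrow> real) \<Rightarrow> 3 \<Rightarrow> 3 \<Rightarrow> 3 \<Rightarrow> (real \<Rightarrow> plane) \<Rightarrow> (real \<Rightarrow> plane) \<Rightarrow> (real \<Rightarrow> plane) \<Rightarrow> (real \<Rightarrow> plane) \<Rightarrow> real \<Rightarrow> bool"
  where "jacobi_newton_at m i j k = jacobi_motion_at (m i + m j) (m k)
     (total_mass m * m i / (m i + m j)) (total_mass m * m j / (m i + m j))
     (m j / (m i + m j)) (- (m i / (m i + m j)))"

lemma newton_imp_jacobi:
  assumes d: "distinct [i, j, k]" and m: "\<And>i. m i > 0" and n: "newton_at m x t"
  shows "jacobi_newton_at m i j k (\<lambda>t. jq i j (x t)) (\<lambda>t. jq i j (velocity x t))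
    (\<lambda>t. jR m i j k (x t)) (\<lambda>t. jR m i j k (velocity x t)) t"
proof -
  define \<mu> where "\<mu> = m i + m j"
  have \<mu>: "\<mu> > 0" using m[of i] m[of j] by (simp add: \<mu>_def)
  have M: "total_mass m = \<mu> + m k" by (simp add: total_mass_def sum_three[OF d] \<mu>_def)
  note third = jacobi_third_body[of m i j k, folded \<mu>_def, OF \<mu>[THEN less_imp_neq, symmetric]]
  have inj: "inj (x t)" by (rule newton_atD(1)[OF m n])
  note dx = newton_atD(2)[OF m n] and dv = newton_atD(3)[OF m n]
  let ?gi = "grav (x t k - x t i)" and ?gj = "grav (x t k - x t j)" and ?gq = "grav (x t j - x t i)"
  have d': "distinct [j, i, k]" "distinct [k, i, j]" using d by auto
  have gneg: "grav (x t i - x t j) = - ?gq" "grav (x t i - x t k) = - ?gi" "grav (x t j - x t k) = - ?gj"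
    by (metis grav_minus minus_diff_eq)+
  have ai: "accel m (x t) i = m j *\<^sub>R ?gq + m k *\<^sub>R ?gi" by (rule accel_eq[OF d])
  have aj: "accel m (x t) j = - (m i *\<^sub>R ?gq) + m k *\<^sub>R ?gj" by (simp add: accel_eq[OF d'(1)] gneg)
  have ak: "accel m (x t) k = - (m i *\<^sub>R ?gi) - m j *\<^sub>R ?gj" by (simp add: accel_eq[OF d'(2)] gneg)
  have q: "((\<lambda>t. jq i j (x t)) has_vector_derivative jq i j (velocity x t)) (at t)"
    unfolding jq_def by (intro has_vector_derivative_diff dx)
  have R: "((\<lambda>t. jR m i j k (x t)) has_vector_derivative jR m i j k (velocity x t)) (at t)"
    unfolding jR_def
    by (intro has_vector_derivative_diff dx bounded_linear.has_vector_derivative[OF bounded_linear_scaleR_right])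
  have w: "((\<lambda>t. jq i j (velocity x t)) has_vector_derivative accel m (x t) j - accel m (x t) i) (at t)"
    unfolding jq_def by (intro has_vector_derivative_diff dv)
  have V: "((\<lambda>t. jR m i j k (velocity x t)) has_vector_derivative
      accel m (x t) k - (m i / \<mu>) *\<^sub>R accel m (x t) i - (m j / \<mu>) *\<^sub>R accel m (x t) j) (at t)"
    unfolding jR_def \<mu>_def
    by (intro has_vector_derivative_diff dv bounded_linear.has_vector_derivative[OF bounded_linear_scaleR_right])
  have w': "accel m (x t) j - accel m (x t) i = m k *\<^sub>R (?gj - ?gi) - \<mu> *\<^sub>R ?gq"
    unfolding ai aj \<mu>_def by (simp add: algebra_simps)
  have V': "accel m (x t) k - (m i / \<mu>) *\<^sub>R accel m (x t) i - (m j / \<mu>) *\<^sub>R accel m (x t) j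
      = - ((total_mass m * m i / \<mu>) *\<^sub>R ?gi + (total_mass m * m j / \<mu>) *\<^sub>R ?gj)"
    unfolding ai aj ak M using \<mu> by (simp add: vec_eq_iff field_simps)
  have ne: "x t j - x t i \<noteq> 0" "x t k - x t i \<noteq> 0" "x t k - x t j \<noteq> 0"
    using inj d by (auto dest: injD)
  show ?thesis
    unfolding jacobi_newton_at_def jacobi_motion_at_def kepler_pert_def \<mu>_def[symmetric] third
    using q w R V w' V' ne by (simp add: jq_def)
qed

lemma jpos_coordinates:
  assumes d: "distinct [i, j, k]" and m: "\<And>i. m i > 0"
  shows "jq i j (jpos m i j k q R) = q" "jR m i j k (jpos m i j k q R) = R"
    "(\<Sum>l\<in>UNIV. m l *\<^sub>R jpos m i j k q R l) = 0"
proof -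
  have p: "m i > 0" "m j > 0" "m k > 0" using m by auto
  have M: "total_mass m = m i + m j + m k" by (simp add: total_mass_def sum_three[OF d])
  have pos: "m i + m j > 0" "m i + m j + m k > 0" using p by auto
  have ne: "m i + m j \<noteq> 0" "m i + m j + m k \<noteq> 0" using pos by auto
  have s1: "m i / (m i + m j) + m j / (m i + m j) = 1"
    using ne by (simp add: add_divide_distrib[symmetric])
  have s2: "(m i + m j) / (m i + m j + m k) + m k / (m i + m j + m k) = 1"
    using ne by (simp add: add_divide_distrib[symmetric])
  show "jq i j (jpos m i j k q R) = q"
    using d s1 unfolding jq_def jpos_def by (auto simp: scaleR_add_left[symmetric] add.commute)
  define \<mu> and M' where "\<mu> = m i + m j" and "M' = m i + m j + m k"
  have \<mu>: "\<mu> \<noteq> 0" "M' \<noteq> 0" "m j = \<mu> - m i" "m k = M' - \<mu>" using ne by (simp_all add: \<mu>_def M'_def)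
  have ji: "j \<noteq> i" "k \<noteq> i" "k \<noteq> j" "i \<noteq> k" "j \<noteq> k" using d by auto
  show "jR m i j k (jpos m i j k q R) = R"
    unfolding jR_def jpos_def M M'_def[symmetric] \<mu>_def[symmetric] \<mu>(3,4) using \<mu>(1,2) ji
    by (simp add: vec_eq_iff field_simps)
  show "(\<Sum>l\<in>UNIV. m l *\<^sub>R jpos m i j k q R l) = 0"
    unfolding sum_three[OF d] jpos_def M M'_def[symmetric] \<mu>_def[symmetric] \<mu>(3,4) using \<mu>(1,2) ji
    by (simp add: vec_eq_iff field_simps)
qed

lemma jpos_jacobi:
  assumes d: "distinct [i, j, k]" and m: "\<And>i. m i > 0" and com: "(\<Sum>l\<in>UNIV. m l *\<^sub>R x l) = 0"
  shows "jpos m i j k (jq i j x) (jR m i j k x) = x"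
proof
  fix l
  have p: "m i > 0" "m j > 0" "m k > 0" using m by auto
  define \<mu> and M where "\<mu> = m i + m j" and "M = m i + m j + m k"
  have M: "total_mass m = M" by (simp add: total_mass_def sum_three[OF d] M_def)
  have \<mu>: "\<mu> > 0" "M > 0" "m j = \<mu> - m i" "m k = M - \<mu>" using p by (simp_all add: \<mu>_def M_def)
  have ji: "j \<noteq> i" "k \<noteq> i" "k \<noteq> j" "i \<noteq> k" "j \<noteq> k" using d by auto
  have "m i *\<^sub>R x i + m j *\<^sub>R x j + m k *\<^sub>R x k = 0" using com by (simp add: sum_three[OF d])
  then have "m i * x i $ n + m j * x j $ n + m k * x k $ n = 0" for n
    by (drule_tac arg_cong[where f = "\<lambda>v. v $ n"]) simp
  then have c: "(M - \<mu>) * x k $ n = - (m i * x i $ n) - (\<mu> - m i) * x j $ n" for n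
    unfolding \<mu>(3,4) by (smt (verit))
  have r: "\<mu> * (xk - mi / \<mu> * xi - (\<mu> - mi) / \<mu> * xj) = M * xk"
    if "(M - \<mu>) * xk = - (mi * xi) - (\<mu> - mi) * xj" for xi xj xk mi :: real
  proof -
    have "\<mu> * (xk - mi / \<mu> * xi - (\<mu> - mi) / \<mu> * xj) = \<mu> * xk - mi * xi - (\<mu> - mi) * xj"
      using \<mu>(1) by (simp add: right_diff_distrib)
    also have "\<dots> = M * xk" using that by (simp add: algebra_simps)
    finally show ?thesis .
  qed
  have R: "jR m i j k x $ n = M * x k $ n / \<mu>" for n
    using r[OF c[of n]] \<mu>(1) unfolding jR_def \<mu>_def[symmetric] \<mu>(3)
    by (simp add: eq_divide_eq mult.commute)
  have c': "\<mu> * x k $ n = M * x k $ n + m i * x i $ n + (\<mu> - m i) * x j $ n" for n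
    using c[of n] by (simp add: algebra_simps)
  have l: "l = i \<or> l = j \<or> l = k" using UNIV_three[OF d] by auto
  have "jpos m i j k (jq i j x) (jR m i j k x) k $ n = x k $ n" for n
    using \<mu>(1,2) unfolding jpos_def M \<mu>_def[symmetric] by (simp add: R)
  moreover have ck: "(M - \<mu>) / M * (M * x k $ n / \<mu>) = (- (m i * x i $ n) - (\<mu> - m i) * x j $ n) / \<mu>" for n
    unfolding c[symmetric] using \<mu>(1,2) by simp
  have "jpos m i j k (jq i j x) (jR m i j k x) i $ n = x i $ n" for n
    using \<mu>(1,2) ji unfolding jpos_def M \<mu>_def[symmetric] \<mu>(3,4)
    by (simp add: R jq_def ck del: times_divide_eq_left times_divide_eq_right) (simp add: field_simps)
  moreover have "jpos m i j k (jq i j x) (jR m i j k x) j $ n = x j $ n" for n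
    using \<mu>(1,2) ji unfolding jpos_def M \<mu>_def[symmetric] \<mu>(3,4)
    by (simp add: R jq_def ck del: times_divide_eq_left times_divide_eq_right) (simp add: field_simps)
  ultimately show "jpos m i j k (jq i j x) (jR m i j k x) l = x l"
    using l by (auto simp: vec_eq_iff)
qed

text \<open>The equations are required near t, as \<open>newton_at\<close> asks for a velocity in a
  neighbourhood.\<close>

lemma jacobi_imp_newton:
  assumes d: "distinct [i, j, k]" and m: "\<And>i. m i > 0"
    and ev: "\<forall>\<^sub>F s in nhds t. jacobi_newton_at m i j k q w R V s"
  shows "newton_at m (\<lambda>t. jpos m i j k (q t) (R t)) t"
proof -
  define \<mu> where "\<mu> = m i + m j"
  define x where "x = (\<lambda>t. jpos m i j k (q t) (R t))"
  have p: "m i > 0" "m j > 0" "m k > 0" using m by auto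
  have \<mu>: "\<mu> > 0" using p by (simp add: \<mu>_def)
  have M: "total_mass m = \<mu> + m k" by (simp add: total_mass_def sum_three[OF d] \<mu>_def)
  note third = jacobi_third_body[of m i j k, folded \<mu>_def, OF \<mu>[THEN less_imp_neq, symmetric]]
  have qx: "jq i j (x t) = q t" "jR m i j k (x t) = R t" for t
    by (simp_all add: x_def jpos_coordinates[OF d m])
  have dij: "x t j - x t i = q t" "x t k - x t i = R t + (m j / \<mu>) *\<^sub>R q t"
    "x t k - x t j = R t + (- (m i / \<mu>)) *\<^sub>R q t" for t
    using third[of "x t"] by (simp_all only: qx) (simp add: qx(1)[symmetric] jq_def)
  have at: "jacobi_newton_at m i j k q w R V t" by (rule eventually_nhds_x_imp_x[OF ev])
  have ne: "q t \<noteq> 0" "R t + (m j / \<mu>) *\<^sub>R q t \<noteq> 0" "R t + (- (m i / \<mu>)) *\<^sub>R q t \<noteq> 0"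
    using at unfolding jacobi_newton_at_def jacobi_motion_at_def \<mu>_def by simp_all
  have lin: "((\<lambda>t. jpos m i j k (f t) (g t) l) has_vector_derivative jpos m i j k f' g' l) (at s)"
    if "(f has_vector_derivative f') (at s)" "(g has_vector_derivative g') (at s)" for f g f' g' s l
    unfolding jpos_def
    by (auto intro!: has_vector_derivative_diff has_vector_derivative_add that
        bounded_linear.has_vector_derivative[OF bounded_linear_scaleR_right] simp del: scaleR_minus_left)
  show ?thesis
    unfolding x_def[symmetric]
  proof (rule newton_atI)
    show "inj (x t)"
    proof (rule injI)
      fix l l' assume eq: "x t l = x t l'"
      have *: "x t j \<noteq> x t i" "x t k \<noteq> x t i" "x t k \<noteq> x t j" using dij[of t] ne by auto
      have "l \<in> {i, j, k}" "l' \<in> {i, j, k}" using UNIV_three[OF d] by auto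
      then show "l = l'" using eq * by auto
    qed
    show "\<forall>\<^sub>F s in nhds t. ((\<lambda>r. x r l) has_vector_derivative jpos m i j k (w s) (V s) l) (at s)" for l
      using ev
    proof eventually_elim
      case (elim s)
      then show ?case unfolding x_def jacobi_newton_at_def jacobi_motion_at_def by (intro lin) auto
    qed
    fix l
    let ?gi = "grav (x t k - x t i)" and ?gj = "grav (x t k - x t j)" and ?gq = "grav (x t j - x t i)"
    let ?q2 = "m k *\<^sub>R (?gj - ?gi) - \<mu> *\<^sub>R ?gq"
    let ?R2 = "- ((total_mass m * m i / \<mu>) *\<^sub>R ?gi + (total_mass m * m j / \<mu>) *\<^sub>R ?gj)"
    have "(w has_vector_derivative ?q2) (at t)" "(V has_vector_derivative ?R2) (at t)"
      using at unfolding dij jacobi_newton_at_def jacobi_motion_at_def kepler_pert_def \<mu>_def by simp_all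
    from lin[OF this] have 1: "((\<lambda>s. jpos m i j k (w s) (V s) l) has_vector_derivative jpos m i j k ?q2 ?R2 l) (at t)" .
    have d': "distinct [j, i, k]" "distinct [k, i, j]" using d by auto
    have gneg: "grav (x t i - x t j) = - ?gq" "grav (x t i - x t k) = - ?gi" "grav (x t j - x t k) = - ?gj"
      by (metis grav_minus minus_diff_eq)+
    have ai: "accel m (x t) i = m j *\<^sub>R ?gq + m k *\<^sub>R ?gi" by (rule accel_eq[OF d])
    have aj: "accel m (x t) j = - (m i *\<^sub>R ?gq) + m k *\<^sub>R ?gj" by (simp add: accel_eq[OF d'(1)] gneg)
    have ak: "accel m (x t) k = - (m i *\<^sub>R ?gi) - m j *\<^sub>R ?gj" by (simp add: accel_eq[OF d'(2)] gneg)
    have M0: "total_mass m \<noteq> 0" and \<mu>0: "\<mu> \<noteq> 0" using \<mu> p by (auto simp: M)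
    \<comment> \<open>The accelerations of i, j and k in one scalar component, with N the total mass
      and s the mass of the pair.\<close>
    have ei: "- (c / N) * (- (N * a / s * gi + N * b / s * gj)) - b / s * (c * (gj - gi) - s * gq) = b * gq + c * gi"
      "- (c / N) * (- (N * a / s * gi + N * b / s * gj)) + a / s * (c * (gj - gi) - s * gq) = - (a * gq) + c * gj"
      "s / N * (- (N * a / s * gi + N * b / s * gj)) = - (a * gi) - b * gj"
      if "N \<noteq> 0" "s \<noteq> 0" "a = s - b" for N s a b c gi gj gq :: real
      unfolding that(3) using that(1,2) by (simp_all add: field_simps)
    have mij: "m i = \<mu> - m j" by (simp add: \<mu>_def)
    note e = ei(1)[OF M0 \<mu>0 mij, of "m k"] ei(2)[OF M0 \<mu>0 mij, of "m k"] ei(3)[OF M0 \<mu>0 mij]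
    have ji: "j \<noteq> i" "k \<noteq> i" "k \<noteq> j" "i \<noteq> k" "j \<noteq> k" using d by auto
    have "jpos m i j k ?q2 ?R2 i = accel m (x t) i"
      unfolding ai vec_eq_iff using ji e(1) by (simp add: jpos_def \<mu>_def[symmetric] del: minus_add_distrib)
    moreover have "jpos m i j k ?q2 ?R2 j = accel m (x t) j"
      unfolding aj vec_eq_iff using ji e(2) by (simp add: jpos_def \<mu>_def[symmetric] del: minus_add_distrib)
    moreover have "jpos m i j k ?q2 ?R2 k = accel m (x t) k"
      unfolding ak vec_eq_iff using ji e(3) by (simp add: jpos_def \<mu>_def[symmetric] del: minus_add_distrib)
    moreover have "l = i \<or> l = j \<or> l = k" using UNIV_three[OF d] by auto
    ultimately have "jpos m i j k ?q2 ?R2 l = accel m (x t) l" by auto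
    then show "((\<lambda>s. jpos m i j k (w s) (V s) l) has_vector_derivative accel m (x t) l) (at t)"
      using 1 by simp
  qed
qed

section \<open>Endpoints of collision-free motions\<close>

definition inertia :: "(3 \<Rightarrow> real) \<Rightarrow> config \<Rightarrow> real" where
  "inertia m q = (\<Sum>i\<in>UNIV. m i * (norm (q i))\<^sup>2)"

lemma three_labels:
  obtains i j k :: 3 where "distinct [i, j, k]"
proof -
  have "(0 :: 3) \<noteq> 1" by simp
  from distinct_third[OF this] show ?thesis using that by blast
qed

lemma inner_grav: "d \<bullet> grav d = 1 / norm d"
  by (cases "d = 0") (simp_all add: grav_def dot_square_norm field_simps power2_eq_square power3_eq_cube)

text \<open>Euler's identity for a potential homogeneous of degree -1: the two contributions of a
  pair combine to the edge against its own field, the inverse distance.\<close>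

lemma sum_inner_accel: "(\<Sum>i\<in>UNIV. m i * (q i \<bullet> accel m q i)) = - potential m q"
proof -
  obtain i j k :: 3 where d: "distinct [i, j, k]" by (rule three_labels)
  have d': "distinct [j, i, k]" "distinct [k, i, j]" using d by auto
  have g: "grav (q i - q j) = - grav (q j - q i)" "grav (q i - q k) = - grav (q k - q i)"
    "grav (q j - q k) = - grav (q k - q j)"
    by (metis grav_minus minus_diff_eq)+
  have p: "q b \<bullet> grav (q b - q a) = q a \<bullet> grav (q b - q a) + 1 / dist (q a) (q b)" for a b
    using inner_grav[of "q b - q a"] by (simp add: inner_diff_left dist_norm norm_minus_commute)
  show ?thesis
    unfolding sum_three[OF d] potential_eq[OF d] accel_eq[OF d] accel_eq[OF d'(1)] accel_eq[OF d'(2)] g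
    by (simp add: inner_add_right p[of j i] p[of k i] p[of k j] p[of i j] p[of i k] p[of j k] algebra_simps dist_commute)
qed

text \<open>The Lagrange-Jacobi identity in two first-order steps; the force term is evaluated by
  \<open>sum_inner_accel\<close>.\<close>

lemma inertia_derivs:
  assumes m: "\<And>i. m i > 0" and n: "newton_at m x t"
  shows "((\<lambda>t. inertia m (x t)) has_real_derivative 2 * (\<Sum>i\<in>UNIV. m i * (x t i \<bullet> velocity x t i))) (at t)"
    "((\<lambda>t. \<Sum>i\<in>UNIV. m i * (x t i \<bullet> velocity x t i)) has_real_derivative
      (\<Sum>i\<in>UNIV. m i * (norm (velocity x t i))\<^sup>2) - potential m (x t)) (at t)"
proof -
  note dx = newton_atD(2)[OF m n] and dv = newton_atD(3)[OF m n]
  have "((\<lambda>t. \<Sum>i\<in>UNIV. m i * (x t i \<bullet> x t i)) has_real_derivative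
      (\<Sum>i\<in>UNIV. m i * (x t i \<bullet> velocity x t i + velocity x t i \<bullet> x t i))) (at t)"
    by (intro DERIV_sum DERIV_cmult has_real_derivative_inner dx)
  then show "((\<lambda>t. inertia m (x t)) has_real_derivative 2 * (\<Sum>i\<in>UNIV. m i * (x t i \<bullet> velocity x t i))) (at t)"
    by (simp add: inertia_def dot_square_norm inner_commute sum_distrib_left mult.left_commute)
  have "((\<lambda>t. \<Sum>i\<in>UNIV. m i * (x t i \<bullet> velocity x t i)) has_real_derivative
      (\<Sum>i\<in>UNIV. m i * (x t i \<bullet> accel m (x t) i + velocity x t i \<bullet> velocity x t i))) (at t)"
    by (intro DERIV_sum DERIV_cmult has_real_derivative_inner dx dv)
  then show "((\<lambda>t. \<Sum>i\<in>UNIV. m i * (x t i \<bullet> velocity x t i)) has_real_derivative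
      (\<Sum>i\<in>UNIV. m i * (norm (velocity x t i))\<^sup>2) - potential m (x t)) (at t)"
    using sum_inner_accel[of m "x t"]
    by (simp add: dot_square_norm distrib_left sum.distrib)
qed

section \<open>Potential and moment of inertia near an endpoint\<close>

lemma potential_deriv:
  assumes m: "\<And>i. m i > 0" and n: "newton_at m x t"
  shows "((\<lambda>t. potential m (x t)) has_real_derivative
    (\<Sum>i\<in>UNIV. m i * (accel m (x t) i \<bullet> velocity x t i))) (at t)"
proof -
  note dx = newton_atD(2)[OF m n]
  have inj: "inj (x t)" by (rule newton_atD(1)[OF m n])
  obtain i j k :: 3 where d: "distinct [i, j, k]" by (rule three_labels)
  have d': "distinct [j, i, k]" "distinct [k, i, j]" using d by auto
  have g: "grav (x t i - x t j) = - grav (x t j - x t i)" "grav (x t i - x t k) = - grav (x t k - x t i)"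
    "grav (x t j - x t k) = - grav (x t k - x t j)"
    by (metis grav_minus minus_diff_eq)+
  have pair: "((\<lambda>t. c / dist (x t a) (x t b)) has_real_derivative
      c * (grav (x t b - x t a) \<bullet> (velocity x t a - velocity x t b))) (at t)" if "a \<noteq> b" for a b c
  proof -
    have ne: "x t a - x t b \<noteq> 0" using inj that by (auto dest: injD)
    have "((\<lambda>t. c / norm (x t a - x t b)) has_real_derivative
        (0 * norm (x t a - x t b) - c * (((x t a - x t b) \<bullet> (velocity x t a - velocity x t b)) / norm (x t a - x t b)))
        / (norm (x t a - x t b) * norm (x t a - x t b))) (at t)"
      using ne by (intro DERIV_divide DERIV_const has_real_derivative_norm has_vector_derivative_diff dx) auto
    moreover have "grav (x t b - x t a) = - grav (x t a - x t b)" by (metis grav_minus minus_diff_eq)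
    ultimately show ?thesis using ne
      by (simp add: dist_norm grav_def power3_eq_cube divide_inverse mult_ac)
  qed
  have "((\<lambda>t. m i * m j / dist (x t i) (x t j) + m i * m k / dist (x t i) (x t k)
      + m j * m k / dist (x t j) (x t k)) has_real_derivative
      m i * m j * (grav (x t j - x t i) \<bullet> (velocity x t i - velocity x t j))
      + m i * m k * (grav (x t k - x t i) \<bullet> (velocity x t i - velocity x t k))
      + m j * m k * (grav (x t k - x t j) \<bullet> (velocity x t j - velocity x t k))) (at t)"
    using d by (intro DERIV_add pair) auto
  then show ?thesis
    unfolding sum_three[OF d] potential_eq[OF d] accel_eq[OF d] accel_eq[OF d'(1)] accel_eq[OF d'(2)] g
    by (rule DERIV_cong) (simp add: inner_add_left inner_diff_right algebra_simps)
qed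

lemma potential_pair_le:
  assumes m: "\<And>i. m i > 0" and "a \<noteq> b"
  shows "m a * m b / dist (q a) (q b) \<le> potential m q"
proof -
  obtain c where d: "distinct [a, b, c]" using distinct_third assms(2) by metis
  have "m a * m c / dist (q a) (q c) \<ge> 0" "m b * m c / dist (q b) (q c) \<ge> 0"
    using m[of a] m[of b] m[of c] by (simp_all add: less_imp_le)
  then show ?thesis unfolding potential_eq[OF d] by simp
qed

lemma potential_pos:
  assumes m: "\<And>i. m i > 0" and "inj q"
  shows "potential m q > 0"
proof -
  obtain i j k :: 3 where d: "distinct [i, j, k]" by (rule three_labels)
  then have "q i \<noteq> q j" using assms(2) by (auto dest: injD)
  then have "m i * m j / dist (q i) (q j) > 0" using m by simp
  then show ?thesis using potential_pair_le[of m i j q, OF m] d by simp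
qed

lemma mass_lower_bound:
  fixes m :: "3 \<Rightarrow> real"
  assumes "\<And>i. m i > 0"
  obtains m0 where "m0 > 0" "\<And>i. m0 \<le> m i"
proof
  show "Min (range m) > 0" using assms by simp
  show "Min (range m) \<le> m i" for i by simp
qed

text \<open>The kinetic sum equals 2 (U + h), which is below 2 U because h is negative.\<close>

lemma speed_bound:
  assumes m: "\<And>i. m i > 0" and e: "energy m x t = h" and h: "h < 0"
    and m0: "m0 > 0" "\<And>i. m0 \<le> m i"
  shows "norm (velocity x t i) \<le> sqrt (2 * potential m (x t) / m0)"
proof -
  have "m i * (norm (velocity x t i))\<^sup>2 \<le> (\<Sum>i\<in>UNIV. m i * (norm (velocity x t i))\<^sup>2)"
    by (rule member_le_sum) (use m in \<open>auto simp: less_imp_le\<close>)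
  also have "\<dots> \<le> 2 * potential m (x t)" using e h by (simp add: energy_def)
  finally have 1: "m i * (norm (velocity x t i))\<^sup>2 \<le> 2 * potential m (x t)" .
  have "m0 * (norm (velocity x t i))\<^sup>2 \<le> m i * (norm (velocity x t i))\<^sup>2"
    using m0(2)[of i] by (intro mult_right_mono) auto
  with 1 have "(norm (velocity x t i))\<^sup>2 \<le> 2 * potential m (x t) / m0"
    using m0(1) by (simp add: field_simps)
  then show ?thesis by (rule real_le_rsqrt)
qed

text \<open>Since \<open>|dU/dt|\<close> is at most a multiple of \<open>U\<^sup>2 * sqrt U\<close>, the function below is Lipschitz, and so
  near an endpoint \<open>U\<close> either tends to infinity or stays bounded.\<close>

lemma potential_endpoint:
  assumes m: "\<And>i. m i > 0" and h: "h < 0" and ab: "a < b"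
    and newton: "\<And>t. a < t \<Longrightarrow> t < b \<Longrightarrow> newton_at m x t"
    and en: "\<And>t. a < t \<Longrightarrow> t < b \<Longrightarrow> energy m x t = h"
  shows "(\<exists>B t1. a \<le> t1 \<and> t1 < b \<and> (\<forall>t. t1 < t \<and> t < b \<longrightarrow> potential m (x t) \<le> B)) \<or>
    (\<forall>B. \<exists>t1. a \<le> t1 \<and> t1 < b \<and> (\<forall>t. t1 < t \<and> t < b \<longrightarrow> potential m (x t) \<ge> B))"
proof -
  obtain m0 where m0: "m0 > 0" "\<And>i. m0 \<le> m i" using mass_lower_bound[of m, OF m] by blast
  define U where "U = (\<lambda>t. potential m (x t))"
  define U' where "U' = (\<lambda>t. \<Sum>i\<in>UNIV. m i * (accel m (x t) i \<bullet> velocity x t i))"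
  \<comment> \<open>The exponent matches |U'| \<le> D U^(5/2): the derivative of U^(-3/2) is - 3/2
    U^(-5/2) U', hence bounded.\<close>
  define f where "f = (\<lambda>t. U t powr (- 3 / 2))"
  \<comment> \<open>Three bodies, each with a force from two partners of at most U^2 / m0^2, times
    the speed bound sqrt (2 U / m0).\<close>
  define D where "D = 6 / m0\<^sup>2 * sqrt (2 / m0)"
  have U: "(U has_real_derivative U' t) (at t)" if "a < t" "t < b" for t
    using potential_deriv[OF m newton[OF that]] by (simp add: U_def U'_def)
  have Upos: "U t > 0" if "a < t" "t < b" for t
    unfolding U_def using newton_atD(1)[OF m newton[OF that]] by (rule potential_pos[OF m])
  have U'b: "\<bar>U' t\<bar> \<le> D * U t powr (5 / 2)" if t: "a < t" "t < b" for t
  proof -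
    have acc: "m i * norm (accel m (x t) i) \<le> 2 * ((U t)\<^sup>2 / m0\<^sup>2)" for i
    proof -
      obtain j :: 3 where "j \<noteq> i" by (metis one_neq_zero)
      then obtain k where d: "distinct [i, j, k]" using distinct_third[of i j] by metis
      \<comment> \<open>The force of a pair is the square of its potential divided by the product of
        the masses.\<close>
      have pair: "m i * (m l * norm (grav (x t l - x t i))) \<le> (U t)\<^sup>2 / m0\<^sup>2" if l: "l \<noteq> i" for l
      proof -
        have ne: "x t i \<noteq> x t l" using newton_atD(1)[OF m newton[OF t]] l by (auto dest: injD)
        define r where "r = dist (x t i) (x t l)"
        have r: "r > 0" using ne by (simp add: r_def)
        have c: "m i * m l > 0" using m by simp
        have cm: "m0\<^sup>2 \<le> m i * m l" unfolding power2_eq_square using m0 by (intro mult_mono) (auto intro: less_imp_le order_trans)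
        have "m i * m l / r \<le> U t" using potential_pair_le[of m i l "x t", OF m] l by (simp add: r_def U_def)
        then have "(m i * m l / r)\<^sup>2 \<le> (U t)\<^sup>2" using c r by (intro power_mono) auto
        then have "(m i * m l / r)\<^sup>2 / (m i * m l) \<le> (U t)\<^sup>2 / m0\<^sup>2"
          using c cm m0 by (intro frac_le) auto
        moreover have "m i * (m l * norm (grav (x t l - x t i))) = (m i * m l / r)\<^sup>2 / (m i * m l)"
          using c r by (simp add: norm_grav r_def dist_norm norm_minus_commute power2_eq_square field_simps)
        ultimately show ?thesis by simp
      qed
      have "norm (accel m (x t) i) \<le> m j * norm (grav (x t j - x t i)) + m k * norm (grav (x t k - x t i))"
        unfolding accel_eq[OF d] using m[of j] m[of k] by (intro order_trans[OF norm_triangle_ineq]) simp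
      then have "m i * norm (accel m (x t) i) \<le> m i * (m j * norm (grav (x t j - x t i)) + m k * norm (grav (x t k - x t i)))"
        using m[of i] by (intro mult_left_mono) auto
      also have "\<dots> \<le> 2 * ((U t)\<^sup>2 / m0\<^sup>2)"
        using pair[of j] pair[of k] d by (auto simp: distrib_left)
      finally show ?thesis .
    qed
    have sp: "norm (velocity x t i) \<le> sqrt (2 * U t / m0)" for i
      unfolding U_def by (rule speed_bound[OF m en[OF t] h m0])
    have "\<bar>U' t\<bar> \<le> (\<Sum>i\<in>UNIV. \<bar>m i * (accel m (x t) i \<bullet> velocity x t i)\<bar>)"
      unfolding U'_def by (rule sum_abs)
    also have "\<dots> \<le> (\<Sum>i\<in>(UNIV::3 set). 2 * ((U t)\<^sup>2 / m0\<^sup>2) * sqrt (2 * U t / m0))"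
    proof (rule sum_mono)
      fix i :: 3
      have "\<bar>m i * (accel m (x t) i \<bullet> velocity x t i)\<bar> \<le> m i * (norm (accel m (x t) i) * norm (velocity x t i))"
        unfolding abs_mult using m[of i] Cauchy_Schwarz_ineq2 by (intro mult_mono) auto
      also have "\<dots> = (m i * norm (accel m (x t) i)) * norm (velocity x t i)" by simp
      also have "\<dots> \<le> 2 * ((U t)\<^sup>2 / m0\<^sup>2) * sqrt (2 * U t / m0)"
        using mult_mono[OF acc[of i] sp[of i]] by simp
      finally show "\<bar>m i * (accel m (x t) i \<bullet> velocity x t i)\<bar> \<le> 2 * ((U t)\<^sup>2 / m0\<^sup>2) * sqrt (2 * U t / m0)" .
    qed
    also have "\<dots> = D * ((U t)\<^sup>2 * sqrt (U t))"
    proof -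
      have "sqrt (2 * U t / m0) = sqrt (2 / m0) * sqrt (U t)" by (simp flip: real_sqrt_mult)
      then show ?thesis by (simp add: D_def)
    qed
    also have "(U t)\<^sup>2 * sqrt (U t) = U t powr (5 / 2)"
    proof -
      have "U t powr (5 / 2) = U t powr (2 + 1 / 2)" by simp
      also have "\<dots> = U t powr 2 * U t powr (1 / 2)" by (rule powr_add)
      also have "\<dots> = (U t)\<^sup>2 * sqrt (U t)" using Upos[OF t] by (simp add: powr_half_sqrt)
      finally show ?thesis by simp
    qed
    finally show ?thesis .
  qed
  have f': "(f has_real_derivative - 3 / 2 * U t powr (- 3 / 2 - 1) * U' t) (at t)" if t: "a < t" "t < b" for t
    unfolding f_def by (rule DERIV_chain2[OF has_real_derivative_powr[OF Upos[OF t]] U[OF t]])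
  have "\<exists>l. (f \<longlongrightarrow> l) (at_left b)"
  proof (rule bounded_derivative_limit_left[OF ab f'])
    fix t assume t: "a < t" "t < b"
    have "U t powr (- 3 / 2 - 1) * U t powr (5 / 2) = U t powr 0"
      unfolding powr_add[symmetric] by simp
    then have 1: "U t powr (- 3 / 2 - 1) * U t powr (5 / 2) = 1" using Upos[OF t] by simp
    have "\<bar>- 3 / 2 * U t powr (- 3 / 2 - 1) * U' t\<bar> = 3 / 2 * (U t powr (- 3 / 2 - 1) * \<bar>U' t\<bar>)"
      unfolding abs_mult by simp
    also have "\<dots> \<le> 3 / 2 * (U t powr (- 3 / 2 - 1) * (D * U t powr (5 / 2)))"
      using U'b[OF t] by (intro mult_left_mono) auto
    also have "\<dots> = 3 / 2 * D * (U t powr (- 3 / 2 - 1) * U t powr (5 / 2))"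
    proof -
      have "3 / 2 * (A * (D * B)) = 3 / 2 * D * (A * B)" for A B :: real by simp
      then show ?thesis .
    qed
    also have "\<dots> = 3 / 2 * D" by (simp only: 1 mult_1_right)
    finally show "\<bar>- 3 / 2 * U t powr (- 3 / 2 - 1) * U' t\<bar> \<le> 3 / 2 * D" .
  qed
  then obtain l where l: "(f \<longlongrightarrow> l) (at_left b)" by blast
  have evD: "\<exists>t1. a \<le> t1 \<and> t1 < b \<and> (\<forall>t. t1 < t \<and> t < b \<longrightarrow> P t)" if "eventually P (at_left b)" for P
  proof -
    have "\<exists>c<b. \<forall>t>c. t < b \<longrightarrow> P t" using that unfolding eventually_at_left[OF ab] .
    then obtain c where c: "c < b" "\<And>t. c < t \<Longrightarrow> t < b \<Longrightarrow> P t" by blast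
    then show ?thesis using ab by (intro exI[of _ "max a c"]) auto
  qed
  have Uf: "U t \<le> B" if t: "a < t" "t < b" and B: "B > 0" "f t \<ge> B powr (- 3 / 2)" for t B
  proof (rule ccontr)
    assume "\<not> U t \<le> B"
    then have "f t < B powr (- 3 / 2)"
      unfolding f_def using B Upos[OF t] by (intro powr_less_mono2_neg) auto
    then show False using B by simp
  qed
  have Uf': "U t \<ge> B" if t: "a < t" "t < b" and B: "B > 0" "f t \<le> B powr (- 3 / 2)" for t B
  proof (rule ccontr)
    assume "\<not> B \<le> U t"
    then have "B powr (- 3 / 2) < f t"
      unfolding f_def using B Upos[OF t] by (intro powr_less_mono2_neg) auto
    then show False using B by simp
  qed
  show ?thesis
  \<comment> \<open>A positive limit of U^(-3/2) keeps U bounded near b; otherwise U eventually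
    exceeds every bound.\<close>
  proof (cases "l > 0")
    case True
    define B where "B = (l / 2) powr (- 2 / 3)"
    have B: "B > 0" "B powr (- 3 / 2) = l / 2" using True by (simp_all add: B_def powr_powr)
    have "eventually (\<lambda>t. f t > l / 2) (at_left b)" using l True by (intro order_tendstoD(1)) auto
    from evD[OF this] obtain t1 where "a \<le> t1" "t1 < b" "\<And>t. t1 < t \<Longrightarrow> t < b \<Longrightarrow> f t > l / 2" by blast
    then show ?thesis using Uf[of _ B] B unfolding U_def by (intro disjI1 exI[of _ B] exI[of _ t1]) (auto simp: less_imp_le)
  next
    case False
    have "\<exists>t1. a \<le> t1 \<and> t1 < b \<and> (\<forall>t. t1 < t \<and> t < b \<longrightarrow> potential m (x t) \<ge> B)" for B
    proof -
      define B' where "B' = max B 1"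
      have B': "B' > 0" "B' \<ge> B" by (auto simp: B'_def)
      have "l < B' powr (- 3 / 2)" using False B' by (smt (verit) powr_gt_zero)
      with l have "eventually (\<lambda>t. f t < B' powr (- 3 / 2)) (at_left b)" by (rule order_tendstoD(2))
      from evD[OF this] obtain t1 where "a \<le> t1" "t1 < b" "\<And>t. t1 < t \<Longrightarrow> t < b \<Longrightarrow> f t < B' powr (- 3 / 2)" by blast
      note t1 = this
      show ?thesis
      proof (intro exI[of _ t1] conjI allI impI)
        show "a \<le> t1" "t1 < b" by (fact t1)+
        fix t assume t: "t1 < t \<and> t < b"
        then have "a < t" "t < b" "f t \<le> B' powr (- 3 / 2)" using t1(1) t1(3)[of t] by auto
        from Uf'[OF this(1,2) B'(1) this(3)] show "B \<le> potential m (x t)" using B'(2) by (simp add: U_def)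
      qed
    qed
    then show ?thesis by blast
  qed
qed

text \<open>Lagrange-Jacobi and the energy give I'' = 2 U + 4 h, so f = I - 2 h (b - t)^2 is convex
  with f'' = 2 U, and it lies above I by a term vanishing at b. If f increases somewhere, I stays
  away from 0 near b. If f never increases and I comes arbitrarily close to 0 at b, convexity puts I
  under a line through 0 at b.\<close>

lemma inertia_endpoint:
  assumes m: "\<And>i. m i > 0" and ab: "a < b"
    and newton: "\<And>t. a < t \<Longrightarrow> t < b \<Longrightarrow> newton_at m x t"
    and en: "\<And>t. a < t \<Longrightarrow> t < b \<Longrightarrow> energy m x t = h" and h: "h < 0"
  shows "(\<exists>c>0. \<exists>t1. a \<le> t1 \<and> t1 < b \<and> (\<forall>t. t1 < t \<and> t < b \<longrightarrow> inertia m (x t) \<ge> c)) \<or>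
    (\<exists>C t1. a \<le> t1 \<and> t1 < b \<and> (\<forall>t. t1 < t \<and> t < b \<longrightarrow> inertia m (x t) \<le> C * (b - t)))"
proof -
  define I where "I = (\<lambda>t. inertia m (x t))"
  define f where "f = (\<lambda>t. I t - 2 * h * (b - t)\<^sup>2)"
  define p where "p = (\<lambda>t. 2 * (\<Sum>i\<in>UNIV. m i * (x t i \<bullet> velocity x t i)) + 4 * h * (b - t))"
  have f': "(f has_real_derivative p t) (at t)" if "a < t" "t < b" for t
  proof -
    have "((\<lambda>t. (b - t)\<^sup>2) has_real_derivative - 2 * (b - t)) (at t)"
      by (auto intro!: derivative_eq_intros)
    from DERIV_diff[OF inertia_derivs(1)[OF m newton[OF that]] DERIV_cmult[OF this, of "2 * h"]]
    show ?thesis unfolding f_def I_def by (rule DERIV_cong) (simp add: p_def algebra_simps)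
  qed
  have p': "(p has_real_derivative 2 * potential m (x t)) (at t)" if t: "a < t" "t < b" for t
  proof -
    have "(p has_real_derivative 2 * ((\<Sum>i\<in>UNIV. m i * (norm (velocity x t i))\<^sup>2) - potential m (x t)) + 4 * h * (0 - 1)) (at t)"
      unfolding p_def
      by (intro DERIV_add DERIV_cmult inertia_derivs(2)[OF m newton[OF t]] DERIV_diff DERIV_const DERIV_ident)
    then show ?thesis using en[OF t] by (simp add: energy_def field_simps)
  qed
  have U: "potential m (x t) > 0" if "a < t" "t < b" for t
    using newton_atD(1)[OF m newton[OF that]] by (rule potential_pos[OF m])
  have pmono: "p s \<le> p t" if "a < s" "s \<le> t" "t < b" for s t
  proof (rule DERIV_nonneg_imp_nondecreasing[OF that(2)])
    fix z assume "s \<le> z" "z \<le> t"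
    then have z: "a < z" "z < b" using that by auto
    show "\<exists>y. (p has_real_derivative y) (at z) \<and> 0 \<le> y"
      using p'[OF z] U[OF z] by (intro exI[of _ "2 * potential m (x z)"]) auto
  qed
  have slope: "f t - f s \<ge> p s * (t - s)" if st: "a < s" "s < t" "t < b" for s t
  proof -
    obtain z where z: "s < z" "z < t" "f t - f s = (t - s) * p z"
      using MVT2[OF st(2), of f p] f' st by auto
    have "p s * (t - s) \<le> p z * (t - s)" using pmono[of s z] z st by (intro mult_right_mono) auto
    then show ?thesis using z(3) by (simp add: mult.commute)
  qed
  have If: "I t \<le> f t" for t using h by (simp add: f_def mult_nonpos_nonneg)
  have Ipos: "I t > 0" if t: "a < t" "t < b" for t
  proof -
    obtain i j k :: 3 where d: "distinct [i, j, k]" by (rule three_labels)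
    have "x t i \<noteq> x t j" using newton_atD(1)[OF m newton[OF t]] d by (auto dest: injD)
    then have "\<exists>l. x t l \<noteq> 0" by metis
    then obtain l where "x t l \<noteq> 0" by blast
    then have "m l * (norm (x t l))\<^sup>2 > 0" using m by simp
    then show ?thesis unfolding I_def inertia_def
      using member_le_sum[of l UNIV "\<lambda>i. m i * (norm (x t i))\<^sup>2"] m by (force simp: less_imp_le)
  qed
  show ?thesis
  proof (cases "\<exists>t0. a < t0 \<and> t0 < b \<and> p t0 > 0")
    case True
    then obtain t0 where t0: "a < t0" "t0 < b" "p t0 > 0" by blast
    have f0: "f t0 > 0" using If[of t0] Ipos[OF t0(1,2)] by simp
    \<comment> \<open>Within distance D of b the correction - 2 h (b - t)^2 is at most half of f
      t0.\<close>
    define D where "D = sqrt (f t0 / (4 * (- h)))"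
    have D: "D > 0" "2 * (- h) * D\<^sup>2 = f t0 / 2" using f0 h by (simp_all add: D_def field_simps)
    have "I t \<ge> f t0 / 2" if t: "max t0 (b - D) < t" "t < b" for t
    proof -
      have "f t \<ge> f t0" using slope[of t0 t] t0 t by (smt (verit) mult_nonneg_nonneg max.strict_boundedE)
      moreover have "(b - t)\<^sup>2 \<le> D\<^sup>2" using t by (intro power_mono) auto
      then have "2 * (- h) * (b - t)\<^sup>2 \<le> 2 * (- h) * D\<^sup>2" using h by (intro mult_left_mono) auto
      ultimately show ?thesis using D(2) by (simp add: f_def)
    qed
    then show ?thesis using f0 t0 D
      by (intro disjI1 exI[of _ "f t0 / 2"] conjI exI[of _ "max t0 (b - D)"]) (auto simp: I_def)
  next
    case False
    then have pneg: "p t \<le> 0" if "a < t" "t < b" for t using that by force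
    show ?thesis
    proof (cases "\<exists>c>0. \<exists>t1. a \<le> t1 \<and> t1 < b \<and> (\<forall>t. t1 < t \<and> t < b \<longrightarrow> I t \<ge> c)")
      case True
      then show ?thesis by (simp add: I_def)
    next
      case no: False
      have small: "\<exists>t. t1 < t \<and> t < b \<and> I t < c" if "c > 0" "a \<le> t1" "t1 < b" for c t1
        using no that by (meson not_le)
      define t0 where "t0 = (a + b) / 2"
      have t0: "a < t0" "t0 < b" using ab by (auto simp: t0_def)
      \<comment> \<open>Were I above this line at t, the tangent to f at t, whose slope is at least
        p t0, would keep f above the gap c up to b. But f becomes smaller than c wherever I < c / 2
        close to b.\<close>
      have "I t \<le> - p t0 * (b - t)" if t: "t0 < t" "t < b" for t
      proof (rule ccontr)
        assume "\<not> I t \<le> - p t0 * (b - t)"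
        then have gap: "f t + p t0 * (b - t) > 0" using If[of t] by simp
        define c where "c = f t + p t0 * (b - t)"
        have c: "c > 0" using gap by (simp add: c_def)
        define D where "D = sqrt (c / (4 * (- h)))"
        have D: "D > 0" "2 * (- h) * D\<^sup>2 = c / 2" using c h by (simp_all add: D_def field_simps)
        have "0 < c / 2" "a \<le> max t (b - D)" "max t (b - D) < b" using c D(1) t t0 by simp_all
        from small[OF this] obtain s where s: "max t (b - D) < s" "s < b" "I s < c / 2" by blast
        have "(b - s)\<^sup>2 \<le> D\<^sup>2" using s by (intro power_mono) auto
        then have "2 * (- h) * (b - s)\<^sup>2 \<le> 2 * (- h) * D\<^sup>2" using h by (intro mult_left_mono) auto
        then have fs: "f s < c" using s(3) D(2) by (simp add: f_def)
        have "f s \<ge> f t + p t * (s - t)" using slope[of t s] s t t0 by simp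
        moreover have "p t * (s - t) \<ge> p t0 * (s - t)"
          using pmono[of t0 t] t t0 s by (intro mult_right_mono) auto
        moreover have "p t0 * (s - t) \<ge> p t0 * (b - t)"
          using pneg[OF t0] s by (intro mult_left_mono_neg) auto
        ultimately show False using fs unfolding c_def by linarith
      qed
      then show ?thesis using t0 by (intro disjI2 exI[of _ "- p t0"] exI[of _ t0]) (auto simp: I_def)
    qed
  qed
qed

section \<open>Continuation at an endpoint without triple collision\<close>

lemma bounded_of_bounded_derivative:
  fixes f f' :: "real \<Rightarrow> real"
  assumes der: "\<And>s. a < s \<Longrightarrow> s < b \<Longrightarrow> (f has_real_derivative f' s) (at s)"
    and bd: "\<And>s. a < s \<Longrightarrow> s < b \<Longrightarrow> \<bar>f' s\<bar> \<le> C" and m: "a < m" "m < b"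
  obtains B where "\<And>t. m < t \<Longrightarrow> t < b \<Longrightarrow> \<bar>f t\<bar> \<le> B"
proof (rule that[of "\<bar>f m\<bar> + C * (b - m)"])
  fix t assume t: "m < t" "t < b"
  obtain z where z: "m < z" "z < t" "f t - f m = (t - m) * f' z"
    using MVT2[OF t(1), of f f'] der m t by auto
  have "\<bar>f' z\<bar> \<le> C" using z m t by (intro bd) auto
  then have "\<bar>(t - m) * f' z\<bar> \<le> (b - m) * C"
    unfolding abs_mult using t by (intro mult_mono) auto
  then show "\<bar>f t\<bar> \<le> \<bar>f m\<bar> + C * (b - m)" using z(3) by (simp add: mult.commute)
qed

lemma norm_plane_le: "norm x \<le> \<bar>x $ 1\<bar> + \<bar>x $ 2\<bar>" for x :: plane
  using norm_le_l1_cart[of x] by (simp add: sum_2)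

lemma bounded_of_bounded_vector_derivative:
  fixes f f' :: "real \<Rightarrow> plane"
  assumes der: "\<And>s. a < s \<Longrightarrow> s < b \<Longrightarrow> (f has_vector_derivative f' s) (at s)"
    and bd: "\<And>s. a < s \<Longrightarrow> s < b \<Longrightarrow> norm (f' s) \<le> C" and m: "a < m" "m < b"
  obtains B where "\<And>t. m < t \<Longrightarrow> t < b \<Longrightarrow> norm (f t) \<le> B"
proof -
  have "\<exists>B. \<forall>t. m < t \<longrightarrow> t < b \<longrightarrow> \<bar>f t $ k\<bar> \<le> B" for k
  proof -
    have d: "((\<lambda>t. f t $ k) has_real_derivative f' s $ k) (at s)" if "a < s" "s < b" for s
      by (rule has_real_derivative_vec_nth[OF der[OF that]])
    have b': "\<bar>f' s $ k\<bar> \<le> C" if "a < s" "s < b" for s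
      using component_le_norm_cart bd[OF that] by (rule order_trans)
    show ?thesis using bounded_of_bounded_derivative[OF d b' m] by metis
  qed
  then obtain B where B: "\<And>k t. m < t \<Longrightarrow> t < b \<Longrightarrow> \<bar>f t $ k\<bar> \<le> B k" by metis
  show ?thesis
  proof (rule that[of "B 1 + B 2"])
    fix t assume "m < t" "t < b"
    from B[OF this, of 1] B[OF this, of 2] norm_plane_le[of "f t"]
    show "norm (f t) \<le> B 1 + B 2" by linarith
  qed
qed

lemma sum_velocity_zero:
  assumes m: "\<And>i. m i > 0" and ab: "a < t" "t < b" and n: "newton_at m x t"
    and com: "\<And>t. a < t \<Longrightarrow> t < b \<Longrightarrow> (\<Sum>i\<in>UNIV. m i *\<^sub>R x t i) = 0"
  shows "(\<Sum>i\<in>UNIV. m i *\<^sub>R velocity x t i) = 0"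
proof -
  have "((\<lambda>t. \<Sum>i\<in>UNIV. m i *\<^sub>R x t i) has_vector_derivative (\<Sum>i\<in>UNIV. m i *\<^sub>R velocity x t i)) (at t)"
    by (intro has_vector_derivative_sum bounded_linear.has_vector_derivative[OF bounded_linear_scaleR_right]
        newton_atD(2)[OF m n])
  moreover have "((\<lambda>t. \<Sum>i\<in>UNIV. m i *\<^sub>R x t i) has_vector_derivative 0) (at t)"
    by (rule has_vector_derivative_transform_within_open[of "\<lambda>_. 0" _ _ "{a<..<b}"]) (use com ab in auto)
  ultimately show ?thesis by (rule vector_derivative_unique_at)
qed

text \<open>Jacobi vectors diagonalize the mass form on configurations with vanishing weighted sum.
  Here it is applied to velocities, to isolate the energy of the pair.\<close>

lemma kinetic_jacobi:
  assumes d: "distinct [i, j, k]" and m: "\<And>i. m i > 0" and com: "(\<Sum>l\<in>UNIV. m l *\<^sub>R v l) = 0"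
  shows "(\<Sum>l\<in>UNIV. m l * (norm (v l))\<^sup>2) = m i * m j / (m i + m j) * (norm (jq i j v))\<^sup>2
    + m k * (m i + m j) / total_mass m * (norm (jR m i j k v))\<^sup>2"
proof -
  define q where "q = jq i j v"
  define R where "R = jR m i j k v"
  have v: "v = jpos m i j k q R" unfolding q_def R_def by (rule jpos_jacobi[OF d m com, symmetric])
  define s and N where "s = m i + m j" and "N = total_mass m"
  have p: "m i > 0" "m j > 0" "m k > 0" using m by auto
  have N: "m k = N - s" by (simp add: N_def s_def total_mass_def sum_three[OF d])
  have s: "s \<noteq> 0" "N \<noteq> 0" "m j = s - m i" using p N by (auto simp: s_def)
  have ji: "j \<noteq> i" "k \<noteq> i" "k \<noteq> j" "i \<noteq> k" "j \<noteq> k" using d by auto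
  have comp: "a * (- (c / N) * r - b / s * z)\<^sup>2 + b * (- (c / N) * r + a / s * z)\<^sup>2 + c * (s / N * r)\<^sup>2
      = a * b / s * z\<^sup>2 + c * s / N * r\<^sup>2" if "b = s - a" "c = N - s" for a b c r z :: real
    unfolding that using s(1,2) by (simp add: field_simps power2_eq_square)
  have nn: "(norm x)\<^sup>2 = (x $ 1)\<^sup>2 + (x $ 2)\<^sup>2" for x :: plane
    unfolding dot_square_norm[symmetric] inner_plane by (simp add: power2_eq_square)
  have "(\<Sum>l\<in>UNIV. m l * (norm (v l))\<^sup>2) = m i * (norm (v i))\<^sup>2 + m j * (norm (v j))\<^sup>2 + m k * (norm (v k))\<^sup>2"
    by (rule sum_three[OF d])
  also have "\<dots> = (m i * (- (m k / N) * R $ 1 - m j / s * q $ 1)\<^sup>2 + m j * (- (m k / N) * R $ 1 + m i / s * q $ 1)\<^sup>2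
        + m k * (s / N * R $ 1)\<^sup>2)
      + (m i * (- (m k / N) * R $ 2 - m j / s * q $ 2)\<^sup>2 + m j * (- (m k / N) * R $ 2 + m i / s * q $ 2)\<^sup>2
        + m k * (s / N * R $ 2)\<^sup>2)"
    using ji unfolding v jpos_def s_def[symmetric] N_def[symmetric] nn by (simp add: distrib_left)
  also have "\<dots> = m i * m j / s * (norm q)\<^sup>2 + m k * s / N * (norm R)\<^sup>2"
    unfolding comp[OF s(3) N] nn by (simp add: algebra_simps)
  finally show ?thesis by (simp add: s_def N_def q_def R_def)
qed

lemma jpos_sums:
  assumes "(\<lambda>n. z ^ n *\<^sub>R cq n) sums q" "(\<lambda>n. z ^ n *\<^sub>R cR n) sums R"
  shows "(\<lambda>n. z ^ n *\<^sub>R jpos m i j k (cq n) (cR n) l) sums jpos m i j k q R l"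
proof -
  have s: "(\<lambda>n. s *\<^sub>R (z ^ n *\<^sub>R c n)) sums (s *\<^sub>R y)" if "(\<lambda>n. z ^ n *\<^sub>R c n) sums y" for s c and y :: plane
    using that by (rule bounded_linear.sums[OF bounded_linear_scaleR_right])
  have sc: "z ^ n *\<^sub>R s *\<^sub>R y = s *\<^sub>R (z ^ n *\<^sub>R y)" for n s and y :: plane by simp
  consider "l = k" | "l \<noteq> k" "l = i" | "l \<noteq> k" "l \<noteq> i" by blast
  then show ?thesis
  proof cases
    case 1
    then show ?thesis using s[OF assms(2)] by (simp only: jpos_def simp_thms if_True sc)
  next
    case 2
    then show ?thesis
      using sums_diff[OF s[OF assms(2)] s[OF assms(1)]]
      by (simp only: jpos_def simp_thms if_True if_False sc scaleR_diff_right)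
  next
    case 3
    then show ?thesis
      using sums_add[OF s[OF assms(2)] s[OF assms(1)]]
      by (simp only: jpos_def if_False sc scaleR_add_right)
  qed
qed

text \<open>With the third body at distance at least \<delta>, R'' is bounded, hence so are V and R.
  The energy of the pair is then bounded as well, being h minus bounded terms, and
  \<open>jacobi_extension\<close> applies. Whether b is regular or a collision is decided only
  afterwards, by whether q' vanishes at b.\<close>

lemma extension_of_labels:
  assumes m: "\<And>i. m i > 0" and d: "distinct [i, j, k]" and ab: "a < b"
    and newton: "\<And>t. a < t \<Longrightarrow> t < b \<Longrightarrow> newton_at m x t"
    and com: "\<And>t. a < t \<Longrightarrow> t < b \<Longrightarrow> (\<Sum>i\<in>UNIV. m i *\<^sub>R x t i) = 0"
    and en: "\<And>t. a < t \<Longrightarrow> t < b \<Longrightarrow> energy m x t = h"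
    and \<delta>: "\<delta> > 0"
    and bq: "\<And>t. a < t \<Longrightarrow> t < b \<Longrightarrow> dist (x t i) (x t j) \<le> C"
    and bi: "\<And>t. a < t \<Longrightarrow> t < b \<Longrightarrow> dist (x t i) (x t k) \<ge> \<delta>"
    and bj: "\<And>t. a < t \<Longrightarrow> t < b \<Longrightarrow> dist (x t j) (x t k) \<ge> \<delta>"
  shows "\<exists>e>0. \<exists>x'. (\<forall>t. t < b \<longrightarrow> x' t = x t) \<and> (\<forall>t. b \<le> t \<and> t < b + e \<longrightarrow>
    (\<Sum>i\<in>UNIV. m i *\<^sub>R x' t i) = 0 \<and> (newton_at m x' t \<or> regularized_binary_collision_at x' t))"
proof -
  define q w R V where "q = (\<lambda>t. jq i j (x t))" and "w = (\<lambda>t. jq i j (velocity x t))"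
    and "R = (\<lambda>t. jR m i j k (x t))" and "V = (\<lambda>t. jR m i j k (velocity x t))"
  define s N where "s = m i + m j" and "N = total_mass m"
  have p: "m i > 0" "m j > 0" "m k > 0" using m by auto
  have sN: "s > 0" "N > 0" using p by (simp_all add: s_def N_def total_mass_def sum_three[OF d])
  have jac: "jacobi_newton_at m i j k q w R V t" if "a < t" "t < b" for t
    unfolding q_def w_def R_def V_def by (rule newton_imp_jacobi[OF d m newton[OF that]])
  have di: "R t + (m j / s) *\<^sub>R q t = x t k - x t i" "R t + (- (m i / s)) *\<^sub>R q t = x t k - x t j" for t
    using jacobi_third_body[of m i j k "x t"] sN by (simp_all add: s_def q_def R_def)
  have ni: "norm (R t + (m j / s) *\<^sub>R q t) \<ge> \<delta>" "norm (R t + (- (m i / s)) *\<^sub>R q t) \<ge> \<delta>"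
    if "a < t" "t < b" for t
    using bi[OF that] bj[OF that] unfolding di by (simp_all add: dist_norm norm_minus_commute)
  have J: "(R has_vector_derivative V t) (at t)"
    "(V has_vector_derivative - ((N * m i / s) *\<^sub>R grav (R t + (m j / s) *\<^sub>R q t)
      + (N * m j / s) *\<^sub>R grav (R t + (- (m i / s)) *\<^sub>R q t))) (at t)" if "a < t" "t < b" for t
    using jac[OF that] unfolding jacobi_newton_at_def jacobi_motion_at_def s_def N_def by blast+
  define m1 where "m1 = (a + b) / 2"
  have m1: "a < m1" "m1 < b" using ab by (auto simp: m1_def)
  define m2 where "m2 = (m1 + b) / 2"
  have m2: "m1 < m2" "m2 < b" using m1 by (auto simp: m2_def)
  have g: "norm (grav y) \<le> 1 / \<delta>\<^sup>2" if "norm y \<ge> \<delta>" for y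
  proof -
    have "norm y > 0" using that \<delta> by linarith
    then show ?thesis unfolding norm_grav using that \<delta> by (intro divide_left_mono power_mono) auto
  qed
  have V'b: "norm (- ((N * m i / s) *\<^sub>R grav (R t + (m j / s) *\<^sub>R q t)
      + (N * m j / s) *\<^sub>R grav (R t + (- (m i / s)) *\<^sub>R q t)))
      \<le> N * m i / s * (1 / \<delta>\<^sup>2) + N * m j / s * (1 / \<delta>\<^sup>2)" if t: "a < t" "t < b" for t
    unfolding norm_minus_cancel
  proof (rule norm_triangle_le, rule add_mono)
    show "norm ((N * m i / s) *\<^sub>R grav (R t + (m j / s) *\<^sub>R q t)) \<le> N * m i / s * (1 / \<delta>\<^sup>2)"
      using mult_left_mono[OF g[OF ni(1)[OF t]], of "N * m i / s"] sN p by simp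
    show "norm ((N * m j / s) *\<^sub>R grav (R t + (- (m i / s)) *\<^sub>R q t)) \<le> N * m j / s * (1 / \<delta>\<^sup>2)"
      using mult_left_mono[OF g[OF ni(2)[OF t]], of "N * m j / s"] sN p by simp
  qed
  obtain B1 where B1: "\<And>t. m1 < t \<Longrightarrow> t < b \<Longrightarrow> norm (V t) \<le> B1"
    using bounded_of_bounded_vector_derivative[OF J(2) V'b m1] by metis
  have J1: "(R has_vector_derivative V t) (at t)" if "m1 < t" "t < b" for t using J(1) that m1 by simp
  obtain B2 where B2: "\<And>t. m2 < t \<Longrightarrow> t < b \<Longrightarrow> norm (R t) \<le> B2"
    using bounded_of_bounded_vector_derivative[OF J1 B1 m2] by metis
  \<comment> \<open>The energy of the pair times m i m j / s is h minus the kinetic energy of R plus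
    the two potential terms of the third body; each is bounded separately.\<close>
  define B3 where "B3 = s / (m i * m j) * (\<bar>h\<bar> + m k * s / (2 * N) * B1\<^sup>2 + (m i * m k + m j * m k) / \<delta>)"
  have E: "\<bar>(w t \<bullet> w t) / 2 - s / norm (q t)\<bar> \<le> B3" if t: "m1 < t" "t < b" for t
  proof -
    have t': "a < t" using t m1 by simp
    define E where "E = (w t \<bullet> w t) / 2 - s / norm (q t)"
    have K: "(\<Sum>l\<in>UNIV. m l * (norm (velocity x t l))\<^sup>2) = m i * m j / s * (norm (w t))\<^sup>2 + m k * s / N * (norm (V t))\<^sup>2"
      using kinetic_jacobi[OF d m sum_velocity_zero[OF m t' t(2) newton[OF t' t(2)] com]]
      by (simp add: s_def N_def w_def V_def)
    have U: "potential m (x t) = m i * m j / norm (q t) + m i * m k / dist (x t i) (x t k) + m j * m k / dist (x t j) (x t k)"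
      unfolding potential_eq[OF d] by (simp add: q_def jq_def dist_norm norm_minus_commute)
    have gen: "\<bar>A\<bar> \<le> \<bar>h\<bar> + KB + (D1 + D2)"
      if "h = A + K - (d1 + d2)" "K \<le> KB" "0 \<le> K" "d1 \<le> D1" "d2 \<le> D2" "0 \<le> d1" "0 \<le> d2"
      for A K KB d1 d2 D1 D2 :: real using that by linarith
    have "h = m i * m j / s * E + m k * s / (2 * N) * (norm (V t))\<^sup>2
        - (m i * m k / dist (x t i) (x t k) + m j * m k / dist (x t j) (x t k))"
      using en[OF t' t(2)] sN unfolding energy_def K U E_def
      by (simp add: dot_square_norm right_diff_distrib add_divide_distrib)
    moreover have "m k * s / (2 * N) * (norm (V t))\<^sup>2 \<le> m k * s / (2 * N) * B1\<^sup>2"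
      using B1[OF t] sN p by (intro mult_left_mono power_mono) auto
    moreover have "0 \<le> m k * s / (2 * N) * (norm (V t))\<^sup>2" using sN p by simp
    moreover have "m i * m k / dist (x t i) (x t k) \<le> m i * m k / \<delta>" "m j * m k / dist (x t j) (x t k) \<le> m j * m k / \<delta>"
      using bi[OF t' t(2)] bj[OF t' t(2)] \<delta> p by (auto intro!: frac_le simp: less_imp_le)
    moreover have "0 \<le> m i * m k / dist (x t i) (x t k)" "0 \<le> m j * m k / dist (x t j) (x t k)" using p by (simp_all add: less_imp_le)
    ultimately have "\<bar>m i * m j / s * E\<bar> \<le> \<bar>h\<bar> + m k * s / (2 * N) * B1\<^sup>2 + (m i * m k / \<delta> + m j * m k / \<delta>)"
      by (rule gen)
    then have "s / (m i * m j) * \<bar>m i * m j / s * E\<bar> \<le> B3"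
      unfolding B3_def add_divide_distrib using sN p by (intro mult_left_mono) auto
    moreover have "s / (m i * m j) * \<bar>m i * m j / s * E\<bar> = \<bar>E\<bar>" using sN p by (simp add: abs_mult)
    ultimately show ?thesis by (simp add: E_def)
  qed
  define D where "D = 1 + \<bar>C\<bar> + \<bar>B1\<bar> + \<bar>B2\<bar> + \<bar>B3\<bar>"
  have D: "D > 0" "C \<le> D" "B1 \<le> D" "B2 \<le> D" "B3 \<le> D" unfolding D_def by linarith+
  have C1: "jacobi_motion_at s (m k) (N * m i / s) (N * m j / s) (m j / s) (- (m i / s)) q w R V t"
    if "m2 < t" "t < b" for t
    using jac[of t] that m1 m2 unfolding jacobi_newton_at_def s_def N_def by simp
  have C2: "norm (q t) \<le> D" if "m2 < t" "t < b" for t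
    using bq[of t] that m1 m2 D by (simp add: q_def jq_def dist_norm norm_minus_commute)
  have C3: "norm (R t) \<le> D" if "m2 < t" "t < b" for t using order_trans[OF B2[OF that] D(4)] .
  have C4: "norm (V t) \<le> D" if "m2 < t" "t < b" for t using B1[of t] that m2 D by simp
  have C5: "\<bar>(w t \<bullet> w t) / 2 - s / norm (q t)\<bar> \<le> D" if "m2 < t" "t < b" for t
    using E[of t] that m2 D(5) by linarith
  have C6: "norm (R t + (m j / s) *\<^sub>R q t) \<ge> \<delta>" "norm (R t + (- (m i / s)) *\<^sub>R q t) \<ge> \<delta>" if "m2 < t" "t < b" for t
    using ni[of t] that m1 m2 by simp_all
  obtain e and q' w' R' V' :: "real \<Rightarrow> plane" where e: "e > 0" "e \<le> b - m2"
    "\<And>t. b - e < t \<Longrightarrow> t < b \<Longrightarrow> q' t = q t \<and> R' t = R t"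
    "\<And>t. \<bar>t - b\<bar> < e \<Longrightarrow> q' t \<noteq> 0 \<Longrightarrow>
      jacobi_motion_at s (m k) (N * m i / s) (N * m j / s) (m j / s) (- (m i / s)) q' w' R' V' t"
    "\<And>t. \<bar>t - b\<bar> < e \<Longrightarrow> t \<noteq> b \<Longrightarrow> q' t \<noteq> 0"
    "\<And>t. \<bar>t - b\<bar> < e \<Longrightarrow> R' t + (m j / s) *\<^sub>R q' t \<noteq> 0 \<and> R' t + (- (m i / s)) *\<^sub>R q' t \<noteq> 0"
    "q' b = 0 \<Longrightarrow> \<exists>cq cR. \<forall>t. \<bar>t - b\<bar> < e \<longrightarrow>
      (\<lambda>n. root 3 (t - b) ^ n *\<^sub>R cq n) sums q' t \<and> (\<lambda>n. root 3 (t - b) ^ n *\<^sub>R cR n) sums R' t"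
    by (rule jacobi_extension[OF sN(1) m2(2) D(1) \<delta> C1 C2 C3 C4 C5 C6]) ((assumption | rule that)+)
  define y where "y = (\<lambda>t. jpos m i j k (q' t) (R' t))"
  \<comment> \<open>Glued at b, but equal to y on a full neighbourhood of b because y agrees with x
    just before b; no matching of derivatives is needed.\<close>
  define x' where "x' = (\<lambda>t. if t < b then x t else y t)"
  have x'y: "x' t = y t" if t: "\<bar>t - b\<bar> < e" for t
  proof (cases "t < b")
    case True
    then have "b - e < t" "a < t" using t e(2) m1 m2 by auto
    then have "y t = jpos m i j k (q t) (R t)" using e(3)[of t] True by (simp add: y_def)
    also have "\<dots> = x t" unfolding q_def R_def using com[OF \<open>a < t\<close> True] by (rule jpos_jacobi[OF d m])
    finally show ?thesis using True by (simp add: x'_def)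
  qed (simp add: x'_def)
  have ball: "\<forall>\<^sub>F u in nhds t. \<bar>u - b\<bar> < e" if "\<bar>t - b\<bar> < e" for t
    using eventually_nhds_in_open[of "ball b e" t] that by (simp add: dist_real_def abs_minus_commute)
  have new: "newton_at m x' t" if t: "\<bar>t - b\<bar> < e" and nz: "q' t \<noteq> 0" for t
  proof -
    have "\<forall>\<^sub>F u in nhds t. \<bar>u - b\<bar> < e \<and> q' u \<noteq> 0"
    proof (cases "t = b")
      case True
      from ball[OF t] show ?thesis
        by eventually_elim (use e(5) nz True in blast)
    next
      case False
      then have "\<forall>\<^sub>F u in nhds t. u \<noteq> b" by (rule t1_space_nhds)
      with ball[OF t] show ?thesis by eventually_elim (use e(5) in blast)
    qed
    then have "\<forall>\<^sub>F u in nhds t. jacobi_newton_at m i j k q' w' R' V' u"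
      unfolding jacobi_newton_at_def s_def[symmetric] N_def[symmetric]
      by eventually_elim (use e(4) in blast)
    then have "newton_at m y t" unfolding y_def by (rule jacobi_imp_newton[OF d m])
    moreover have "\<forall>\<^sub>F u in nhds t. x' u = y u" using ball[OF t] by eventually_elim (rule x'y)
    ultimately show ?thesis by (rule newton_at_cong)
  qed
  have reg: "regularized_binary_collision_at x' b" if q0: "q' b = 0"
    unfolding regularized_binary_collision_at_def
  proof (intro conjI allI)
    have b: "\<bar>b - b\<bar> < e" using e(1) by simp
    have yb: "jq i j (y b) = 0" "jR m i j k (y b) = R' b"
      unfolding y_def q0 by (rule jpos_coordinates[OF d m])+
    have R0: "R' b \<noteq> 0" using e(6)[OF b] q0 by simp
    have eq: "y b j = y b i" using yb(1) by (simp add: jq_def)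
    have "jR m i j k (y b) + (m j / s) *\<^sub>R jq i j (y b) = y b k - y b i"
      using jacobi_third_body(1)[of m i j k "y b"] sN by (simp add: s_def)
    then have ne: "y b k \<noteq> y b i" using yb R0 by auto
    have "range (x' b) = {y b i, y b k}"
      unfolding x'y[OF b] using UNIV_three[OF d] eq by auto
    then show "card (range (x' b)) = 2" using ne by simp
    have ev: "\<forall>\<^sub>F t in at b. \<bar>t - b\<bar> < e \<and> t \<noteq> b"
      using ball[OF b] unfolding eventually_at_filter by eventually_elim simp
    then show "\<forall>\<^sub>F t in at b. inj (x' t)"
    proof eventually_elim
      case (elim t)
      then have "newton_at m x' t" by (intro new e(5)) auto
      then show ?case by (simp add: newton_at_def)
    qed
    fix l
    obtain cq cR where c: "\<And>t. \<bar>t - b\<bar> < e \<Longrightarrow>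
      (\<lambda>n. root 3 (t - b) ^ n *\<^sub>R cq n) sums q' t \<and> (\<lambda>n. root 3 (t - b) ^ n *\<^sub>R cR n) sums R' t"
      using e(7)[OF q0] by blast
    from ball[OF b] have "\<forall>\<^sub>F t in nhds b. (\<lambda>n. root 3 (t - b) ^ n *\<^sub>R jpos m i j k (cq n) (cR n) l) sums x' t l"
    proof eventually_elim
      case (elim t)
      then show ?case unfolding x'y[OF elim] y_def using c[OF elim] by (intro jpos_sums) auto
    qed
    then show "\<exists>c. \<forall>\<^sub>F t in nhds b. (\<lambda>n. root 3 (t - b) ^ n *\<^sub>R c n) sums x' t l"
      by (rule exI[of _ "\<lambda>n. jpos m i j k (cq n) (cR n) l"])
  qed
  show ?thesis
  proof (intro exI[of _ e] conjI exI[of _ x'] allI impI)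
    show "e > 0" by fact
    show "x' t = x t" if "t < b" for t using that by (simp add: x'_def)
    fix t assume t: "b \<le> t \<and> t < b + e"
    then have tb: "\<bar>t - b\<bar> < e" by auto
    show "(\<Sum>i\<in>UNIV. m i *\<^sub>R x' t i) = 0"
      unfolding x'y[OF tb] y_def by (rule jpos_coordinates(3)[OF d m])
    show "newton_at m x' t \<or> regularized_binary_collision_at x' t"
      using new[OF tb] e(5)[OF tb] reg by blast
  qed
qed

text \<open>With the center of mass at 0, total mass times x i is the weighted sum of the
  differences x i - x j, so small distances force small positions.\<close>

lemma inertia_le_of_close:
  assumes m: "\<And>i. m i > 0" and com: "(\<Sum>i\<in>UNIV. m i *\<^sub>R x i) = 0"
    and close: "\<And>i j. dist (x i) (x j) \<le> e"
  shows "inertia m x \<le> total_mass m * e\<^sup>2"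
proof -
  have M: "total_mass m > 0" unfolding total_mass_def using m by (intro sum_pos) auto
  have "norm (x i) \<le> e" for i
  proof -
    have "total_mass m *\<^sub>R x i = (\<Sum>j\<in>UNIV. m j *\<^sub>R (x i - x j))"
      using com by (simp add: total_mass_def scaleR_sum_left scaleR_diff_right sum_subtractf)
    then have "total_mass m * norm (x i) = norm (\<Sum>j\<in>UNIV. m j *\<^sub>R (x i - x j))"
      using M by (metis abs_of_pos norm_scaleR)
    also have "\<dots> \<le> (\<Sum>j\<in>UNIV. norm (m j *\<^sub>R (x i - x j)))" by (rule norm_sum)
    also have "\<dots> \<le> (\<Sum>j\<in>UNIV. m j * e)"
    proof (rule sum_mono)
      fix j show "norm (m j *\<^sub>R (x i - x j)) \<le> m j * e"
        using close[of i j] m[of j] by (simp add: dist_norm)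
    qed
    also have "\<dots> = total_mass m * e" by (simp add: total_mass_def sum_distrib_right)
    finally show ?thesis using M by simp
  qed
  then have "m i * (norm (x i))\<^sup>2 \<le> m i * e\<^sup>2" for i
    using m[of i] by (intro mult_left_mono power_mono) auto
  then have "inertia m x \<le> (\<Sum>i\<in>UNIV. m i * e\<^sup>2)" unfolding inertia_def by (intro sum_mono) auto
  then show ?thesis by (simp add: total_mass_def sum_distrib_right)
qed

text \<open>If U is bounded, all distances are bounded below and any labelling will do. If U tends
  to infinity, some pair is close at each time. Inertia bounded below permits only one close pair at
  a time, and continuity forbids a change of pair.\<close>

lemma endpoint_labels:
  assumes m: "\<And>i. m i > 0" and h: "h < 0" and ab: "a < b"
    and newton: "\<And>t. a < t \<Longrightarrow> t < b \<Longrightarrow> newton_at m x t"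
    and com: "\<And>t. a < t \<Longrightarrow> t < b \<Longrightarrow> (\<Sum>i\<in>UNIV. m i *\<^sub>R x t i) = 0"
    and en: "\<And>t. a < t \<Longrightarrow> t < b \<Longrightarrow> energy m x t = h"
    and c: "c > 0" and In: "\<And>t. a < t \<Longrightarrow> t < b \<Longrightarrow> inertia m (x t) \<ge> c"
  obtains i j k :: 3 and t1 C \<delta> :: real
  where "distinct [i, j, k]" "a \<le> t1" "t1 < b" "\<delta> > 0"
    "\<And>t. t1 < t \<Longrightarrow> t < b \<Longrightarrow> dist (x t i) (x t j) \<le> C"
    "\<And>t. t1 < t \<Longrightarrow> t < b \<Longrightarrow> dist (x t i) (x t k) \<ge> \<delta>"
    "\<And>t. t1 < t \<Longrightarrow> t < b \<Longrightarrow> dist (x t j) (x t k) \<ge> \<delta>"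
proof -
  consider B t1 where "a \<le> t1" "t1 < b" "\<And>t. t1 < t \<Longrightarrow> t < b \<Longrightarrow> potential m (x t) \<le> B"
    | "\<And>B. \<exists>t1. a \<le> t1 \<and> t1 < b \<and> (\<forall>t. t1 < t \<and> t < b \<longrightarrow> potential m (x t) \<ge> B)"
    using potential_endpoint[OF m h ab newton en] by blast
  then show ?thesis
  proof cases
    case (1 B t1)
    obtain m0 where m0: "m0 > 0" "\<And>i. m0 \<le> m i" using mass_lower_bound[of m, OF m] by blast
    obtain i j k :: 3 where d: "distinct [i, j, k]" by (rule three_labels)
    define t2 where "t2 = (t1 + b) / 2"
    have t2: "t1 < t2" "t2 < b" using 1 by (auto simp: t2_def)
    have "inj (x t2)" using newton_atD(1)[OF m newton[of t2]] t2 1(1) by simp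
    from less_le_trans[OF potential_pos[of m, OF m this] 1(3)[OF t2]] have Bpos: "B > 0" .
    have far: "dist (x t l) (x t l') \<ge> m0 * m0 / B" if t: "t1 < t" "t < b" and l: "l \<noteq> l'" for t l l'
    proof -
      have "inj (x t)" using newton_atD(1)[OF m newton[of t]] t 1(1) by simp
      then have r: "dist (x t l) (x t l') > 0" using l by (auto dest: injD)
      have "m0 * m0 \<le> m l * m l'" using m0 by (intro mult_mono) (auto intro: less_imp_le order_trans)
      also have "m l * m l' \<le> B * dist (x t l) (x t l')"
        using order_trans[OF potential_pair_le[of m l l' "x t", OF m l] 1(3)[OF t]] r by (simp add: pos_divide_le_eq)
      finally show ?thesis using Bpos by (simp add: pos_divide_le_eq mult.commute)
    qed
    have q': "((\<lambda>t. x t j - x t i) has_vector_derivative velocity x t j - velocity x t i) (at t)" if "t1 < t" "t < b" for t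
      using that 1(1) by (intro has_vector_derivative_diff newton_atD(2)[OF m newton]) auto
    have "norm (velocity x t j - velocity x t i) \<le> 2 * sqrt (2 * B / m0)" if t: "t1 < t" "t < b" for t
    proof -
      have ta: "a < t" using t 1(1) by simp
      have "norm (velocity x t l) \<le> sqrt (2 * B / m0)" for l
      proof -
        have "sqrt (2 * potential m (x t) / m0) \<le> sqrt (2 * B / m0)"
          using 1(3)[OF t] m0(1) by (simp add: divide_right_mono)
        then show ?thesis using speed_bound[OF m en[OF ta t(2)] h m0, of l] by linarith
      qed
      from add_mono[OF this[of j] this[of i]] norm_triangle_ineq4[of "velocity x t j" "velocity x t i"]
      show ?thesis by linarith
    qed
    from bounded_of_bounded_vector_derivative[OF q' this t2]
    obtain C where C: "\<And>t. t2 < t \<Longrightarrow> t < b \<Longrightarrow> norm (x t j - x t i) \<le> C" by metis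
    show ?thesis
    proof (rule that[OF d])
      show "a \<le> t2" "t2 < b" using t2 1(1) by auto
      show "m0 * m0 / B > 0" using m0 Bpos by simp
      fix t assume t: "t2 < t" "t < b"
      show "dist (x t i) (x t j) \<le> C" using C[OF t] by (simp add: dist_norm norm_minus_commute)
      show "dist (x t i) (x t k) \<ge> m0 * m0 / B" "dist (x t j) (x t k) \<ge> m0 * m0 / B"
        using d t t2 by (auto intro!: far)
    qed
  next
    case 2
    have M: "total_mass m > 0" unfolding total_mass_def using m by (intro sum_pos) auto
    \<comment> \<open>If two pairs were within e, all distances would be at most 2 e and the inertia
      at most c / 2, below its lower bound c.\<close>
    define e where "e = sqrt (c / (8 * total_mass m))"
    have e: "e > 0" "total_mass m * (2 * e)\<^sup>2 = c / 2"
      using c M by (simp_all add: e_def power_mult_distrib field_simps)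
    \<comment> \<open>Exceeds the potential of any configuration whose distances are all at least
      e.\<close>
    define P where "P = (\<Sum>i\<in>UNIV. \<Sum>j\<in>UNIV. m i * m j) / e + 1"
    obtain t1 where t1: "a \<le> t1" "t1 < b" "\<And>t. t1 < t \<Longrightarrow> t < b \<Longrightarrow> potential m (x t) \<ge> P" using 2[of P] by blast
    have close: "\<exists>l l'. l \<noteq> l' \<and> dist (x t l) (x t l') < e" if t: "t1 < t" "t < b" for t
    proof (rule ccontr)
      assume "\<not> ?thesis"
      then have far: "dist (x t l) (x t l') \<ge> e" if "l \<noteq> l'" for l l' using that by force
      obtain i j k :: 3 where d: "distinct [i, j, k]" by (rule three_labels)
      have pr: "m l * m l' / dist (x t l) (x t l') \<le> m l * m l' / e" if "l \<noteq> l'" for l l'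
        using far[OF that] e(1) m[of l] m[of l'] by (intro frac_le) auto
      have nn: "0 \<le> m l * m l' / e" for l l' using m[of l] m[of l'] e(1) by simp
      have "potential m (x t) \<le> m i * m j / e + m i * m k / e + m j * m k / e"
        unfolding potential_eq[OF d] using d by (intro add_mono pr) auto
      also have "\<dots> \<le> (\<Sum>i\<in>UNIV. \<Sum>j\<in>UNIV. m i * m j) / e"
        unfolding sum_three[OF d] add_divide_distrib
        using nn[of i i] nn[of j i] nn[of j j] nn[of k i] nn[of k j] nn[of k k] by linarith
      also have "\<dots> < P" by (simp add: P_def)
      finally show False using t1(3)[OF t] by simp
    qed
    have excl: "dist (x t l) (x t n) > e" if t: "t1 < t" "t < b" and l: "l \<noteq> l'" "n \<noteq> l" "n \<noteq> l'"
      and dl: "dist (x t l) (x t l') \<le> e" for t l l' n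
    proof (rule ccontr)
      assume "\<not> ?thesis"
      then have dn: "dist (x t l) (x t n) \<le> e" by simp
      have d: "distinct [l, l', n]" using l by auto
      have "dist (x t l') (x t n) \<le> 2 * e"
        using dist_triangle[of "x t l'" "x t n" "x t l"] dl dn by (simp add: dist_commute)
      then have "dist (x t i) (x t j) \<le> 2 * e" for i j
      proof -
        have "i \<in> {l, l', n}" "j \<in> {l, l', n}" using UNIV_three[OF d] by auto
        then show ?thesis using dl dn e(1) \<open>dist (x t l') (x t n) \<le> 2 * e\<close> by (auto simp: dist_commute)
      qed
      moreover have "a < t" using t t1(1) by simp
      ultimately have "inertia m (x t) \<le> c / 2"
        unfolding e(2)[symmetric] by (intro inertia_le_of_close m com t(2))
      then show False using In[of t] t t1(1) c by simp
    qed
    define t3 where "t3 = (t1 + b) / 2"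
    have t3: "t1 < t3" "t3 < b" using t1 by (auto simp: t3_def)
    obtain i j where ij: "i \<noteq> j" "dist (x t3 i) (x t3 j) < e" using close[OF t3] by blast
    obtain k where d: "distinct [i, j, k]" using distinct_third[OF ij(1)] by blast
    \<comment> \<open>Otherwise the distance of i and j equals e at some time; then
      \<open>excl\<close> keeps the other two distances above e, so no pair is closer than e,
      against \<open>close\<close>.\<close>
    have stay: "dist (x t i) (x t j) < e" if t: "t3 \<le> t" "t < b" for t
    proof (rule ccontr)
      assume "\<not> dist (x t i) (x t j) < e"
      moreover have "continuous_on {t3..t} (\<lambda>t. x t l)" for l
      proof (intro continuous_at_imp_continuous_on ballI)
        fix s assume "s \<in> {t3..t}"
        then have "newton_at m x s" using t t3 t1 by (intro newton) auto
        from newton_atD(2)[OF m this] show "isCont (\<lambda>t. x t l) s"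
          by (rule has_vector_derivative_continuous)
      qed
      then have "continuous_on {t3..t} (\<lambda>t. dist (x t i) (x t j))" by (intro continuous_on_dist)
      ultimately obtain s where s: "t3 \<le> s" "s \<le> t" "dist (x s i) (x s j) = e"
        using IVT'[of "\<lambda>t. dist (x t i) (x t j)" t3 e t] ij(2) t(1) by (auto simp: not_less less_imp_le)
      then have s': "t1 < s" "s < b" using t t3 by auto
      have e1: "dist (x s i) (x s k) > e" using d s(3) by (intro excl[OF s', of i j k]) auto
      have e2: "dist (x s j) (x s k) > e" using d s(3) by (intro excl[OF s', of j i k]) (auto simp: dist_commute)
      obtain l l' where ll: "l \<noteq> l'" "dist (x s l) (x s l') < e" using close[OF s'] by blast
      have "l \<in> {i, j, k}" "l' \<in> {i, j, k}" using UNIV_three[OF d] by auto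
      then show False using ll s(3) e1 e2 by (auto simp: dist_commute)
    qed
    show ?thesis
    proof (rule that[OF d])
      show "a \<le> t3" "t3 < b" "e > 0" using t1 t3 e by auto
      fix t assume t: "t3 < t" "t < b"
      then have t': "t1 < t" using t3 by simp
      have s: "dist (x t i) (x t j) < e" using t by (intro stay) auto
      then show "dist (x t i) (x t j) \<le> e" by simp
      show "e \<le> dist (x t i) (x t k)" using excl[OF t' t(2), of i j k] d s by auto
      show "e \<le> dist (x t j) (x t k)" using excl[OF t' t(2), of j i k] d s by (auto simp: dist_commute)
    qed
  qed
qed

lemma endpoint_dichotomy:
  assumes m: "\<And>i. m i > 0" and h: "h < 0" and ab: "a < b"
    and newton: "\<And>t. a < t \<Longrightarrow> t < b \<Longrightarrow> newton_at m x t"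
    and com: "\<And>t. a < t \<Longrightarrow> t < b \<Longrightarrow> (\<Sum>i\<in>UNIV. m i *\<^sub>R x t i) = 0"
    and en: "\<And>t. a < t \<Longrightarrow> t < b \<Longrightarrow> energy m x t = h"
  shows "(\<exists>C t1. a \<le> t1 \<and> t1 < b \<and> (\<forall>t. t1 < t \<and> t < b \<longrightarrow> inertia m (x t) \<le> C * (b - t))) \<or>
    (\<exists>e>0. \<exists>x'. (\<forall>t. t < b \<longrightarrow> x' t = x t) \<and> (\<forall>t. b \<le> t \<and> t < b + e \<longrightarrow>
      (\<Sum>i\<in>UNIV. m i *\<^sub>R x' t i) = 0 \<and> (newton_at m x' t \<or> regularized_binary_collision_at x' t)))"
proof -
  consider c t1 where "c > 0" "a \<le> t1" "t1 < b" "\<And>t. t1 < t \<Longrightarrow> t < b \<Longrightarrow> inertia m (x t) \<ge> c"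
    | "\<exists>C t1. a \<le> t1 \<and> t1 < b \<and> (\<forall>t. t1 < t \<and> t < b \<longrightarrow> inertia m (x t) \<le> C * (b - t))"
    using inertia_endpoint[OF m ab newton en h] by blast
  then show ?thesis
  proof cases
    case (1 c t1)
    have N1: "newton_at m x t" "(\<Sum>i\<in>UNIV. m i *\<^sub>R x t i) = 0" "energy m x t = h" if "t1 < t" "t < b" for t
      using that 1(2) by (auto intro: newton com en)
    obtain i j k :: 3 and t2 C \<delta> :: real where l: "distinct [i, j, k]" "t1 \<le> t2" "t2 < b" "\<delta> > 0"
      "\<And>t. t2 < t \<Longrightarrow> t < b \<Longrightarrow> dist (x t i) (x t j) \<le> C"
      "\<And>t. t2 < t \<Longrightarrow> t < b \<Longrightarrow> dist (x t i) (x t k) \<ge> \<delta>"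
      "\<And>t. t2 < t \<Longrightarrow> t < b \<Longrightarrow> dist (x t j) (x t k) \<ge> \<delta>"
      by (rule endpoint_labels[OF m h 1(3) N1 1(1,4)]) ((assumption | rule that)+)
    have N2: "newton_at m x t" "(\<Sum>i\<in>UNIV. m i *\<^sub>R x t i) = 0" "energy m x t = h" if "t2 < t" "t < b" for t
      using that l(2) by (auto intro: N1)
    show ?thesis using extension_of_labels[OF m l(1,3) N2 l(4-7)] by blast
  next
    case 2
    then show ?thesis by blast
  qed
qed

section \<open>Area and shape of the triangle\<close>

text \<open>A symmetric 2x2 form with zero trace against a positive semidefinite form with c11 > 0
  cannot be definite; the conclusion says that the determinant of the form with diagonal A, D and
  off-diagonal S / 2 is nonpositive. The proof completes a square.\<close>

lemma real_quadratic_trace: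
  fixes A D S :: real
  assumes "c11 > 0" "c12\<^sup>2 \<le> c11 * c22" "c11 * A + c12 * S + c22 * D = 0"
  shows "4 * A * D \<le> S\<^sup>2"
proof -
  have "c11 * (c11 * (S\<^sup>2 - 4 * A * D)) = (c11 * S + 2 * c12 * D)\<^sup>2 + 4 * (c11 * c22 - c12\<^sup>2) * D\<^sup>2"
  proof -
    have cA: "c11 * A = - c12 * S - c22 * D" using assms(3) by simp
    have "c11 * (c11 * (S\<^sup>2 - 4 * A * D)) = c11 * (c11 * S\<^sup>2 - 4 * D * (c11 * A))" by (simp add: algebra_simps)
    also have "\<dots> = (c11 * S + 2 * c12 * D)\<^sup>2 + 4 * (c11 * c22 - c12\<^sup>2) * D\<^sup>2"
      unfolding cA by (simp add: algebra_simps power2_eq_square)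
    finally show ?thesis .
  qed
  also have "\<dots> \<ge> 0" using assms(2) by simp
  finally have "c11 * (c11 * (S\<^sup>2 - 4 * A * D)) \<ge> 0" .
  then show ?thesis using assms(1) by (simp add: zero_le_mult_iff)
qed

lemma wedge_pluecker:
  "wedge e1 e2 * wedge f1 f2 = wedge e1 f1 * wedge e2 f2 - wedge e1 f2 * wedge e2 f1"
  by (simp add: wedge_def algebra_simps)

text \<open>With zero angular momentum the velocity is \<open>L x\<close> for a linear \<open>L\<close> that has real
  eigenvalues, i.e. \<open>4 det L \<le> (tr L)\<^sup>2\<close>; multiplied by the squared area this is the following.\<close>

lemma area_velocity_ineq:
  fixes m1 m2 m3 :: real
  assumes m: "m1 > 0" "m2 > 0" "m3 > 0"
    and J: "m2 * m3 * wedge e1 f1 + m1 * m3 * wedge e2 f2 + m1 * m2 * wedge (e1 + e2) (f1 + f2) = 0"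
  shows "4 * (wedge e1 e2 * wedge f1 f2) \<le> (wedge f1 e2 + wedge e1 f2)\<^sup>2"
proof -
  define A B C D where "A = wedge e1 f1" and "B = wedge e1 f2" and "C = wedge e2 f1" and "D = wedge e2 f2"
  \<comment> \<open>Zero angular momentum is the vanishing trace: the form with entries A, (B + C) /
    2, D is paired with the mass form of the edges, whose determinant is positive.\<close>
  have "(m1 * m2)\<^sup>2 \<le> (m2 * m3 + m1 * m2) * (m1 * m3 + m1 * m2)"
    using m by (simp add: power2_eq_square algebra_simps add_increasing add_increasing2)
  moreover have "(m2 * m3 + m1 * m2) * A + (m1 * m2) * (B + C) + (m1 * m3 + m1 * m2) * D = 0"
    using J by (simp add: A_def B_def C_def D_def wedge_def algebra_simps)
  moreover have "m2 * m3 + m1 * m2 > 0" using m by (simp add: add_pos_pos)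
  ultimately have "4 * A * D \<le> (B + C)\<^sup>2"
    by (intro real_quadratic_trace[of "m2 * m3 + m1 * m2" "m1 * m2"])
  have 1: "wedge f1 e2 + wedge e1 f2 = B - C" by (simp add: B_def C_def wedge_def)
  have 2: "wedge e1 e2 * wedge f1 f2 = A * D - B * C"
    unfolding A_def B_def C_def D_def by (rule wedge_pluecker)
  have "(B - C)\<^sup>2 - 4 * (A * D - B * C) = (B + C)\<^sup>2 - 4 * A * D"
    by (simp add: power2_eq_square algebra_simps)
  then show ?thesis unfolding 1 2 using \<open>4 * A * D \<le> (B + C)\<^sup>2\<close> by linarith
qed

text \<open>Up to a factor, the components of the complex number \<open>e1 + \<omega> e2 + \<omega>\<^sup>2 e3\<close> with \<open>\<omega>\<close> a primitive
  third root of unity and \<open>e3 = - (e1 + e2)\<close>.\<close>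

definition ua :: "plane \<Rightarrow> plane \<Rightarrow> real" where
  "ua e1 e2 = sqrt 3 / 2 * e1 $ 1 + (e2 $ 2 + e1 $ 2 / 2)"
definition ub :: "plane \<Rightarrow> plane \<Rightarrow> real" where
  "ub e1 e2 = sqrt 3 / 2 * e1 $ 2 - (e2 $ 1 + e1 $ 1 / 2)"

text \<open>The first three terms are half the sum of the squared sides, and the wedge is twice the
  signed area. By Weitzenboeck's inequality the expression vanishes only for negatively oriented
  equilateral or degenerate triangles.\<close>

lemma u_norm: "(ua e1 e2)\<^sup>2 + (ub e1 e2)\<^sup>2 = e1 \<bullet> e1 + e1 \<bullet> e2 + e2 \<bullet> e2 + sqrt 3 * wedge e1 e2"
proof -
  have "sqrt 3 * (sqrt 3 * x) = 3 * x" for x :: real by (simp add: mult.assoc[symmetric])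
  then show ?thesis
    by (simp add: ua_def ub_def wedge_def inner_plane power2_eq_square field_simps)
qed

text \<open>The g are the accelerations of the edges when \<open>p1\<close>, \<open>p2\<close>,
  \<open>p3\<close> are the inverse cubes of the sides. The same mass-weighted sum of inverse cubes
  multiplies the squared shape vector and the area. The remainder is made of products (p - p') (s'^2
  - s^2), which have a sign because inverse cubes decrease.\<close>

lemma shape_force_identity:
  fixes e1 e2 g1 g2 :: plane
  defines "e3 \<equiv> - (e1 + e2)"
  assumes g1: "g1 = m1 *\<^sub>R (p1 *\<^sub>R e1 + p2 *\<^sub>R e2 + p3 *\<^sub>R e3) - ((m1 + m2 + m3) * p1) *\<^sub>R e1"
    and g2: "g2 = m2 *\<^sub>R (p1 *\<^sub>R e1 + p2 *\<^sub>R e2 + p3 *\<^sub>R e3) - ((m1 + m2 + m3) * p2) *\<^sub>R e2"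
  shows "2 * (ua e1 e2 * ua g1 g2 + ub e1 e2 * ub g1 g2)
      + ((ua e1 e2)\<^sup>2 + (ub e1 e2)\<^sup>2) * ((m2 + m3) * p1 + (m1 + m3) * p2 + (m1 + m2) * p3)
    = m1 * (p2 - p3) * (e3 \<bullet> e3 - e2 \<bullet> e2) + m2 * (p1 - p3) * (e3 \<bullet> e3 - e1 \<bullet> e1)
      + m3 * (p1 - p2) * (e2 \<bullet> e2 - e1 \<bullet> e1)"
    and "wedge g1 e2 + wedge e1 g2 = - ((m2 + m3) * p1 + (m1 + m3) * p2 + (m1 + m2) * p3) * wedge e1 e2"
proof -
  obtain a b c d where abcd: "a = e1 $ 1" "b = e1 $ 2" "c = e2 $ 1" "d = e2 $ 2" by blast
  define s where "s = sqrt (3::real)"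
  have s: "s * (s * x) = 3 * x" "s * s = 3" for x by (simp_all add: s_def mult.assoc[symmetric])
  show "2 * (ua e1 e2 * ua g1 g2 + ub e1 e2 * ub g1 g2)
      + ((ua e1 e2)\<^sup>2 + (ub e1 e2)\<^sup>2) * ((m2 + m3) * p1 + (m1 + m3) * p2 + (m1 + m2) * p3)
    = m1 * (p2 - p3) * (e3 \<bullet> e3 - e2 \<bullet> e2) + m2 * (p1 - p3) * (e3 \<bullet> e3 - e1 \<bullet> e1)
      + m3 * (p1 - p2) * (e2 \<bullet> e2 - e1 \<bullet> e1)"
    unfolding g1 g2 ua_def ub_def inner_plane e3_def s_def[symmetric] power2_eq_square
    by (simp add: abcd[symmetric]) (simp add: field_simps s)
  show "wedge g1 e2 + wedge e1 g2 = - ((m2 + m3) * p1 + (m1 + m3) * p2 + (m1 + m2) * p3) * wedge e1 e2"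
    unfolding g1 g2 wedge_def e3_def
    by (simp add: abcd[symmetric]) (simp add: algebra_simps)
qed

lemma inverse_cube_antimono:
  assumes "(r::real) > 0" "s > 0"
  shows "(1 / r ^ 3 - 1 / s ^ 3) * (s\<^sup>2 - r\<^sup>2) \<ge> 0"
    and "(1 / r ^ 3 - 1 / s ^ 3) * (s\<^sup>2 - r\<^sup>2) = 0 \<Longrightarrow> r = s"
proof -
  have lt: "(1 / r ^ 3 - 1 / s ^ 3) * (s\<^sup>2 - r\<^sup>2) > 0" if "0 < r" "r < s" for r s :: real
  proof -
    have "r ^ 3 < s ^ 3" "r\<^sup>2 < s\<^sup>2" using that by (auto intro!: power_strict_mono)
    then show ?thesis using that by (intro mult_pos_pos) (auto simp: frac_less2)
  qed
  have sym: "(1 / r ^ 3 - 1 / s ^ 3) * (s\<^sup>2 - r\<^sup>2) = (1 / s ^ 3 - 1 / r ^ 3) * (r\<^sup>2 - s\<^sup>2)"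
    by (simp add: algebra_simps)
  consider "r < s" | "r = s" | "s < r" by linarith
  then have "(1 / r ^ 3 - 1 / s ^ 3) * (s\<^sup>2 - r\<^sup>2) > 0 \<or> r = s"
    using lt[of r s] lt[of s r] assms sym by cases auto
  then show "(1 / r ^ 3 - 1 / s ^ 3) * (s\<^sup>2 - r\<^sup>2) \<ge> 0"
    and "(1 / r ^ 3 - 1 / s ^ 3) * (s\<^sup>2 - r\<^sup>2) = 0 \<Longrightarrow> r = s" by auto
qed

text \<open>The labels belong to the notion so that the orientation can be positive: the mirror
  image of a triangle is treated by exchanging labels.\<close>

definition noncollinear_motion ::
  "(3 \<Rightarrow> real) \<Rightarrow> real \<Rightarrow> 3 \<Rightarrow> 3 \<Rightarrow> 3 \<Rightarrow> trajectory \<Rightarrow> real \<Rightarrow> real \<Rightarrow> bool" where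
  "noncollinear_motion m h i j k x a b \<longleftrightarrow> (\<forall>i. m i > 0) \<and> distinct [i, j, k] \<and>
     (\<forall>t. a < t \<and> t < b \<longrightarrow> newton_at m x t \<and> (\<Sum>i\<in>UNIV. m i *\<^sub>R x t i) = 0 \<and>
        angular_momentum m x t = 0 \<and> energy m x t = h \<and> wedge (x t k - x t j) (x t i - x t k) > 0)"

section \<open>Differential inequalities for area and shape\<close>

lemma wedge_simps:
  "wedge (u + v) w = wedge u w + wedge v w" "wedge u (v + w) = wedge u v + wedge u w"
  "wedge (c *\<^sub>R u) w = c * wedge u w" "wedge u (c *\<^sub>R w) = c * wedge u w"
  "wedge (u - v) w = wedge u w - wedge v w" "wedge u (v - w) = wedge u v - wedge u w"
  "wedge 0 w = 0" "wedge u 0 = 0" "wedge (- u) w = - wedge u w" "wedge u (- w) = - wedge u w"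
  by (simp_all add: wedge_def algebra_simps)

text \<open>Lagrange's identity for the bilinear form \<open>wedge\<close>: the mixed terms are
  those of the wedge of the two weighted sums, both of which vanish.\<close>

lemma angular_momentum_edges:
  fixes x v :: config
  assumes d: "distinct [i, j, k]" and x: "(\<Sum>i\<in>UNIV. m i *\<^sub>R x i) = 0" and v: "(\<Sum>i\<in>UNIV. m i *\<^sub>R v i) = 0"
  shows "m j * m k * wedge (x k - x j) (v k - v j) + m i * m k * wedge (x i - x k) (v i - v k)
      + m i * m j * wedge (x i - x j) (v i - v j)
    = (m i + m j + m k) * (\<Sum>i\<in>UNIV. m i * wedge (x i) (v i))"
proof -
  have x': "m i *\<^sub>R x i + m j *\<^sub>R x j + m k *\<^sub>R x k = 0" using x by (simp add: sum_three[OF d])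
  have v': "m i *\<^sub>R v i + m j *\<^sub>R v j + m k *\<^sub>R v k = 0" using v by (simp add: sum_three[OF d])
  have "wedge (m i *\<^sub>R x i + m j *\<^sub>R x j + m k *\<^sub>R x k) (m i *\<^sub>R v i + m j *\<^sub>R v j + m k *\<^sub>R v k) = 0"
    unfolding x' by (simp add: wedge_def)
  then show ?thesis unfolding sum_three[OF d] by (simp add: wedge_simps algebra_simps)
qed

lemma has_real_derivative_wedge:
  assumes "(f has_vector_derivative f') (at t)" "(g has_vector_derivative g') (at t)"
  shows "((\<lambda>t. wedge (f t) (g t)) has_real_derivative wedge f' (g t) + wedge (f t) g') (at t)"
proof -
  note d = has_real_derivative_vec_nth[OF assms(1)] has_real_derivative_vec_nth[OF assms(2)]
  show ?thesis unfolding wedge_def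
    by (rule DERIV_cong[OF DERIV_diff[OF DERIV_mult[OF d(1) d(2)] DERIV_mult[OF d(1) d(2)]]])
      (simp add: algebra_simps)
qed

lemma has_real_derivative_u:
  assumes "(f has_vector_derivative f') (at t)" "(g has_vector_derivative g') (at t)"
  shows "((\<lambda>t. ua (f t) (g t)) has_real_derivative ua f' g') (at t)"
    "((\<lambda>t. ub (f t) (g t)) has_real_derivative ub f' g') (at t)"
proof -
  note d = has_real_derivative_vec_nth[OF assms(1)] has_real_derivative_vec_nth[OF assms(2)]
  show "((\<lambda>t. ua (f t) (g t)) has_real_derivative ua f' g') (at t)"
    unfolding ua_def by (intro DERIV_add DERIV_cmult DERIV_cdivide d)
  show "((\<lambda>t. ub (f t) (g t)) has_real_derivative ub f' g') (at t)"
    unfolding ub_def by (intro DERIV_add DERIV_diff DERIV_cmult DERIV_cdivide d)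
qed

lemma convexity_estimate:
  fixes n :: real
  assumes "S \<le> n * B" "2 * C = F - n * T"
  shows "2 * S - T * n\<^sup>2 + n * F \<le> 2 * n * (B + C)"
proof -
  have "2 * n * (B + C) = 2 * (n * B) + n * (2 * C)" by (simp add: algebra_simps)
  also have "\<dots> = 2 * (n * B) + (n * F - T * n\<^sup>2)"
    unfolding assms(2) by (simp add: algebra_simps power2_eq_square)
  finally show ?thesis using assms(1) by linarith
qed

text \<open>W is twice the area and n the squared shape vector. Free of roots, the two inequalities
  say S'' \<le> - (T/2) S for S = sqrt W and a'' \<ge> - (T/2) a + F / (2 a) for a = sqrt n; F
  measures the deviation from an equilateral shape. The last bound lets n inherit the decay of the
  inertia.\<close>

lemma shape_motion:
  assumes nm: "noncollinear_motion m h i j k x a b"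
  obtains W W1 W2 n n1 n2 T F :: "real \<Rightarrow> real"
  where
    "\<And>t. a < t \<Longrightarrow> t < b \<Longrightarrow> (W has_real_derivative W1 t) (at t)"
    "\<And>t. a < t \<Longrightarrow> t < b \<Longrightarrow> (W1 has_real_derivative W2 t) (at t)"
    "\<And>t. a < t \<Longrightarrow> t < b \<Longrightarrow> (n has_real_derivative 2 * n1 t) (at t)"
    "\<And>t. a < t \<Longrightarrow> t < b \<Longrightarrow> (n1 has_real_derivative n2 t) (at t)"
    "\<And>t. a < t \<Longrightarrow> t < b \<Longrightarrow> W t > 0" "\<And>t. a < t \<Longrightarrow> t < b \<Longrightarrow> n t > 0"
    "\<And>t. a < t \<Longrightarrow> t < b \<Longrightarrow> 2 * W t * W2 t \<le> (W1 t)\<^sup>2 - 2 * T t * (W t)\<^sup>2"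
    "\<And>t. a < t \<Longrightarrow> t < b \<Longrightarrow> 2 * n t * n2 t \<ge> 2 * (n1 t)\<^sup>2 - T t * (n t)\<^sup>2 + n t * F t"
    "\<And>t. a < t \<Longrightarrow> t < b \<Longrightarrow> F t \<ge> 0"
    "\<And>t. a < t \<Longrightarrow> t < b \<Longrightarrow> F t = 0 \<Longrightarrow> dist (x t i) (x t j) = dist (x t i) (x t k) \<and>
        dist (x t j) (x t k) = dist (x t i) (x t k)"
    "\<And>t. a < t \<Longrightarrow> t < b \<Longrightarrow> T t = (m j + m k) / dist (x t j) (x t k) ^ 3
        + (m i + m k) / dist (x t i) (x t k) ^ 3 + (m i + m j) / dist (x t i) (x t j) ^ 3"
    "\<And>t. n t \<le> 12 * ((norm (x t i))\<^sup>2 + (norm (x t j))\<^sup>2 + (norm (x t k))\<^sup>2)"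
proof -
  have m: "\<And>i. m i > 0" and d: "distinct [i, j, k]" using nm by (auto simp: noncollinear_motion_def)
  define e1 e2 e3 where "e1 = (\<lambda>t. x t k - x t j)" and "e2 = (\<lambda>t. x t i - x t k)" and "e3 = (\<lambda>t. - (e1 t + e2 t))"
  have e3: "e3 t = x t j - x t i" for t by (simp add: e3_def e1_def e2_def)
  define f1 f2 where "f1 = (\<lambda>t. velocity x t k - velocity x t j)" and "f2 = (\<lambda>t. velocity x t i - velocity x t k)"
  define g1 g2 where "g1 = (\<lambda>t. accel m (x t) k - accel m (x t) j)" and "g2 = (\<lambda>t. accel m (x t) i - accel m (x t) k)"
  define p where "p = (\<lambda>v::plane. 1 / norm v ^ 3)"
  define T where "T = (\<lambda>t. (m j + m k) * p (e1 t) + (m i + m k) * p (e2 t) + (m i + m j) * p (e3 t))"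
  define F where "F = (\<lambda>t. m i * (p (e2 t) - p (e3 t)) * (e3 t \<bullet> e3 t - e2 t \<bullet> e2 t)
      + m j * (p (e1 t) - p (e3 t)) * (e3 t \<bullet> e3 t - e1 t \<bullet> e1 t)
      + m k * (p (e1 t) - p (e2 t)) * (e2 t \<bullet> e2 t - e1 t \<bullet> e1 t))"
  define W where "W = (\<lambda>t. wedge (e1 t) (e2 t))"
  define W1 where "W1 = (\<lambda>t. wedge (f1 t) (e2 t) + wedge (e1 t) (f2 t))"
  define W2 where "W2 = (\<lambda>t. (wedge (g1 t) (e2 t) + wedge (e1 t) (g2 t)) + 2 * wedge (f1 t) (f2 t))"
  define n where "n = (\<lambda>t. (ua (e1 t) (e2 t))\<^sup>2 + (ub (e1 t) (e2 t))\<^sup>2)"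
  define n1 where "n1 = (\<lambda>t. ua (e1 t) (e2 t) * ua (f1 t) (f2 t) + ub (e1 t) (e2 t) * ub (f1 t) (f2 t))"
  define n2 where "n2 = (\<lambda>t. ((ua (f1 t) (f2 t))\<^sup>2 + (ub (f1 t) (f2 t))\<^sup>2)
      + (ua (e1 t) (e2 t) * ua (g1 t) (g2 t) + ub (e1 t) (e2 t) * ub (g1 t) (g2 t)))"
  have N: "newton_at m x t" "(\<Sum>i\<in>UNIV. m i *\<^sub>R x t i) = 0" "angular_momentum m x t = 0" "W t > 0"
    if "a < t" "t < b" for t
    using nm that by (auto simp: noncollinear_motion_def W_def e1_def e2_def)
  have de1: "(e1 has_vector_derivative f1 t) (at t)" and de2: "(e2 has_vector_derivative f2 t) (at t)"
    and df1: "(f1 has_vector_derivative g1 t) (at t)" and df2: "(f2 has_vector_derivative g2 t) (at t)"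
    if "a < t" "t < b" for t
    unfolding e1_def e2_def f1_def f2_def g1_def g2_def
    by (intro has_vector_derivative_diff newton_atD(2)[OF m N(1)[OF that]] newton_atD(3)[OF m N(1)[OF that]])+
  have pg: "grav v = p v *\<^sub>R v" for v by (simp add: grav_def p_def inverse_eq_divide)
  have g1: "g1 t = m i *\<^sub>R (p (e1 t) *\<^sub>R e1 t + p (e2 t) *\<^sub>R e2 t + p (e3 t) *\<^sub>R (- (e1 t + e2 t)))
      - ((m i + m j + m k) * p (e1 t)) *\<^sub>R e1 t"
    and g2: "g2 t = m j *\<^sub>R (p (e1 t) *\<^sub>R e1 t + p (e2 t) *\<^sub>R e2 t + p (e3 t) *\<^sub>R (- (e1 t + e2 t)))
      - ((m i + m j + m k) * p (e2 t)) *\<^sub>R e2 t" for t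
  proof -
    have d': "distinct [j, i, k]" "distinct [k, i, j]" using d by auto
    have gneg: "grav (x t i - x t j) = - grav (e3 t)" "grav (x t k - x t i) = - grav (e2 t)" "grav (x t j - x t k) = - grav (e1 t)"
      unfolding e3 e1_def e2_def by (metis grav_minus minus_diff_eq)+
    have gpos: "grav (x t j - x t i) = grav (e3 t)" "grav (x t i - x t k) = grav (e2 t)" "grav (x t k - x t j) = grav (e1 t)"
      unfolding e3 e1_def e2_def by simp_all
    note acc = accel_eq[OF d, of m "x t", unfolded gneg gpos] accel_eq[OF d'(1), of m "x t", unfolded gneg gpos]
      accel_eq[OF d'(2), of m "x t", unfolded gneg gpos]
    show "g1 t = m i *\<^sub>R (p (e1 t) *\<^sub>R e1 t + p (e2 t) *\<^sub>R e2 t + p (e3 t) *\<^sub>R (- (e1 t + e2 t)))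
      - ((m i + m j + m k) * p (e1 t)) *\<^sub>R e1 t"
      unfolding g1_def acc pg e3_def[THEN fun_cong] by (simp add: algebra_simps)
    show "g2 t = m j *\<^sub>R (p (e1 t) *\<^sub>R e1 t + p (e2 t) *\<^sub>R e2 t + p (e3 t) *\<^sub>R (- (e1 t + e2 t)))
      - ((m i + m j + m k) * p (e2 t)) *\<^sub>R e2 t"
      unfolding g2_def acc pg e3_def[THEN fun_cong] by (simp add: algebra_simps)
  qed
  note ident = shape_force_identity[OF g1 g2]
  have npos: "n t > 0" if "a < t" "t < b" for t
  proof -
    have "(norm (e1 t + e2 t))\<^sup>2 = e1 t \<bullet> e1 t + 2 * (e1 t \<bullet> e2 t) + e2 t \<bullet> e2 t"
      unfolding dot_square_norm[symmetric] by (simp add: inner_add_left inner_add_right inner_commute)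
    then have eq: "2 * (e1 t \<bullet> e1 t + e1 t \<bullet> e2 t + e2 t \<bullet> e2 t)
        = (norm (e1 t + e2 t))\<^sup>2 + e1 t \<bullet> e1 t + e2 t \<bullet> e2 t" by simp
    have "0 \<le> 2 * (e1 t \<bullet> e1 t + e1 t \<bullet> e2 t + e2 t \<bullet> e2 t)"
      unfolding eq by (intro add_nonneg_nonneg) auto
    then have "0 \<le> e1 t \<bullet> e1 t + e1 t \<bullet> e2 t + e2 t \<bullet> e2 t" by (simp only: zero_le_mult_iff) simp
    moreover have "sqrt 3 * wedge (e1 t) (e2 t) > 0" using N(4)[OF that] by (simp add: W_def)
    ultimately show ?thesis unfolding n_def u_norm by (rule add_nonneg_pos)
  qed
  show ?thesis
  proof (rule that[of W W1 W2 n n1 n2 T F])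
    fix t assume t: "a < t" "t < b"
    show "(W has_real_derivative W1 t) (at t)"
      unfolding W_def W1_def by (rule has_real_derivative_wedge[OF de1[OF t] de2[OF t]])
    show "(W1 has_real_derivative W2 t) (at t)"
      unfolding W1_def W2_def
      by (rule DERIV_cong[OF DERIV_add[OF has_real_derivative_wedge[OF df1[OF t] de2[OF t]]
            has_real_derivative_wedge[OF de1[OF t] df2[OF t]]]]) simp
    note du = has_real_derivative_u[OF de1[OF t] de2[OF t]] and du' = has_real_derivative_u[OF df1[OF t] df2[OF t]]
    show "(n has_real_derivative 2 * n1 t) (at t)"
      unfolding n_def n1_def power2_eq_square
      by (rule DERIV_cong[OF DERIV_add[OF DERIV_mult[OF du(1) du(1)] DERIV_mult[OF du(2) du(2)]]]) simp
    show "(n1 has_real_derivative n2 t) (at t)"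
      unfolding n1_def n2_def
      by (rule DERIV_cong[OF DERIV_add[OF DERIV_mult[OF du(1) du'(1)] DERIV_mult[OF du(2) du'(2)]]])
        (simp add: power2_eq_square)
    show "W t > 0" by (rule N(4)[OF t])
    show "n t > 0" by (rule npos[OF t])
    have J: "m j * m k * wedge (e1 t) (f1 t) + m i * m k * wedge (e2 t) (f2 t)
        + m i * m j * wedge (e1 t + e2 t) (f1 t + f2 t) = 0"
    proof -
      have v: "(\<Sum>i\<in>UNIV. m i *\<^sub>R velocity x t i) = 0"
        by (rule sum_velocity_zero[OF m t N(1)[OF t] N(2)])
      have "e1 t + e2 t = x t i - x t j" "f1 t + f2 t = velocity x t i - velocity x t j"
        by (simp_all add: e1_def e2_def f1_def f2_def)
      then show ?thesis
        using angular_momentum_edges[OF d N(2)[OF t] v] N(3)[OF t]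
        by (simp add: e1_def e2_def f1_def f2_def angular_momentum_def)
    qed
    have ineq: "4 * (wedge (e1 t) (e2 t) * wedge (f1 t) (f2 t)) \<le> (W1 t)\<^sup>2"
      unfolding W1_def by (rule area_velocity_ineq[OF m m m J])
    have W2e: "W2 t = - T t * W t + 2 * wedge (f1 t) (f2 t)"
      unfolding W2_def ident(2) T_def W_def e3_def by simp
    have eq: "2 * W t * W2 t = 4 * (wedge (e1 t) (e2 t) * wedge (f1 t) (f2 t)) - 2 * T t * (W t)\<^sup>2"
      unfolding W2e by (simp add: W_def algebra_simps power2_eq_square)
    show "2 * W t * W2 t \<le> (W1 t)\<^sup>2 - 2 * T t * (W t)\<^sup>2"
      unfolding eq using ineq by (rule diff_right_mono)
    have "(n1 t)\<^sup>2 \<le> n t * ((ua (f1 t) (f2 t))\<^sup>2 + (ub (f1 t) (f2 t))\<^sup>2)"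
    proof -
      have "(A * C + B * D)\<^sup>2 \<le> (A\<^sup>2 + B\<^sup>2) * (C\<^sup>2 + D\<^sup>2)" for A B C D :: real
      proof -
        have "(A\<^sup>2 + B\<^sup>2) * (C\<^sup>2 + D\<^sup>2) - (A * C + B * D)\<^sup>2 = (A * D - B * C)\<^sup>2"
          by (simp add: algebra_simps power2_eq_square)
        then show ?thesis using zero_le_power2[of "A * D - B * C"] by linarith
      qed
      then show ?thesis unfolding n1_def n_def .
    qed
    moreover have "2 * (ua (e1 t) (e2 t) * ua (g1 t) (g2 t) + ub (e1 t) (e2 t) * ub (g1 t) (g2 t)) = F t - n t * T t"
      using ident(1)[of t] unfolding F_def n_def T_def e3_def by linarith
    ultimately show "2 * n t * n2 t \<ge> 2 * (n1 t)\<^sup>2 - T t * (n t)\<^sup>2 + n t * F t"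
      unfolding n2_def by (rule convexity_estimate)
    have inj: "inj (x t)" by (rule newton_atD(1)[OF m N(1)[OF t]])
    have r: "norm (e1 t) > 0" "norm (e2 t) > 0" "norm (e3 t) > 0"
      using inj d unfolding e3 e1_def e2_def by (auto dest: injD)
    note ic = inverse_cube_antimono[OF r(2) r(3)] inverse_cube_antimono[OF r(1) r(3)] inverse_cube_antimono[OF r(1) r(2)]
    have Fe: "F t = m i * ((p (e2 t) - p (e3 t)) * ((norm (e3 t))\<^sup>2 - (norm (e2 t))\<^sup>2))
      + m j * ((p (e1 t) - p (e3 t)) * ((norm (e3 t))\<^sup>2 - (norm (e1 t))\<^sup>2))
      + m k * ((p (e1 t) - p (e2 t)) * ((norm (e2 t))\<^sup>2 - (norm (e1 t))\<^sup>2))"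
      unfolding F_def dot_square_norm by (simp add: mult.assoc)
    have nn: "0 \<le> m i * ((p (e2 t) - p (e3 t)) * ((norm (e3 t))\<^sup>2 - (norm (e2 t))\<^sup>2))"
      "0 \<le> m j * ((p (e1 t) - p (e3 t)) * ((norm (e3 t))\<^sup>2 - (norm (e1 t))\<^sup>2))"
      "0 \<le> m k * ((p (e1 t) - p (e2 t)) * ((norm (e2 t))\<^sup>2 - (norm (e1 t))\<^sup>2))"
      using ic(1,3,5) m[of i] m[of j] m[of k] by (simp_all add: p_def)
    show "F t \<ge> 0" unfolding Fe using nn by linarith
    show "dist (x t i) (x t j) = dist (x t i) (x t k) \<and> dist (x t j) (x t k) = dist (x t i) (x t k)" if "F t = 0"
    proof -
      have "m i * ((p (e2 t) - p (e3 t)) * ((norm (e3 t))\<^sup>2 - (norm (e2 t))\<^sup>2)) = 0"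
        "m k * ((p (e1 t) - p (e2 t)) * ((norm (e2 t))\<^sup>2 - (norm (e1 t))\<^sup>2)) = 0"
        using that nn unfolding Fe by linarith+
      then have "(p (e2 t) - p (e3 t)) * ((norm (e3 t))\<^sup>2 - (norm (e2 t))\<^sup>2) = 0"
        "(p (e1 t) - p (e2 t)) * ((norm (e2 t))\<^sup>2 - (norm (e1 t))\<^sup>2) = 0"
        using m[of i] m[of k] by (simp_all only: mult_eq_0_iff) auto
      then have "norm (e2 t) = norm (e3 t)" "norm (e1 t) = norm (e2 t)"
        using ic(2,6) unfolding p_def by blast+
      then show ?thesis unfolding e3 e1_def e2_def by (simp add: dist_norm norm_minus_commute)
    qed
    show "T t = (m j + m k) / dist (x t j) (x t k) ^ 3 + (m i + m k) / dist (x t i) (x t k) ^ 3 + (m i + m j) / dist (x t i) (x t j) ^ 3"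
      unfolding T_def p_def e3 e1_def e2_def by (simp add: dist_norm norm_minus_commute)
  next
    fix t
    have ab: "(norm (u - v))\<^sup>2 \<le> 2 * ((norm u)\<^sup>2 + (norm v)\<^sup>2)" for u v :: plane
    proof -
      have "(norm (u - v))\<^sup>2 + (norm (u + v))\<^sup>2 = 2 * ((norm u)\<^sup>2 + (norm v)\<^sup>2)"
        unfolding dot_square_norm[symmetric] by (simp add: inner_diff_left inner_diff_right inner_add_left inner_add_right inner_commute)
      then show ?thesis using zero_le_power2[of "norm (u + v)"] by linarith
    qed
    \<comment> \<open>The 12 is 3 from n \<le> 3 (|e1|^2 + |e2|^2) times 2 from |u - v|^2 \<le> 2
      (|u|^2 + |v|^2), times 2 because x k occurs in both edges.\<close>
    have gen1: "A + c + B + w \<le> 3 * (A + B)" if "c \<le> N" "w \<le> 2 * N" "2 * N \<le> A + B" "0 \<le> A" "0 \<le> B"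
      for A B c w N :: real using that by argo
    have gen2: "v \<le> 12 * (I + J + K)"
      if "v \<le> 3 * (A + B)" "A \<le> 2 * (K + J)" "B \<le> 2 * (I + K)" "0 \<le> I" "0 \<le> J"
      for v A B I J K :: real using that by argo
    have "e1 t \<bullet> e2 t \<le> norm (e1 t) * norm (e2 t)" by (rule norm_cauchy_schwarz)
    moreover have "sqrt 3 * wedge (e1 t) (e2 t) \<le> 2 * (norm (e1 t) * norm (e2 t))"
    proof -
      have "(wedge (e1 t) (e2 t))\<^sup>2 + (e1 t \<bullet> e2 t)\<^sup>2 = (e1 t \<bullet> e1 t) * (e2 t \<bullet> e2 t)"
        unfolding wedge_def inner_plane by (simp add: algebra_simps power2_eq_square)
      then have eq: "(norm (e1 t) * norm (e2 t))\<^sup>2 = (wedge (e1 t) (e2 t))\<^sup>2 + (e1 t \<bullet> e2 t)\<^sup>2"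
        by (simp add: dot_square_norm power_mult_distrib)
      have "(wedge (e1 t) (e2 t))\<^sup>2 \<le> (norm (e1 t) * norm (e2 t))\<^sup>2"
        unfolding eq by simp
      then have "\<bar>wedge (e1 t) (e2 t)\<bar> \<le> norm (e1 t) * norm (e2 t)"
        by (simp only: abs_le_square_iff[symmetric]) (simp add: abs_mult)
      moreover have "sqrt 3 \<le> (2::real)" by (rule real_le_lsqrt) auto
      ultimately have "sqrt 3 * \<bar>wedge (e1 t) (e2 t)\<bar> \<le> 2 * (norm (e1 t) * norm (e2 t))"
        by (intro mult_mono) auto
      moreover have "sqrt 3 * wedge (e1 t) (e2 t) \<le> sqrt 3 * \<bar>wedge (e1 t) (e2 t)\<bar>" by (intro mult_left_mono) auto
      ultimately show ?thesis by linarith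
    qed
    moreover have "2 * (norm (e1 t) * norm (e2 t)) \<le> (norm (e1 t))\<^sup>2 + (norm (e2 t))\<^sup>2"
      using zero_le_power2[of "norm (e1 t) - norm (e2 t)"] by (simp add: power2_diff)
    ultimately have "n t \<le> 3 * ((norm (e1 t))\<^sup>2 + (norm (e2 t))\<^sup>2)"
      unfolding n_def u_norm dot_square_norm by (rule gen1) simp_all
    moreover have "(norm (e1 t))\<^sup>2 \<le> 2 * ((norm (x t k))\<^sup>2 + (norm (x t j))\<^sup>2)"
      "(norm (e2 t))\<^sup>2 \<le> 2 * ((norm (x t i))\<^sup>2 + (norm (x t k))\<^sup>2)"
      unfolding e1_def e2_def by (rule ab)+
    ultimately show "n t \<le> 12 * ((norm (x t i))\<^sup>2 + (norm (x t j))\<^sup>2 + (norm (x t k))\<^sup>2)"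
      by (rule gen2) simp_all
  qed
qed

text \<open>A longer interval would contain a full arch of sin (w (t - s)). The Wronskian G of S
  with this arch is nonincreasing, yet it runs from - w S < 0 to w S > 0.\<close>

lemma sturm_interval_bound:
  fixes S S1 S2 :: "real \<Rightarrow> real"
  assumes der: "\<And>t. a < t \<Longrightarrow> t < b \<Longrightarrow> (S has_real_derivative S1 t) (at t)"
    "\<And>t. a < t \<Longrightarrow> t < b \<Longrightarrow> (S1 has_real_derivative S2 t) (at t)"
    and pos: "\<And>t. a < t \<Longrightarrow> t < b \<Longrightarrow> S t > 0"
    and ineq: "\<And>t. a < t \<Longrightarrow> t < b \<Longrightarrow> S2 t \<le> - (w\<^sup>2 * S t)" and w: "w > 0"
  shows "b - a \<le> pi / w"
proof (rule ccontr)
  assume "\<not> b - a \<le> pi / w"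
  then obtain s where s: "a < s" "s + pi / w < b"
    using dense[of a "b - pi / w"] by (auto simp: algebra_simps)
  define e where "e = s + pi / w"
  have e: "s < e" "e < b" "w * (e - s) = pi" using s w by (simp_all add: e_def)
  define G where "G = (\<lambda>t. S1 t * sin (w * (t - s)) - w * (S t * cos (w * (t - s))))"
  have "G e \<le> G s"
  proof (rule DERIV_nonpos_imp_nonincreasing[OF less_imp_le[OF e(1)], of G])
    fix t assume t: "s \<le> t" "t \<le> e"
    then have t': "a < t" "t < b" using s e by auto
    have ds: "((\<lambda>t. sin (w * (t - s))) has_real_derivative w * cos (w * (t - s))) (at t)"
      by (auto intro!: derivative_eq_intros)
    have dc: "((\<lambda>t. cos (w * (t - s))) has_real_derivative - (w * sin (w * (t - s)))) (at t)"
      by (auto intro!: derivative_eq_intros)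
    have "(G has_real_derivative (S2 t + w\<^sup>2 * S t) * sin (w * (t - s))) (at t)"
      unfolding G_def
      by (rule DERIV_cong[OF DERIV_diff[OF DERIV_mult[OF der(2)[OF t'] ds]
            DERIV_cmult[OF DERIV_mult[OF der(1)[OF t'] dc]]]])
        (simp add: algebra_simps power2_eq_square)
    moreover have "sin (w * (t - s)) \<ge> 0"
    proof (rule sin_ge_zero)
      show "0 \<le> w * (t - s)" using w t by simp
      have "w * (t - s) \<le> w * (e - s)" using w t by (intro mult_left_mono) auto
      then show "w * (t - s) \<le> pi" using e(3) by simp
    qed
    then have "(S2 t + w\<^sup>2 * S t) * sin (w * (t - s)) \<le> 0"
      using ineq[OF t'] by (intro mult_nonpos_nonneg) auto
    ultimately show "\<exists>y. (G has_real_derivative y) (at t) \<and> y \<le> 0" by blast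
  qed
  moreover have "G s = - (w * S s)" by (simp add: G_def)
  moreover have "G e = w * S e" by (simp add: G_def e(3))
  moreover have "w * S s > 0" "w * S e > 0" using pos[of s] pos[of e] s e w by auto
  ultimately show False by simp
qed

text \<open>Sturm comparison for sqrt W; its equation carries T / 2, hence the threshold 2 w^2 for
  T.\<close>

lemma sqrt_area_interval_bound:
  fixes W W1 W2 T :: "real \<Rightarrow> real"
  assumes der: "\<And>t. a < t \<Longrightarrow> t < b \<Longrightarrow> (W has_real_derivative W1 t) (at t)"
    "\<And>t. a < t \<Longrightarrow> t < b \<Longrightarrow> (W1 has_real_derivative W2 t) (at t)"
    and pos: "\<And>t. a < t \<Longrightarrow> t < b \<Longrightarrow> W t > 0"
    and ineq: "\<And>t. a < t \<Longrightarrow> t < b \<Longrightarrow> 2 * W t * W2 t \<le> (W1 t)\<^sup>2 - 2 * T t * (W t)\<^sup>2"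
    and T: "\<And>t. a < t \<Longrightarrow> t < b \<Longrightarrow> T t \<ge> 2 * w\<^sup>2" and w: "w > 0"
  shows "b - a \<le> pi / w"
proof (rule sturm_interval_bound[OF _ _ _ _ w])
  fix t assume t: "a < t" "t < b"
  define S where "S = sqrt (W t)"
  have S: "S > 0" "W t = S * S" using pos[OF t] by (simp_all add: S_def)
  show "((\<lambda>t. sqrt (W t)) has_real_derivative W1 t / (2 * sqrt (W t))) (at t)"
    using DERIV_chain2[OF DERIV_real_sqrt[OF pos[OF t]] der(1)[OF t]] by (simp add: field_simps)
  then have dS: "((\<lambda>t. 2 * sqrt (W t)) has_real_derivative 2 * (W1 t / (2 * S))) (at t)"
    unfolding S_def by (rule DERIV_cmult)
  show "((\<lambda>t. W1 t / (2 * sqrt (W t))) has_real_derivative (2 * W t * W2 t - (W1 t)\<^sup>2) / (4 * W t * sqrt (W t))) (at t)"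
    by (rule DERIV_cong[OF DERIV_divide[OF der(2)[OF t] dS]])
      (use S in \<open>simp_all add: S_def[symmetric] field_simps power2_eq_square\<close>)
  show "sqrt (W t) > 0" using pos[OF t] by simp
  have "2 * W t * W2 t - (W1 t)\<^sup>2 \<le> - (4 * w\<^sup>2 * (W t)\<^sup>2)"
  proof -
    have "2 * w\<^sup>2 * (W t)\<^sup>2 \<le> T t * (W t)\<^sup>2" using T[OF t] by (intro mult_right_mono) auto
    then show ?thesis using ineq[OF t] by (simp add: algebra_simps)
  qed
  then have "(2 * W t * W2 t - (W1 t)\<^sup>2) / (4 * W t * sqrt (W t)) \<le> - (4 * w\<^sup>2 * (W t)\<^sup>2) / (4 * W t * sqrt (W t))"
    using pos[OF t] by (intro divide_right_mono) auto
  also have "\<dots> = - (w\<^sup>2 * sqrt (W t))"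
    using S by (simp add: S_def[symmetric] field_simps power2_eq_square)
  finally show "(2 * W t * W2 t - (W1 t)\<^sup>2) / (4 * W t * sqrt (W t)) \<le> - (w\<^sup>2 * sqrt (W t))" .
qed

text \<open>The function below is \<open>a' S - a S'\<close> with \<open>S = sqrt W\<close> and \<open>a = sqrt n\<close>, that is
  \<open>- n (S / a)'\<close>.\<close>

lemma shape_momentum_deriv:
  fixes W W1 n n1 :: "real \<Rightarrow> real"
  assumes der: "(W has_real_derivative W1 t) (at t)" "(W1 has_real_derivative W2) (at t)"
    "(n has_real_derivative 2 * n1 t) (at t)" "(n1 has_real_derivative n2) (at t)"
    and pos: "W t > 0" "n t > 0"
    and i1: "2 * W t * W2 \<le> (W1 t)\<^sup>2 - 2 * T * (W t)\<^sup>2"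
    and i2: "2 * n t * n2 \<ge> 2 * (n1 t)\<^sup>2 - T * (n t)\<^sup>2 + n t * F"
  shows "\<exists>D. ((\<lambda>t. (2 * n1 t * W t - n t * W1 t) / (2 * sqrt (n t * W t))) has_real_derivative D) (at t) \<and>
      D \<ge> F * W t / (2 * sqrt (n t * W t))"
proof -
  define Q where "Q = sqrt (n t * W t)"
  have Q: "Q > 0" "Q * Q = n t * W t" using pos by (simp_all add: Q_def)
  have dQ: "((\<lambda>t. 2 * sqrt (n t * W t)) has_real_derivative (2 * n1 t * W t + n t * W1 t) / Q) (at t)"
  proof -
    have "((\<lambda>t. n t * W t) has_real_derivative 2 * n1 t * W t + W1 t * n t) (at t)"
      by (rule DERIV_mult[OF der(3) der(1)])
    from DERIV_cmult[OF DERIV_chain2[OF DERIV_real_sqrt this], of 2] pos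
    have "((\<lambda>t. 2 * sqrt (n t * W t)) has_real_derivative
        2 * (inverse (sqrt (n t * W t)) / 2 * (2 * n1 t * W t + W1 t * n t))) (at t)" by simp
    moreover have "2 * (inverse s / 2 * (u + v * w)) = (u + w * v) / s" for s u v w :: real
      by (cases "s = 0") (simp_all add: field_simps)
    ultimately show ?thesis unfolding Q_def by (simp only:)
  qed
  have dZ: "((\<lambda>t. 2 * n1 t * W t - n t * W1 t) has_real_derivative 2 * n2 * W t - n t * W2) (at t)"
  proof -
    have d1: "((\<lambda>t. 2 * n1 t) has_real_derivative 2 * n2) (at t)" by (rule DERIV_cmult[OF der(4)])
    have "2 * n2 * W t + W1 t * (2 * n1 t) - (2 * n1 t * W1 t + W2 * n t) = 2 * n2 * W t - n t * W2" by simp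
    with DERIV_diff[OF DERIV_mult[OF d1 der(1)] DERIV_mult[OF der(3) der(2)]]
    show ?thesis by (simp only:)
  qed
  define Z where "Z = 2 * n1 t * W t - n t * W1 t"
  define D where "D = ((2 * n2 * W t - n t * W2) * (2 * Q) - Z * ((2 * n1 t * W t + n t * W1 t) / Q)) / ((2 * Q) * (2 * Q))"
  have d: "((\<lambda>t. (2 * n1 t * W t - n t * W1 t) / (2 * sqrt (n t * W t))) has_real_derivative D) (at t)"
    unfolding D_def Z_def Q_def by (rule DERIV_divide[OF dZ dQ[unfolded Q_def]]) (use pos in simp)
  \<comment> \<open>Generic scalar identities keep the compound terms opaque; this one clears the
    quotient rule, after which Q^2 is replaced by n W.\<close>
  have g0: "(N * (2 * q) - z * (v / q)) / ((2 * q) * (2 * q)) = (N * (2 * (q * q)) - z * v) / (4 * (q * q) * q)"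
    if "q \<noteq> 0" for N q z v :: real using that by (simp add: field_simps)
  have D: "D = ((2 * n2 * W t - n t * W2) * (2 * (n t * W t)) - Z * (2 * n1 t * W t + n t * W1 t)) / (4 * (n t * W t) * Q)"
  proof -
    have "D = ((2 * n2 * W t - n t * W2) * (2 * (Q * Q)) - Z * (2 * n1 t * W t + n t * W1 t)) / (4 * (Q * Q) * Q)"
      unfolding D_def by (rule g0) (use Q(1) in simp)
    then show ?thesis unfolding Q(2) .
  qed
  have g1: "(2 * c * w - \<nu> * d) * (2 * (\<nu> * w)) = 2 * ((2 * \<nu> * c) * w\<^sup>2) - \<nu>\<^sup>2 * (2 * w * d)" for c w \<nu> d :: real
    by algebra
  have g2: "(2 * c * w - \<nu> * d) * (2 * c * w + \<nu> * d) = 4 * c\<^sup>2 * w\<^sup>2 - \<nu>\<^sup>2 * d\<^sup>2" for c w \<nu> d :: real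
    by algebra
  have g3: "2 * \<nu> * f * w = 2 * ((2 * c - \<tau> * \<nu>\<^sup>2 + \<nu> * f) * w) - \<nu>\<^sup>2 * (d - 2 * \<tau> * w) - (4 * c * w - \<nu>\<^sup>2 * d)"
    for \<nu> f w c d \<tau> :: real by (simp add: algebra_simps)
  have g5: "2 * \<nu> * f * w\<^sup>2 / (4 * (\<nu> * w) * q) = f * w / (2 * q)" if "\<nu> \<noteq> 0" "w \<noteq> 0" "q \<noteq> 0"
    for \<nu> f w q :: real using that by (simp add: field_simps power2_eq_square)
  have g4: "e \<le> 2 * B - C - p" if "e = 2 * A - D - p" "A \<le> B" "C \<le> D" for e A B C D p :: real using that by linarith
  have e: "(2 * n2 * W t - n t * W2) * (2 * (n t * W t)) - Z * (2 * n1 t * W t + n t * W1 t)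
      = 2 * ((2 * n t * n2) * (W t)\<^sup>2) - (n t)\<^sup>2 * (2 * W t * W2) - (4 * (n1 t)\<^sup>2 * (W t)\<^sup>2 - (n t)\<^sup>2 * (W1 t)\<^sup>2)"
    unfolding Z_def g1 g2 ..
  \<comment> \<open>Inserting the two inequalities, the terms with T cancel, and so do the squares
    of n1 and W1; only the term with F survives.\<close>
  have "2 * n t * F * (W t)\<^sup>2 \<le> (2 * n2 * W t - n t * W2) * (2 * (n t * W t)) - Z * (2 * n1 t * W t + n t * W1 t)"
    unfolding e by (rule g4[OF g3 mult_right_mono[OF i2 zero_le_power2] mult_left_mono[OF i1 zero_le_power2]])
  then have "2 * n t * F * (W t)\<^sup>2 / (4 * (n t * W t) * Q) \<le> D"
    unfolding D using pos Q(1) by (intro divide_right_mono) auto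
  moreover have "2 * n t * F * (W t)\<^sup>2 / (4 * (n t * W t) * Q) = F * W t / (2 * Q)"
    by (rule g5) (use pos Q(1) in simp_all)
  ultimately have "F * W t / (2 * Q) \<le> D" by simp
  then show ?thesis using d unfolding Q_def by blast
qed

section \<open>The Wronskian between two triple collisions\<close>

lemma shape_ratio_deriv:
  fixes W W1 n n1 :: "real \<Rightarrow> real"
  assumes der: "(W has_real_derivative W1 t) (at t)" "(n has_real_derivative 2 * n1 t) (at t)"
    and pos: "W t > 0" "n t > 0"
  shows "((\<lambda>t. sqrt (W t / n t)) has_real_derivative
      - ((2 * n1 t * W t - n t * W1 t) / (2 * sqrt (n t * W t))) / n t) (at t)"
proof -
  define a S where "a = sqrt (n t)" and "S = sqrt (W t)"
  have aS: "a > 0" "S > 0" "n t = a * a" "W t = S * S" "sqrt (n t * W t) = a * S" "sqrt (W t / n t) = S / a"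
    using pos by (simp_all add: a_def S_def real_sqrt_mult real_sqrt_divide)
  have "((\<lambda>t. W t / n t) has_real_derivative (W1 t * n t - W t * (2 * n1 t)) / (n t * n t)) (at t)"
    using DERIV_divide[OF der] pos by simp
  from DERIV_chain2[OF DERIV_real_sqrt this] pos
  have "((\<lambda>t. sqrt (W t / n t)) has_real_derivative
      inverse (sqrt (W t / n t)) / 2 * ((W1 t * n t - W t * (2 * n1 t)) / (n t * n t))) (at t)" by simp
  then show ?thesis
    by (rule DERIV_cong) (unfold aS(5,6), unfold aS(3,4), use aS(1,2) in \<open>simp add: field_simps\<close>)
qed

text \<open>Near triple collision \<open>n\<close> decays linearly, so that \<open>1 / n\<close> is not integrable there.\<close>

lemma momentum_nonpos:
  fixes Y P n :: "real \<Rightarrow> real"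
  assumes ab: "a < b"
    and der: "\<And>t. a < t \<Longrightarrow> t < b \<Longrightarrow> (Y has_real_derivative - P t / n t) (at t)"
    and mono: "\<And>s t. a < s \<Longrightarrow> s \<le> t \<Longrightarrow> t < b \<Longrightarrow> P s \<le> P t"
    and pos: "\<And>t. a < t \<Longrightarrow> t < b \<Longrightarrow> Y t > 0" "\<And>t. a < t \<Longrightarrow> t < b \<Longrightarrow> n t > 0"
    and t1: "a \<le> t1" "t1 < b" and decay: "\<And>t. t1 < t \<Longrightarrow> t < b \<Longrightarrow> n t \<le> C * (b - t)"
    and t0: "a < t0" "t0 < b"
  shows "P t0 \<le> 0"
proof (rule ccontr)
  assume "\<not> P t0 \<le> 0"
  then have c: "P t0 > 0" by simp
  define s where "s = (max t0 t1 + b) / 2"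
  have s: "t0 < s" "t1 < s" "s < b" "a < s" using t0 t1 by (auto simp: s_def)
  have "0 < C * (b - s)" using pos(2)[OF s(4,3)] decay[OF s(2,3)] by simp
  then have C: "C > 0" using s by (simp add: zero_less_mult_iff)
  \<comment> \<open>Beyond s one has P / n \<ge> k / (b - t), so Y decreases at least as fast as k
    ln (b - t), which tends to minus infinity.\<close>
  define k where "k = P t0 / C"
  have k: "k > 0" using c C by (simp add: k_def)
  define Z where "Z = (\<lambda>t. Y t - k * ln (b - t))"
  have Z: "Z t \<le> Z s" if t: "s \<le> t" "t < b" for t
  proof (rule DERIV_nonpos_imp_nonincreasing[OF t(1)])
    fix x assume x: "s \<le> x" "x \<le> t"
    then have x': "a < x" "x < b" "t1 < x" "t0 \<le> x" "b - x > 0" using s t by auto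
    have "((\<lambda>t. ln (b - t)) has_real_derivative - 1 / (b - x)) (at x)"
      using x'(5) by (auto intro!: derivative_eq_intros simp: field_simps)
    from DERIV_diff[OF der[OF x'(1,2)] DERIV_cmult[OF this, of k]]
    have "(Z has_real_derivative - P x / n x - k * (- 1 / (b - x))) (at x)" unfolding Z_def .
    moreover have "k / (b - x) \<le> P x / n x"
    proof -
      have "k / (b - x) = P t0 / (C * (b - x))" by (simp add: k_def)
      also have "\<dots> \<le> P x / n x"
        using mono[OF t0(1) x'(4,2)] c decay[OF x'(3,2)] pos(2)[OF x'(1,2)] by (intro frac_le) auto
      finally show ?thesis .
    qed
    then have "- P x / n x - k * (- 1 / (b - x)) \<le> 0" by simp
    ultimately show "\<exists>y. (Z has_real_derivative y) (at x) \<and> y \<le> 0" by blast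
  qed
  \<comment> \<open>Solves k ln d = k ln (b - s) - (Y s + 1), so that monotonicity of Z forces Y (b
    - d) \<le> -1.\<close>
  define d where "d = (b - s) * exp (- (Y s + 1) / k)"
  have "- (Y s + 1) / k < 0" using k pos(1)[OF s(4,3)] by (intro divide_neg_pos) auto
  then have "(b - s) * exp (- (Y s + 1) / k) < (b - s) * 1"
    using s by (intro mult_strict_left_mono) auto
  then have d: "d > 0" "d < b - s" using s by (simp_all add: d_def)
  have "Z (b - d) \<le> Z s" using d by (intro Z) auto
  moreover have "ln d = ln (b - s) - (Y s + 1) / k" using s by (simp add: d_def ln_mult minus_divide_left)
  then have "k * ln d = k * ln (b - s) - (Y s + 1)" using k by (simp add: right_diff_distrib)
  ultimately have "Y (b - d) \<le> - 1" by (simp add: Z_def)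
  moreover have "Y (b - d) > 0" using d s by (intro pos) auto
  ultimately show False by simp
qed

lemma equilateral_of_collisions:
  assumes nm: "noncollinear_motion m h i j k x a b" and ab: "a < b"
    and right: "\<exists>C t1. a \<le> t1 \<and> t1 < b \<and> (\<forall>t. t1 < t \<and> t < b \<longrightarrow> inertia m (x t) \<le> C * (b - t))"
    and left: "\<exists>C t1. a < t1 \<and> t1 \<le> b \<and> (\<forall>t. a < t \<and> t < t1 \<longrightarrow> inertia m (x t) \<le> C * (t - a))"
    and t: "a < t" "t < b"
  shows "dist (x t i) (x t j) = dist (x t i) (x t k) \<and> dist (x t j) (x t k) = dist (x t i) (x t k)"
proof -
  have m: "\<And>i. m i > 0" and d: "distinct [i, j, k]" using nm by (auto simp: noncollinear_motion_def)
  obtain W W1 W2 n n1 n2 T F :: "real \<Rightarrow> real" where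
    sm: "\<And>t. a < t \<Longrightarrow> t < b \<Longrightarrow> (W has_real_derivative W1 t) (at t)"
    "\<And>t. a < t \<Longrightarrow> t < b \<Longrightarrow> (W1 has_real_derivative W2 t) (at t)"
    "\<And>t. a < t \<Longrightarrow> t < b \<Longrightarrow> (n has_real_derivative 2 * n1 t) (at t)"
    "\<And>t. a < t \<Longrightarrow> t < b \<Longrightarrow> (n1 has_real_derivative n2 t) (at t)"
    "\<And>t. a < t \<Longrightarrow> t < b \<Longrightarrow> W t > 0" "\<And>t. a < t \<Longrightarrow> t < b \<Longrightarrow> n t > 0"
    "\<And>t. a < t \<Longrightarrow> t < b \<Longrightarrow> 2 * W t * W2 t \<le> (W1 t)\<^sup>2 - 2 * T t * (W t)\<^sup>2"
    "\<And>t. a < t \<Longrightarrow> t < b \<Longrightarrow> 2 * n t * n2 t \<ge> 2 * (n1 t)\<^sup>2 - T t * (n t)\<^sup>2 + n t * F t"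
    "\<And>t. a < t \<Longrightarrow> t < b \<Longrightarrow> F t \<ge> 0"
    "\<And>t. a < t \<Longrightarrow> t < b \<Longrightarrow> F t = 0 \<Longrightarrow> dist (x t i) (x t j) = dist (x t i) (x t k) \<and>
        dist (x t j) (x t k) = dist (x t i) (x t k)"
    "\<And>t. a < t \<Longrightarrow> t < b \<Longrightarrow> T t = (m j + m k) / dist (x t j) (x t k) ^ 3
        + (m i + m k) / dist (x t i) (x t k) ^ 3 + (m i + m j) / dist (x t i) (x t j) ^ 3"
    "\<And>t. n t \<le> 12 * ((norm (x t i))\<^sup>2 + (norm (x t j))\<^sup>2 + (norm (x t k))\<^sup>2)"
    by (rule shape_motion[OF nm]) (rule that; assumption)
  define Pi where "Pi = (\<lambda>t. (2 * n1 t * W t - n t * W1 t) / (2 * sqrt (n t * W t)))"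
  define Y where "Y = (\<lambda>t. sqrt (W t / n t))"
  have dPi: "\<exists>D. (Pi has_real_derivative D) (at t) \<and> D \<ge> F t * W t / (2 * sqrt (n t * W t))" if "a < t" "t < b" for t
    unfolding Pi_def
    by (rule shape_momentum_deriv[where W = W and ?W1.0 = W1 and n = n and ?n1.0 = n1, OF sm(1)[OF that] sm(2)[OF that] sm(3)[OF that] sm(4)[OF that]
          sm(5)[OF that] sm(6)[OF that] sm(7)[OF that] sm(8)[OF that]])
  have nn: "F t * W t / (2 * sqrt (n t * W t)) \<ge> 0" if "a < t" "t < b" for t
    using sm(5,6,9)[OF that] by simp
  have mono: "Pi s \<le> Pi t" if "a < s" "s \<le> t" "t < b" for s t
  proof (rule DERIV_nonneg_imp_nondecreasing[OF that(2)])
    fix z assume "s \<le> z" "z \<le> t"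
    then have z: "a < z" "z < b" using that by auto
    show "\<exists>y. (Pi has_real_derivative y) (at z) \<and> 0 \<le> y" using dPi[OF z] nn[OF z] by force
  qed
  have dY: "(Y has_real_derivative - Pi t / n t) (at t)" if "a < t" "t < b" for t
    unfolding Y_def Pi_def by (rule shape_ratio_deriv[where W = W and ?W1.0 = W1 and n = n and ?n1.0 = n1, OF sm(1)[OF that] sm(3)[OF that] sm(5)[OF that] sm(6)[OF that]])
  have Ypos: "Y t > 0" if "a < t" "t < b" for t using sm(5,6)[OF that] by (simp add: Y_def)
  obtain m0 where m0: "m0 > 0" "\<And>i. m0 \<le> m i" using mass_lower_bound[of m, OF m] by blast
  have nI: "n t \<le> 12 / m0 * inertia m (x t)" for t
  proof -
    have "m0 * ((norm (x t i))\<^sup>2 + (norm (x t j))\<^sup>2 + (norm (x t k))\<^sup>2) \<le> inertia m (x t)"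
      unfolding inertia_def sum_three[OF d] distrib_left using m0(2) by (intro add_mono mult_right_mono) auto
    then have "(norm (x t i))\<^sup>2 + (norm (x t j))\<^sup>2 + (norm (x t k))\<^sup>2 \<le> inertia m (x t) / m0"
      using m0(1) by (simp add: pos_le_divide_eq mult.commute)
    then have "12 * ((norm (x t i))\<^sup>2 + (norm (x t j))\<^sup>2 + (norm (x t k))\<^sup>2) \<le> 12 * (inertia m (x t) / m0)"
      by (intro mult_left_mono) auto
    then show ?thesis using sm(12)[of t] by simp
  qed
  obtain C t1 where C: "a \<le> t1" "t1 < b" "\<And>t. t1 < t \<Longrightarrow> t < b \<Longrightarrow> inertia m (x t) \<le> C * (b - t)"
    using right by blast
  have np: "Pi t \<le> 0" if t: "a < t" "t < b" for t
  proof (rule momentum_nonpos[OF ab dY mono Ypos sm(6) C(1,2) _ t, of "12 / m0 * C"])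
    fix t assume "t1 < t" "t < b"
    from C(3)[OF this] have "12 / m0 * inertia m (x t) \<le> 12 / m0 * (C * (b - t))"
      using m0(1) by (intro mult_left_mono) auto
    then show "n t \<le> 12 / m0 * C * (b - t)" using nI[of t] by (simp add: mult.assoc)
  qed
  obtain C' t2 where C': "a < t2" "t2 \<le> b" "\<And>t. a < t \<Longrightarrow> t < t2 \<Longrightarrow> inertia m (x t) \<le> C' * (t - a)"
    using left by blast
  have nneg: "Pi t \<ge> 0" if t: "a < t" "t < b" for t
  proof -
    \<comment> \<open>The left end is treated by reversing time: the ratio Y keeps its form, while
      the Wronskian changes sign and stays monotone.\<close>
    have "- Pi (- (- t)) \<le> 0"
    proof (rule momentum_nonpos[of "- b" "- a" "\<lambda>t. Y (- t)" "\<lambda>t. - Pi (- t)" "\<lambda>t. n (- t)" "- t2" "12 / m0 * C'" "- t"])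
      show "- b < - a" using ab by simp
      show "((\<lambda>t. Y (- t)) has_real_derivative - (- Pi (- t)) / n (- t)) (at t)" if "- b < t" "t < - a" for t
      proof -
        have "a < - t" "- t < b" using that by auto
        from DERIV_chain2[OF dY[OF this] DERIV_minus[OF DERIV_ident]] show ?thesis by simp
      qed
      show "- Pi (- s) \<le> - Pi (- t)" if "- b < s" "s \<le> t" "t < - a" for s t
        using mono[of "- t" "- s"] that by simp
      show "Y (- t) > 0" "n (- t) > 0" if "- b < t" "t < - a" for t using Ypos[of "- t"] sm(6)[of "- t"] that by auto
      show "- b \<le> - t2" "- t2 < - a" using C' by auto
      show "n (- t) \<le> 12 / m0 * C' * (- a - t)" if tt: "- t2 < t" "t < - a" for t
      proof -
        have "a < - t" "- t < t2" using tt by auto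
        from C'(3)[OF this] have "12 / m0 * inertia m (x (- t)) \<le> 12 / m0 * (C' * (- t - a))"
          using m0(1) by (intro mult_left_mono) auto
        moreover have "C' * (- t - a) = C' * (- a - t)" by simp
        ultimately show ?thesis using nI[of "- t"] by (simp only: mult.assoc)
      qed
      show "- b < - t" "- t < - a" using t by auto
    qed
    then show ?thesis by simp
  qed
  have Pi0: "Pi s = 0" if "a < s" "s < b" for s using np[OF that] nneg[OF that] by simp
  \<comment> \<open>Pi vanishes identically, so its derivative does too; the nonnegative lower bound
    F W / (2 sqrt (n W)) is thereby squeezed to 0.\<close>
  obtain D where D: "(Pi has_real_derivative D) (at t)" "D \<ge> F t * W t / (2 * sqrt (n t * W t))" using dPi[OF t] by blast
  have "(Pi has_real_derivative 0) (at t)"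
  proof (rule has_field_derivative_transform_within_open)
    show "((\<lambda>_. 0) has_real_derivative 0) (at t)" by (rule DERIV_const)
    show "t \<in> {a<..<b}" using t by simp
    show "0 = Pi s" if "s \<in> {a<..<b}" for s using Pi0[of s] that by simp
  qed simp
  then have "D = 0" using D(1) DERIV_unique by blast
  then have "F t * W t / (2 * sqrt (n t * W t)) = 0" using D(2) nn[OF t] by simp
  then have "F t = 0" using sm(5,6)[OF t] by simp
  then show ?thesis by (rule sm(10)[OF t])
qed

text \<open>By energy U \<ge> - h, so one of its three terms is at least - h / 3. That pair is then
  at distance at most r0, and its inverse cube alone bounds T from below by a constant depending
  only on the masses and h.\<close>

lemma motion_interval_bound:
  assumes m: "\<And>i. m i > 0" and h: "h < 0"
  obtains L where "\<And>i j k x a b. noncollinear_motion m h i j k x a b \<Longrightarrow> b - a \<le> L"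
proof -
  obtain m0 where m0: "m0 > 0" "\<And>i. m0 \<le> m i" using mass_lower_bound[of m, OF m] by blast
  define M where "M = total_mass m"
  have mM: "m i \<le> M" for i
    unfolding M_def total_mass_def using m by (intro member_le_sum) (auto simp: less_imp_le)
  have M: "M > 0" using m[of 0] mM[of 0] by simp
  \<comment> \<open>From m l m l' / r \<ge> - h / 3 and masses at most M.\<close>
  define r0 where "r0 = 3 * (M * M) / (- h)"
  have r0: "r0 > 0" using M h by (simp add: r0_def divide_pos_neg)
  define w where "w = sqrt (m0 / r0 ^ 3)"
  have w: "w > 0" "w\<^sup>2 = m0 / r0 ^ 3" using m0 r0 by (simp_all add: w_def)
  show ?thesis
  proof (rule that[of "pi / w"])
    fix i j k x a b assume nm: "noncollinear_motion m h i j k x a b"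
    have d: "distinct [i, j, k]" using nm by (simp add: noncollinear_motion_def)
  obtain W W1 W2 n n1 n2 T F :: "real \<Rightarrow> real" where
    sm: "\<And>t. a < t \<Longrightarrow> t < b \<Longrightarrow> (W has_real_derivative W1 t) (at t)"
    "\<And>t. a < t \<Longrightarrow> t < b \<Longrightarrow> (W1 has_real_derivative W2 t) (at t)"
    "\<And>t. a < t \<Longrightarrow> t < b \<Longrightarrow> (n has_real_derivative 2 * n1 t) (at t)"
    "\<And>t. a < t \<Longrightarrow> t < b \<Longrightarrow> (n1 has_real_derivative n2 t) (at t)"
    "\<And>t. a < t \<Longrightarrow> t < b \<Longrightarrow> W t > 0" "\<And>t. a < t \<Longrightarrow> t < b \<Longrightarrow> n t > 0"
    "\<And>t. a < t \<Longrightarrow> t < b \<Longrightarrow> 2 * W t * W2 t \<le> (W1 t)\<^sup>2 - 2 * T t * (W t)\<^sup>2"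
    "\<And>t. a < t \<Longrightarrow> t < b \<Longrightarrow> 2 * n t * n2 t \<ge> 2 * (n1 t)\<^sup>2 - T t * (n t)\<^sup>2 + n t * F t"
    "\<And>t. a < t \<Longrightarrow> t < b \<Longrightarrow> F t \<ge> 0"
    "\<And>t. a < t \<Longrightarrow> t < b \<Longrightarrow> F t = 0 \<Longrightarrow> dist (x t i) (x t j) = dist (x t i) (x t k) \<and>
        dist (x t j) (x t k) = dist (x t i) (x t k)"
    "\<And>t. a < t \<Longrightarrow> t < b \<Longrightarrow> T t = (m j + m k) / dist (x t j) (x t k) ^ 3
        + (m i + m k) / dist (x t i) (x t k) ^ 3 + (m i + m j) / dist (x t i) (x t j) ^ 3"
    "\<And>t. n t \<le> 12 * ((norm (x t i))\<^sup>2 + (norm (x t j))\<^sup>2 + (norm (x t k))\<^sup>2)"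
    by (rule shape_motion[OF nm]) (rule that; assumption)
    show "b - a \<le> pi / w"
    proof (rule sqrt_area_interval_bound[of a b W W1 W2 T w, OF sm(1) sm(2) sm(5) sm(7) _ w(1)])
      fix t assume t: "a < t" "t < b"
      have N: "newton_at m x t" "energy m x t = h" using nm t by (auto simp: noncollinear_motion_def)
      have inj: "inj (x t)" by (rule newton_atD(1)[OF m N(1)])
      have "(\<Sum>i\<in>UNIV. m i * (norm (velocity x t i))\<^sup>2) \<ge> 0"
        using m by (intro sum_nonneg) (simp add: less_imp_le)
      then have U: "potential m (x t) \<ge> - h" using N(2) by (simp add: energy_def)
      define A where "A = (\<lambda>l l'. (m l + m l') / dist (x t l) (x t l') ^ 3)"
      have Ann: "A l l' \<ge> 0" for l l' using m[of l] m[of l'] by (simp add: A_def)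
      have big: "A l l' \<ge> 2 * w\<^sup>2" if l: "l \<noteq> l'" "m l * m l' / dist (x t l) (x t l') \<ge> - h / 3" for l l'
      proof -
        define r where "r = dist (x t l) (x t l')"
        have r: "r > 0" using inj l(1) by (auto simp: r_def dest: injD)
        have "- h / 3 * r \<le> m l * m l'" using l(2) r by (simp add: r_def[symmetric] pos_le_divide_eq)
        also have "\<dots> \<le> M * M" using mM m[of l] m[of l'] M by (intro mult_mono) (auto simp: less_imp_le)
        finally have "r \<le> r0" using h by (simp add: r0_def field_simps)
        then have "r ^ 3 \<le> r0 ^ 3" using r by (intro power_mono) auto
        then have "(m0 + m0) / r0 ^ 3 \<le> (m l + m l') / r ^ 3"
          using r m0 m[of l] m[of l'] by (intro frac_le add_mono) auto
        then show ?thesis by (simp add: A_def r_def w(2) add_divide_distrib)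
      qed
      have T: "T t = A j k + A i k + A i j" unfolding sm(11)[OF t] A_def ..
      have "m i * m j / dist (x t i) (x t j) \<ge> - h / 3 \<or> m i * m k / dist (x t i) (x t k) \<ge> - h / 3
          \<or> m j * m k / dist (x t j) (x t k) \<ge> - h / 3"
        using U unfolding potential_eq[OF d] by argo
      then show "T t \<ge> 2 * w\<^sup>2"
        unfolding T using big[of i j] big[of i k] big[of j k] d Ann[of i j] Ann[of i k] Ann[of j k] by auto
    qed
  qed
qed

section \<open>Motions without syzygies\<close>

lemma eventually_nhds_uminus:
  fixes t :: real
  assumes "eventually P (nhds t)"
  shows "eventually (\<lambda>s. P (- s)) (nhds (- t))"
proof -
  obtain S where S: "open S" "t \<in> S" "\<And>s. s \<in> S \<Longrightarrow> P s" using assms unfolding eventually_nhds by blast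
  have "open (uminus ` S)" using S(1) by (rule open_negations)
  moreover have "- t \<in> uminus ` S" using S(2) by simp
  moreover have "P (- s)" if "s \<in> uminus ` S" for s using S(3) that by auto
  ultimately show ?thesis unfolding eventually_nhds by blast
qed

lemma has_vector_derivative_uminus:
  assumes "(f has_vector_derivative d) (at (- t))"
  shows "((\<lambda>s. f (- s)) has_vector_derivative - d) (at t)"
proof -
  have "((\<lambda>s::real. - s) has_vector_derivative - 1) (at t)"
    by (auto intro!: derivative_eq_intros)
  from vector_diff_chain_at[OF this assms] show ?thesis by (simp add: o_def)
qed

lemma newton_at_eventually_velocity:
  assumes "newton_at m x t"
  shows "\<forall>\<^sub>F s in nhds t. ((\<lambda>r. x r i) has_vector_derivative velocity x s i) (at s)"
proof -
  obtain v where "\<forall>\<^sub>F s in nhds t. ((\<lambda>r. x r i) has_vector_derivative v s) (at s)"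
    using assms unfolding newton_at_def by blast
  then show ?thesis
    by (rule eventually_mono) (simp add: velocity_def vector_derivative_at)
qed

lemma velocity_uminus:
  assumes m: "\<And>i. m i > 0" and n: "newton_at m x (- t)"
  shows "velocity (\<lambda>s. x (- s)) t i = - velocity x (- t) i"
  unfolding velocity_def[of "\<lambda>s. x (- s)"]
  by (rule vector_derivative_at[OF has_vector_derivative_uminus[OF newton_atD(2)[OF m n]]])

lemma newton_at_uminus:
  assumes m: "\<And>i. m i > 0" and n: "newton_at m x (- t)"
  shows "newton_at m (\<lambda>s. x (- s)) t"
proof (rule newton_atI[where v = "\<lambda>i s. - velocity x (- s) i"])
  show "inj (x (- t))" by (rule newton_atD(1)[OF m n])
  fix i
  from eventually_nhds_uminus[OF newton_at_eventually_velocity[OF n, of i]]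
  have "\<forall>\<^sub>F s in nhds t. ((\<lambda>r. x r i) has_vector_derivative velocity x (- s) i) (at (- s))" by simp
  then show "\<forall>\<^sub>F s in nhds t. ((\<lambda>r. x (- r) i) has_vector_derivative - velocity x (- s) i) (at s)"
    by (rule eventually_mono) (rule has_vector_derivative_uminus)
  show "((\<lambda>s. - velocity x (- s) i) has_vector_derivative accel m (x (- t)) i) (at t)"
    using has_vector_derivative_minus[OF has_vector_derivative_uminus[OF newton_atD(3)[OF m n, of i]]] by simp
qed

text \<open>The real cube root is odd, so reversal multiplies the n-th coefficient by
  (-1)^n.\<close>

lemma regularized_uminus:
  assumes "regularized_binary_collision_at x (- t)"
  shows "regularized_binary_collision_at (\<lambda>s. x (- s)) t"
  unfolding regularized_binary_collision_at_def
proof (intro conjI allI)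
  show "card (range (x (- t))) = 2" using assms by (simp add: regularized_binary_collision_at_def)
  have "\<forall>\<^sub>F s in nhds (- t). s \<noteq> - t \<longrightarrow> inj (x s)"
    using assms by (simp add: regularized_binary_collision_at_def eventually_at_filter)
  from eventually_nhds_uminus[OF this]
  show "\<forall>\<^sub>F s in at t. inj (x (- s))" by (simp add: eventually_at_filter)
  fix i
  obtain c where "\<forall>\<^sub>F s in nhds (- t). (\<lambda>n. root 3 (s - - t) ^ n *\<^sub>R c n) sums x s i"
    using assms unfolding regularized_binary_collision_at_def by blast
  from eventually_nhds_uminus[OF this]
  have ev: "\<forall>\<^sub>F s in nhds t. (\<lambda>n. root 3 (- s - - t) ^ n *\<^sub>R c n) sums x (- s) i" by simp
  have "root 3 (- s - - t) = - root 3 (s - t)" for s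
    using real_root_minus[of 3 "s - t"] by simp
  then have "root 3 (- s - - t) ^ n *\<^sub>R c n = root 3 (s - t) ^ n *\<^sub>R ((- 1) ^ n *\<^sub>R c n)" for s n
    by (simp add: power_minus[of "root 3 (s - t)"] mult.commute)
  with ev have "\<forall>\<^sub>F s in nhds t. (\<lambda>n. root 3 (s - t) ^ n *\<^sub>R ((- 1) ^ n *\<^sub>R c n)) sums x (- s) i"
    by (simp only:)
  then show "\<exists>c. \<forall>\<^sub>F s in nhds t. (\<lambda>n. root 3 (s - t) ^ n *\<^sub>R c n) sums x (- s) i"
    by (rule exI[of _ "\<lambda>n. (- 1) ^ n *\<^sub>R c n"])
qed

lemma solution_uminus:
  assumes m: "\<And>i. m i > 0" and s: "solution m I x"
  shows "solution m (uminus ` I) (\<lambda>t. x (- t))"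
  unfolding solution_def
proof (intro conjI ballI)
  have I: "open I" "is_interval I" "I \<noteq> {}" using s by (auto simp: solution_def)
  show "open (uminus ` I)" by (rule open_negations[OF I(1)])
  show "is_interval (uminus ` I)" using I(2) by simp
  show "uminus ` I \<noteq> {}" using I(3) by simp
  fix t assume "t \<in> uminus ` I"
  then have t: "- t \<in> I" by auto
  show "(\<Sum>i\<in>UNIV. m i *\<^sub>R x (- t) i) = 0" using s t by (simp add: solution_def)
  show "newton_at m (\<lambda>t. x (- t)) t \<or> regularized_binary_collision_at (\<lambda>t. x (- t)) t"
    using s t newton_at_uminus[of m x t, OF m] regularized_uminus[of x t] by (auto simp: solution_def)
qed

lemma maximal_solution_uminus:
  assumes m: "\<And>i. m i > 0" and s: "maximal_solution m I x"
  shows "maximal_solution m (uminus ` I) (\<lambda>t. x (- t))"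
  unfolding maximal_solution_def
proof (intro conjI allI impI)
  show "solution m (uminus ` I) (\<lambda>t. x (- t))"
    using s by (intro solution_uminus m) (simp add: maximal_solution_def)
  fix I' x' assume a: "solution m I' x' \<and> uminus ` I \<subseteq> I' \<and> (\<forall>t\<in>uminus ` I. x' t = x (- t))"
  have "uminus ` I' = I"
  proof -
    have "solution m (uminus ` I') (\<lambda>t. x' (- t))" using a by (intro solution_uminus m) simp
    moreover have "I \<subseteq> uminus ` I'" using a by force
    moreover have "\<forall>t\<in>I. x' (- t) = x t" using a by simp
    ultimately show ?thesis using s unfolding maximal_solution_def by blast
  qed
  then show "I' = uminus ` I" by force
qed

text \<open>In the other case of \<open>endpoint_dichotomy\<close> the glued motion is a solution on
  a strictly larger interval, against maximality.\<close>

lemma right_end_triple_collision: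
  assumes m: "\<And>i. m i > 0" and h: "h < 0" and ab: "a < b"
    and max: "maximal_solution m {a<..<b} x"
    and newton: "\<And>t. a < t \<Longrightarrow> t < b \<Longrightarrow> newton_at m x t"
    and en: "\<And>t. a < t \<Longrightarrow> t < b \<Longrightarrow> energy m x t = h"
  shows "\<exists>C t1. a \<le> t1 \<and> t1 < b \<and> (\<forall>t. t1 < t \<and> t < b \<longrightarrow> inertia m (x t) \<le> C * (b - t))"
proof -
  have com: "(\<Sum>i\<in>UNIV. m i *\<^sub>R x t i) = 0" if "a < t" "t < b" for t
    using max that by (simp add: maximal_solution_def solution_def)
  have False if "\<exists>e>0. \<exists>x'. (\<forall>t. t < b \<longrightarrow> x' t = x t) \<and> (\<forall>t. b \<le> t \<and> t < b + e \<longrightarrow>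
      (\<Sum>i\<in>UNIV. m i *\<^sub>R x' t i) = 0 \<and> (newton_at m x' t \<or> regularized_binary_collision_at x' t))"
  proof -
    from that obtain e where e1: "e > 0" and "\<exists>x'. (\<forall>t. t < b \<longrightarrow> x' t = x t) \<and> (\<forall>t. b \<le> t \<and> t < b + e \<longrightarrow>
      (\<Sum>i\<in>UNIV. m i *\<^sub>R x' t i) = 0 \<and> (newton_at m x' t \<or> regularized_binary_collision_at x' t))"
      by blast
    then obtain x' where x': "\<forall>t. t < b \<longrightarrow> x' t = x t" "\<forall>t. b \<le> t \<and> t < b + e \<longrightarrow>
      (\<Sum>i\<in>UNIV. m i *\<^sub>R x' t i) = 0 \<and> (newton_at m x' t \<or> regularized_binary_collision_at x' t)"
      by blast
    have e2: "x' t = x t" if "t < b" for t using x'(1) that by blast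
    have e3: "(\<Sum>i\<in>UNIV. m i *\<^sub>R x' t i) = 0" "newton_at m x' t \<or> regularized_binary_collision_at x' t"
      if "b \<le> t" "t < b + e" for t using x'(2) that by blast+
    note e = e1 e2 e3
    have n': "newton_at m x' t" if "a < t" "t < b" for t
    proof (rule newton_at_cong[OF newton[OF that]])
      have "\<forall>\<^sub>F s in nhds t. s \<in> {..<b}" using that by (intro eventually_nhds_in_open) auto
      then show "\<forall>\<^sub>F s in nhds t. x' s = x s" by (rule eventually_mono) (simp add: e(2))
    qed
    have "solution m {a<..<b + e} x'"
      unfolding solution_def
    proof (intro conjI ballI)
      show "{a<..<b + e} \<noteq> {}" using ab e(1) by simp
      fix t assume t: "t \<in> {a<..<b + e}"
      show "(\<Sum>i\<in>UNIV. m i *\<^sub>R x' t i) = 0"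
        using t com[of t] e(2)[of t] e(3)[of t] by (cases "t < b") auto
      show "newton_at m x' t \<or> regularized_binary_collision_at x' t"
        using t n'[of t] e(4)[of t] by (cases "t < b") auto
    qed (auto simp: is_interval_oo)
    moreover have "{a<..<b} \<subseteq> {a<..<b + e}" using e(1) by auto
    moreover have "\<forall>t\<in>{a<..<b}. x' t = x t" using e(2) by simp
    ultimately have "{a<..<b + e} = {a<..<b}" using max unfolding maximal_solution_def by blast
    moreover have "b \<in> {a<..<b + e}" using ab e(1) by simp
    ultimately show False by simp
  qed
  with endpoint_dichotomy[of m h a b x, OF m h ab newton com en] show ?thesis by blast
qed

lemma left_end_triple_collision:
  assumes m: "\<And>i. m i > 0" and h: "h < 0" and ab: "a < b"
    and max: "maximal_solution m {a<..<b} x"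
    and newton: "\<And>t. a < t \<Longrightarrow> t < b \<Longrightarrow> newton_at m x t"
    and en: "\<And>t. a < t \<Longrightarrow> t < b \<Longrightarrow> energy m x t = h"
  shows "\<exists>C t1. a < t1 \<and> t1 \<le> b \<and> (\<forall>t. a < t \<and> t < t1 \<longrightarrow> inertia m (x t) \<le> C * (t - a))"
proof -
  have "\<exists>C t1. - b \<le> t1 \<and> t1 < - a \<and> (\<forall>t. t1 < t \<and> t < - a \<longrightarrow> inertia m (x (- t)) \<le> C * (- a - t))"
  proof (rule right_end_triple_collision[of m h "- b" "- a" "\<lambda>t. x (- t)", OF m h])
    show "- b < - a" using ab by simp
    have "uminus ` {a<..<b} = {- b<..<- a}" by (rule image_uminus_greaterThanLessThan)
    with maximal_solution_uminus[of m, OF m max] show "maximal_solution m {- b<..<- a} (\<lambda>t. x (- t))" by simp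
    fix t assume "- b < t" "t < - a"
    then have t: "a < - t" "- t < b" by auto
    note n = newton[OF t]
    show "newton_at m (\<lambda>t. x (- t)) t" by (rule newton_at_uminus[of m, OF m n])
    show "energy m (\<lambda>t. x (- t)) t = h"
      using en[OF t] unfolding energy_def velocity_uminus[of m, OF m n] by simp
  qed
  then obtain C t1 where C: "- b \<le> t1" "t1 < - a"
    "\<And>t. t1 < t \<Longrightarrow> t < - a \<Longrightarrow> inertia m (x (- t)) \<le> C * (- a - t)" by blast
  have "inertia m (x t) \<le> C * (t - a)" if "a < t" "t < - t1" for t
    using C(3)[of "- t"] that by (simp add: algebra_simps)
  with C show ?thesis by (intro exI[of _ C] exI[of _ "- t1"]) auto
qed

section \<open>From equilateral shape to homothety\<close>

lemma triple_collision_of_inertia: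
  assumes m: "\<And>i. m i > 0" and le: "\<forall>\<^sub>F t in F. inertia m (x t) \<le> g t" and g: "(g \<longlongrightarrow> 0) F"
  shows "triple_collision x F"
  unfolding triple_collision_def
proof (intro exI[of _ 0] allI)
  fix i
  have le': "m i * (norm (x t i))\<^sup>2 \<le> inertia m (x t)" for t
    unfolding inertia_def using m
    by (intro member_le_sum[of i UNIV "\<lambda>i. m i * (norm (x t i))\<^sup>2"]) (auto simp: less_imp_le)
  have "((\<lambda>t. (norm (x t i))\<^sup>2) \<longlongrightarrow> 0) F"
  proof (rule tendsto_sandwich[OF _ _ tendsto_const])
    show "((\<lambda>t. g t / m i) \<longlongrightarrow> 0) F" using tendsto_divide[OF g tendsto_const[of "m i"]] m[of i] by simp
    show "\<forall>\<^sub>F t in F. (norm (x t i))\<^sup>2 \<le> g t / m i"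
      using le
    proof (rule eventually_mono)
      fix t assume "inertia m (x t) \<le> g t"
      then have "(norm (x t i))\<^sup>2 * m i \<le> g t" using le'[of t] by (simp add: mult.commute)
      then show "(norm (x t i))\<^sup>2 \<le> g t / m i" using m[of i] by (simp add: pos_le_divide_eq)
    qed
  qed simp
  then have "((\<lambda>t. sqrt ((norm (x t i))\<^sup>2)) \<longlongrightarrow> sqrt 0) F" by (rule tendsto_real_sqrt)
  then show "((\<lambda>t. x t i) \<longlongrightarrow> 0) F" by (simp add: tendsto_norm_zero_iff)
qed

lemma collinear_of_wedge:
  assumes d: "distinct [i, j, k]" and w: "wedge (q k - q j) (q i - q k) = 0"
  shows "collinear (range (q :: config))"
proof -
  define u v where "u = q k - q j" and "v = q i - q k"
  have q: "q j = q k - u" "q i = q k + v" by (simp_all add: u_def v_def)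
  have "range q = q ` {i, j, k}" unfolding UNIV_three[OF d] ..
  then have r: "range q = {q i, q j, q k}" by simp
  show ?thesis
  proof (cases "u = 0")
    case True
    then have "range q = {q i, q k}" using r q by auto
    then show ?thesis by simp
  next
    case False
    have w': "u $ 1 * v $ 2 = u $ 2 * v $ 1" using w by (simp add: wedge_def u_def v_def)
    have "\<exists>c. v = c *\<^sub>R u"
    proof (cases "u $ 1 = 0")
      case True
      then have "u $ 2 \<noteq> 0" using False by (auto simp: vec_eq_iff forall_2)
      with True w' show ?thesis by (intro exI[of _ "v $ 2 / u $ 2"]) (auto simp: vec_eq_iff forall_2)
    next
      case False
      with w' show ?thesis by (intro exI[of _ "v $ 1 / u $ 1"]) (auto simp: vec_eq_iff forall_2 field_simps)
    qed
    then obtain c where c: "v = c *\<^sub>R u" by blast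
    show ?thesis
      unfolding collinear_alt
    proof (rule exI[of _ "q k"], rule exI[of _ u], rule ballI)
      fix y assume "y \<in> range q"
      then consider "y = q k" | "y = q j" | "y = q i" using r by auto
      then show "\<exists>c. y = q k + c *\<^sub>R u"
      proof cases
        case 1 then show ?thesis by (intro exI[of _ 0]) simp
      next
        case 2 then show ?thesis by (intro exI[of _ "- 1"]) (simp add: q)
      next
        case 3 then show ?thesis by (intro exI[of _ c]) (simp add: q c)
      qed
    qed
  qed
qed

text \<open>On a line the largest of three mutual distances is the sum of the other two, so the
  three cannot be equal and positive.\<close>

lemma equilateral_not_collinear:
  assumes "equilateral q"
  shows "\<not> collinear (range q)"
proof
  assume "collinear (range q)"
  then obtain u v where uv: "\<forall>x\<in>range q. \<exists>c. x = u + c *\<^sub>R v" unfolding collinear_alt by blast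
  then have "\<forall>l. \<exists>c. q l = u + c *\<^sub>R v" by blast
  then obtain c where c: "\<And>l. q l = u + c l *\<^sub>R v" by metis
  obtain d where d: "d > 0" "\<And>i j. i \<noteq> j \<Longrightarrow> dist (q i) (q j) = d" using assms unfolding equilateral_def by blast
  have cd: "\<bar>c i - c j\<bar> * norm v = d" if "i \<noteq> j" for i j
    using d(2)[OF that] by (simp add: c dist_norm scaleR_diff_left[symmetric])
  obtain i j k :: 3 where "distinct [i, j, k]" by (rule three_labels)
  then have ne: "i \<noteq> j" "i \<noteq> k" "j \<noteq> k" by auto
  have v: "norm v > 0" using cd[OF ne(1)] d(1) by (cases "norm v = 0") auto
  then have "\<bar>c i - c j\<bar> = d / norm v" "\<bar>c i - c k\<bar> = d / norm v" "\<bar>c j - c k\<bar> = d / norm v"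
    using cd[OF ne(1)] cd[OF ne(2)] cd[OF ne(3)] by (simp_all add: eq_divide_eq)
  moreover have "d / norm v > 0" using v d(1) by simp
  ultimately show False by linarith
qed

lemma newton_of_noncollinear:
  assumes sol: "solution m I x" and t: "t \<in> I" and nc: "\<not> collinear (range (x t))"
  shows "newton_at m x t"
proof -
  have "\<not> regularized_binary_collision_at x t"
  proof
    assume "regularized_binary_collision_at x t"
    then have "card (range (x t)) = 2" by (simp add: regularized_binary_collision_at_def)
    then obtain p q where "range (x t) = {p, q}" by (auto simp: card_2_iff)
    then show False using nc by simp
  qed
  then show ?thesis using sol t by (auto simp: solution_def)
qed

lemma config_eq_of_edges:
  fixes y z :: config
  assumes m: "\<And>i. m i > 0" and d: "distinct [i, j, k]"
    and com: "(\<Sum>l\<in>UNIV. m l *\<^sub>R y l) = 0" "(\<Sum>l\<in>UNIV. m l *\<^sub>R z l) = 0"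
    and e: "y k - y j = z k - z j" "y i - y k = z i - z k"
  shows "y = z"
proof -
  define u where "u = y k - z k"
  have yz: "y k = z k + u" "y j = z j + u" "y i = z i + u"
    using e by (simp_all add: u_def algebra_simps)
  have "(m i + m j + m k) *\<^sub>R u = 0"
    using com unfolding sum_three[OF d] yz by (simp add: scaleR_add_left scaleR_add_right algebra_simps)
  moreover have "m i + m j + m k > 0" using m[of i] m[of j] m[of k] by simp
  ultimately have "u = 0" by simp
  then have "y l = z l" if "l \<in> {i, j, k}" for l using yz that by auto
  then show ?thesis using UNIV_three[OF d] by (metis UNIV_I ext)
qed

text \<open>Rotation by 120 degrees, which takes an edge of a positively oriented equilateral
  triangle to the next one.\<close>

definition rot :: "plane \<Rightarrow> plane" where
  "rot u = (\<chi> n. if n = 1 then - u $ 1 / 2 - sqrt 3 / 2 * u $ 2 else sqrt 3 / 2 * u $ 1 - u $ 2 / 2)"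

lemma rot_nth: "rot u $ 1 = - u $ 1 / 2 - sqrt 3 / 2 * u $ 2" "rot u $ 2 = sqrt 3 / 2 * u $ 1 - u $ 2 / 2"
  by (simp_all add: rot_def)

lemma linear_rot: "linear rot"
  by (rule linearI) (simp_all add: vec_eq_iff forall_2 rot_nth algebra_simps add_divide_distrib diff_divide_distrib)

text \<open>Rotations preserve the wedge; u + \<open>rot\<close> u is u turned by 60 degrees, as 1 +
  \<omega> = - \<omega>^2 for a primitive third root of unity.\<close>

lemma wedge_rot: "wedge (rot u) (rot v) = wedge u v" "wedge (u + rot u) (v + rot v) = wedge u v"
proof -
  define s where "s = sqrt 3 / (2::real)"
  have s: "s * s = 3 / 4" by (simp add: s_def)
  show "wedge (rot u) (rot v) = wedge u v" "wedge (u + rot u) (v + rot v) = wedge u v"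
    unfolding wedge_def vector_add_component rot_nth s_def[symmetric] using s by algebra+
qed

text \<open>The three lengths give the inner product - r^2 / 2, the sign of the wedge then gives its
  value sqrt 3 / 2 r^2, and these two numbers determine v from u.\<close>

lemma equilateral_rot:
  assumes "norm u = r" "norm v = r" "norm (u + v) = r" "wedge u v > 0"
  shows "v = rot u"
proof -
  have n: "u $ 1 * u $ 1 + u $ 2 * u $ 2 = r * r" "v $ 1 * v $ 1 + v $ 2 * v $ 2 = r * r"
    "(u $ 1 + v $ 1) * (u $ 1 + v $ 1) + (u $ 2 + v $ 2) * (u $ 2 + v $ 2) = r * r"
    using assms(1-3) dot_square_norm[of u] dot_square_norm[of v] dot_square_norm[of "u + v"]
    by (simp_all add: inner_plane power2_eq_square)
  have dot: "u $ 1 * v $ 1 + u $ 2 * v $ 2 = - (r * r) / 2" using n by (simp add: algebra_simps)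
  define s where "s = sqrt 3 / (2::real)"
  have s: "s * s = 3 / 4" "s > 0" by (simp_all add: s_def)
  have w2: "wedge u v * wedge u v = (s * (r * r)) * (s * (r * r))"
  proof -
    have "wedge u v * wedge u v = (u $ 1 * u $ 1 + u $ 2 * u $ 2) * (v $ 1 * v $ 1 + v $ 2 * v $ 2)
        - (u $ 1 * v $ 1 + u $ 2 * v $ 2) * (u $ 1 * v $ 1 + u $ 2 * v $ 2)"
      unfolding wedge_def by algebra
    also have "\<dots> = (r * r) * (r * r) * (3 / 4)" unfolding n dot by simp
    finally show ?thesis using s(1) by algebra
  qed
  have "s * (r * r) \<ge> 0" using s(2) by simp
  with w2 assms(4) have w: "wedge u v = s * (r * r)"
    by (metis abs_of_nonneg abs_of_pos real_sqrt_abs2)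
  have r: "r * r \<noteq> 0"
  proof
    assume "r * r = 0"
    with w show False using assms(4) by simp
  qed
  have "r * r * v $ 1 = r * r * (- u $ 1 / 2 - s * u $ 2)" "r * r * v $ 2 = r * r * (s * u $ 1 - u $ 2 / 2)"
  proof -
    have "r * r * v $ 1 = (u $ 1 * v $ 1 + u $ 2 * v $ 2) * u $ 1 - wedge u v * u $ 2"
      unfolding n(1)[symmetric] wedge_def by algebra
    then show "r * r * v $ 1 = r * r * (- u $ 1 / 2 - s * u $ 2)" unfolding dot w by (simp add: algebra_simps)
    have "r * r * v $ 2 = (u $ 1 * v $ 1 + u $ 2 * v $ 2) * u $ 2 + wedge u v * u $ 1"
      unfolding n(1)[symmetric] wedge_def by algebra
    then show "r * r * v $ 2 = r * r * (s * u $ 1 - u $ 2 / 2)" unfolding dot w by (simp add: algebra_simps)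
  qed
  then have "v $ 1 = - u $ 1 / 2 - s * u $ 2" "v $ 2 = s * u $ 1 - u $ 2 / 2"
    using r by (simp_all only: mult_cancel_left simp_thms)
  then show ?thesis by (simp add: vec_eq_iff forall_2 rot_nth s_def)
qed

text \<open>The velocity is parallel to e, so each component of e / |e| has derivative 0.\<close>

lemma fixed_direction:
  fixes e f :: "real \<Rightarrow> plane"
  assumes der: "\<And>t. a < t \<Longrightarrow> t < b \<Longrightarrow> (e has_vector_derivative f t) (at t)"
    and nz: "\<And>t. a < t \<Longrightarrow> t < b \<Longrightarrow> e t \<noteq> 0"
    and w: "\<And>t. a < t \<Longrightarrow> t < b \<Longrightarrow> wedge (e t) (f t) = 0"
    and s: "a < s" "s < b" and t: "a < t" "t < b"
  shows "e t = (norm (e t) / norm (e s)) *\<^sub>R e s"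
proof -
  have c: "e t $ n / norm (e t) = e s $ n / norm (e s)" for n
  proof (rule DERIV_isconst3[of a b t s "\<lambda>t. e t $ n / norm (e t)"])
    show "a < b" using s by simp
    show "t \<in> {a<..<b}" "s \<in> {a<..<b}" using s t by auto
    fix z assume "z \<in> {a<..<b}"
    then have z: "a < z" "z < b" by auto
    have nn: "norm (e z) \<noteq> 0" using nz[OF z] by simp
    have "f z $ n * (norm (e z) * norm (e z)) = e z $ n * (e z \<bullet> f z)"
    proof -
      have "norm (e z) * norm (e z) = e z $ 1 * e z $ 1 + e z $ 2 * e z $ 2"
        using dot_square_norm[of "e z"] by (simp add: inner_plane power2_eq_square)
      moreover have "e z $ 1 * f z $ 2 = e z $ 2 * f z $ 1" using w[OF z] by (simp add: wedge_def)
      ultimately have "f z $ 1 * (norm (e z) * norm (e z)) = e z $ 1 * (e z $ 1 * f z $ 1 + e z $ 2 * f z $ 2)"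
        "f z $ 2 * (norm (e z) * norm (e z)) = e z $ 2 * (e z $ 1 * f z $ 1 + e z $ 2 * f z $ 2)"
        by algebra+
      then show ?thesis unfolding inner_plane using exhaust_2[of n] by metis
    qed
    then have "(f z $ n * norm (e z) - e z $ n * ((e z \<bullet> f z) / norm (e z))) / (norm (e z) * norm (e z)) = 0"
      using nn by (simp add: field_simps)
    then show "((\<lambda>t. e t $ n / norm (e t)) has_real_derivative 0) (at z)"
      by (rule DERIV_cong[OF DERIV_divide[OF has_real_derivative_vec_nth[OF der[OF z], of n]
              has_real_derivative_norm[OF der[OF z] nz[OF z]] nn]])
  qed
  have nn: "norm (e t) \<noteq> 0" using nz[OF t] by simp
  have "e t $ n = norm (e t) / norm (e s) * e s $ n" for n
    using c[of n] nn by (simp add: field_simps)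
  then show ?thesis by (simp add: vec_eq_iff)
qed

lemma no_syzygy_imp_homothety:
  assumes m: "\<And>i. m i > 0" and h: "h < 0"
    and max: "maximal_solution m I x" and J: "zero_angular_momentum m I x" and E: "has_energy m h I x"
    and nosyz: "\<not> has_syzygy I x"
  shows "lagrange_homothety I x"
proof -
  have sol: "solution m I x" using max by (simp add: maximal_solution_def)
  have I: "open I" "is_interval I" "I \<noteq> {}"
    and com: "\<And>t. t \<in> I \<Longrightarrow> (\<Sum>i\<in>UNIV. m i *\<^sub>R x t i) = 0" using sol by (auto simp: solution_def)
  have nc: "\<not> collinear (range (x t))" if "t \<in> I" for t using nosyz that by (auto simp: has_syzygy_def)
  have newton: "newton_at m x t" if t: "t \<in> I" for t
    by (rule newton_of_noncollinear[OF sol t nc[OF t]])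
  have inj: "inj (x t)" if "t \<in> I" for t by (rule newton_atD(1)[OF m newton[OF that]])
  have en: "energy m x t = h" and am: "angular_momentum m x t = 0" if "t \<in> I" for t
    using E J inj[OF that] that by (auto simp: has_energy_def zero_angular_momentum_def)
  obtain i0 j0 k0 :: 3 where d0: "distinct [i0, j0, k0]" by (rule three_labels)
  obtain i j k where d: "distinct [i, j, k]"
    and W: "\<And>t. t \<in> I \<Longrightarrow> wedge (x t k - x t j) (x t i - x t k) > 0"
  proof -
    \<comment> \<open>Without syzygies the signed area is continuous and nowhere zero on an
      interval, hence of constant sign.\<close>
    define w where "w = (\<lambda>t. wedge (x t k0 - x t j0) (x t i0 - x t k0))"
    have w0: "w t \<noteq> 0" if "t \<in> I" for t using nc[OF that] collinear_of_wedge[OF d0, of "x t"] by (auto simp: w_def)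
    have "continuous_on I w"
    proof (rule continuous_at_imp_continuous_on, rule ballI)
      fix t assume "t \<in> I"
      note n = newton_atD(2)[OF m newton[OF this]]
      show "isCont w t" unfolding w_def
        by (rule DERIV_isCont[OF has_real_derivative_wedge[OF has_vector_derivative_diff[OF n n] has_vector_derivative_diff[OF n n]]])
    qed
    then have conn: "connected (w ` I)" using I(2) by (intro connected_continuous_image is_interval_connected)
    have sign: False if "s \<in> I" "t \<in> I" "w s < 0" "w t > 0" for s t
    proof -
      have "0 \<in> w ` I" by (rule connectedD_interval[OF conn, of "w s" "w t"]) (use that in auto)
      then show False using w0 by auto
    qed
    show ?thesis
    proof (cases "\<exists>t\<in>I. w t > 0")
      case True
      then have "w t > 0" if "t \<in> I" for t using sign w0[OF that] that by force
      then show ?thesis using that[OF d0] by (simp add: w_def)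
    next
      case False
      \<comment> \<open>Exchanging two labels reverses the sign of the area.\<close>
      have "wedge (x t k0 - x t i0) (x t j0 - x t k0) > 0" if "t \<in> I" for t
      proof -
        have "wedge (x t k0 - x t i0) (x t j0 - x t k0) = - w t" unfolding w_def wedge_def by (simp add: algebra_simps)
        then show ?thesis using False w0[OF that] that by force
      qed
      moreover have "distinct [j0, i0, k0]" using d0 by auto
      ultimately show ?thesis using that by blast
    qed
  qed
  obtain L where L: "\<And>i j k x a b. noncollinear_motion m h i j k x a b \<Longrightarrow> b - a \<le> L"
    using motion_interval_bound[of m h, OF m h] by blast
  have mem: "t \<in> I" if "s \<in> I" "u \<in> I" "s \<le> t" "t \<le> u" for s t u
    using I(2) that unfolding is_interval_1 by blast
  have nmI: "noncollinear_motion m h i j k x a b" if "{a<..<b} \<subseteq> I" for a b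
    unfolding noncollinear_motion_def using m d newton com am en W that by (auto simp: subset_iff)
  \<comment> \<open>The bound L is independent of the interval, so it applies between any two points
    of I and shows that I is bounded.\<close>
  have bd: "u - s \<le> L" if "s \<in> I" "u \<in> I" for s u
    by (rule L[OF nmI]) (use mem[OF that] in auto)
  obtain t0 where t0: "t0 \<in> I" using I(3) by blast
  have ba: "bdd_above I" "bdd_below I"
    using bd[OF t0] bd[OF _ t0] by (auto intro!: bdd_aboveI[of _ "t0 + L"] bdd_belowI[of _ "t0 - L"] simp: algebra_simps)
  define a b where "a = Inf I" and "b = Sup I"
  have Iab: "I = {a<..<b}"
  proof (intro equalityI subsetI)
    fix t assume t: "t \<in> I"
    then obtain e where e: "e > 0" "ball t e \<subseteq> I" using I(1) open_contains_ball by blast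
    have "t - e / 2 \<in> I" "t + e / 2 \<in> I" using e by (auto simp: subset_iff dist_real_def)
    then have "a \<le> t - e / 2" "t + e / 2 \<le> b" using ba by (auto simp: a_def b_def intro: cInf_lower cSup_upper)
    then show "t \<in> {a<..<b}" using e(1) by auto
  next
    fix t assume "t \<in> {a<..<b}"
    then have "Inf I < t" "t < Sup I" by (auto simp: a_def b_def)
    then obtain s u where "s \<in> I" "s < t" "u \<in> I" "t < u"
      using cInf_lessD[OF I(3)] less_cSupD[OF I(3)] by metis
    then show "t \<in> I" using mem[of s u t] by simp
  qed
  have ab: "a < b" using t0 Iab by auto
  have tI: "t \<in> I" if "a < t" "t < b" for t using that Iab by simp
  note max' = max[unfolded Iab]
  note right = right_end_triple_collision[of m h a b x, OF m h ab max' newton[OF tI] en[OF tI]]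
  note left = left_end_triple_collision[of m h a b x, OF m h ab max' newton[OF tI] en[OF tI]]
  have nm: "noncollinear_motion m h i j k x a b" by (rule nmI) (simp add: Iab)
  have eq: "dist (x t i) (x t j) = dist (x t i) (x t k)" "dist (x t j) (x t k) = dist (x t i) (x t k)"
    if "a < t" "t < b" for t
    using equilateral_of_collisions[OF nm ab right left that] by auto
  define r where "r = (\<lambda>t. dist (x t i) (x t k))"
  have rpos: "r t > 0" if "a < t" "t < b" for t using inj[OF tI[OF that]] d by (auto simp: r_def dest: injD)
  have equi: "equilateral (x t)" if t: "t \<in> I" for t
    unfolding equilateral_def
  proof (intro exI conjI allI impI)
    have t': "a < t" "t < b" using t Iab by auto
    show "r t > 0" by (rule rpos[OF t'])
    fix l l' :: 3 assume ne: "l \<noteq> l'"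
    have "l \<in> {i, j, k}" "l' \<in> {i, j, k}" using UNIV_three[OF d] by auto
    then show "dist (x t l) (x t l') = r t" using ne eq[OF t'] unfolding r_def by (auto simp: dist_commute)
  qed
  have tcr: "triple_collision x (at_left b)"
  proof -
    obtain C t1 where C: "t1 < b" "\<And>t. t1 < t \<Longrightarrow> t < b \<Longrightarrow> inertia m (x t) \<le> C * (b - t)" using right by blast
    have "((\<lambda>t. C * (b - t)) \<longlongrightarrow> C * (b - b)) (at_left b)" by (intro tendsto_intros)
    moreover have "\<forall>\<^sub>F t in at_left b. inertia m (x t) \<le> C * (b - t)"
      unfolding eventually_at_left[OF C(1)] using C by blast
    ultimately show ?thesis by (intro triple_collision_of_inertia[of m, OF m]) auto
  qed
  have tcl: "triple_collision x (at_right a)"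
  proof -
    obtain C t1 where C: "a < t1" "\<And>t. a < t \<Longrightarrow> t < t1 \<Longrightarrow> inertia m (x t) \<le> C * (t - a)" using left by blast
    have "((\<lambda>t. C * (t - a)) \<longlongrightarrow> C * (a - a)) (at_right a)" by (intro tendsto_intros)
    moreover have "\<forall>\<^sub>F t in at_right a. inertia m (x t) \<le> C * (t - a)"
      unfolding eventually_at_right[OF C(1)] using C by blast
    ultimately show ?thesis by (intro triple_collision_of_inertia[of m, OF m]) auto
  qed
  define e1 f1 where "e1 = (\<lambda>t. x t k - x t j)" and "f1 = (\<lambda>t. velocity x t k - velocity x t j)"
  define e2 f2 where "e2 = (\<lambda>t. x t i - x t k)" and "f2 = (\<lambda>t. velocity x t i - velocity x t k)"
  have ne1: "norm (e1 t) = r t" and e2: "e2 t = rot (e1 t)" if "a < t" "t < b" for t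
  proof -
    show n1: "norm (e1 t) = r t" using eq(2)[OF that] by (simp add: e1_def r_def dist_norm norm_minus_commute)
    have s: "e1 t + e2 t = x t i - x t j" by (simp add: e1_def e2_def)
    have n3: "norm (e1 t + e2 t) = r t" unfolding s using eq(1)[OF that] by (simp add: r_def dist_norm)
    show "e2 t = rot (e1 t)"
      by (rule equilateral_rot[OF n1 _ n3]) (use W[OF tI[OF that]] in \<open>simp_all add: e1_def e2_def r_def dist_norm\<close>)
  qed
  have de: "(e1 has_vector_derivative f1 t) (at t)" "(e2 has_vector_derivative f2 t) (at t)" if "a < t" "t < b" for t
    unfolding e1_def e2_def f1_def f2_def
    by (intro has_vector_derivative_diff newton_atD(2)[OF m newton[OF tI[OF that]]])+
  have f2: "f2 t = rot (f1 t)" if t: "a < t" "t < b" for t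
  proof -
    have "bounded_linear rot" using linear_rot by (simp add: linear_conv_bounded_linear)
    then have "((\<lambda>t. rot (e1 t)) has_vector_derivative rot (f1 t)) (at t)"
      using de(1)[OF t] by (rule bounded_linear.has_vector_derivative)
    then have "(e2 has_vector_derivative rot (f1 t)) (at t)"
      by (rule has_vector_derivative_transform_within_open[of _ _ _ "{a<..<b}"]) (use t e2 in auto)
    then show ?thesis using de(2)[OF t] by (rule vector_derivative_unique_at[symmetric])
  qed
  have w0: "wedge (e1 t) (f1 t) = 0" if t: "a < t" "t < b" for t
  proof -
    have v: "(\<Sum>l\<in>UNIV. m l *\<^sub>R velocity x t l) = 0"
      by (rule sum_velocity_zero[of m a t b x, OF m t newton[OF tI[OF t]] com[OF tI]])
    have s: "x t i - x t j = e1 t + rot (e1 t)" "velocity x t i - velocity x t j = f1 t + rot (f1 t)"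
      unfolding e2[OF t, symmetric] f2[OF t, symmetric] by (simp_all add: e1_def e2_def f1_def f2_def)
    have s2: "x t i - x t k = rot (e1 t)" "velocity x t i - velocity x t k = rot (f1 t)"
      unfolding e2[OF t, symmetric] f2[OF t, symmetric] by (simp_all add: e2_def f2_def)
    \<comment> \<open>All edges are rotations of e1 and their velocities rotate along, so the three
      wedges coincide and zero angular momentum forces the common value to be 0.\<close>
    have "m j * m k * wedge (e1 t) (f1 t) + m i * m k * wedge (e1 t) (f1 t) + m i * m j * wedge (e1 t) (f1 t) = 0"
      using angular_momentum_edges[of i j k m "x t" "velocity x t", OF d com[OF tI[OF t]] v] am[OF tI[OF t]]
      unfolding s s2 wedge_rot angular_momentum_def by (simp add: e1_def f1_def)
    then have "(m j * m k + m i * m k + m i * m j) * wedge (e1 t) (f1 t) = 0" by (simp only: distrib_right)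
    moreover have "m j * m k + m i * m k + m i * m j > 0" using m by (intro add_pos_pos mult_pos_pos)
    ultimately show ?thesis by simp
  qed
  have nz: "e1 t \<noteq> 0" if "a < t" "t < b" for t using ne1[OF that] rpos[OF that] by auto
  have t0': "a < t0" "t0 < b" using t0 Iab by auto
  have hom: "x t l = r t *\<^sub>R ((1 / r t0) *\<^sub>R x t0 l)" if t: "a < t" "t < b" for t l
  proof -
    define c where "c = r t / r t0"
    have e1c: "e1 t = c *\<^sub>R e1 t0"
      using fixed_direction[of a b e1 f1, OF de(1) nz w0 t0' t] ne1[OF t] ne1[OF t0'] by (simp add: c_def)
    then have e2c: "e2 t = c *\<^sub>R e2 t0" unfolding e2[OF t] e2[OF t0'] using linear_cmul[OF linear_rot] by simp
    have "x t = (\<lambda>l. c *\<^sub>R x t0 l)"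
    proof (rule config_eq_of_edges[of m i j k, OF m d com[OF tI[OF t]]])
      have "(\<Sum>l\<in>UNIV. m l *\<^sub>R c *\<^sub>R x t0 l) = c *\<^sub>R (\<Sum>l\<in>UNIV. m l *\<^sub>R x t0 l)"
        unfolding scaleR_sum_right by (rule sum.cong) (simp_all add: mult.commute)
      then show "(\<Sum>l\<in>UNIV. m l *\<^sub>R c *\<^sub>R x t0 l) = 0" using com[OF t0] by simp
      show "x t k - x t j = c *\<^sub>R x t0 k - c *\<^sub>R x t0 j" using e1c by (simp add: e1_def scaleR_diff_right)
      show "x t i - x t k = c *\<^sub>R x t0 i - c *\<^sub>R x t0 k" using e2c by (simp add: e2_def scaleR_diff_right)
    qed
    then have "x t l = c *\<^sub>R x t0 l" by (rule fun_cong)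
    then show ?thesis by (simp add: c_def)
  qed
  show ?thesis
    unfolding lagrange_homothety_def
  proof (intro conjI)
    show "\<exists>a b. a < b \<and> I = {a<..<b} \<and> triple_collision x (at_right a) \<and> triple_collision x (at_left b)"
      using ab Iab tcl tcr by blast
    show "\<forall>t\<in>I. equilateral (x t)" using equi by blast
    show "\<exists>q \<rho>. \<forall>t\<in>I. \<rho> t > 0 \<and> (\<forall>i. x t i = \<rho> t *\<^sub>R q i)"
      using hom rpos unfolding Iab by (intro exI[of _ "\<lambda>l. (1 / r t0) *\<^sub>R x t0 l"] exI[of _ r]) auto
  qed
qed

section \<open>The homothetic solutions\<close>

definition unit_equilateral :: "(3 \<Rightarrow> real) \<Rightarrow> config \<Rightarrow> bool" where
  "unit_equilateral m q \<longleftrightarrow> (\<Sum>i\<in>UNIV. m i *\<^sub>R q i) = 0 \<and> (\<forall>i j. i \<noteq> j \<longrightarrow> dist (q i) (q j) = 1)"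

definition pair_mass :: "(3 \<Rightarrow> real) \<Rightarrow> real" where
  "pair_mass m = (\<Sum>(i, j)\<in>{(i, j). i < j}. m i * m j)"

text \<open>With equal distances the inverse cubes factor out, and the remaining weighted sum of
  differences points to the center of mass.\<close>

lemma accel_equilateral:
  assumes com: "(\<Sum>i\<in>UNIV. m i *\<^sub>R q i) = 0" and d: "\<And>i j. i \<noteq> j \<Longrightarrow> dist (q i) (q j) = d"
  shows "accel m q i = (- (total_mass m / d ^ 3)) *\<^sub>R q i"
proof -
  have "accel m q i = (\<Sum>j\<in>UNIV - {i}. (1 / d ^ 3) *\<^sub>R (m j *\<^sub>R (q j - q i)))"
    unfolding accel_def
  proof (rule sum.cong[OF refl])
    fix j assume "j \<in> UNIV - {i}"
    then have "norm (q j - q i) = d" using d[of j i] by (simp add: dist_norm)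
    then show "m j *\<^sub>R grav (q j - q i) = (1 / d ^ 3) *\<^sub>R (m j *\<^sub>R (q j - q i))"
      by (simp add: grav_def inverse_eq_divide)
  qed
  also have "\<dots> = (\<Sum>j\<in>UNIV. (1 / d ^ 3) *\<^sub>R (m j *\<^sub>R (q j - q i)))"
    by (rule sum.mono_neutral_left) auto
  also have "\<dots> = (1 / d ^ 3) *\<^sub>R ((\<Sum>j\<in>UNIV. m j *\<^sub>R q j) - (\<Sum>j\<in>UNIV. m j) *\<^sub>R q i)"
    by (simp add: scaleR_sum_right scaleR_diff_right sum_subtractf scaleR_sum_left)
  finally show ?thesis unfolding com by (simp add: total_mass_def)
qed

lemma potential_equilateral:
  assumes d: "\<And>i j. i \<noteq> j \<Longrightarrow> dist (q i) (q j) = d"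
  shows "potential m q = pair_mass m / d"
  unfolding potential_def pair_mass_def sum_divide_distrib
proof (rule sum.cong[OF refl])
  fix p :: "3 \<times> 3" assume "p \<in> {(i, j). i < j}"
  then obtain i j where p: "p = (i, j)" "i < j" by (cases p) auto
  then show "(case p of (i, j) \<Rightarrow> m i * m j / dist (q i) (q j)) = (case p of (i, j) \<Rightarrow> m i * m j) / d"
    using d[OF less_imp_neq[OF p(2)]] by simp
qed

text \<open>Euler's identity for the potential, combined with the central force just computed,
  relates inertia and potential at side length 1.\<close>

lemma inertia_unit_equilateral:
  assumes "unit_equilateral m q"
  shows "total_mass m * inertia m q = pair_mass m"
proof -
  have q: "(\<Sum>i\<in>UNIV. m i *\<^sub>R q i) = 0" "\<And>i j. i \<noteq> j \<Longrightarrow> dist (q i) (q j) = 1"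
    using assms by (auto simp: unit_equilateral_def)
  have "- potential m q = (\<Sum>i\<in>UNIV. m i * (q i \<bullet> accel m q i))" by (rule sum_inner_accel[symmetric])
  also have "\<dots> = (\<Sum>i\<in>UNIV. - total_mass m * (m i * (norm (q i))\<^sup>2))"
    by (rule sum.cong) (simp_all add: accel_equilateral[of m q 1, OF q] dot_square_norm)
  also have "\<dots> = - (total_mass m * inertia m q)"
    unfolding sum_distrib_left[symmetric] by (simp add: inertia_def)
  finally show ?thesis by (simp add: potential_equilateral[of q 1, OF q(2)])
qed

lemma pair_mass_pos:
  assumes m: "\<And>i. m i > 0"
  shows "pair_mass m > 0"
  unfolding pair_mass_def
proof (rule sum_pos)
  have "(0::3) < 1 \<or> (1::3) < 0" using neq_iff[of "0::3" 1] by simp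
  then have "(0, 1) \<in> {(i, j). i < (j :: 3)} \<or> (1, 0) \<in> {(i, j). i < (j :: 3)}" by simp
  then show "{(i, j). i < (j :: 3)} \<noteq> {}" by blast
qed (use m in auto)

lemma total_mass_pos:
  assumes m: "\<And>i. m i > 0"
  shows "total_mass m > 0"
  unfolding total_mass_def using m by (intro sum_pos) auto

lemma dist_plane: "dist u v = sqrt ((u $ 1 - v $ 1)\<^sup>2 + (u $ 2 - v $ 2)\<^sup>2)" for u v :: plane
  by (simp add: dist_norm norm_eq_sqrt_inner inner_plane power2_eq_square)

lemma unit_equilateral_exists:
  assumes m: "\<And>i. m i > 0"
  obtains q where "unit_equilateral m q"
proof -
  obtain i j k :: 3 where d: "distinct [i, j, k]" by (rule three_labels)
  define p :: config where "p = (\<lambda>l. if l = i then vector [0, 0] else if l = j then vector [1, 0] else vector [1 / 2, sqrt 3 / 2])"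
  have p: "p i = vector [0, 0]" "p j = vector [1, 0]" "p k = vector [1 / 2, sqrt 3 / 2]"
    using d by (auto simp: p_def)
  have pd: "dist (p i) (p j) = 1" "dist (p i) (p k) = 1" "dist (p j) (p k) = 1"
    unfolding dist_plane p by (simp_all add: power_divide)
  define c where "c = (1 / total_mass m) *\<^sub>R (\<Sum>l\<in>UNIV. m l *\<^sub>R p l)"
  have "unit_equilateral m (\<lambda>l. p l - c)"
    unfolding unit_equilateral_def
  proof (intro conjI allI impI)
    have "(\<Sum>l\<in>UNIV. m l *\<^sub>R (p l - c)) = (\<Sum>l\<in>UNIV. m l *\<^sub>R p l) - total_mass m *\<^sub>R c"
      by (simp add: scaleR_diff_right sum_subtractf total_mass_def scaleR_sum_left)
    then show "(\<Sum>l\<in>UNIV. m l *\<^sub>R (p l - c)) = 0" using total_mass_pos[of m, OF m] by (simp add: c_def)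
    fix l l' :: 3 assume ne: "l \<noteq> l'"
    have "l \<in> {i, j, k}" "l' \<in> {i, j, k}" using UNIV_three[OF d] by auto
    then have "dist (p l) (p l') = 1" using ne pd by (auto simp: dist_commute)
    then show "dist (p l - c) (p l' - c) = 1" by (simp add: dist_norm)
  qed
  then show ?thesis by (rule that)
qed

section \<open>The radial Kepler problem\<close>

definition kepler :: "real \<Rightarrow> (real \<Rightarrow> real) \<Rightarrow> (real \<Rightarrow> real) \<Rightarrow> real \<Rightarrow> real \<Rightarrow> bool" where
  "kepler M r r1 a b \<longleftrightarrow> (\<forall>t. a < t \<and> t < b \<longrightarrow> r t > 0 \<and>
     (r has_real_derivative r1 t) (at t) \<and> (r1 has_real_derivative - (M / (r t)\<^sup>2)) (at t))"

lemma keplerD: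
  assumes "kepler M r r1 a b" "a < t" "t < b"
  shows "r t > 0" "(r has_real_derivative r1 t) (at t)" "(r1 has_real_derivative - (M / (r t)\<^sup>2)) (at t)"
  using assms by (auto simp: kepler_def)

lemma kepler_uminus:
  assumes "kepler M r r1 a b"
  shows "kepler M (\<lambda>t. r (- t)) (\<lambda>t. - r1 (- t)) (- b) (- a)"
  unfolding kepler_def
proof (intro allI impI conjI)
  fix t assume "- b < t \<and> t < - a"
  then have t: "a < - t" "- t < b" by auto
  note k = keplerD[OF assms t]
  have u: "((\<lambda>t::real. - t) has_real_derivative - 1) (at t)" by (auto intro!: derivative_eq_intros)
  show "r (- t) > 0" by (rule k(1))
  show "((\<lambda>t. r (- t)) has_real_derivative - r1 (- t)) (at t)" using DERIV_chain2[OF k(2) u] by simp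
  show "((\<lambda>t. - r1 (- t)) has_real_derivative - (M / (r (- t))\<^sup>2)) (at t)"
    using DERIV_minus[OF DERIV_chain2[OF k(3) u]] by simp
qed

lemma kepler_shift:
  assumes "kepler M r r1 a b"
  shows "kepler M (\<lambda>t. r (t + \<tau>)) (\<lambda>t. r1 (t + \<tau>)) (a - \<tau>) (b - \<tau>)"
  unfolding kepler_def
proof (intro allI impI)
  fix t assume "a - \<tau> < t \<and> t < b - \<tau>"
  then have t: "a < t + \<tau>" "t + \<tau> < b" by auto
  show "r (t + \<tau>) > 0 \<and> ((\<lambda>t. r (t + \<tau>)) has_real_derivative r1 (t + \<tau>)) (at t) \<and>
    ((\<lambda>t. r1 (t + \<tau>)) has_real_derivative - (M / (r (t + \<tau>))\<^sup>2)) (at t)"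
    using keplerD[OF assms t] by (simp add: DERIV_shift)
qed

lemma kepler_subinterval: "kepler M r r1 a b \<Longrightarrow> a \<le> a' \<Longrightarrow> b' \<le> b \<Longrightarrow> kepler M r r1 a' b'"
  by (auto simp: kepler_def)

lemma kepler_lower_bound:
  assumes k: "kepler M r r1 a b" and st: "a < s" "s \<le> t" "t < b"
  obtains \<delta> where "\<delta> > 0" "\<And>u. s \<le> u \<Longrightarrow> u \<le> t \<Longrightarrow> \<delta> \<le> r u"
proof -
  have "continuous_on {s..t} r"
    by (rule DERIV_continuous_on[of _ _ r1]) (use keplerD(2)[OF k] st in \<open>auto intro: has_field_derivative_at_within\<close>)
  then obtain u where u: "u \<in> {s..t}" "\<forall>v\<in>{s..t}. r u \<le> r v"
    using continuous_attains_inf[of "{s..t}" r] st by auto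
  have "r u > 0" using keplerD(1)[OF k, of u] u(1) st by simp
  moreover have "r u \<le> r v" if "s \<le> v" "v \<le> t" for v using u(2) that by simp
  ultimately show ?thesis by (rule that)
qed

lemma inverse_square_lipschitz:
  fixes p q \<delta> M :: real
  assumes "\<delta> > 0" "\<delta> \<le> p" "\<delta> \<le> q" "M > 0"
  shows "\<bar>M / q\<^sup>2 - M / p\<^sup>2\<bar> \<le> 2 * M / \<delta> ^ 3 * \<bar>p - q\<bar>"
proof -
  have pq: "p > 0" "q > 0" using assms by auto
  have "M / q\<^sup>2 - M / p\<^sup>2 = (M / (p * q\<^sup>2) + M / (p\<^sup>2 * q)) * (p - q)"
    using pq by (simp add: field_simps power2_eq_square)
  then have e: "\<bar>M / q\<^sup>2 - M / p\<^sup>2\<bar> = (M / (p * q\<^sup>2) + M / (p\<^sup>2 * q)) * \<bar>p - q\<bar>"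
    using pq assms(4) by (simp add: abs_mult abs_of_pos add_pos_pos)
  have "M / (p * q\<^sup>2) \<le> M / (\<delta> * \<delta>\<^sup>2)" "M / (p\<^sup>2 * q) \<le> M / (\<delta>\<^sup>2 * \<delta>)"
    using assms pq by (intro divide_left_mono mult_mono power_mono mult_pos_pos; simp)+
  moreover have "\<delta> * \<delta>\<^sup>2 = \<delta> ^ 3" "\<delta>\<^sup>2 * \<delta> = \<delta> ^ 3" by (simp_all add: power3_eq_cube power2_eq_square)
  ultimately have "M / (p * q\<^sup>2) + M / (p\<^sup>2 * q) \<le> 2 * M / \<delta> ^ 3" by simp
  then show ?thesis unfolding e by (rule mult_right_mono) simp
qed

text \<open>On a compact interval ending at c both radii stay above some \<delta>, so the
  inverse-square force is Lipschitz there and Gronwall applies to the squared distance of the two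
  states.\<close>

lemma kepler_unique_left:
  assumes M: "M > 0" and k: "kepler M r r1 a b" "kepler M s s1 a b"
    and c: "a < c" "c < b" "r c = s c" "r1 c = s1 c" and t: "a < t" "t < c"
  shows "r t = s t"
proof -
  obtain t0 where t0: "a < t0" "t0 < t" using dense[OF t(1)] by blast
  have le: "t0 \<le> c" using t0 t by simp
  obtain \<delta>1 where d1: "\<delta>1 > 0" "\<And>u. t0 \<le> u \<Longrightarrow> u \<le> c \<Longrightarrow> \<delta>1 \<le> r u"
    by (rule kepler_lower_bound[OF k(1) t0(1) le c(2)]) (rule that; assumption)
  obtain \<delta>2 where d2: "\<delta>2 > 0" "\<And>u. t0 \<le> u \<Longrightarrow> u \<le> c \<Longrightarrow> \<delta>2 \<le> s u"
    by (rule kepler_lower_bound[OF k(2) t0(1) le c(2)]) (rule that; assumption)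
  define \<delta> where "\<delta> = min \<delta>1 \<delta>2"
  have d: "\<delta> > 0" using d1 d2 by (simp add: \<delta>_def)
  define K where "K = 2 * M / \<delta> ^ 3"
  have K: "K > 0" using M d by (simp add: K_def)
  define D where "D = (\<lambda>u. (r u - s u) * (r u - s u) + (r1 u - s1 u) * (r1 u - s1 u))"
  define D' where "D' = (\<lambda>u. 2 * ((r u - s u) * (r1 u - s1 u)) + 2 * ((r1 u - s1 u) * (M / (s u)\<^sup>2 - M / (r u)\<^sup>2)))"
  have dD: "(D has_real_derivative D' u) (at u)" if u: "a < u" "u < b" for u
  proof -
    note e1 = DERIV_diff[OF keplerD(2)[OF k(1) u] keplerD(2)[OF k(2) u]]
    note e2 = DERIV_diff[OF keplerD(3)[OF k(1) u] keplerD(3)[OF k(2) u]]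
    show ?thesis
      unfolding D_def D'_def
      by (rule DERIV_cong[OF DERIV_add[OF DERIV_mult[OF e1 e1] DERIV_mult[OF e2 e2]]]) (simp add: algebra_simps)
  qed
  have "D t = 0"
  proof (rule gronwall_zero_left[of t0 c D D' "1 + K" t])
    show "(D has_real_derivative D' u) (at u)" if "t0 < u" "u < c" for u using dD[of u] that t0 c by simp
    show "\<bar>D' u\<bar> \<le> (1 + K) * D u" if u: "t0 < u" "u < c" for u
    proof -
      define p q w where "p = r u - s u" and "q = r1 u - s1 u" and "w = M / (s u)\<^sup>2 - M / (r u)\<^sup>2"
      have w: "\<bar>w\<bar> \<le> K * \<bar>p\<bar>"
        unfolding w_def K_def p_def
        by (rule inverse_square_lipschitz[OF d _ _ M]) (use d1(2)[of u] d2(2)[of u] u in \<open>auto simp: \<delta>_def\<close>)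
      have "\<bar>D' u\<bar> \<le> \<bar>2 * (p * q)\<bar> + \<bar>2 * (q * w)\<bar>"
        unfolding D'_def p_def q_def w_def by (rule abs_triangle_ineq)
      also have "\<dots> = 2 * (\<bar>q\<bar> * \<bar>p\<bar>) + 2 * (\<bar>q\<bar> * \<bar>w\<bar>)" by (simp add: abs_mult)
      also have "\<dots> \<le> 2 * (\<bar>q\<bar> * \<bar>p\<bar>) + 2 * (\<bar>q\<bar> * (K * \<bar>p\<bar>))" using w by (simp add: mult_left_mono)
      also have "\<dots> = (1 + K) * (2 * (\<bar>q\<bar> * \<bar>p\<bar>))" by (simp add: algebra_simps)
      also have "\<dots> \<le> (1 + K) * (p * p + q * q)"
      proof (rule mult_left_mono)
        have "(\<bar>p\<bar> - \<bar>q\<bar>)\<^sup>2 \<ge> 0" by simp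
        then show "2 * (\<bar>q\<bar> * \<bar>p\<bar>) \<le> p * p + q * q" by (simp add: power2_eq_square algebra_simps)
      qed (use K in simp)
      finally show ?thesis by (simp add: D_def p_def q_def)
    qed
    have "isCont D c" by (rule DERIV_isCont[OF dD[OF c(1,2)]])
    then have "(D \<longlongrightarrow> D c) (at_left c)" unfolding isCont_def by (rule tendsto_within_subset) simp
    then show "(D \<longlongrightarrow> 0) (at_left c)" using c(3,4) by (simp add: D_def)
    show "t0 < t" "t < c" using t0 t by auto
    show "D t \<ge> 0" by (simp add: D_def)
  qed
  then have "(r t - s t) * (r t - s t) = 0" unfolding D_def by (smt (verit) zero_le_square)
  then show ?thesis by simp
qed

lemma kepler_unique:
  assumes M: "M > 0" and k: "kepler M r r1 a b" "kepler M s s1 a b"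
    and c: "a < c" "c < b" "r c = s c" "r1 c = s1 c" and t: "a < t" "t < b"
  shows "r t = s t"
proof (cases t c rule: linorder_cases)
  case less
  then show ?thesis by (rule kepler_unique_left[OF M k c t(1)])
next
  case equal
  then show ?thesis using c by simp
next
  case greater
  have "r (- (- t)) = s (- (- t))"
    by (rule kepler_unique_left[OF M kepler_uminus[OF k(1)] kepler_uminus[OF k(2)], of "- c" "- t"])
      (use c t greater in auto)
  then show ?thesis by simp
qed

text \<open>A Kepler solution still alive at b would be positive and continuous there, yet it agrees
  before b with a function tending to 0. Applied in both directions this makes the right ends
  equal.\<close>

lemma kepler_right_end_le:
  assumes k: "kepler M s s1 a' b'" and c: "a < c" "c < b" "a' < c" "c < b'"
    and eq: "\<And>t. a < t \<Longrightarrow> t < b \<Longrightarrow> a' < t \<Longrightarrow> t < b' \<Longrightarrow> r t = s t"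
    and lim: "(r \<longlongrightarrow> 0) (at_left b)"
  shows "b' \<le> b"
proof (rule ccontr)
  assume "\<not> b' \<le> b"
  then have b: "a' < b" "b < b'" using c by auto
  have "isCont s b" by (rule DERIV_isCont[OF keplerD(2)[OF k b]])
  then have "(s \<longlongrightarrow> s b) (at_left b)" unfolding isCont_def by (rule tendsto_within_subset) simp
  moreover have "\<forall>\<^sub>F t in at_left b. r t = s t"
    unfolding eventually_at_left[OF c(2)] by (rule exI[of _ c]) (use eq c b in auto)
  then have "(s \<longlongrightarrow> 0) (at_left b)" using lim by (rule Lim_transform_eventually[rotated])
  ultimately have "s b = 0" by (rule tendsto_unique[OF trivial_limit_at_left_real])
  then show False using keplerD(1)[OF k b] by simp
qed

text \<open>The radius tends to 0 at both ends, so it has an interior maximum, where it is at rest;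
  this normalizes the origin of time.\<close>

lemma kepler_turning_point:
  assumes k: "kepler M r r1 a b" and ab: "a < b"
    and lim: "(r \<longlongrightarrow> 0) (at_right a)" "(r \<longlongrightarrow> 0) (at_left b)"
  obtains t where "a < t" "t < b" "r1 t = 0"
proof -
  define t0 where "t0 = (a + b) / 2"
  have t0: "a < t0" "t0 < b" using ab by (auto simp: t0_def)
  have r0: "r t0 > 0" by (rule keplerD(1)[OF k t0])
  obtain u1 where u1: "a < u1" "\<And>y. a < y \<Longrightarrow> y < u1 \<Longrightarrow> r y < r t0"
    using order_tendstoD(2)[OF lim(1) r0] unfolding eventually_at_right[OF ab] by blast
  obtain u2 where u2: "u2 < b" "\<And>y. u2 < y \<Longrightarrow> y < b \<Longrightarrow> r y < r t0"
    using order_tendstoD(2)[OF lim(2) r0] unfolding eventually_at_left[OF ab] by blast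
  obtain s1 where s1: "a < s1" "s1 < min u1 t0" using dense[of a "min u1 t0"] u1(1) t0 by auto
  obtain s2 where s2: "max u2 t0 < s2" "s2 < b" using dense[of "max u2 t0" b] u2(1) t0 by auto
  have lt: "r s1 < r t0" "r s2 < r t0" using u1(2)[of s1] u2(2)[of s2] s1 s2 by auto
  have "continuous_on {s1..s2} r"
    by (rule DERIV_continuous_on[of _ _ r1]) (use keplerD(2)[OF k] s1 s2 in \<open>auto intro: has_field_derivative_at_within\<close>)
  then obtain t where t: "t \<in> {s1..s2}" "\<forall>v\<in>{s1..s2}. r v \<le> r t"
    using continuous_attains_sup[of "{s1..s2}" r] s1 s2 by auto
  have "r t0 \<le> r t" using t(2) s1 s2 by simp
  then have "t \<noteq> s1" "t \<noteq> s2" using lt by auto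
  then have ts: "s1 < t" "t < s2" using t(1) by auto
  then have tab: "a < t" "t < b" using s1 s2 by auto
  have "r1 t = 0"
  proof (rule DERIV_local_max[OF keplerD(2)[OF k tab], of "min (t - s1) (s2 - t)"])
    show "0 < min (t - s1) (s2 - t)" using ts by simp
    show "\<forall>y. \<bar>t - y\<bar> < min (t - s1) (s2 - t) \<longrightarrow> r y \<le> r t"
    proof (intro allI impI)
      fix y assume "\<bar>t - y\<bar> < min (t - s1) (s2 - t)"
      then have "s1 \<le> y" "y \<le> s2" by (auto simp: abs_less_iff)
      then show "r y \<le> r t" using t(2) by simp
    qed
  qed
  with tab show ?thesis by (rule that)
qed

text \<open>The collapsing and expanding radial orbit is the cycloid
  \<open>r = B (1 - cos \<theta>)\<close>, \<open>t = A (\<theta> - sin \<theta>)\<close>.\<close>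

lemma kepler_cycloid:
  fixes M B :: real
  assumes M: "M > 0" and B: "B > 0"
  obtains T r r1 where "T > 0" "kepler M r r1 0 T"
    "\<And>t. 0 < t \<Longrightarrow> t < T \<Longrightarrow> (r1 t)\<^sup>2 = 2 * M / r t - M / B"
    "(r \<longlongrightarrow> 0) (at_right 0)" "(r \<longlongrightarrow> 0) (at_left T)"
proof -
  \<comment> \<open>Kepler's third law A^2 = B^3 / M is what makes the second derivative equal - M /
    r^2.\<close>
  define A where "A = sqrt (B ^ 3 / M)"
  have A: "A > 0" "A * A = B ^ 3 / M" using M B by (simp_all add: A_def)
  define f where "f = (\<lambda>\<theta>. A * (\<theta> - sin \<theta>))"
  define S where "S = {0..2 * pi}"
  have df: "(f has_real_derivative A * (1 - cos \<theta>)) (at \<theta>)" for \<theta>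
    unfolding f_def by (auto intro!: derivative_eq_intros)
  have cf: "continuous_on X f" for X unfolding f_def by (intro continuous_intros)
  have cpos: "1 - cos \<theta> > 0" if "0 < \<theta>" "\<theta> < 2 * pi" for \<theta>
  proof -
    have "sin (\<theta> / 2) > 0" using that by (intro sin_gt_zero) auto
    then have "2 * (sin (\<theta> / 2))\<^sup>2 > 0" by simp
    then show ?thesis using cos_double_sin[of "\<theta> / 2"] by simp
  qed
  have mono: "f s < f t" if "0 \<le> s" "s < t" "t \<le> 2 * pi" for s t
  proof (rule DERIV_pos_imp_increasing_open[OF that(2) _ cf])
    fix x assume "s < x" "x < t"
    then show "\<exists>y. (f has_real_derivative y) (at x) \<and> 0 < y"
      using df[of x] cpos[of x] A(1) that by (intro exI[of _ "A * (1 - cos x)"]) auto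
  qed
  have inj: "inj_on f S"
    unfolding S_def by (rule linorder_inj_onI) (use mono in \<open>force+\<close>)
  define g where "g = inv_into S f"
  have gf: "g (f \<theta>) = \<theta>" if "\<theta> \<in> S" for \<theta> unfolding g_def by (rule inv_into_f_f[OF inj that])
  define T where "T = f (2 * pi)"
  have f0: "f 0 = 0" by (simp add: f_def)
  have T: "T > 0" using mono[of 0 "2 * pi"] by (simp add: T_def f0)
  have surj: "{0..T} \<subseteq> f ` S"
  proof
    fix y assume "y \<in> {0..T}"
    then obtain x where "0 \<le> x" "x \<le> 2 * pi" "f x = y"
      using IVT'[of f 0 y "2 * pi", OF _ _ _ cf] by (auto simp: f0 T_def)
    then show "y \<in> f ` S" by (auto simp: S_def)
  qed
  have gS: "g y \<in> S" "f (g y) = y" if "y \<in> {0..T}" for y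
    using surj that gf by (auto simp: subset_iff image_iff)
  have gin: "0 < g y" "g y < 2 * pi" if "0 < y" "y < T" for y
  proof -
    have y: "g y \<in> S" "f (g y) = y" using gS[of y] that by auto
    then have "g y \<noteq> 0" "g y \<noteq> 2 * pi" using that f0 T_def by auto
    then show "0 < g y" "g y < 2 * pi" using y(1) by (auto simp: S_def)
  qed
  have "continuous_on (f ` S) g"
    by (rule continuous_on_inv[OF cf]) (use gf in \<open>auto simp: S_def\<close>)
  then have cg: "continuous_on {0..T} g" using surj by (rule continuous_on_subset)
  have dg: "(g has_real_derivative inverse (A * (1 - cos (g y)))) (at y)" if y: "0 < y" "y < T" for y
  proof (rule DERIV_inverse_function[where f = f and a = 0 and b = T, OF df _ y])
    show "A * (1 - cos (g y)) \<noteq> 0" using A(1) cpos[OF gin[OF y]] by simp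
    show "f (g z) = z" if "0 < z" "z < T" for z using gS(2)[of z] that by simp
    show "isCont g y" by (rule continuous_on_interior[OF cg]) (use y in \<open>simp add: interior_atLeastAtMost_real\<close>)
  qed
  define r where "r = (\<lambda>t. B * (1 - cos (g t)))"
  define r1 where "r1 = (\<lambda>t. (B / A) * (sin (g t) / (1 - cos (g t))))"
  have k: "kepler M r r1 0 T"
    unfolding kepler_def
  proof (intro allI impI conjI)
    fix t assume "0 < t \<and> t < T"
    then have t: "0 < t" "t < T" by auto
    define C c s where "C = cos (g t)" and "c = 1 - cos (g t)" and "s = sin (g t)"
    have c: "c > 0" unfolding c_def by (rule cpos[OF gin[OF t]])
    show "r t > 0" using B c by (simp add: r_def c_def)
    have "((\<lambda>\<theta>. B * (1 - cos \<theta>)) has_real_derivative B * sin (g t)) (at (g t))"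
      by (auto intro!: derivative_eq_intros)
    from DERIV_chain2[OF this dg[OF t]]
    have "(r has_real_derivative B * s * inverse (A * c)) (at t)" unfolding r_def s_def c_def .
    moreover have "B * s * inverse (A * c) = r1 t"
      using A(1) c unfolding r1_def s_def[symmetric] c_def[symmetric] by (simp add: field_simps)
    ultimately show "(r has_real_derivative r1 t) (at t)" by simp
    have "((\<lambda>\<theta>. 1 - cos \<theta>) has_real_derivative sin (g t)) (at (g t))"
      by (auto intro!: derivative_eq_intros)
    from DERIV_divide[OF DERIV_sin this] c
    have "((\<lambda>\<theta>. sin \<theta> / (1 - cos \<theta>)) has_real_derivative (C * c - s * s) / (c * c)) (at (g t))"
      unfolding C_def c_def s_def by simp
    from DERIV_chain2[OF DERIV_cmult[OF this, of "B / A"] dg[OF t]]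
    have "(r1 has_real_derivative (B / A) * ((C * c - s * s) / (c * c)) * inverse (A * c)) (at t)"
      unfolding r1_def c_def .
    moreover have "(B / A) * ((C * c - s * s) / (c * c)) * inverse (A * c) = - (M / (r t)\<^sup>2)"
    proof -
      have "s * s + C * C = 1" using sin_cos_squared_add[of "g t"] by (simp add: s_def C_def power2_eq_square)
      moreover have cC: "c = 1 - C" by (simp add: c_def C_def)
      ultimately have n: "C * c - s * s = - c" by algebra
      have "(B / A) * ((C * c - s * s) / (c * c)) * inverse (A * c) = - (B / ((A * A) * (c * c)))"
        unfolding n using A(1) c by (simp add: field_simps)
      also have "\<dots> = - (M / (B * c)\<^sup>2)"
        unfolding A(2) using B M c by (simp add: field_simps power2_eq_square power3_eq_cube)
      finally show ?thesis by (simp add: r_def c_def)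
    qed
    ultimately show "(r1 has_real_derivative - (M / (r t)\<^sup>2)) (at t)" by simp
  qed
  \<comment> \<open>The constant - M / B ties the parameter B of the cycloid to the energy; the
    largest radius is 2 B.\<close>
  have en: "(r1 t)\<^sup>2 = 2 * M / r t - M / B" if t: "0 < t" "t < T" for t
  proof -
    define c s where "c = 1 - cos (g t)" and "s = sin (g t)"
    have c: "c > 0" unfolding c_def by (rule cpos[OF gin[OF t]])
    have "s * s + (1 - c) * (1 - c) = 1"
      using sin_cos_squared_add[of "g t"] by (simp add: s_def c_def power2_eq_square)
    then have s: "s * s = c * (2 - c)" by algebra
    have "(r1 t)\<^sup>2 = B * B / (A * A) * ((s * s) / (c * c))"
      unfolding r1_def s_def[symmetric] c_def[symmetric] by (simp add: power2_eq_square mult_ac)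
    also have "\<dots> = 2 * M / (B * c) - M / B"
      unfolding A(2) s using B M c by (simp add: field_simps power3_eq_cube)
    finally show ?thesis by (simp add: r_def c_def)
  qed
  have cr: "continuous_on {0..T} r" unfolding r_def by (intro continuous_intros cg)
  have "g 0 = 0" using gf[of 0] by (simp add: S_def f0)
  then have "r 0 = 0" by (simp add: r_def)
  then have l0: "(r \<longlongrightarrow> 0) (at_right 0)" using continuous_on_Icc_at_rightD[OF cr T] by simp
  have "g T = 2 * pi" using gf[of "2 * pi"] by (simp add: S_def T_def)
  then have "r T = 0" by (simp add: r_def)
  then have lT: "(r \<longlongrightarrow> 0) (at_left T)" using continuous_on_Icc_at_leftD[OF cr T] by simp
  show ?thesis by (rule that[OF T k en l0 lT])
qed

section \<open>Existence of the homothetic solution\<close>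

lemma isCont_regularized:
  assumes "regularized_binary_collision_at x t"
  shows "isCont (\<lambda>s. x s i) t"
proof -
  obtain c where "\<forall>\<^sub>F s in nhds t. (\<lambda>n. root 3 (s - t) ^ n *\<^sub>R c n) sums x s i"
    using assms unfolding regularized_binary_collision_at_def by blast
  then obtain e where e: "e > 0" "\<And>s. dist s t < e \<Longrightarrow> (\<lambda>n. root 3 (s - t) ^ n *\<^sub>R c n) sums x s i"
    unfolding eventually_nhds_metric by blast
  have comp: "isCont (\<lambda>s. x s i $ k) t" for k
  proof -
    have sm: "(\<lambda>n. c n $ k * root 3 (s - t) ^ n) sums (x s i $ k)" if "dist s t < e" for s
      using bounded_linear.sums[OF bounded_linear_vec_nth e(2)[OF that], of k] by (simp add: mult.commute)
    define G where "G = (\<lambda>z. \<Sum>n. c n $ k * z ^ n)"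
    have "dist (t + e / 2) t < e" using e(1) by (simp add: dist_real_def)
    from sums_summable[OF sm[OF this]] have "summable (\<lambda>n. c n $ k * root 3 (e / 2) ^ n)" by simp
    then have G: "isCont G 0" unfolding G_def by (rule isCont_powser) (use e(1) in simp)
    have "isCont (\<lambda>s. root 3 (s - t)) t" by (intro continuous_intros)
    moreover have "isCont G (root 3 (t - t))" using G by simp
    ultimately have c: "isCont (\<lambda>s. G (root 3 (s - t))) t" by (rule isCont_o2)
    have "\<forall>\<^sub>F s in nhds t. G (root 3 (s - t)) = x s i $ k"
      unfolding eventually_nhds_metric G_def using e(1) sm by (intro exI[of _ e]) (auto simp: sums_iff)
    from isCont_cong[OF this] c show ?thesis by simp
  qed
  show ?thesis unfolding isCont_def by (rule vec_tendstoI) (use comp in \<open>simp add: isCont_def\<close>)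
qed

text \<open>At a time inside a solution the positions are continuous and take at least two values,
  even at a binary collision, so they cannot all tend to one point.\<close>

lemma no_triple_collision_inside:
  assumes m: "\<And>i. m i > 0" and at: "newton_at m y s \<or> regularized_binary_collision_at y s"
    and F: "F \<le> at s" "F \<noteq> bot" and tc: "triple_collision x F" and eq: "\<forall>\<^sub>F t in F. x t = y t"
  shows False
proof -
  have "isCont (\<lambda>t. y t i) s" for i
    using at isCont_regularized[of y s i] has_vector_derivative_continuous[OF newton_atD(2)[of m y s i, OF m]] by blast
  then have ly: "((\<lambda>t. y t i) \<longlongrightarrow> y s i) F" for i unfolding isCont_def by (rule tendsto_mono[OF F(1)])
  obtain p where p: "\<And>i. ((\<lambda>t. x t i) \<longlongrightarrow> p) F" using tc unfolding triple_collision_def by blast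
  have "y s i = p" for i
  proof -
    have "\<forall>\<^sub>F t in F. x t i = y t i" using eq by (rule eventually_mono) simp
    then have "((\<lambda>t. y t i) \<longlongrightarrow> p) F" using p[of i] by (rule Lim_transform_eventually[rotated])
    then show ?thesis by (rule tendsto_unique[OF F(2) ly])
  qed
  then have c: "y s = (\<lambda>_. p)" by (rule ext)
  have "\<not> newton_at m y s"
  proof
    assume "newton_at m y s"
    then have "inj (y s)" by (simp add: newton_at_def)
    then have "(0::3) = 1" unfolding c by (rule injD) simp
    then show False by simp
  qed
  moreover have "\<not> regularized_binary_collision_at y s"
  proof
    assume "regularized_binary_collision_at y s"
    then have "card (range (y s)) = 2" by (simp add: regularized_binary_collision_at_def)
    then show False unfolding c by simp
  qed
  ultimately show False using at by blast
qed

text \<open>An interval properly containing (a, b) contains a or b, and the extension would have a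
  triple collision at an interior time.\<close>

lemma triple_collision_maximal:
  assumes m: "\<And>i. m i > 0" and ab: "a < b" and sol: "solution m {a<..<b} x"
    and tc: "triple_collision x (at_right a)" "triple_collision x (at_left b)"
  shows "maximal_solution m {a<..<b} x"
  unfolding maximal_solution_def
proof (intro conjI allI impI sol)
  fix I' x' assume A: "solution m I' x' \<and> {a<..<b} \<subseteq> I' \<and> (\<forall>t\<in>{a<..<b}. x' t = x t)"
  then have I': "is_interval I'" "{a<..<b} \<subseteq> I'" and eq: "\<And>t. a < t \<Longrightarrow> t < b \<Longrightarrow> x t = x' t"
    and at: "\<And>t. t \<in> I' \<Longrightarrow> newton_at m x' t \<or> regularized_binary_collision_at x' t"
    by (auto simp: solution_def)
  have nb: "b \<notin> I'"
  proof
    assume "b \<in> I'"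
    show False
    proof (rule no_triple_collision_inside[of m x' b "at_left b" x, OF m at[OF \<open>b \<in> I'\<close>] _ _ tc(2)])
      show "at_left b \<le> at b" by (rule at_le) simp
      show "at_left b \<noteq> bot" by simp
      show "\<forall>\<^sub>F t in at_left b. x t = x' t" unfolding eventually_at_left[OF ab] using eq ab by blast
    qed
  qed
  have na: "a \<notin> I'"
  proof
    assume "a \<in> I'"
    show False
    proof (rule no_triple_collision_inside[of m x' a "at_right a" x, OF m at[OF \<open>a \<in> I'\<close>] _ _ tc(1)])
      show "at_right a \<le> at a" by (rule at_le) simp
      show "at_right a \<noteq> bot" by simp
      show "\<forall>\<^sub>F t in at_right a. x t = x' t" unfolding eventually_at_right[OF ab] using eq ab by blast
    qed
  qed
  have c: "(a + b) / 2 \<in> I'" using I'(2) ab by auto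
  have mem: "t \<in> I'" if "s \<in> I'" "u \<in> I'" "s \<le> t" "t \<le> u" for s t u
    using I'(1) that unfolding is_interval_1 by blast
  have out: "a < t \<and> t < b" if t: "t \<in> I'" for t
  proof -
    have "\<not> t \<le> a" using mem[OF t c, of a] na ab by auto
    moreover have "\<not> b \<le> t" using mem[OF c t, of b] nb ab by auto
    ultimately show ?thesis by simp
  qed
  show "I' = {a<..<b}" using I'(2) out by auto
qed

lemma kepler_homothety:
  assumes m: "\<And>i. m i > 0" and q: "unit_equilateral m q" and k: "kepler (total_mass m) r r1 a b"
    and t: "a < t" "t < b"
  defines "x \<equiv> \<lambda>t l. r t *\<^sub>R q l"
  shows "newton_at m x t" "velocity x t l = r1 t *\<^sub>R q l" "equilateral (x t)"
    "energy m x t = (r1 t)\<^sup>2 * pair_mass m / (2 * total_mass m) - pair_mass m / r t"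
proof -
  have q': "(\<Sum>i\<in>UNIV. m i *\<^sub>R q i) = 0" "\<And>i j. i \<noteq> j \<Longrightarrow> dist (q i) (q j) = 1"
    using q by (auto simp: unit_equilateral_def)
  note kt = keplerD[OF k t]
  have dx: "((\<lambda>s. x s i) has_vector_derivative r1 s *\<^sub>R q i) (at s)" if "a < s" "s < b" for s i
    unfolding x_def using has_vector_derivative_scaleR[OF keplerD(2)[OF k that] has_vector_derivative_const[of "q i"]] by simp
  have dist: "dist (x t i) (x t j) = r t" if "i \<noteq> j" for i j
    using q'(2)[OF that] kt(1) by (simp add: x_def dist_norm scaleR_diff_right[symmetric])
  have com: "(\<Sum>i\<in>UNIV. m i *\<^sub>R x t i) = 0"
  proof -
    have "(\<Sum>i\<in>UNIV. m i *\<^sub>R x t i) = r t *\<^sub>R (\<Sum>i\<in>UNIV. m i *\<^sub>R q i)"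
      unfolding x_def scaleR_sum_right by (rule sum.cong) (simp_all add: mult.commute)
    then show ?thesis using q'(1) by simp
  qed
  show "newton_at m x t"
  proof (rule newton_atI[where v = "\<lambda>i s. r1 s *\<^sub>R q i"])
    show "inj (x t)"
    proof (rule injI, rule ccontr)
      fix i j assume "x t i = x t j" "i \<noteq> j"
      then show False using dist[of i j] kt(1) by simp
    qed
    fix i
    have "\<forall>\<^sub>F s in nhds t. s \<in> {a<..<b}" using t by (intro eventually_nhds_in_open) auto
    then show "\<forall>\<^sub>F s in nhds t. ((\<lambda>s. x s i) has_vector_derivative r1 s *\<^sub>R q i) (at s)"
      by (rule eventually_mono) (simp add: dx)
    have "accel m (x t) i = (- (total_mass m / r t ^ 3)) *\<^sub>R x t i" by (rule accel_equilateral[OF com dist])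
    also have "\<dots> = (- (total_mass m / (r t)\<^sup>2)) *\<^sub>R q i"
      using kt(1) by (simp add: x_def power3_eq_cube power2_eq_square)
    finally have acc: "accel m (x t) i = (- (total_mass m / (r t)\<^sup>2)) *\<^sub>R q i" .
    show "((\<lambda>s. r1 s *\<^sub>R q i) has_vector_derivative accel m (x t) i) (at t)"
      unfolding acc using has_vector_derivative_scaleR[OF kt(3) has_vector_derivative_const[of "q i"]] by simp
  qed
  have vel: "velocity x t l = r1 t *\<^sub>R q l" for l
    unfolding velocity_def by (rule vector_derivative_at[OF dx[OF t]])
  then show "velocity x t l = r1 t *\<^sub>R q l" .
  show "equilateral (x t)" unfolding equilateral_def using dist kt(1) by blast
  have "(\<Sum>i\<in>UNIV. m i * (norm (velocity x t i))\<^sup>2) = (r1 t)\<^sup>2 * inertia m q"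
    unfolding vel inertia_def sum_distrib_left by (rule sum.cong) (simp_all add: power_mult_distrib)
  moreover have "inertia m q = pair_mass m / total_mass m"
    using inertia_unit_equilateral[OF q] total_mass_pos[of m, OF m] by (simp add: field_simps)
  moreover have "potential m (x t) = pair_mass m / r t" by (rule potential_equilateral[OF dist])
  ultimately show "energy m x t = (r1 t)\<^sup>2 * pair_mass m / (2 * total_mass m) - pair_mass m / r t"
    unfolding energy_def by (simp add: mult.commute)
qed

lemma homothety_exists:
  assumes m: "\<And>i. m i > 0" and h: "h < 0"
  shows "\<exists>I x. maximal_solution m I x \<and> zero_angular_momentum m I x \<and> has_energy m h I x \<and> lagrange_homothety I x"
proof -
  note M = total_mass_pos[of m, OF m] and U = pair_mass_pos[of m, OF m]
  \<comment> \<open>For the cycloid the kinetic and potential parts add up to -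
    \<open>pair_mass\<close> m / (2 B), which has to be h.\<close>
  define B where "B = pair_mass m / (- 2 * h)"
  have B: "B > 0" using U h unfolding B_def by (intro divide_pos_pos) auto
  obtain q where q: "unit_equilateral m q" by (rule unit_equilateral_exists[of m, OF m])
  obtain T r r1 where T: "T > 0" and k: "kepler (total_mass m) r r1 0 T"
    and en: "\<And>t. 0 < t \<Longrightarrow> t < T \<Longrightarrow> (r1 t)\<^sup>2 = 2 * total_mass m / r t - total_mass m / B"
    and lim: "(r \<longlongrightarrow> 0) (at_right 0)" "(r \<longlongrightarrow> 0) (at_left T)"
    by (rule kepler_cycloid[OF M B]) (rule that; assumption)
  define x :: trajectory where "x = (\<lambda>t l. r t *\<^sub>R q l)"
  note kh = kepler_homothety[OF m q k, folded x_def]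
  have com: "(\<Sum>i\<in>UNIV. m i *\<^sub>R x t i) = 0" for t
  proof -
    have "(\<Sum>i\<in>UNIV. m i *\<^sub>R x t i) = r t *\<^sub>R (\<Sum>i\<in>UNIV. m i *\<^sub>R q i)"
      unfolding x_def scaleR_sum_right by (rule sum.cong) (simp_all add: mult.commute)
    then show ?thesis using q by (simp add: unit_equilateral_def)
  qed
  have sol: "solution m {0<..<T} x"
    unfolding solution_def using T com kh(1) by (auto simp: is_interval_oo)
  have tc: "triple_collision x F" if "(r \<longlongrightarrow> 0) F" for F
    unfolding triple_collision_def
  proof (intro exI[of _ 0] allI)
    fix i
    show "((\<lambda>t. x t i) \<longlongrightarrow> 0) F" unfolding x_def using tendsto_scaleR[OF that tendsto_const[of "q i"]] by simp
  qed
  have "maximal_solution m {0<..<T} x"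
    by (rule triple_collision_maximal[of m, OF m T sol tc[OF lim(1)] tc[OF lim(2)]])
  moreover have "zero_angular_momentum m {0<..<T} x"
    unfolding zero_angular_momentum_def
  proof (intro ballI impI)
    fix t assume "t \<in> {0<..<T}"
    then have t: "0 < t" "t < T" by auto
    have "wedge (x t i) (velocity x t i) = 0" for i
      unfolding kh(2)[OF t] by (simp add: x_def wedge_def)
    then show "angular_momentum m x t = 0" by (simp add: angular_momentum_def)
  qed
  moreover have "has_energy m h {0<..<T} x"
    unfolding has_energy_def
  proof (intro ballI impI)
    fix t assume "t \<in> {0<..<T}"
    then have t: "0 < t" "t < T" by auto
    have gen: "(2 * \<mu> / \<rho> - \<mu> / (u / (- 2 * h))) * u / (2 * \<mu>) - u / \<rho> = h"
      if "\<mu> > 0" "\<rho> > 0" "u > 0" for \<mu> \<rho> u :: real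
    proof -
      have "\<mu> / (u / (- 2 * h)) = - (2 * h * \<mu> / u)" by simp
      then show ?thesis using that by (simp add: field_simps)
    qed
    show "energy m x t = h" unfolding kh(4)[OF t] en[OF t] B_def by (rule gen[OF M keplerD(1)[OF k t] U])
  qed
  moreover have "lagrange_homothety {0<..<T} x"
    unfolding lagrange_homothety_def
  proof (intro conjI)
    show "\<exists>a b. a < b \<and> {0<..<T} = {a<..<b} \<and> triple_collision x (at_right a) \<and> triple_collision x (at_left b)"
      using T tc lim by blast
    show "\<forall>t\<in>{0<..<T}. equilateral (x t)" using kh(3) by (simp add: x_def)
    show "\<exists>q \<rho>. \<forall>t\<in>{0<..<T}. \<rho> t > 0 \<and> (\<forall>i. x t i = \<rho> t *\<^sub>R q i)"
      using keplerD(1)[OF k] by (intro exI[of _ q] exI[of _ r]) (auto simp: x_def)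
  qed
  ultimately show ?thesis by blast
qed

section \<open>Uniqueness of the homothetic solution\<close>

lemma homothety_kepler:
  assumes m: "\<And>i. m i > 0" and max: "maximal_solution m I x" and E: "has_energy m h I x"
    and lh: "lagrange_homothety I x"
  obtains a b q r r1 where "a < b" "I = {a<..<b}" "unit_equilateral m q" "kepler (total_mass m) r r1 a b"
    "\<And>t l. a < t \<Longrightarrow> t < b \<Longrightarrow> x t l = r t *\<^sub>R q l"
    "\<And>t. a < t \<Longrightarrow> t < b \<Longrightarrow> (r1 t)\<^sup>2 * pair_mass m / (2 * total_mass m) - pair_mass m / r t = h"
    "(r \<longlongrightarrow> 0) (at_right a)" "(r \<longlongrightarrow> 0) (at_left b)"
proof -
  have sol: "solution m I x" using max by (simp add: maximal_solution_def)
  obtain a b where ab: "a < b" and I: "I = {a<..<b}"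
    and tc: "triple_collision x (at_right a)" "triple_collision x (at_left b)"
    using lh unfolding lagrange_homothety_def by blast
  have equi: "equilateral (x t)" if "a < t" "t < b" for t using lh that I unfolding lagrange_homothety_def by simp
  obtain p \<rho> where "\<forall>t\<in>I. \<rho> t > 0 \<and> (\<forall>i. x t i = \<rho> t *\<^sub>R p i)" using lh unfolding lagrange_homothety_def by blast
  then have \<rho>: "\<rho> t > 0" and xp: "x t i = \<rho> t *\<^sub>R p i" if "a < t" "t < b" for t i using that I by auto
  have newton: "newton_at m x t" if "a < t" "t < b" for t
    by (rule newton_of_noncollinear[OF sol _ equilateral_not_collinear[OF equi[OF that]]]) (use that I in simp)
  have com: "(\<Sum>i\<in>UNIV. m i *\<^sub>R x t i) = 0" if "a < t" "t < b" for t using sol that I by (simp add: solution_def)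
  obtain t0 where t0: "a < t0" "t0 < b" using dense[OF ab] by blast
  obtain d0 where d0: "d0 > 0" "\<And>i j. i \<noteq> j \<Longrightarrow> dist (x t0 i) (x t0 j) = d0"
    using equi[OF t0] unfolding equilateral_def by blast
  \<comment> \<open>The reference shape p of a homothety is arbitrary in size; d is its side, and
    rescaling by it makes r the actual side length of the triangle.\<close>
  define d where "d = d0 / \<rho> t0"
  have d: "d > 0" using d0(1) \<rho>[OF t0] by (simp add: d_def)
  have pd: "dist (p i) (p j) = d" if "i \<noteq> j" for i j
    using d0(2)[OF that] \<rho>[OF t0] by (simp add: xp[OF t0] d_def dist_norm scaleR_diff_right[symmetric] eq_divide_eq mult.commute)
  define q where "q = (\<lambda>l. (1 / d) *\<^sub>R p l)"
  define r where "r = (\<lambda>t. \<rho> t * d)"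
  have rpos: "r t > 0" and xq: "x t l = r t *\<^sub>R q l" if "a < t" "t < b" for t l
    using \<rho>[OF that] xp[OF that] d by (simp_all add: r_def q_def)
  have q1: "dist (q i) (q j) = 1" if "i \<noteq> j" for i j
    using pd[OF that] d by (simp add: q_def dist_norm scaleR_diff_right[symmetric])
  have qcom: "(\<Sum>i\<in>UNIV. m i *\<^sub>R q i) = 0"
  proof -
    have "(\<Sum>i\<in>UNIV. m i *\<^sub>R x t0 i) = r t0 *\<^sub>R (\<Sum>i\<in>UNIV. m i *\<^sub>R q i)"
      unfolding xq[OF t0] scaleR_sum_right by (rule sum.cong) (simp_all add: mult.commute)
    then show ?thesis using com[OF t0] rpos[OF t0] by simp
  qed
  have q: "unit_equilateral m q" using qcom q1 by (simp add: unit_equilateral_def)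
  \<comment> \<open>The scale factor in \<open>lagrange_homothety\<close> is not assumed
    differentiable. Projecting an edge of the motion on the fixed unit edge u recovers r and
    transfers both its derivatives and its limits from the positions.\<close>
  define u where "u = q 1 - q 0"
  have "norm u = 1" using q1[of 1 0] by (simp add: u_def dist_norm)
  then have uu: "u \<bullet> u = 1" by (simp add: dot_square_norm)
  have ru: "r t = (x t 1 - x t 0) \<bullet> u" if "a < t" "t < b" for t
  proof -
    have "x t 1 - x t 0 = r t *\<^sub>R u" by (simp add: xq[OF that] u_def scaleR_diff_right)
    then show ?thesis using uu by simp
  qed
  define r1 where "r1 = (\<lambda>t. (velocity x t 1 - velocity x t 0) \<bullet> u)"
  have k: "kepler (total_mass m) r r1 a b"
    unfolding kepler_def
  proof (intro allI impI conjI)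
    fix t assume "a < t \<and> t < b"
    then have t: "a < t" "t < b" by auto
    show "r t > 0" by (rule rpos[OF t])
    note n = newton_atD[OF m newton[OF t]]
    have "((\<lambda>t. (x t 1 - x t 0) \<bullet> u) has_real_derivative r1 t) (at t)"
      using has_real_derivative_inner[OF has_vector_derivative_diff[OF n(2) n(2)] has_vector_derivative_const[of u]]
      by (simp add: r1_def)
    then show "(r has_real_derivative r1 t) (at t)"
      by (rule has_field_derivative_transform_within_open[of _ _ _ "{a<..<b}"]) (use t ru in auto)
    have dt: "dist (x t i) (x t j) = r t" if "i \<noteq> j" for i j
      using q1[OF that] rpos[OF t] by (simp add: xq[OF t] dist_norm scaleR_diff_right[symmetric])
    have "((\<lambda>t. (velocity x t 1 - velocity x t 0) \<bullet> u) has_real_derivative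
        (accel m (x t) 1 - accel m (x t) 0) \<bullet> u) (at t)"
      using has_real_derivative_inner[OF has_vector_derivative_diff[OF n(3)[of 1] n(3)[of 0]] has_vector_derivative_const[of u]]
      by simp
    moreover have "(accel m (x t) 1 - accel m (x t) 0) \<bullet> u = - (total_mass m / (r t)\<^sup>2)"
    proof -
      have acc: "accel m (x t) i = (- (total_mass m / r t ^ 3)) *\<^sub>R x t i" for i
        by (rule accel_equilateral[OF com[OF t] dt])
      have "accel m (x t) 1 - accel m (x t) 0 = (- (total_mass m / r t ^ 3)) *\<^sub>R (x t 1 - x t 0)"
        unfolding acc by (simp only: scaleR_diff_right)
      then have "(accel m (x t) 1 - accel m (x t) 0) \<bullet> u = - (total_mass m / r t ^ 3) * r t"
        unfolding ru[OF t] by simp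
      also have "\<dots> = - (total_mass m / (r t)\<^sup>2)" using rpos[OF t] by (simp add: power3_eq_cube power2_eq_square)
      finally show ?thesis .
    qed
    ultimately show "(r1 has_real_derivative - (total_mass m / (r t)\<^sup>2)) (at t)" unfolding r1_def by simp
  qed
  have en: "(r1 t)\<^sup>2 * pair_mass m / (2 * total_mass m) - pair_mass m / r t = h" if t: "a < t" "t < b" for t
  proof -
    have "velocity x t l = velocity (\<lambda>t l. r t *\<^sub>R q l) t l" for l
    proof -
      have "((\<lambda>t. r t *\<^sub>R q l) has_vector_derivative velocity x t l) (at t)"
        by (rule has_vector_derivative_transform_within_open[OF newton_atD(2)[OF m newton[OF t]], of "{a<..<b}"])
          (use t xq in auto)
      then show ?thesis by (simp add: velocity_def[of "\<lambda>t l. r t *\<^sub>R q l"] vector_derivative_at)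
    qed
    moreover have "x t = (\<lambda>l. r t *\<^sub>R q l)" using xq[OF t] by (rule ext)
    ultimately have "energy m x t = energy m (\<lambda>t l. r t *\<^sub>R q l) t" unfolding energy_def by simp
    also have "\<dots> = (r1 t)\<^sup>2 * pair_mass m / (2 * total_mass m) - pair_mass m / r t"
      by (rule kepler_homothety(4)[OF m q k t])
    finally show ?thesis
      using E newton_atD(1)[OF m newton[OF t]] t I by (simp add: has_energy_def)
  qed
  have lim: "(r \<longlongrightarrow> 0) F" if tcF: "triple_collision x F" and ev: "\<forall>\<^sub>F t in F. a < t \<and> t < b" for F
  proof -
    obtain c where c: "\<And>i. ((\<lambda>t. x t i) \<longlongrightarrow> c) F" using tcF unfolding triple_collision_def by blast
    have "((\<lambda>t. (x t 1 - x t 0) \<bullet> u) \<longlongrightarrow> (c - c) \<bullet> u) F"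
      by (intro tendsto_inner tendsto_diff c tendsto_const)
    then have "((\<lambda>t. (x t 1 - x t 0) \<bullet> u) \<longlongrightarrow> 0) F" by simp
    moreover have "\<forall>\<^sub>F t in F. (x t 1 - x t 0) \<bullet> u = r t" using ev by (rule eventually_mono) (simp add: ru)
    ultimately show ?thesis by (rule Lim_transform_eventually)
  qed
  have l1: "(r \<longlongrightarrow> 0) (at_right a)"
    by (rule lim[OF tc(1)]) (use ab in \<open>auto simp: eventually_at_right[OF ab]\<close>)
  have l2: "(r \<longlongrightarrow> 0) (at_left b)"
    by (rule lim[OF tc(2)]) (use ab in \<open>auto simp: eventually_at_left[OF ab]\<close>)
  show ?thesis by (rule that[OF ab I q k xq en l1 l2])
qed

text \<open>In the plane g is D times the quarter turn of f, with D the determinant of the frame and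
  D^2 = 1; the two squares then add up to those of v.\<close>

lemma plane_parseval:
  fixes f g v :: plane
  assumes "f \<bullet> f = 1" "g \<bullet> g = 1" "f \<bullet> g = 0"
  shows "v \<bullet> v = (v \<bullet> f)\<^sup>2 + (v \<bullet> g)\<^sup>2"
proof -
  define a b c d D where "a = f $ 1" and "b = f $ 2" and "c = g $ 1" and "d = g $ 2" and "D = a * d - b * c"
  have o: "a * a + b * b = 1" "c * c + d * d = 1" "a * c + b * d = 0"
    using assms unfolding inner_plane by (simp_all add: a_def b_def c_def d_def)
  have bd: "b * d = - (a * c)" using o(3) by simp
  have "c = c * (a * a + b * b)" unfolding o(1) by simp
  also have "\<dots> = - a * (- (a * c)) + b * b * c" by (simp add: algebra_simps)
  also have "\<dots> = - (D * b)" unfolding bd[symmetric] by (simp add: D_def algebra_simps)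
  finally have c: "c = - (D * b)" .
  have ac: "a * c = - (b * d)" using o(3) by simp
  have "d = d * (a * a + b * b)" unfolding o(1) by simp
  also have "\<dots> = a * a * d - b * (- (b * d))" by (simp add: algebra_simps)
  also have "\<dots> = D * a" unfolding ac[symmetric] by (simp add: D_def algebra_simps)
  finally have d: "d = D * a" .
  have "D * D = D * D * (a * a + b * b)" unfolding o(1) by simp
  also have "\<dots> = (D * b) * (D * b) + (D * a) * (D * a)" by (simp add: algebra_simps)
  also have "\<dots> = c * c + d * d" using c d by (metis minus_mult_minus)
  finally have D: "D * D = 1" unfolding o(2) .
  have "(v $ 1 * c + v $ 2 * d)\<^sup>2 = (D * D) * (v $ 2 * a - v $ 1 * b)\<^sup>2"
  proof -
    have "v $ 1 * c + v $ 2 * d = D * (v $ 2 * a - v $ 1 * b)"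
      by (subst c, subst d) (simp add: algebra_simps)
    then show ?thesis by (simp add: power2_eq_square)
  qed
  moreover have "(v $ 1 * a + v $ 2 * b)\<^sup>2 + (v $ 2 * a - v $ 1 * b)\<^sup>2 = (a * a + b * b) * (v $ 1 * v $ 1 + v $ 2 * v $ 2)"
    by (simp add: power2_eq_square algebra_simps)
  ultimately show ?thesis
    unfolding inner_plane a_def[symmetric] b_def[symmetric] c_def[symmetric] d_def[symmetric] o(1) D by simp
qed

text \<open>Gram-Schmidt on two edges. The coefficients are the same for every unit equilateral
  triangle; its orientation is hidden in the frame.\<close>

lemma unit_equilateral_frame:
  assumes d: "distinct [i, j, k]" and q: "unit_equilateral m q"
  obtains f g where "f \<bullet> f = 1" "g \<bullet> g = 1" "f \<bullet> g = 0" "q k - q j = f"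
    "q i - q k = (sqrt 3 / 2) *\<^sub>R g - (1 / 2) *\<^sub>R f"
proof -
  define f e where "f = q k - q j" and "e = q i - q k"
  have "norm f = 1" "norm e = 1" "norm (f + e) = 1"
    using q d by (auto simp: f_def e_def unit_equilateral_def dist_norm[symmetric])
  then have n: "f \<bullet> f = 1" "e \<bullet> e = 1" "(f + e) \<bullet> (f + e) = 1" by (simp_all add: dot_square_norm)
  then have fe: "f \<bullet> e = - 1 / 2" by (simp add: inner_add_left inner_add_right inner_commute)
  define s where "s = sqrt 3 / (2::real)"
  have s: "s * s = 3 / 4" "s \<noteq> 0" by (simp_all add: s_def)
  define w where "w = e + (1 / 2) *\<^sub>R f"
  have w: "w \<bullet> w = 3 / 4" "f \<bullet> w = 0"
    using n(1,2) fe by (simp_all add: w_def inner_add_left inner_add_right inner_commute)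
  show ?thesis
  proof (rule that[of f "(1 / s) *\<^sub>R w"])
    show "f \<bullet> f = 1" by (rule n(1))
    show "((1 / s) *\<^sub>R w) \<bullet> ((1 / s) *\<^sub>R w) = 1" using w(1) s by simp
    show "f \<bullet> ((1 / s) *\<^sub>R w) = 0" using w(2) by simp
    show "q k - q j = f" by (simp add: f_def)
    show "q i - q k = (sqrt 3 / 2) *\<^sub>R ((1 / s) *\<^sub>R w) - (1 / 2) *\<^sub>R f"
      unfolding s_def[symmetric] using s(2) by (simp add: w_def e_def)
  qed
qed

text \<open>Mapping one frame to the other is orthogonal and matches the edges; the common center of
  mass then matches the vertices. The map may be a reflection.\<close>

lemma unit_equilateral_congruent:
  assumes m: "\<And>i. m i > 0" and q: "unit_equilateral m q" "unit_equilateral m q'"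
  obtains A where "orthogonal_transformation A" "\<And>l. A (q l) = q' l"
proof -
  obtain i j k :: 3 where d: "distinct [i, j, k]" by (rule three_labels)
  obtain f g where f: "f \<bullet> f = 1" "g \<bullet> g = 1" "f \<bullet> g = 0" "q k - q j = f"
    "q i - q k = (sqrt 3 / 2) *\<^sub>R g - (1 / 2) *\<^sub>R f"
    by (rule unit_equilateral_frame[OF d q(1)]) (rule that; assumption)
  obtain f' g' where f': "f' \<bullet> f' = 1" "g' \<bullet> g' = 1" "f' \<bullet> g' = 0" "q' k - q' j = f'"
    "q' i - q' k = (sqrt 3 / 2) *\<^sub>R g' - (1 / 2) *\<^sub>R f'"
    by (rule unit_equilateral_frame[OF d q(2)]) (rule that; assumption)
  define A where "A = (\<lambda>v. (v \<bullet> f) *\<^sub>R f' + (v \<bullet> g) *\<^sub>R g')"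
  have lin: "linear A"
    by (rule linearI) (simp_all add: A_def inner_add_left scaleR_add_left scaleR_add_right)
  have "(A v) \<bullet> (A v) = v \<bullet> v" for v
  proof -
    have "A v \<bullet> A v = (v \<bullet> f)\<^sup>2 + (v \<bullet> g)\<^sup>2"
      unfolding A_def using f'(1-3) inner_commute[of g' f']
      by (simp add: inner_add_left inner_add_right power2_eq_square)
    then show ?thesis using plane_parseval[OF f(1-3), of v] by simp
  qed
  then have "norm (A v) = norm v" for v by (simp add: norm_eq_sqrt_inner)
  with lin have orth: "orthogonal_transformation A" by (simp add: orthogonal_transformation)
  have Af: "A f = f'" "A g = g'" using f(1-3) by (simp_all add: A_def inner_commute)
  have "(\<lambda>l. A (q l)) = q'"
  proof (rule config_eq_of_edges[of m i j k, OF m d])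
    have "(\<Sum>l\<in>UNIV. m l *\<^sub>R A (q l)) = A (\<Sum>l\<in>UNIV. m l *\<^sub>R q l)"
      by (simp add: linear_sum[OF lin] linear_cmul[OF lin])
    then show "(\<Sum>l\<in>UNIV. m l *\<^sub>R A (q l)) = 0" using q(1) linear_0[OF lin] by (simp add: unit_equilateral_def)
    show "(\<Sum>l\<in>UNIV. m l *\<^sub>R q' l) = 0" using q(2) by (simp add: unit_equilateral_def)
    show "A (q k) - A (q j) = q' k - q' j"
      unfolding linear_diff[OF lin, symmetric] f(4) f'(4) Af ..
    show "A (q i) - A (q k) = q' i - q' k"
      unfolding linear_diff[OF lin, symmetric] f(5) f'(5) by (simp add: linear_diff[OF lin] linear_cmul[OF lin] Af)
  qed
  then have "A (q l) = q' l" for l by (rule fun_cong)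
  with orth show ?thesis by (rule that)
qed

text \<open>Both motions have a moment of rest, and there the energy fixes the size. Aligning these
  moments gives equal initial data for the radial Kepler problem, so the radii agree on the common
  interval and the intervals have the same ends.\<close>

lemma homothety_unique:
  assumes m: "\<And>i. m i > 0" and h: "h < 0"
    and x: "maximal_solution m I x" "has_energy m h I x" "lagrange_homothety I x"
    and y: "maximal_solution m I' y" "has_energy m h I' y" "lagrange_homothety I' y"
  shows "congruent_solutions I x I' y"
proof -
  note M = total_mass_pos[of m, OF m] and U = pair_mass_pos[of m, OF m]
  obtain a b q r r1 where X: "a < b" "I = {a<..<b}" "unit_equilateral m q" "kepler (total_mass m) r r1 a b"
    "\<And>t l. a < t \<Longrightarrow> t < b \<Longrightarrow> x t l = r t *\<^sub>R q l"
    "\<And>t. a < t \<Longrightarrow> t < b \<Longrightarrow> (r1 t)\<^sup>2 * pair_mass m / (2 * total_mass m) - pair_mass m / r t = h"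
    "(r \<longlongrightarrow> 0) (at_right a)" "(r \<longlongrightarrow> 0) (at_left b)"
    by (rule homothety_kepler[of m, OF m x]) (rule that; assumption)
  obtain a' b' q' s s1 where Y: "a' < b'" "I' = {a'<..<b'}" "unit_equilateral m q'" "kepler (total_mass m) s s1 a' b'"
    "\<And>t l. a' < t \<Longrightarrow> t < b' \<Longrightarrow> y t l = s t *\<^sub>R q' l"
    "\<And>t. a' < t \<Longrightarrow> t < b' \<Longrightarrow> (s1 t)\<^sup>2 * pair_mass m / (2 * total_mass m) - pair_mass m / s t = h"
    "(s \<longlongrightarrow> 0) (at_right a')" "(s \<longlongrightarrow> 0) (at_left b')"
    by (rule homothety_kepler[of m, OF m y]) (rule that; assumption)
  obtain t1 where t1: "a < t1" "t1 < b" "r1 t1 = 0"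
    by (rule kepler_turning_point[OF X(4,1,7,8)]) (rule that; assumption)
  obtain t2 where t2: "a' < t2" "t2 < b'" "s1 t2 = 0"
    by (rule kepler_turning_point[OF Y(4,1,7,8)]) (rule that; assumption)
  \<comment> \<open>At rest the energy is purely potential, so the side length is determined by
    h.\<close>
  have size: "\<rho> = - pair_mass m / h" if "- pair_mass m / \<rho> = h" "\<rho> > 0" for \<rho>
    using that h by (simp add: field_simps)
  have "r t1 = s t2"
    using size[of "r t1"] size[of "s t2"] X(6)[OF t1(1,2)] Y(6)[OF t2(1,2)] t1(3) t2(3)
      keplerD(1)[OF X(4) t1(1,2)] keplerD(1)[OF Y(4) t2(1,2)] by simp
  define \<tau> where "\<tau> = t2 - t1"
  define w w1 where "w = (\<lambda>t. s (t + \<tau>))" and "w1 = (\<lambda>t. s1 (t + \<tau>))"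
  have kw: "kepler (total_mass m) w w1 (a' - \<tau>) (b' - \<tau>)" unfolding w_def w1_def by (rule kepler_shift[OF Y(4)])
  have eq0: "r t1 = w t1" "r1 t1 = w1 t1" using \<open>r t1 = s t2\<close> t1(3) t2(3) by (simp_all add: w_def w1_def \<tau>_def)
  have c: "a' - \<tau> < t1" "t1 < b' - \<tau>" using t2 by (simp_all add: \<tau>_def)
  have eq: "r t = w t" if "a < t" "t < b" "a' - \<tau> < t" "t < b' - \<tau>" for t
    by (rule kepler_unique[OF M kepler_subinterval[OF X(4), of "max a (a' - \<tau>)" "min b (b' - \<tau>)"]
          kepler_subinterval[OF kw, of "max a (a' - \<tau>)" "min b (b' - \<tau>)"] _ _ eq0])
      (use that t1 c in auto)
  have sh: "filterlim (\<lambda>t. t + \<tau>) (at_left b') (at_left (b' - \<tau>))" "filterlim (\<lambda>t. t + \<tau>) (at_right a') (at_right (a' - \<tau>))"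
    using filtermap_at_left_shift[of "- \<tau>" "b' - \<tau>"] filtermap_at_right_shift[of "- \<tau>" "a' - \<tau>"]
    by (simp_all add: filterlim_def)
  have wl: "(w \<longlongrightarrow> 0) (at_left (b' - \<tau>))" "(w \<longlongrightarrow> 0) (at_right (a' - \<tau>))"
    unfolding w_def by (rule filterlim_compose[OF Y(8) sh(1)], rule filterlim_compose[OF Y(7) sh(2)])
  have neg: "((\<lambda>t. f (- t)) \<longlongrightarrow> 0) (at_left (- z))" if "(f \<longlongrightarrow> 0) (at_right z)" for f :: "real \<Rightarrow> real" and z
    by (rule filterlim_compose[OF that]) (simp add: filterlim_def at_right_minus[of z] filtermap_filtermap)
  have b: "b' - \<tau> = b"
  proof (rule antisym)
    show "b' - \<tau> \<le> b"
      by (rule kepler_right_end_le[OF kw t1(1,2) c _ X(8)]) (rule eq)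
    show "b \<le> b' - \<tau>"
      by (rule kepler_right_end_le[OF X(4) c t1(1,2) _ wl(1)]) (rule eq[symmetric])
  qed
  have a: "a' - \<tau> = a"
  proof (rule antisym)
    \<comment> \<open>Left ends are compared as right ends of the reversed motions.\<close>
    have "- a \<le> - (a' - \<tau>)"
      by (rule kepler_right_end_le[OF kepler_uminus[OF X(4)], of "- (b' - \<tau>)" "- t1" "- (a' - \<tau>)" "\<lambda>t. w (- t)"])
        (use t1 c eq neg[OF wl(2)] in \<open>auto simp: eq[symmetric]\<close>)
    then show "a' - \<tau> \<le> a" by simp
    have "- (a' - \<tau>) \<le> - a"
      by (rule kepler_right_end_le[OF kepler_uminus[OF kw], of "- b" "- t1" "- a" "\<lambda>t. r (- t)"])
        (use t1 c eq neg[OF X(7)] in auto)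
    then show "a \<le> a' - \<tau>" by simp
  qed
  obtain A where A: "orthogonal_transformation A" "\<And>l. A (q l) = q' l"
    by (rule unit_equilateral_congruent[of m, OF m X(3) Y(3)]) (rule that; assumption)
  show ?thesis
    unfolding congruent_solutions_def
  proof (intro exI conjI ballI allI)
    show "orthogonal_transformation A" by (rule A(1))
    have ab': "a' = a + \<tau>" "b' = b + \<tau>" using a b by auto
    show "I' = (\<lambda>t. t + \<tau>) ` I"
    proof (intro equalityI subsetI)
      fix t assume "t \<in> I'"
      then have "t - \<tau> \<in> I" unfolding X(2) Y(2) ab' by auto
      then show "t \<in> (\<lambda>t. t + \<tau>) ` I" by (intro image_eqI[of _ _ "t - \<tau>"]) auto
    next
      fix t assume "t \<in> (\<lambda>t. t + \<tau>) ` I"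
      then show "t \<in> I'" unfolding X(2) Y(2) ab' by auto
    qed
    fix t l assume "t \<in> I"
    then have t: "a < t" "t < b" using X(2) by auto
    then have t': "a' < t + \<tau>" "t + \<tau> < b'" unfolding ab' by auto
    have "y (t + \<tau>) l = w t *\<^sub>R q' l" unfolding Y(5)[OF t'] w_def ..
    also have "w t = r t" using eq[of t] t t' by simp
    also have "r t *\<^sub>R q' l = A (x t l)"
      unfolding X(5)[OF t] A(2)[symmetric]
      using linear_cmul[OF orthogonal_transformation_linear[OF A(1)]] by simp
    finally show "y (t + \<tau>) l = A (x t l)" .
  qed
qed

theorem theorem0p1:
  fixes m :: "3 \<Rightarrow> real" and h :: real
  assumes masses: "\<And>i. m i > 0" and negative_energy: "h < 0"
  shows "(\<forall>I x. maximal_solution m I x \<and> zero_angular_momentum m I x \<and> has_energy m h I x \<longrightarrow>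
            (has_syzygy I x \<longleftrightarrow> \<not> lagrange_homothety I x)) \<and>
         (\<exists>I x. maximal_solution m I x \<and> zero_angular_momentum m I x \<and> has_energy m h I x \<and>
            lagrange_homothety I x) \<and>
         (\<forall>I x I' x'.
            maximal_solution m I x \<and> zero_angular_momentum m I x \<and> has_energy m h I x \<and>
            lagrange_homothety I x \<and>
            maximal_solution m I' x' \<and> zero_angular_momentum m I' x' \<and> has_energy m h I' x' \<and>
            lagrange_homothety I' x' \<longrightarrow>
            congruent_solutions I x I' x')"
proof (intro conjI allI impI)
  fix I x
  assume A: "maximal_solution m I x \<and> zero_angular_momentum m I x \<and> has_energy m h I x"
  show "has_syzygy I x \<longleftrightarrow> \<not> lagrange_homothety I x"
  proof
    assume "has_syzygy I x"
    then show "\<not> lagrange_homothety I x"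
      using equilateral_not_collinear unfolding has_syzygy_def lagrange_homothety_def by blast
  next
    assume "\<not> lagrange_homothety I x"
    then show "has_syzygy I x" using no_syzygy_imp_homothety[of m h I x, OF masses negative_energy] A by blast
  qed
next
  show "\<exists>I x. maximal_solution m I x \<and> zero_angular_momentum m I x \<and> has_energy m h I x \<and> lagrange_homothety I x"
    by (rule homothety_exists[of m, OF masses negative_energy])
next
  fix I x I' x'
  assume "maximal_solution m I x \<and> zero_angular_momentum m I x \<and> has_energy m h I x \<and> lagrange_homothety I x \<and>
    maximal_solution m I' x' \<and> zero_angular_momentum m I' x' \<and> has_energy m h I' x' \<and> lagrange_homothety I' x'"
  then show "congruent_solutions I x I' x'"
    using homothety_unique[of m h I x I' x', OF masses negative_energy] by blast
qed

end
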